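(* Let $\mathbf{k}$ be a differential field of characteristic $0$ with derivation $\partial$ and field of constants $C$, let $\bar{\mathbf{k}}$ be the differential closure of $\mathbf{k}$, and let $V$ be a finite dimensional $\mathbf{k}$-vector space. A linear differential algebraic group $G\subset\mathbf{GL}(V)$ is conjugate to a group $H\subset\mathbf{GL}(V)(C)$ of constant matrices if and only if $$\bar{\mathbf{k}}\otimes V^{(p)}=\bar{\mathbf{k}}\otimes\Bigl(V\oplus\bigoplus_{i=1}^pV_i\Bigr)$$ for all $p\geq 1$, where $V$ is a faithful representation of $G$ and $V_i\cong V$.
   Context: The field of constants of $\mathbf{k}$ is $C=\{c\in\mathbf{k}:\partial(c)=0\}$. A group $H$ is called a group of constant matrices if it is a subgroup of some $\mathbf{GL}_n(C)$. The differential closure $\bar{\mathbf{k}}$ of $\mathbf{k}$ is a differentially closed differential field extension of $\mathbf{k}$ that embeds over $\mathbf{k}$ into every differentially closed extension of $\mathbf{k}$. A differential field is differentially closed if every finite system of differential polynomial equations and inequations over it that has a solution in some differential field extension already has a solution in it. A linear differential algebraic group $G\subset\mathbf{GL}(V)$ over $\mathbf{k}$ is a subgroup of $\mathbf{GL}(V)(\mathcal{U})$ defined by the vanishing of differential polynomials with coefficients in $\mathbf{k}$, where $\mathcal{U}\supset\mathbf{k}$ is a semi-universal differential field (every differentially finitely generated differential field extension of $\mathbf{k}$ embeds in $\mathcal{U}$ over $\mathbf{k}$). Its coordinate ring $A=\mathbf{k}\{G\}$, the quotient of $\mathbf{k}\{X_{ij},1/\det\}$ by the radical differential ideal of $G$,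 is a differential Hopf algebra. A (differential) representation of $G$ is a finite dimensional $\mathbf{k}$-vector space $W$ with a differential polynomial group homomorphism $G\to\mathbf{GL}(W)$, or equivalently with an $A$-comodule structure $\rho:W\to W\otimes A$. The inclusion $G\subset\mathbf{GL}(V)$ makes $V$ a faithful representation of $G$. Prolongation: let $\mathbf{k}[\partial]$ be the ring of linear differential operators (with $\partial\cdot a=a\cdot\partial+\partial(a)$ for $a\in\mathbf{k}$), and let $\mathbf{k}[\partial]_{\le p}$ be the operators of order at most $p$. Then $V^{(p)}:=\mathbf{k}[\partial]_{\le p}\otimes_{\mathbf{k}}V$, where $\mathbf{k}[\partial]_{\le p}$ is used as a right $\mathbf{k}$-space in the tensor product; write $\partial^qv:=\partial^q\otimes v$. If $v_1,\dots,v_n$ is a basis of $V$ and $\rho(v_j)=\sum_iv_i\otimes a_{ij}$, then $V^{(p)}$ is a representation of $G$ via $\rho(\partial^mv_j)=\sum_{i=1}^n\sum_{q=0}^m\binom{m}{q}\partial^qv_i\otimes\partial^{m-q}a_{ij}$ for $0\le m\le p$. The displayed equality and the isomorphisms $V_i\cong V$ are understood as those of representations of $G$.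
   Formalization: GL(V)(C) is read as the differential algebraic group of matrices with zero derivative, so H has entries in the constants of the universal field U, not only of k; with constants of k alone the claim fails for G = {g : g' = 0} in GL_1. Conjugation is by an element of GL(V)(U). *)

theory Defs
  imports
    "HOL-Algebra.Indexed_Polynomials"
    "HOL-Algebra.QuotRing"
    "HOL-Algebra.Subrings"
    "HOL-Algebra.Free_Abelian_Groups"
    "HOL-Combinatorics.Permutations"
begin

section \<open>Differential fields and their extensions\<close>

record 'a diff_ring = "'a ring" +
  der :: "'a \<Rightarrow> 'a"

locale differential_field = field R for R :: "'a diff_ring" (structure) +
  assumes der_closed: "x \<in> carrier R \<Longrightarrow> der R x \<in> carrier R"
    and der_add: "\<lbrakk>x \<in> carrier R; y \<in> carrier R\<rbrakk> \<Longrightarrow> der R (x \<oplus> y) = der R x \<oplus> der R y"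
    and der_mult: "\<lbrakk>x \<in> carrier R; y \<in> carrier R\<rbrakk>
                    \<Longrightarrow> der R (x \<otimes> y) = (der R x \<otimes> y) \<oplus> (x \<otimes> der R y)"

definition char_zero :: "('a, 'm) ring_scheme \<Rightarrow> bool" where
  "char_zero R \<longleftrightarrow> (\<forall>m::nat. m > 0 \<longrightarrow> [m] \<cdot>\<^bsub>R\<^esub> \<one>\<^bsub>R\<^esub> \<noteq> \<zero>\<^bsub>R\<^esub>)"

definition constants :: "'a diff_ring \<Rightarrow> 'a set" where
  "constants R = {c \<in> carrier R. der R c = \<zero>\<^bsub>R\<^esub>}"

definition diff_hom :: "'a diff_ring \<Rightarrow> 'b diff_ring \<Rightarrow> ('a \<Rightarrow> 'b) set" where
  "diff_hom R S = {h \<in> ring_hom R S. \<forall>x \<in> carrier R. h (der R x) = der S (h x)}"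

text \<open>An extension \<open>L\<close> of \<open>K\<close> is given together with its embedding \<open>e\<close>; ring homomorphisms
  between fields are injective.\<close>

definition diff_extension :: "'a diff_ring \<Rightarrow> 'b diff_ring \<Rightarrow> ('a \<Rightarrow> 'b) \<Rightarrow> bool" where
  "diff_extension K L e \<longleftrightarrow> differential_field K \<and> differential_field L \<and> e \<in> diff_hom K L"

definition diff_fin_gen :: "'a diff_ring \<Rightarrow> 'b diff_ring \<Rightarrow> ('a \<Rightarrow> 'b) \<Rightarrow> bool" where
  "diff_fin_gen K L e \<longleftrightarrow> diff_extension K L e \<and>
     (\<exists>S. finite S \<and> S \<subseteq> carrier L \<and>
       (\<forall>F. subfield F L \<and> der L ` F \<subseteq> F \<and> e ` carrier K \<subseteq> F \<and> S \<subseteq> F \<longrightarrow> F = carrier L))"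

text \<open>
  HOL cannot quantify over all types inside a definition, so "every extension" of a differential
  field with elements in \<open>'a\<close> is rendered as "every extension with elements in \<open>nat \<Rightarrow> 'a\<close>"
  (arbitrary carrier, operations and embedding). In characteristic 0 this loses nothing up to
  isomorphism: a differentially finitely generated extension of \<open>K\<close> has the cardinality of \<open>K\<close>,
  a solution of a system in some extension lies in a differentially finitely generated one, and,
  by Loewenheim-Skolem, every differentially closed extension of \<open>K\<close> contains one of the
  cardinality of \<open>K\<close>.
\<close>

definition semi_universal :: "'a diff_ring \<Rightarrow> 'c diff_ring \<Rightarrow> ('a \<Rightarrow> 'c) \<Rightarrow> bool" where
  "semi_universal K U \<iota> \<longleftrightarrow> diff_extension K U \<iota> \<and>
     (\<forall>(M :: (nat \<Rightarrow> 'a) diff_ring) j. diff_fin_gen K M j \<longrightarrow>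
       (\<exists>h \<in> diff_hom M U. \<forall>x \<in> carrier K. h (j x) = \<iota> x))"


section \<open>Differential polynomials\<close>

text \<open>
  Differential polynomials in the variables \<open>V\<close> are the polynomials in the letters \<open>(v, j)\<close>, where
  \<open>(v, j)\<close> stands for the \<open>j\<close>-th derivative of \<open>v\<close>. A polynomial maps a monomial (a multiset of
  letters) to its coefficient.
\<close>

text \<open>The derivation sends the letter \<open>(v, j)\<close> to \<open>(v, Suc j)\<close>. The monomial \<open>m\<close> therefore arises
  from each \<open>m'\<close> obtained by replacing one \<open>(v, Suc j)\<close> in \<open>m\<close> by \<open>(v, j)\<close>, with multiplicity the
  exponent of \<open>(v, j)\<close> in \<open>m'\<close>.\<close>

definition dpoly_der ::
    "'a diff_ring \<Rightarrow> (('v \<times> nat) multiset \<Rightarrow> 'a) \<Rightarrow> (('v \<times> nat) multiset \<Rightarrow> 'a)" where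
  "dpoly_der R P = (\<lambda>m. der R (P m) \<oplus>\<^bsub>R\<^esub>
     (\<Oplus>\<^bsub>R\<^esub>x \<in> {x. (fst x, Suc (snd x)) \<in># m}.
        let m' = m - {#(fst x, Suc (snd x))#} + {#x#} in [count m' x] \<cdot>\<^bsub>R\<^esub> P m'))"

definition dpoly_ring :: "'a diff_ring \<Rightarrow> 'v set \<Rightarrow> (('v \<times> nat) multiset \<Rightarrow> 'a) diff_ring" where
  "dpoly_ring R V =
     \<lparr>carrier = ring.indexed_pset R (V \<times> UNIV) (carrier R),
      monoid.mult = (\<lambda>P Q m. \<Oplus>\<^bsub>R\<^esub>l \<in> {l. l \<subseteq># m}. P l \<otimes>\<^bsub>R\<^esub> Q (m - l)),
      one = ring.indexed_const R \<one>\<^bsub>R\<^esub>,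
      ring.zero = ring.indexed_const R \<zero>\<^bsub>R\<^esub>,
      ring.add = ring.indexed_padd R,
      der = dpoly_der R\<rparr>"

text \<open>Value in \<open>S\<close>, at the point \<open>s\<close>, of a differential polynomial over \<open>R\<close>; its coefficients are
  moved to \<open>S\<close> by \<open>h\<close>.\<close>

definition dpoly_eval ::
    "'a diff_ring \<Rightarrow> 'b diff_ring \<Rightarrow> ('a \<Rightarrow> 'b) \<Rightarrow> ('v \<Rightarrow> 'b) \<Rightarrow> (('v \<times> nat) multiset \<Rightarrow> 'a) \<Rightarrow> 'b" where
  "dpoly_eval R S h s P =
     (\<Oplus>\<^bsub>S\<^esub>m \<in> {m. P m \<noteq> \<zero>\<^bsub>R\<^esub>}. h (P m) \<otimes>\<^bsub>S\<^esub>
        (\<Otimes>\<^bsub>S\<^esub>x \<in> set_mset m. ((der S ^^ snd x) (s (fst x))) [^]\<^bsub>S\<^esub> count m x))"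


section \<open>Differential closure\<close>

definition solves_system ::
    "'a diff_ring \<Rightarrow> 'b diff_ring \<Rightarrow> ('a \<Rightarrow> 'b) \<Rightarrow> (('v \<times> nat) multiset \<Rightarrow> 'a) set \<Rightarrow>
     (('v \<times> nat) multiset \<Rightarrow> 'a) set \<Rightarrow> ('v \<Rightarrow> 'b) \<Rightarrow> bool" where
  "solves_system L M e E N s \<longleftrightarrow> range s \<subseteq> carrier M \<and>
     (\<forall>F \<in> E. dpoly_eval L M e s F = \<zero>\<^bsub>M\<^esub>) \<and> (\<forall>F \<in> N. dpoly_eval L M e s F \<noteq> \<zero>\<^bsub>M\<^esub>)"

definition differentially_closed :: "'a diff_ring \<Rightarrow> bool" where
  "differentially_closed L \<longleftrightarrow> differential_field L \<and>
     (\<forall>E N. finite E \<and> finite N \<and> E \<union> N \<subseteq> carrier (dpoly_ring L (UNIV :: nat set)) \<longrightarrow>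
        (\<exists>(M :: (nat \<Rightarrow> 'a) diff_ring) e s. diff_extension L M e \<and> solves_system L M e E N s) \<longrightarrow>
        (\<exists>s. solves_system L L (\<lambda>x. x) E N s))"

definition differential_closure :: "'a diff_ring \<Rightarrow> 'b diff_ring \<Rightarrow> ('a \<Rightarrow> 'b) \<Rightarrow> bool" where
  "differential_closure K L e \<longleftrightarrow> diff_extension K L e \<and> differentially_closed L \<and>
     (\<forall>(M :: (nat \<Rightarrow> 'a) diff_ring) j. diff_extension K M j \<and> differentially_closed M \<longrightarrow>
       (\<exists>h \<in> diff_hom L M. \<forall>x \<in> carrier K. h (e x) = j x))"


section \<open>Matrices and linear differential algebraic groups\<close>

definition mats :: "('a, 'm) ring_scheme \<Rightarrow> 'i set \<Rightarrow> 'j set \<Rightarrow> ('i \<Rightarrow> 'j \<Rightarrow> 'a) set" where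
  "mats R I J = I \<rightarrow>\<^sub>E (J \<rightarrow>\<^sub>E carrier R)"

definition mat_mult ::
    "('a, 'm) ring_scheme \<Rightarrow> 'i set \<Rightarrow> 'j set \<Rightarrow> 'k set \<Rightarrow>
     ('i \<Rightarrow> 'j \<Rightarrow> 'a) \<Rightarrow> ('j \<Rightarrow> 'k \<Rightarrow> 'a) \<Rightarrow> ('i \<Rightarrow> 'k \<Rightarrow> 'a)" where
  "mat_mult R I J L A B = (\<lambda>i\<in>I. \<lambda>k\<in>L. \<Oplus>\<^bsub>R\<^esub>j \<in> J. A i j \<otimes>\<^bsub>R\<^esub> B j k)"

definition mat_one :: "('a, 'm) ring_scheme \<Rightarrow> 'i set \<Rightarrow> ('i \<Rightarrow> 'i \<Rightarrow> 'a)" where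
  "mat_one R I = (\<lambda>i\<in>I. \<lambda>j\<in>I. if i = j then \<one>\<^bsub>R\<^esub> else \<zero>\<^bsub>R\<^esub>)"

definition mat_det :: "('a, 'm) ring_scheme \<Rightarrow> nat \<Rightarrow> (nat \<Rightarrow> nat \<Rightarrow> 'a) \<Rightarrow> 'a" where
  "mat_det R n M = (\<Oplus>\<^bsub>R\<^esub>\<pi> \<in> {\<pi>. \<pi> permutes {..<n}}.
     (if evenperm \<pi> then \<Otimes>\<^bsub>R\<^esub>i \<in> {..<n}. M i (\<pi> i) else \<ominus>\<^bsub>R\<^esub> (\<Otimes>\<^bsub>R\<^esub>i \<in> {..<n}. M i (\<pi> i))))"

definition GL :: "('a, 'm) ring_scheme \<Rightarrow> nat \<Rightarrow> (nat \<Rightarrow> nat \<Rightarrow> 'a) monoid" where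
  "GL F n = \<lparr>carrier = {M \<in> mats F {..<n} {..<n}. mat_det F n M \<noteq> \<zero>\<^bsub>F\<^esub>},
             monoid.mult = mat_mult F {..<n} {..<n} {..<n},
             one = mat_one F {..<n}\<rparr>"

text \<open>
  The group of constant matrices as a linear differential algebraic group: it is defined by the
  equations \<open>der X\<^sub>i\<^sub>j = 0\<close>, and its points in \<open>U\<close> are the invertible matrices over the constants of
  \<open>U\<close>.
\<close>

definition GL_const :: "'c diff_ring \<Rightarrow> nat \<Rightarrow> (nat \<Rightarrow> nat \<Rightarrow> 'c) set" where
  "GL_const U n = {h \<in> carrier (GL U n). \<forall>i<n. \<forall>j<n. h i j \<in> constants U}"

definition conjugate_by :: "('g, 'm) monoid_scheme \<Rightarrow> 'g \<Rightarrow> 'g set \<Rightarrow> 'g set" where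
  "conjugate_by M x G = (\<lambda>g. x \<otimes>\<^bsub>M\<^esub> g \<otimes>\<^bsub>M\<^esub> inv\<^bsub>M\<^esub> x) ` G"

datatype gl_var = Entry nat nat | InvDet

definition gl_vars :: "nat \<Rightarrow> gl_var set" where
  "gl_vars n = {Entry i j | i j. i < n \<and> j < n} \<union> {InvDet}"

fun gl_point :: "('c, 'm) ring_scheme \<Rightarrow> nat \<Rightarrow> (nat \<Rightarrow> nat \<Rightarrow> 'c) \<Rightarrow> gl_var \<Rightarrow> 'c" where
  "gl_point U n g (Entry i j) = g i j"
| "gl_point U n g InvDet = inv\<^bsub>U\<^esub> (mat_det U n g)"

definition linear_diff_alg_group ::
    "'a diff_ring \<Rightarrow> 'c diff_ring \<Rightarrow> ('a \<Rightarrow> 'c) \<Rightarrow> nat \<Rightarrow> (nat \<Rightarrow> nat \<Rightarrow> 'c) set \<Rightarrow> bool" where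
  "linear_diff_alg_group K U \<iota> n G \<longleftrightarrow> subgroup G (GL U n) \<and>
     (\<exists>S \<subseteq> carrier (dpoly_ring K (gl_vars n)).
        G = {g \<in> carrier (GL U n). \<forall>F \<in> S. dpoly_eval K U \<iota> (gl_point U n g) F = \<zero>\<^bsub>U\<^esub>})"


section \<open>The coordinate ring\<close>

text \<open>
  The ring \<open>K{X\<^sub>i\<^sub>j, 1/det}\<close> is the quotient of the differential polynomial ring in the variables
  \<open>gl_vars n\<close> by the differential ideal generated by \<open>InvDet * det X - 1\<close>. That ideal is contained
  in the vanishing ideal below, so the coordinate ring is obtained by a single quotient.
\<close>

definition vanishing_ideal ::
    "'a diff_ring \<Rightarrow> 'c diff_ring \<Rightarrow> ('a \<Rightarrow> 'c) \<Rightarrow> nat \<Rightarrow> (nat \<Rightarrow> nat \<Rightarrow> 'c) set \<Rightarrow>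
     ((gl_var \<times> nat) multiset \<Rightarrow> 'a) set" where
  "vanishing_ideal K U \<iota> n G =
     {F \<in> carrier (dpoly_ring K (gl_vars n)).
        \<forall>g \<in> G. dpoly_eval K U \<iota> (gl_point U n g) F = \<zero>\<^bsub>U\<^esub>}"

definition coord_ring ::
    "'a diff_ring \<Rightarrow> 'c diff_ring \<Rightarrow> ('a \<Rightarrow> 'c) \<Rightarrow> nat \<Rightarrow> (nat \<Rightarrow> nat \<Rightarrow> 'c) set \<Rightarrow>
     ((gl_var \<times> nat) multiset \<Rightarrow> 'a) set diff_ring" where
  "coord_ring K U \<iota> n G =
     (let P = dpoly_ring K (gl_vars n); I = vanishing_ideal K U \<iota> n G
      in ring.extend (P Quot I) (diff_ring.fields (\<lambda>a. \<Union>f\<in>a. I +>\<^bsub>P\<^esub> der P f)))"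

definition coord_const ::
    "'a diff_ring \<Rightarrow> 'c diff_ring \<Rightarrow> ('a \<Rightarrow> 'c) \<Rightarrow> nat \<Rightarrow> (nat \<Rightarrow> nat \<Rightarrow> 'c) set \<Rightarrow>
     'a \<Rightarrow> ((gl_var \<times> nat) multiset \<Rightarrow> 'a) set" where
  "coord_const K U \<iota> n G c =
     vanishing_ideal K U \<iota> n G +>\<^bsub>dpoly_ring K (gl_vars n)\<^esub> ring.indexed_const K c"

definition coord_entry ::
    "'a diff_ring \<Rightarrow> 'c diff_ring \<Rightarrow> ('a \<Rightarrow> 'c) \<Rightarrow> nat \<Rightarrow> (nat \<Rightarrow> nat \<Rightarrow> 'c) set \<Rightarrow>
     nat \<Rightarrow> nat \<Rightarrow> ((gl_var \<times> nat) multiset \<Rightarrow> 'a) set" where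
  "coord_entry K U \<iota> n G i j =
     vanishing_ideal K U \<iota> n G +>\<^bsub>dpoly_ring K (gl_vars n)\<^esub> ring.indexed_var K (Entry i j, 0)"


section \<open>Tensor products\<close>

text \<open>The additive group of \<open>L \<otimes>\<^sub>K A\<close> for \<open>K\<close>-algebras \<open>e : K \<rightarrow> L\<close> and \<open>u : K \<rightarrow> A\<close>: the free abelian
  group on pairs modulo the biadditivity and balancing relations. It is written multiplicatively,
  so sums of tensors appear as \<open>\<Otimes>\<close>.\<close>

definition tensor_relations ::
    "('a, 'k) ring_scheme \<Rightarrow> ('b, 'l) ring_scheme \<Rightarrow> ('a \<Rightarrow> 'b) \<Rightarrow> ('x, 'm) ring_scheme \<Rightarrow> ('a \<Rightarrow> 'x) \<Rightarrow>
     ('b \<times> 'x \<Rightarrow>\<^sub>0 int) set" where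
  "tensor_relations K L e A u =
     {frag_of (x \<oplus>\<^bsub>L\<^esub> y, a) - frag_of (x, a) - frag_of (y, a) | x y a.
        x \<in> carrier L \<and> y \<in> carrier L \<and> a \<in> carrier A} \<union>
     {frag_of (x, a \<oplus>\<^bsub>A\<^esub> b) - frag_of (x, a) - frag_of (x, b) | x a b.
        x \<in> carrier L \<and> a \<in> carrier A \<and> b \<in> carrier A} \<union>
     {frag_of (e c \<otimes>\<^bsub>L\<^esub> x, a) - frag_of (x, u c \<otimes>\<^bsub>A\<^esub> a) | c x a.
        c \<in> carrier K \<and> x \<in> carrier L \<and> a \<in> carrier A}"

definition tensor_null ::
    "('a, 'k) ring_scheme \<Rightarrow> ('b, 'l) ring_scheme \<Rightarrow> ('a \<Rightarrow> 'b) \<Rightarrow> ('x, 'm) ring_scheme \<Rightarrow> ('a \<Rightarrow> 'x) \<Rightarrow>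
     ('b \<times> 'x \<Rightarrow>\<^sub>0 int) set" where
  "tensor_null K L e A u =
     generate (free_Abelian_group (carrier L \<times> carrier A)) (tensor_relations K L e A u)"

definition tensor_product ::
    "('a, 'k) ring_scheme \<Rightarrow> ('b, 'l) ring_scheme \<Rightarrow> ('a \<Rightarrow> 'b) \<Rightarrow> ('x, 'm) ring_scheme \<Rightarrow> ('a \<Rightarrow> 'x) \<Rightarrow>
     ('b \<times> 'x \<Rightarrow>\<^sub>0 int) set monoid" where
  "tensor_product K L e A u =
     free_Abelian_group (carrier L \<times> carrier A) Mod tensor_null K L e A u"

definition pure_tensor ::
    "('a, 'k) ring_scheme \<Rightarrow> ('b, 'l) ring_scheme \<Rightarrow> ('a \<Rightarrow> 'b) \<Rightarrow> ('x, 'm) ring_scheme \<Rightarrow> ('a \<Rightarrow> 'x) \<Rightarrow>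
     'b \<Rightarrow> 'x \<Rightarrow> ('b \<times> 'x \<Rightarrow>\<^sub>0 int) set" where
  "pure_tensor K L e A u x a =
     tensor_null K L e A u #>\<^bsub>free_Abelian_group (carrier L \<times> carrier A)\<^esub> frag_of (x, a)"


section \<open>Representations\<close>

text \<open>A representation \<open>W\<close> with basis \<open>(w\<^sub>i)\<close>, \<open>i \<in> basis W\<close>, is given by the matrix of its coaction:
  \<open>\<rho>(w\<^sub>j) = \<Sum>\<^sub>i w\<^sub>i \<otimes> coact W i j\<close>, with entries in the coordinate ring.\<close>

record ('i, 'x) rep =
  basis :: "'i set"
  coact :: "'i \<Rightarrow> 'i \<Rightarrow> 'x"

definition standard_rep ::
    "'a diff_ring \<Rightarrow> 'c diff_ring \<Rightarrow> ('a \<Rightarrow> 'c) \<Rightarrow> nat \<Rightarrow> (nat \<Rightarrow> nat \<Rightarrow> 'c) set \<Rightarrow>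
     (nat, ((gl_var \<times> nat) multiset \<Rightarrow> 'a) set) rep" where
  "standard_rep K U \<iota> n G = \<lparr>basis = {..<n}, coact = coord_entry K U \<iota> n G\<rparr>"

text \<open>The index \<open>(q, i)\<close> stands for \<open>\<partial>\<^sup>q w\<^sub>i\<close>.\<close>

definition prolongation :: "'x diff_ring \<Rightarrow> nat \<Rightarrow> ('i, 'x) rep \<Rightarrow> (nat \<times> 'i, 'x) rep" where
  "prolongation A p W =
     \<lparr>basis = {..p} \<times> basis W,
      coact = (\<lambda>(q, i) (m, j).
        if q \<le> m then [(m choose q)] \<cdot>\<^bsub>A\<^esub> ((der A ^^ (m - q)) (coact W i j)) else \<zero>\<^bsub>A\<^esub>)\<rparr>"

definition direct_sum_rep ::
    "('x, 'm) ring_scheme \<Rightarrow> 't set \<Rightarrow> ('t \<Rightarrow> ('i, 'x) rep) \<Rightarrow> ('t \<times> 'i, 'x) rep" where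
  "direct_sum_rep A T W =
     \<lparr>basis = (SIGMA t:T. basis (W t)),
      coact = (\<lambda>(s, i) (t, j). if s = t then coact (W t) i j else \<zero>\<^bsub>A\<^esub>)\<rparr>"

text \<open>
  \<open>L \<otimes> W\<close> and \<open>L \<otimes> W'\<close> are isomorphic as representations over \<open>L\<close>, i.e. as comodules over \<open>L \<otimes>\<^sub>K A\<close>:
  there is an invertible \<open>L\<close>-linear map \<open>w\<^sub>j \<mapsto> \<Sum>\<^sub>i P i j w'\<^sub>i\<close> commuting with the coactions. The equation
  compares the coefficients in \<open>L \<otimes>\<^sub>K A\<close> of \<open>w'\<^sub>i\<close> in the two images of \<open>w\<^sub>j\<close>.
\<close>

definition iso_rep_over ::
    "('a, 'k) ring_scheme \<Rightarrow> ('b, 'l) ring_scheme \<Rightarrow> ('a \<Rightarrow> 'b) \<Rightarrow> ('x, 'm) ring_scheme \<Rightarrow> ('a \<Rightarrow> 'x) \<Rightarrow>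
     ('i, 'x) rep \<Rightarrow> ('j, 'x) rep \<Rightarrow> bool" where
  "iso_rep_over K L e A u W W' \<longleftrightarrow>
     (\<exists>P \<in> mats L (basis W') (basis W). \<exists>Q \<in> mats L (basis W) (basis W').
        mat_mult L (basis W') (basis W) (basis W') P Q = mat_one L (basis W') \<and>
        mat_mult L (basis W) (basis W') (basis W) Q P = mat_one L (basis W) \<and>
        (\<forall>i \<in> basis W'. \<forall>j \<in> basis W.
           (\<Otimes>\<^bsub>tensor_product K L e A u\<^esub>l \<in> basis W. pure_tensor K L e A u (P i l) (coact W l j)) =
           (\<Otimes>\<^bsub>tensor_product K L e A u\<^esub>l \<in> basis W'. pure_tensor K L e A u (P l j) (coact W' i l))))"

end

theory Submission
  imports Defs "Jordan_Normal_Form.Determinant"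
begin

text \<open>
  Conjugating by \<open>x\<close> makes \<open>G\<close> constant iff every \<open>g \<in> G\<close> satisfies \<open>g' = g B - B g\<close> with
  \<open>B = x\<^sup>-\<^sup>1 x'\<close>. Such a \<open>B\<close> can be taken over \<open>K\<close>: the equations for \<open>B\<close> are linear, a solution
  with a maximal set of vanishing entries is unique, hence fixed by all differential embeddings into \<open>U\<close> over
  \<open>K\<close>. Conversely \<open>x' = x B\<close> has a fundamental matrix in a differentially finitely generated extension of
  \<open>K\<close>, which embeds into \<open>U\<close>.

  Given \<open>B\<close>, the operators \<open>(\<partial> + B)\<^sup>k\<close> applied to \<open>1\<close> give the coefficients of an isomorphism between
  \<open>V\<^sup>(\<^sup>p\<^sup>)\<close> and \<open>V \<oplus> \<dots> \<oplus> V\<close>, already over \<open>K\<close>. In the other direction only \<open>p = 1\<close> is needed: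
  \<open>V\<^sup>(\<^sup>1\<^sup>)\<close> is an extension of \<open>V\<close> by \<open>V\<close> whose middle term is isomorphic to the direct sum, hence it splits
  (Miyata), and a \<open>K\<close>-linear retraction of the closure onto \<open>K\<close> turns the splitting into \<open>B\<close>.
\<close>

section \<open>Free commutative rings\<close>

text \<open>Semi-universality supplies embeddings of finitely generated extensions into
  \<open>U\<close>, not automorphisms of \<open>U\<close>. Descent to \<open>K\<close> therefore
  rests on this: an element \<open>u\<close> outside \<open>K\<close> of a finitely generated
  \<open>E\<close> inside \<open>U\<close> is moved by some embedding of \<open>E\<close>. Such
  embeddings come from two copies of \<open>E\<close> in one differential field, a residue field of
  the tensor square of \<open>E\<close> over \<open>K\<close> at a prime that avoids
  \<open>u \<otimes> 1 - 1 \<otimes> u\<close>. That element is not nilpotent because it acts as a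
  commutator on the \<open>K\<close>-linear endomorphisms of \<open>E\<close>. A prime is made
  differential by passing to the kernel of the Taylor expansion modulo it. Both steps use
  characteristic 0. The system for \<open>B\<close> is infinite, with equations for each
  \<open>g\<close>, and its coefficients lie in \<open>U\<close>. An embedding over \<open>K\<close>
  carries the equations of \<open>g\<close> to those of its image, which is again in
  \<open>G\<close> because \<open>G\<close> is defined over \<open>K\<close>. In the direction from
  the isomorphism to \<open>B\<close>, the comodule equation lives in a tensor product with the
  coordinate ring; \<open>K\<close>-linear functionals on functions on \<open>G\<close> turn it into
  matrix equations over the closure without a choice of basis.\<close>

datatype 'g ring_term = Var 'g | Zero | One | Neg "'g ring_term"
  | Plus "'g ring_term" "'g ring_term" | Times "'g ring_term" "'g ring_term"

inductive ring_eq :: "'g ring_term \<Rightarrow> 'g ring_term \<Rightarrow> bool" where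
  ring_eq_refl: "ring_eq s s"
| ring_eq_sym: "ring_eq s t \<Longrightarrow> ring_eq t s"
| ring_eq_trans: "ring_eq s t \<Longrightarrow> ring_eq t r \<Longrightarrow> ring_eq s r"
| neg_cong: "ring_eq s t \<Longrightarrow> ring_eq (Neg s) (Neg t)"
| plus_cong: "ring_eq s t \<Longrightarrow> ring_eq s' t' \<Longrightarrow> ring_eq (Plus s s') (Plus t t')"
| times_cong: "ring_eq s t \<Longrightarrow> ring_eq s' t' \<Longrightarrow> ring_eq (Times s s') (Times t t')"
| plus_assoc: "ring_eq (Plus (Plus r s) t) (Plus r (Plus s t))"
| plus_comm: "ring_eq (Plus s t) (Plus t s)"
| plus_zero: "ring_eq (Plus Zero s) s"
| plus_neg: "ring_eq (Plus (Neg s) s) Zero"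
| times_assoc: "ring_eq (Times (Times r s) t) (Times r (Times s t))"
| times_comm: "ring_eq (Times s t) (Times t s)"
| times_one: "ring_eq (Times One s) s"
| distrib: "ring_eq (Times (Plus r s) t) (Plus (Times r t) (Times s t))"

quotient_type 'g free_ring = "'g ring_term" / ring_eq
  by (auto intro!: equivpI reflpI sympI transpI intro: ring_eq.intros)

text \<open>Evaluation in the integers at the origin. It is invariant under \<open>ring_eq\<close>
  and so separates 0 from 1, as the class \<open>comm_ring_1\<close> demands.\<close>

primrec term_int :: "'g ring_term \<Rightarrow> int" where
  "term_int (Var g) = 0"
| "term_int Zero = 0"
| "term_int One = 1"
| "term_int (Neg s) = - term_int s"
| "term_int (Plus s t) = term_int s + term_int t"
| "term_int (Times s t) = term_int s * term_int t"

lemma term_int_cong: "ring_eq s t \<Longrightarrow> term_int s = term_int t"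
  by (induction rule: ring_eq.induct) (auto simp: algebra_simps)

instantiation free_ring :: (type) comm_ring_1
begin

lift_definition zero_free_ring :: "'a free_ring" is Zero .
lift_definition one_free_ring :: "'a free_ring" is One .
lift_definition uminus_free_ring :: "'a free_ring \<Rightarrow> 'a free_ring" is Neg
  by (rule neg_cong)
lift_definition plus_free_ring :: "'a free_ring \<Rightarrow> 'a free_ring \<Rightarrow> 'a free_ring" is Plus
  by (rule plus_cong)
lift_definition times_free_ring :: "'a free_ring \<Rightarrow> 'a free_ring \<Rightarrow> 'a free_ring" is Times
  by (rule times_cong)
definition minus_free_ring :: "'a free_ring \<Rightarrow> 'a free_ring \<Rightarrow> 'a free_ring" where
  "minus_free_ring r s = r + - s"

instance
proof
  fix a b c :: "'a free_ring"
  show "a + b + c = a + (b + c)" by transfer (rule plus_assoc)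
  show "a + b = b + a" by transfer (rule plus_comm)
  show "0 + a = a" by transfer (rule plus_zero)
  show "- a + a = 0" by transfer (rule plus_neg)
  show "a - b = a + - b" by (rule minus_free_ring_def)
  show "a * b * c = a * (b * c)" by transfer (rule times_assoc)
  show "a * b = b * a" by transfer (rule times_comm)
  show "1 * a = a" by transfer (rule times_one)
  show "(a + b) * c = a * c + b * c" by transfer (rule distrib)
  show "(0::'a free_ring) \<noteq> 1" by transfer (auto dest: term_int_cong)
qed

end

lift_definition gen :: "'g \<Rightarrow> 'g free_ring" is Var .

lemma abs_free_ring_simps:
  "abs_free_ring (Var g) = gen g" "abs_free_ring Zero = 0" "abs_free_ring One = 1"
  "abs_free_ring (Neg s) = - abs_free_ring s"
  "abs_free_ring (Plus s t) = abs_free_ring s + abs_free_ring t"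
  "abs_free_ring (Times s t) = abs_free_ring s * abs_free_ring t"
  by (simp_all add: gen.abs_eq zero_free_ring.abs_eq one_free_ring.abs_eq uminus_free_ring.abs_eq
      plus_free_ring.abs_eq times_free_ring.abs_eq)

lemma free_ring_induct [case_names gen zero one uminus plus times]:
  assumes "\<And>g. Q (gen g)" "Q 0" "Q 1" "\<And>r. Q r \<Longrightarrow> Q (- r)"
    "\<And>r s. Q r \<Longrightarrow> Q s \<Longrightarrow> Q (r + s)" "\<And>r s. Q r \<Longrightarrow> Q s \<Longrightarrow> Q (r * s)"
  shows "Q r"
proof (induction r rule: free_ring.abs_induct)
  case (1 t)
  show ?case by (induction t) (auto simp: abs_free_ring_simps assms)
qed

lemma rep_free_ring_simps:
  "ring_eq (rep_free_ring (gen g)) (Var g)" "ring_eq (rep_free_ring 0) Zero"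
  "ring_eq (rep_free_ring 1) One"
  "ring_eq (rep_free_ring (- r)) (Neg (rep_free_ring r))"
  "ring_eq (rep_free_ring (r + s)) (Plus (rep_free_ring r) (rep_free_ring s))"
  "ring_eq (rep_free_ring (r * s)) (Times (rep_free_ring r) (rep_free_ring s))"
  by (simp_all only: free_ring.abs_eq_iff[symmetric] abs_free_ring_simps
      Quotient_abs_rep[OF Quotient_free_ring])

primrec term_eval :: "('u, 'm) ring_scheme \<Rightarrow> ('g \<Rightarrow> 'u) \<Rightarrow> 'g ring_term \<Rightarrow> 'u" where
  "term_eval U s (Var g) = s g"
| "term_eval U s Zero = \<zero>\<^bsub>U\<^esub>"
| "term_eval U s One = \<one>\<^bsub>U\<^esub>"
| "term_eval U s (Neg t) = \<ominus>\<^bsub>U\<^esub> term_eval U s t"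
| "term_eval U s (Plus t t') = term_eval U s t \<oplus>\<^bsub>U\<^esub> term_eval U s t'"
| "term_eval U s (Times t t') = term_eval U s t \<otimes>\<^bsub>U\<^esub> term_eval U s t'"

text \<open>A representative is evaluated; \<open>term_eval_cong\<close> makes its choice irrelevant
  as soon as the generators are sent into the carrier.\<close>

definition free_eval :: "('u, 'm) ring_scheme \<Rightarrow> ('g \<Rightarrow> 'u) \<Rightarrow> 'g free_ring \<Rightarrow> 'u" where
  "free_eval U s r = term_eval U s (rep_free_ring r)"

text \<open>A bridge between two styles of algebra: the source is a type of class
  \<open>comm_ring_1\<close>, where \<open>det\<close> and \<open>adj_mat\<close> live, the target a
  ring with a carrier. Identities of generic matrices are transported along such maps.\<close>

locale cring_map = cring U for U :: "('u, 'm) ring_scheme" (structure) +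
  fixes f :: "'r::comm_ring_1 \<Rightarrow> 'u"
  assumes map_closed [simp, intro]: "f a \<in> carrier U"
    and map_add: "f (a + b) = f a \<oplus> f b"
    and map_mult: "f (a * b) = f a \<otimes> f b"
    and map_one: "f 1 = \<one>"
begin

lemma map_zero: "f 0 = \<zero>"
  by (metis add.l_cancel_one' add.right_neutral map_add map_closed)

lemma map_uminus: "f (- a) = \<ominus> f a"
  by (metis add.right_inverse map_add map_closed map_zero minus_equality minus_minus neg_eq_iff_add_eq_0)

lemma map_minus: "f (a - b) = f a \<ominus> f b"
  by (metis a_minus_def diff_conv_add_uminus map_add map_uminus)

lemma map_sum: "f (\<Sum>i\<in>I. x i) = (\<Oplus>i\<in>I. f (x i))"
  by (induction I rule: infinite_finite_induct) (auto simp: map_zero map_add)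

lemma map_prod: "f (\<Prod>i\<in>I. x i) = (\<Otimes>i\<in>I. f (x i))"
  by (induction I rule: infinite_finite_induct) (auto simp: map_one map_mult)

lemma map_det: "f (det (mat n n (\<lambda>(i, j). x i j))) = mat_det U n (\<lambda>i j. f (x i j))"
proof -
  have *: "f (signof p * (\<Prod>i = 0..<n. x i (p i))) =
     (if evenperm p then \<Otimes>i\<in>{..<n}. f (x i (p i)) else \<ominus> (\<Otimes>i\<in>{..<n}. f (x i (p i))))" for p
    by (simp add: sign_def map_uminus map_prod lessThan_atLeast0)
  have "f (det (mat n n (\<lambda>(i, j). x i j))) =
      f (\<Sum>p \<in> {p. p permutes {0..<n}}. signof p * (\<Prod>i = 0..<n. x i (p i)))"
    unfolding det_def'[OF mat_carrier]
    by (intro arg_cong[of _ _ f] sum.cong refl arg_cong2[of _ _ _ _ "(*)"] prod.cong)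
      (auto dest: permutes_in_image)
  then show ?thesis by (simp add: map_sum * mat_det_def lessThan_atLeast0)
qed

end

lemma (in cring) term_eval_closed:
  assumes "\<And>g. s g \<in> carrier R" shows "term_eval R s t \<in> carrier R"
  by (induction t) (auto simp: assms)

lemma (in cring) term_eval_cong:
  assumes "\<And>g. s g \<in> carrier R" and "ring_eq t t'"
  shows "term_eval R s t = term_eval R s t'"
  using assms(2)
  by (induction rule: ring_eq.induct)
    (auto simp: term_eval_closed[OF assms(1)] a_assoc m_assoc l_neg l_distr intro: a_comm m_comm)

lemma (in cring) free_eval_gen:
  assumes "\<And>g. s g \<in> carrier R" shows "free_eval R s (gen g) = s g"
  using term_eval_cong[OF assms rep_free_ring_simps(1)] by (simp add: free_eval_def)

lemma (in cring) free_eval_map: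
  fixes s :: "'g \<Rightarrow> 'a"
  assumes "\<And>g. s g \<in> carrier R" shows "cring_map R (free_eval R s)"
proof
  fix a b :: "'g free_ring"
  show "free_eval R s a \<in> carrier R"
    by (simp add: free_eval_def term_eval_closed[OF assms])
  show "free_eval R s (a + b) = free_eval R s a \<oplus> free_eval R s b"
    using term_eval_cong[OF assms rep_free_ring_simps(5)] by (simp add: free_eval_def)
  show "free_eval R s (a * b) = free_eval R s a \<otimes> free_eval R s b"
    using term_eval_cong[OF assms rep_free_ring_simps(6)] by (simp add: free_eval_def)
  show "free_eval R s 1 = \<one>"
    using term_eval_cong[OF assms rep_free_ring_simps(3)] by (simp add: free_eval_def)
qed

section \<open>Derivations of the free ring and the iterated Leibniz rule\<close>

primrec term_der :: "('g \<Rightarrow> 'g free_ring) \<Rightarrow> 'g ring_term \<Rightarrow> 'g free_ring" where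
  "term_der D (Var g) = D g"
| "term_der D Zero = 0"
| "term_der D One = 0"
| "term_der D (Neg s) = - term_der D s"
| "term_der D (Plus s t) = term_der D s + term_der D t"
| "term_der D (Times s t) = term_der D s * abs_free_ring t + abs_free_ring s * term_der D t"

definition free_der :: "('g \<Rightarrow> 'g free_ring) \<Rightarrow> 'g free_ring \<Rightarrow> 'g free_ring" where
  "free_der D r = term_der D (rep_free_ring r)"

text \<open>The derivative of a product involves the classes of its factors, so equality of the
  classes has to be carried along in the induction.\<close>

lemma term_der_cong: "ring_eq s t \<Longrightarrow> abs_free_ring s = abs_free_ring t \<and> term_der D s = term_der D t"
proof (induction rule: ring_eq.induct)
qed (auto simp: abs_free_ring_simps algebra_simps)

locale derivation =
  fixes d :: "'r::comm_ring_1 \<Rightarrow> 'r"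
  assumes d_add: "d (a + b) = d a + d b"
    and d_mult: "d (a * b) = d a * b + a * d b"
begin

lemma d_zero: "d 0 = 0"
  using d_add[of 0 0] by simp

lemma d_one: "d 1 = 0"
  using d_mult[of 1 1] by simp

lemma d_uminus: "d (- a) = - d a"
  using d_add[of a "- a"] by (simp add: d_zero eq_neg_iff_add_eq_0 add.commute)

lemma d_minus: "d (a - b) = d a - d b"
  using d_add[of a "- b"] by (simp add: d_uminus)

lemma d_sum: "d (\<Sum>i\<in>I. x i) = (\<Sum>i\<in>I. d (x i))"
  by (induction I rule: infinite_finite_induct) (auto simp: d_zero d_add)

lemma d_of_nat_mult: "d (of_nat k * a) = of_nat k * d a"
  by (induction k) (auto simp: d_zero d_add algebra_simps)

lemma d_pow_add: "(d ^^ k) (a + b) = (d ^^ k) a + (d ^^ k) b"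
  by (induction k) (auto simp: d_add)

lemma leibniz:
  "(d ^^ n) (a * b) = (\<Sum>i\<le>n. of_nat (n choose i) * ((d ^^ i) a * (d ^^ (n - i)) b))"
proof (induction n)
  case (Suc n)
  let ?t = "\<lambda>i j. (d ^^ i) a * (d ^^ j) b"
  have "(d ^^ Suc n) (a * b) = (\<Sum>i\<le>n. of_nat (n choose i) * (?t (Suc i) (n - i) + ?t i (Suc n - i)))"
    by (simp add: Suc d_sum d_of_nat_mult) (simp add: d_mult Suc_diff_le)
  also have "\<dots> = (\<Sum>i\<le>n. of_nat (n choose i) * ?t (Suc i) (n - i)) + (\<Sum>i\<le>n. of_nat (n choose i) * ?t i (Suc n - i))"
    by (simp add: distrib_left sum.distrib)
  also have "(\<Sum>i\<le>n. of_nat (n choose i) * ?t i (Suc n - i)) = (\<Sum>i\<le>Suc n. of_nat (n choose i) * ?t i (Suc n - i))"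
    by (simp add: binomial_eq_0)
  also have "\<dots> = ?t 0 (Suc n) + (\<Sum>i\<le>n. of_nat (n choose Suc i) * ?t (Suc i) (n - i))"
    by (subst sum.atMost_Suc_shift) simp
  finally have "(d ^^ Suc n) (a * b) = ?t 0 (Suc n) + (\<Sum>i\<le>n. of_nat (Suc n choose Suc i) * ?t (Suc i) (n - i))"
    by (simp add: sum.distrib[symmetric] algebra_simps)
  also have "\<dots> = (\<Sum>i\<le>Suc n. of_nat (Suc n choose i) * ?t i (Suc n - i))"
    by (subst sum.atMost_Suc_shift) simp
  finally show ?case .
qed simp

end

lemma free_der_derivation: "derivation (free_der D)"
proof
  fix a b :: "'a free_ring"
  show "free_der D (a + b) = free_der D a + free_der D b"
    using term_der_cong[OF rep_free_ring_simps(5)[of a b], where D = D] by (simp add: free_der_def)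
  show "free_der D (a * b) = free_der D a * b + a * free_der D b"
    using term_der_cong[OF rep_free_ring_simps(6)[of a b], where D = D, THEN conjunct2]
    by (simp only: free_der_def term_der.simps Quotient_abs_rep[OF Quotient_free_ring] simp_thms)
qed

lemma free_der_gen: "free_der D (gen g) = D g"
  using term_der_cong[OF rep_free_ring_simps(1), where D = D] by (simp add: free_der_def)

section \<open>Prime ideals and their residue fields\<close>

locale prime_ideal =
  fixes P :: "'r::comm_ring_1 set"
  assumes zero_mem: "0 \<in> P"
    and add_mem: "a \<in> P \<Longrightarrow> b \<in> P \<Longrightarrow> a + b \<in> P"
    and mult_mem: "a \<in> P \<Longrightarrow> r * a \<in> P"
    and one_not_mem: "1 \<notin> P"
    and prime: "a * b \<in> P \<Longrightarrow> a \<in> P \<or> b \<in> P"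
begin

lemma uminus_mem: "a \<in> P \<Longrightarrow> - a \<in> P"
  using mult_mem[of a "- 1"] by simp

lemma minus_mem: "a \<in> P \<Longrightarrow> b \<in> P \<Longrightarrow> a - b \<in> P"
  using add_mem[of a "- b"] uminus_mem by simp

lemma mult_mem_right: "a \<in> P \<Longrightarrow> a * r \<in> P"
  using mult_mem[of a r] by (simp add: mult.commute)

lemma sum_mem: "(\<And>i. i \<in> I \<Longrightarrow> x i \<in> P) \<Longrightarrow> sum x I \<in> P"
  by (induction I rule: infinite_finite_induct) (auto intro: zero_mem add_mem)

end

definition diff_core :: "('r \<Rightarrow> 'r) \<Rightarrow> 'r set \<Rightarrow> 'r set" where
  "diff_core d P = {r. \<forall>k. (d ^^ k) r \<in> P}"

text \<open>The kernel of the Taylor expansion \<open>r \<mapsto> \<Sum>\<^sub>k d\<^sup>k r / k! t\<^sup>k\<close> modulo \<open>P\<close>. It is prime because the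
  lowest terms of two power series over a domain of characteristic 0 multiply to a nonzero term.\<close>

lemma diff_core_prime:
  assumes "derivation d" and "prime_ideal P" and char0: "\<And>n::nat. n > 0 \<Longrightarrow> of_nat n \<notin> P"
  shows "prime_ideal (diff_core d P)"
proof -
  interpret derivation d by fact
  interpret prime_ideal P by fact
  have d0: "(d ^^ k) 0 = 0" for k by (induction k) (auto simp: d_zero)
  show ?thesis
  proof
    fix a b r
    show "0 \<in> diff_core d P" by (simp add: diff_core_def d0 zero_mem)
    show "a + b \<in> diff_core d P" if "a \<in> diff_core d P" "b \<in> diff_core d P"
      using that by (simp add: diff_core_def d_pow_add add_mem)
    show "r * a \<in> diff_core d P" if "a \<in> diff_core d P"
      using that by (auto simp: diff_core_def leibniz intro!: sum_mem mult_mem)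
    have "(d ^^ 0) 1 \<notin> P" using one_not_mem by simp
    then show "1 \<notin> diff_core d P" unfolding diff_core_def by blast
    show "a \<in> diff_core d P \<or> b \<in> diff_core d P" if ab: "a * b \<in> diff_core d P"
    proof (rule ccontr)
      assume "\<not> ?thesis"
      then have ex: "\<exists>k. (d ^^ k) a \<notin> P" "\<exists>k. (d ^^ k) b \<notin> P" by (auto simp: diff_core_def)
      define i where "i = (LEAST k. (d ^^ k) a \<notin> P)"
      define j where "j = (LEAST k. (d ^^ k) b \<notin> P)"
      have i: "(d ^^ i) a \<notin> P" "\<And>k. k < i \<Longrightarrow> (d ^^ k) a \<in> P"
        using LeastI_ex[OF ex(1)] not_less_Least by (auto simp: i_def)
      have j: "(d ^^ j) b \<notin> P" "\<And>k. k < j \<Longrightarrow> (d ^^ k) b \<in> P"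
        using LeastI_ex[OF ex(2)] not_less_Least by (auto simp: j_def)
      let ?t = "\<lambda>k. of_nat ((i + j) choose k) * ((d ^^ k) a * (d ^^ (i + j - k)) b)"
      \<comment> \<open>In the Leibniz sum of order \<open>i + j\<close>, every term but the
        \<open>i\<close>-th contains a derivative of \<open>a\<close> of order below
        \<open>i\<close> or one of \<open>b\<close> of order below \<open>j\<close>.\<close>
      have "?t k \<in> P" if "k \<in> {..i + j} - {i}" for k
      proof (cases "k < i")
        case True then show ?thesis by (intro mult_mem mult_mem_right i(2))
      next
        case False
        then have "i + j - k < j" using that by auto
        then show ?thesis by (intro mult_mem j(2))
      qed
      then have "sum ?t ({..i + j} - {i}) \<in> P" by (rule sum_mem)
      moreover have "(d ^^ (i + j)) (a * b) \<in> P" using ab by (simp add: diff_core_def)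
      moreover have "(d ^^ (i + j)) (a * b) = ?t i + sum ?t ({..i + j} - {i})"
        by (simp add: leibniz sum.remove[of "{..i + j}" i])
      ultimately have "?t i + sum ?t ({..i + j} - {i}) - sum ?t ({..i + j} - {i}) \<in> P"
        by (intro minus_mem) simp_all
      then have "of_nat ((i + j) choose i) * ((d ^^ i) a * (d ^^ j) b) \<in> P" by simp
      moreover have "of_nat ((i + j) choose i) \<notin> P" by (rule char0) simp
      ultimately show False using i(1) j(1) prime by blast
    qed
  qed
qed

lemma diff_core_subset: "diff_core d P \<subseteq> P"
  unfolding diff_core_def by (auto dest: spec[of _ 0])

lemma diff_core_closed: "r \<in> diff_core d P \<Longrightarrow> d r \<in> diff_core d P"
  unfolding diff_core_def by (auto simp: funpow_swap1 dest: spec[of _ "Suc _"])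

text \<open>The fraction \<open>a/b\<close> in the field of fractions of the ring modulo
  \<open>P\<close>: cross multiplication modulo \<open>P\<close> performs the quotient and the
  localization in one step.\<close>

definition frac :: "'r::comm_ring_1 set \<Rightarrow> 'r \<Rightarrow> 'r \<Rightarrow> ('r \<times> 'r) set" where
  "frac P a b = {(x, y). y \<notin> P \<and> a * y - b * x \<in> P}"

text \<open>Each operation is the union of its values over all representatives; as the value does
  not depend on them, the union is a single fraction.\<close>

definition residue_field :: "('r \<Rightarrow> 'r) \<Rightarrow> 'r::comm_ring_1 set \<Rightarrow> ('r \<times> 'r) set diff_ring" where
  "residue_field d P =
     \<lparr>carrier = {frac P a b | a b. b \<notin> P},
      monoid.mult = (\<lambda>A B. \<Union>(a, b)\<in>A. \<Union>(x, y)\<in>B. frac P (a * x) (b * y)),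
      one = frac P 1 1,
      ring.zero = frac P 0 1,
      ring.add = (\<lambda>A B. \<Union>(a, b)\<in>A. \<Union>(x, y)\<in>B. frac P (a * y + b * x) (b * y)),
      der = (\<lambda>A. \<Union>(a, b)\<in>A. frac P (d a * b - a * d b) (b * b))\<rparr>"

context prime_ideal
begin

lemma frac_eq_iff:
  assumes "b \<notin> P" "y \<notin> P"
  shows "frac P a b = frac P x y \<longleftrightarrow> a * y - b * x \<in> P"
proof
  assume "frac P a b = frac P x y"
  moreover have "(x, y) \<in> frac P x y" using assms zero_mem by (auto simp: frac_def mult.commute)
  ultimately show "a * y - b * x \<in> P" by (auto simp: frac_def)
next
  have *: "frac P a b \<subseteq> frac P x y" if "a * y - b * x \<in> P" "b \<notin> P" for a b x y
  proof safe
    fix u v assume "(u, v) \<in> frac P a b"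
    then have v: "v \<notin> P" "a * v - b * u \<in> P" by (auto simp: frac_def)
    \<comment> \<open>Transitivity of cross multiplication up to the factor \<open>b\<close>, which
      is outside \<open>P\<close> and cancels by primality.\<close>
    have "b * (x * v - y * u) = y * (a * v - b * u) - v * (a * y - b * x)" by (simp add: algebra_simps)
    then have "b * (x * v - y * u) \<in> P" using v that by (metis minus_mem mult_mem)
    then show "(u, v) \<in> frac P x y" using that v prime by (auto simp: frac_def)
  qed
  assume 1: "a * y - b * x \<in> P"
  then have "x * b - y * a \<in> P" using uminus_mem[OF 1] by (simp add: algebra_simps)
  then show "frac P a b = frac P x y" using * 1 assms by blast
qed

lemma mem_frac: "b \<notin> P \<Longrightarrow> (a, b) \<in> frac P a b"
  using zero_mem by (auto simp: frac_def mult.commute)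

lemma mem_fracD: "(x, y) \<in> frac P a b \<Longrightarrow> y \<notin> P \<and> a * y - b * x \<in> P"
  by (auto simp: frac_def)

lemma mult_not_mem: "a \<notin> P \<Longrightarrow> b \<notin> P \<Longrightarrow> a * b \<notin> P"
  using prime by blast

lemma residue_mult:
  assumes "b \<notin> P" "y \<notin> P"
  shows "frac P a b \<otimes>\<^bsub>residue_field d P\<^esub> frac P x y = frac P (a * x) (b * y)"
proof -
  have "frac P (a' * x') (b' * y') = frac P (a * x) (b * y)"
    if "(a', b') \<in> frac P a b" "(x', y') \<in> frac P x y" for a' b' x' y'
  proof -
    have *: "b' \<notin> P" "y' \<notin> P" "a * b' - b * a' \<in> P" "x * y' - y * x' \<in> P"
      using that mem_fracD by auto
    have "a' * x' * (b * y) - b' * y' * (a * x) =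
       - (b' * a) * (x * y' - y * x') - (y * x') * (a * b' - b * a')"
      by (simp add: algebra_simps)
    then show ?thesis using * assms
      by (simp add: frac_eq_iff mult_not_mem minus_mem mult_mem uminus_mem)
  qed
  then have "(\<Union>(a', b')\<in>frac P a b. \<Union>(x', y')\<in>frac P x y. frac P (a' * x') (b' * y')) = frac P (a * x) (b * y)"
    using mem_frac[OF assms(1), of a] mem_frac[OF assms(2), of x] by fast
  then show ?thesis by (simp add: residue_field_def)
qed

lemma residue_add:
  assumes "b \<notin> P" "y \<notin> P"
  shows "frac P a b \<oplus>\<^bsub>residue_field d P\<^esub> frac P x y = frac P (a * y + b * x) (b * y)"
proof -
  have "frac P (a' * y' + b' * x') (b' * y') = frac P (a * y + b * x) (b * y)"
    if "(a', b') \<in> frac P a b" "(x', y') \<in> frac P x y" for a' b' x' y'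
  proof -
    have *: "b' \<notin> P" "y' \<notin> P" "a * b' - b * a' \<in> P" "x * y' - y * x' \<in> P"
      using that mem_fracD by auto
    have "(a' * y' + b' * x') * (b * y) - b' * y' * (a * y + b * x) =
       - (b' * b) * (x * y' - y * x') - (y * y') * (a * b' - b * a')"
      by (simp add: algebra_simps)
    then show ?thesis using * assms
      by (simp add: frac_eq_iff mult_not_mem minus_mem mult_mem uminus_mem)
  qed
  then have "(\<Union>(a', b')\<in>frac P a b. \<Union>(x', y')\<in>frac P x y. frac P (a' * y' + b' * x') (b' * y'))
      = frac P (a * y + b * x) (b * y)"
    using mem_frac[OF assms(1), of a] mem_frac[OF assms(2), of x] by fast
  then show ?thesis by (simp add: residue_field_def)
qed

lemma residue_der:
  assumes "derivation d" and dP: "d ` P \<subseteq> P" and "b \<notin> P"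
  shows "der (residue_field d P) (frac P a b) = frac P (d a * b - a * d b) (b * b)"
proof -
  interpret derivation d by fact
  have "frac P (d a' * b' - a' * d b') (b' * b') = frac P (d a * b - a * d b) (b * b)"
    if "(a', b') \<in> frac P a b" for a' b'
  proof -
    have *: "b' \<notin> P" "a * b' - b * a' \<in> P" using that mem_fracD by auto
    then have **: "d a * b' + a * d b' - (d b * a' + b * d a') \<in> P"
      using dP by (metis d_minus d_mult image_subset_iff)
    \<comment> \<open>The two quotient rules differ by a multiple of \<open>a b' - b a'\<close> and
      a multiple of its derivative, and \<open>P\<close> is closed under \<open>d\<close>.\<close>
    have "(d a' * b' - a' * d b') * (b * b) - b' * b' * (d a * b - a * d b) =
       - (b * b') * (d a * b' + a * d b' - (d b * a' + b * d a'))
       + (b * d b' + b' * d b) * (a * b' - b * a')"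
      by (simp add: algebra_simps)
    then show ?thesis using * ** assms
      by (simp add: frac_eq_iff mult_not_mem add_mem minus_mem mult_mem uminus_mem)
  qed
  then have "(\<Union>(a', b')\<in>frac P a b. frac P (d a' * b' - a' * d b') (b' * b')) = frac P (d a * b - a * d b) (b * b)"
    using mem_frac[OF assms(3), of a] by fast
  then show ?thesis by (simp add: residue_field_def)
qed

lemma frac_closed [intro]: "b \<notin> P \<Longrightarrow> frac P a b \<in> carrier (residue_field d P)"
  by (auto simp: residue_field_def)

lemma residue_carrierE:
  assumes "A \<in> carrier (residue_field d P)"
  obtains a b where "b \<notin> P" "A = frac P a b"
  using assms by (auto simp: residue_field_def)

lemma residue_one: "\<one>\<^bsub>residue_field d P\<^esub> = frac P 1 1"
  and residue_zero: "\<zero>\<^bsub>residue_field d P\<^esub> = frac P 0 1"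
  by (auto simp: residue_field_def)

lemma field_residue_field: "field (residue_field d P)" (is "field ?F")
proof -
  note simps = residue_mult residue_add residue_one residue_zero frac_eq_iff one_not_mem mult_not_mem
  have cr: "cring ?F"
  proof (intro cringI abelian_groupI comm_monoidI)
    fix A B C assume "A \<in> carrier ?F" "B \<in> carrier ?F" "C \<in> carrier ?F"
    then obtain a b x y u v where *: "b \<notin> P" "y \<notin> P" "v \<notin> P" "A = frac P a b" "B = frac P x y" "C = frac P u v"
      by (meson residue_carrierE)
    show "A \<otimes>\<^bsub>?F\<^esub> B \<in> carrier ?F" "A \<oplus>\<^bsub>?F\<^esub> B \<in> carrier ?F"
      using * by (auto simp: simps)
    have z: "r \<in> P" if "r = 0" for r using that zero_mem by simp
    show "A \<oplus>\<^bsub>?F\<^esub> B \<oplus>\<^bsub>?F\<^esub> C = A \<oplus>\<^bsub>?F\<^esub> (B \<oplus>\<^bsub>?F\<^esub> C)" "A \<oplus>\<^bsub>?F\<^esub> B = B \<oplus>\<^bsub>?F\<^esub> A"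
      "\<zero>\<^bsub>?F\<^esub> \<oplus>\<^bsub>?F\<^esub> A = A" "A \<otimes>\<^bsub>?F\<^esub> B \<otimes>\<^bsub>?F\<^esub> C = A \<otimes>\<^bsub>?F\<^esub> (B \<otimes>\<^bsub>?F\<^esub> C)"
      "\<one>\<^bsub>?F\<^esub> \<otimes>\<^bsub>?F\<^esub> A = A" "A \<otimes>\<^bsub>?F\<^esub> B = B \<otimes>\<^bsub>?F\<^esub> A"
      "(A \<oplus>\<^bsub>?F\<^esub> B) \<otimes>\<^bsub>?F\<^esub> C = A \<otimes>\<^bsub>?F\<^esub> C \<oplus>\<^bsub>?F\<^esub> B \<otimes>\<^bsub>?F\<^esub> C"
      using * by (auto simp: simps intro!: z) (simp_all add: algebra_simps)
    show "\<exists>B\<in>carrier ?F. B \<oplus>\<^bsub>?F\<^esub> A = \<zero>\<^bsub>?F\<^esub>"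
      using * by (intro bexI[of _ "frac P (- a) b"] frac_closed) (auto simp: simps z)
  qed (auto simp: residue_one residue_zero one_not_mem)
  interpret cring ?F by fact
  show ?thesis
  proof (rule cring_fieldI2)
    show "\<zero>\<^bsub>?F\<^esub> \<noteq> \<one>\<^bsub>?F\<^esub>"
      using one_not_mem uminus_mem[of "- 1"] by (auto simp: simps)
    fix A assume "A \<in> carrier ?F" "A \<noteq> \<zero>\<^bsub>?F\<^esub>"
    then obtain a b where "b \<notin> P" "A = frac P a b" by (meson residue_carrierE)
    moreover have "a \<notin> P" using calculation \<open>A \<noteq> \<zero>\<^bsub>?F\<^esub>\<close> by (auto simp: simps)
    ultimately show "\<exists>B\<in>carrier ?F. A \<otimes>\<^bsub>?F\<^esub> B = \<one>\<^bsub>?F\<^esub>"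
      using zero_mem by (intro bexI[of _ "frac P b a"]) (auto simp: simps mult.commute)
  qed
qed

lemma differential_field_residue_field:
  assumes "derivation d" and "d ` P \<subseteq> P"
  shows "differential_field (residue_field d P)" (is "differential_field ?F")
proof -
  interpret derivation d by fact
  interpret F: field ?F by (rule field_residue_field)
  note simps = residue_mult residue_add residue_der[OF assms] frac_eq_iff mult_not_mem
  show ?thesis
  proof
    fix A B assume "A \<in> carrier ?F"
    then obtain a b where A: "b \<notin> P" "A = frac P a b" by (meson residue_carrierE)
    then show "der ?F A \<in> carrier ?F" by (auto simp: simps)
    assume "B \<in> carrier ?F"
    then obtain x y where B: "y \<notin> P" "B = frac P x y" by (meson residue_carrierE)
    have z: "r \<in> P" if "r = 0" for r using that zero_mem by simp
    show "der ?F (A \<oplus>\<^bsub>?F\<^esub> B) = der ?F A \<oplus>\<^bsub>?F\<^esub> der ?F B"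
      "der ?F (A \<otimes>\<^bsub>?F\<^esub> B) = der ?F A \<otimes>\<^bsub>?F\<^esub> B \<oplus>\<^bsub>?F\<^esub> A \<otimes>\<^bsub>?F\<^esub> der ?F B"
      using A B by (auto simp: simps d_add d_mult intro!: z) (simp_all add: algebra_simps)
  qed
qed

lemma residue_map: "cring_map (residue_field d P) (\<lambda>r. frac P r 1)"
proof -
  interpret F: field "residue_field d P" by (rule field_residue_field)
  have "r \<in> P" if "r = 0" for r using that zero_mem by simp
  then show ?thesis
    by unfold_locales (auto simp: residue_mult residue_add residue_one frac_eq_iff one_not_mem)
qed

lemma residue_der_of:
  assumes "derivation d" and "d ` P \<subseteq> P"
  shows "der (residue_field d P) (frac P r 1) = frac P (d r) 1"
  using derivation.d_one[OF assms(1)] by (simp add: residue_der[OF assms] one_not_mem)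

lemma residue_eq_zero_iff: "frac P r 1 = \<zero>\<^bsub>residue_field d P\<^esub> \<longleftrightarrow> r \<in> P"
  by (simp add: residue_zero frac_eq_iff one_not_mem)

end

section \<open>Linear functionals\<close>

definition functionals :: "('a, 'm) ring_scheme \<Rightarrow> ('a, 'b, 'n) module_scheme \<Rightarrow> ('b \<Rightarrow> 'a) set" where
  "functionals K M = {\<phi> \<in> carrier M \<rightarrow> carrier K.
     (\<forall>x \<in> carrier M. \<forall>y \<in> carrier M. \<phi> (x \<oplus>\<^bsub>M\<^esub> y) = \<phi> x \<oplus>\<^bsub>K\<^esub> \<phi> y) \<and>
     (\<forall>c \<in> carrier K. \<forall>x \<in> carrier M. \<phi> (c \<odot>\<^bsub>M\<^esub> x) = c \<otimes>\<^bsub>K\<^esub> \<phi> x)}"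

lemma (in module) submodule_chain_Union:
  assumes "C \<noteq> {}" "\<And>N. N \<in> C \<Longrightarrow> submodule N R M" "subset.chain A C"
  shows "submodule (\<Union>C) R M"
proof (rule submoduleI)
  note E = submoduleE[OF assms(2)]
  show "\<Union>C \<subseteq> carrier M" using E(1) by blast
  show "\<zero>\<^bsub>M\<^esub> \<in> \<Union>C"
    using assms(1,2) subgroup.one_closed[OF submodule.axioms(1)] by fastforce
  fix a assume a: "a \<in> \<Union>C"
  then obtain N where N: "N \<in> C" "a \<in> N" by blast
  show "\<ominus>\<^bsub>M\<^esub> a \<in> \<Union>C" using N E(3)[OF N(1)] by auto
  show "c \<odot>\<^bsub>M\<^esub> a \<in> \<Union>C" if "c \<in> carrier R" for c using N E(4)[OF N(1) that] by auto
  show "a \<oplus>\<^bsub>M\<^esub> b \<in> \<Union>C" if b: "b \<in> \<Union>C" for b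
  proof -
    obtain N N' where N: "a \<in> N" "b \<in> N'" "N \<in> C" "N' \<in> C" using a b by blast
    then consider "N \<subseteq> N'" | "N' \<subseteq> N" using assms(3) by (auto simp: subset_chain_def)
    then show ?thesis
    proof cases
      case 1 then show ?thesis using N E(5)[OF N(4), of a b] by auto
    next
      case 2 then show ?thesis using N E(5)[OF N(3), of a b] by auto
    qed
  qed
qed

text \<open>A submodule \<open>N\<close> maximal among those that contain \<open>W\<close> and avoid
  \<open>z\<close> is a hyperplane complementary to the line of \<open>z\<close>; the functional
  reads off the coefficient of \<open>z\<close> modulo \<open>N\<close>. Such functionals take the
  place of bases in spaces of infinite dimension.\<close>

lemma (in module) functional_separating:
  assumes "field R" and W: "submodule W R M" and z: "z \<in> carrier M" "z \<notin> W"
  obtains \<phi> where "\<phi> \<in> functionals R M" "\<And>w. w \<in> W \<Longrightarrow> \<phi> w = \<zero>" "\<phi> z = \<one>"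
proof -
  interpret field R by fact
  let ?A = "{N. submodule N R M \<and> W \<subseteq> N \<and> z \<notin> N}"
  have "\<exists>N\<in>?A. \<forall>N'\<in>?A. N \<subseteq> N' \<longrightarrow> N' = N"
  proof (rule subset_Zorn_nonempty)
    show "?A \<noteq> {}" using W z by blast
    fix C assume C: "C \<noteq> {}" "subset.chain ?A C"
    then have "submodule (\<Union>C) R M"
      by (intro submodule_chain_Union[of C ?A]) (auto simp: subset_chain_def)
    then show "\<Union>C \<in> ?A" using C by (auto simp: subset_chain_def)
  qed
  then obtain N where N: "submodule N R M" "W \<subseteq> N" "z \<notin> N"
    and max: "\<And>N'. submodule N' R M \<Longrightarrow> N \<subseteq> N' \<Longrightarrow> z \<notin> N' \<Longrightarrow> N' = N"
    by (smt (verit, ccfv_threshold) mem_Collect_eq subset_trans)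
  note sub = submoduleE[OF N(1)]
  have zero: "\<zero>\<^bsub>M\<^esub> \<in> N" using subgroup.one_closed[OF submodule.axioms(1)[OF N(1)]] by simp
  have minus_zero: "\<ominus>\<^bsub>M\<^esub> \<zero>\<^bsub>M\<^esub> = \<zero>\<^bsub>M\<^esub>"
    by (metis M.l_neg M.r_zero M.zero_closed M.a_inv_closed)
  have ex: "\<exists>c\<in>carrier R. x \<ominus>\<^bsub>M\<^esub> c \<odot>\<^bsub>M\<^esub> z \<in> N" if x: "x \<in> carrier M" for x
  proof (cases "x \<in> N")
    case True
    then show ?thesis using x z by (intro bexI[of _ \<zero>]) (auto simp: a_minus_def minus_zero)
  next
    case False
    \<comment> \<open>\<open>N\<close> enlarged by the line of \<open>x\<close>. By maximality it
      contains \<open>z\<close>, with a nonzero coefficient at \<open>x\<close> because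
      \<open>z\<close> is not in \<open>N\<close>; the relation is then solved for
      \<open>x\<close>.\<close>
    let ?N = "{s \<oplus>\<^bsub>M\<^esub> c \<odot>\<^bsub>M\<^esub> x | s c. s \<in> N \<and> c \<in> carrier R}"
    have N1: "submodule ?N R M"
    proof (rule submoduleI)
      show "?N \<subseteq> carrier M" using sub x by auto
      show "\<zero>\<^bsub>M\<^esub> \<in> ?N" using zero x by (intro CollectI exI[of _ "\<zero>\<^bsub>M\<^esub>"] exI[of _ \<zero>]) auto
      fix a assume "a \<in> ?N"
      then obtain s c where a: "a = s \<oplus>\<^bsub>M\<^esub> c \<odot>\<^bsub>M\<^esub> x" "s \<in> N" "c \<in> carrier R" by blast
      then show "\<ominus>\<^bsub>M\<^esub> a \<in> ?N" using sub x
        by (intro CollectI exI[of _ "\<ominus>\<^bsub>M\<^esub> s"] exI[of _ "\<ominus> c"]) (auto simp: smult_l_minus M.minus_add subset_iff)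
      show "b \<odot>\<^bsub>M\<^esub> a \<in> ?N" if "b \<in> carrier R" for b using a sub x that
        by (intro CollectI exI[of _ "b \<odot>\<^bsub>M\<^esub> s"] exI[of _ "b \<otimes> c"]) (auto simp: smult_r_distr smult_assoc1 subset_iff)
      fix a' assume "a' \<in> ?N"
      then obtain s' c' where a': "a' = s' \<oplus>\<^bsub>M\<^esub> c' \<odot>\<^bsub>M\<^esub> x" "s' \<in> N" "c' \<in> carrier R" by blast
      then show "a \<oplus>\<^bsub>M\<^esub> a' \<in> ?N" using a sub x
        by (intro CollectI exI[of _ "s \<oplus>\<^bsub>M\<^esub> s'"] exI[of _ "c \<oplus> c'"])
          (auto simp: smult_l_distr subset_iff M.a_ac)
    qed
    have N2: "N \<subseteq> ?N"
    proof
      fix s assume "s \<in> N"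
      then show "s \<in> ?N" using sub x by (intro CollectI exI[of _ s] exI[of _ \<zero>]) auto
    qed
    have N3: "x \<in> ?N" using zero x by (intro CollectI exI[of _ "\<zero>\<^bsub>M\<^esub>"] exI[of _ \<one>]) auto
    have "z \<in> ?N"
    proof (rule ccontr)
      assume "z \<notin> ?N"
      then have "?N = N" by (rule max[OF N1 N2])
      then show False using N3 False by simp
    qed
    then obtain s c where s: "z = s \<oplus>\<^bsub>M\<^esub> c \<odot>\<^bsub>M\<^esub> x" "s \<in> N" "c \<in> carrier R" by blast
    have "c \<noteq> \<zero>" using s N(3) x sub by auto
    then have c: "c \<in> Units R" using s by (simp add: field_Units)
    have sM: "s \<in> carrier M" using s sub by blast
    have "x \<ominus>\<^bsub>M\<^esub> inv c \<odot>\<^bsub>M\<^esub> z = \<ominus>\<^bsub>M\<^esub> (inv c \<odot>\<^bsub>M\<^esub> s)"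
    proof -
      have "inv c \<odot>\<^bsub>M\<^esub> z = inv c \<odot>\<^bsub>M\<^esub> s \<oplus>\<^bsub>M\<^esub> x"
        using s c x sM by (simp add: smult_r_distr smult_assoc1[symmetric])
      then show ?thesis
        using c x sM by (simp add: a_minus_def M.minus_add) (subst M.a_lcomm, auto simp: M.r_neg)
    qed
    moreover have "\<ominus>\<^bsub>M\<^esub> (inv c \<odot>\<^bsub>M\<^esub> s) \<in> N" using s c by (intro sub(3,4)) auto
    ultimately have "x \<ominus>\<^bsub>M\<^esub> inv c \<odot>\<^bsub>M\<^esub> z \<in> N" by simp
    then show ?thesis using c by blast
  qed
  have uniq: "c = c'" if "c \<in> carrier R" "c' \<in> carrier R" "x \<in> carrier M"
    "x \<ominus>\<^bsub>M\<^esub> c \<odot>\<^bsub>M\<^esub> z \<in> N" "x \<ominus>\<^bsub>M\<^esub> c' \<odot>\<^bsub>M\<^esub> z \<in> N" for x c c'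
  proof (rule ccontr)
    assume "c \<noteq> c'"
    then have "c \<ominus> c' \<noteq> \<zero>" using that by simp
    then have u: "c \<ominus> c' \<in> Units R" using that by (simp add: field_Units)
    have "(x \<ominus>\<^bsub>M\<^esub> c' \<odot>\<^bsub>M\<^esub> z) \<oplus>\<^bsub>M\<^esub> (\<ominus>\<^bsub>M\<^esub> (x \<ominus>\<^bsub>M\<^esub> c \<odot>\<^bsub>M\<^esub> z)) = (c \<ominus> c') \<odot>\<^bsub>M\<^esub> z"
    proof -
      have *: "(x \<oplus>\<^bsub>M\<^esub> \<ominus>\<^bsub>M\<^esub> p) \<oplus>\<^bsub>M\<^esub> (\<ominus>\<^bsub>M\<^esub> x \<oplus>\<^bsub>M\<^esub> q) = q \<oplus>\<^bsub>M\<^esub> \<ominus>\<^bsub>M\<^esub> p"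
        if "p \<in> carrier M" "q \<in> carrier M" for p q
      proof -
        have "(x \<oplus>\<^bsub>M\<^esub> \<ominus>\<^bsub>M\<^esub> p) \<oplus>\<^bsub>M\<^esub> (\<ominus>\<^bsub>M\<^esub> x \<oplus>\<^bsub>M\<^esub> q) = \<ominus>\<^bsub>M\<^esub> p \<oplus>\<^bsub>M\<^esub> (x \<oplus>\<^bsub>M\<^esub> (\<ominus>\<^bsub>M\<^esub> x \<oplus>\<^bsub>M\<^esub> q))"
          using that \<open>x \<in> carrier M\<close> by (simp add: M.a_ac)
        also have "\<dots> = \<ominus>\<^bsub>M\<^esub> p \<oplus>\<^bsub>M\<^esub> q" using that \<open>x \<in> carrier M\<close> by (simp add: M.r_neg2)
        also have "\<dots> = q \<oplus>\<^bsub>M\<^esub> \<ominus>\<^bsub>M\<^esub> p" using that by (simp add: M.a_comm)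
        finally show ?thesis .
      qed
      show ?thesis
        using that z by (simp add: a_minus_def M.minus_add smult_l_distr smult_l_minus *)
    qed
    then have "(c \<ominus> c') \<odot>\<^bsub>M\<^esub> z \<in> N" using sub(5)[OF that(5) sub(3)[OF that(4)]] by simp
    then have "inv (c \<ominus> c') \<odot>\<^bsub>M\<^esub> ((c \<ominus> c') \<odot>\<^bsub>M\<^esub> z) \<in> N"
      by (rule sub(4)[OF Units_inv_closed[OF u]])
    moreover have "inv (c \<ominus> c') \<odot>\<^bsub>M\<^esub> ((c \<ominus> c') \<odot>\<^bsub>M\<^esub> z) = z"
      using u z by (subst smult_assoc1[symmetric]) auto
    ultimately show False using N(3) by simp
  qed
  define \<phi> where "\<phi> x = (THE c. c \<in> carrier R \<and> x \<ominus>\<^bsub>M\<^esub> c \<odot>\<^bsub>M\<^esub> z \<in> N)" for x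
  have \<phi>: "\<phi> x = c" if "c \<in> carrier R" "x \<in> carrier M" "x \<ominus>\<^bsub>M\<^esub> c \<odot>\<^bsub>M\<^esub> z \<in> N" for x c
    unfolding \<phi>_def using that uniq by blast
  have \<phi>': "\<phi> x \<in> carrier R \<and> x \<ominus>\<^bsub>M\<^esub> \<phi> x \<odot>\<^bsub>M\<^esub> z \<in> N" if x: "x \<in> carrier M" for x
    using ex[OF x] \<phi>[OF _ x] by blast
  have "\<phi> \<in> functionals R M"
    unfolding functionals_def
  proof (intro CollectI conjI ballI)
    fix x y assume xy: "x \<in> carrier M" "y \<in> carrier M"
    have "(x \<ominus>\<^bsub>M\<^esub> \<phi> x \<odot>\<^bsub>M\<^esub> z) \<oplus>\<^bsub>M\<^esub> (y \<ominus>\<^bsub>M\<^esub> \<phi> y \<odot>\<^bsub>M\<^esub> z) \<in> N"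
      using \<phi>' xy by (intro sub(5)) auto
    moreover have "(x \<ominus>\<^bsub>M\<^esub> \<phi> x \<odot>\<^bsub>M\<^esub> z) \<oplus>\<^bsub>M\<^esub> (y \<ominus>\<^bsub>M\<^esub> \<phi> y \<odot>\<^bsub>M\<^esub> z) = (x \<oplus>\<^bsub>M\<^esub> y) \<ominus>\<^bsub>M\<^esub> (\<phi> x \<oplus> \<phi> y) \<odot>\<^bsub>M\<^esub> z"
      using xy z \<phi>' by (simp add: a_minus_def M.minus_add smult_l_distr M.a_ac)
    ultimately show "\<phi> (x \<oplus>\<^bsub>M\<^esub> y) = \<phi> x \<oplus> \<phi> y" using \<phi> \<phi>' xy by auto
  next
    fix c x assume xc: "c \<in> carrier R" "x \<in> carrier M"
    have "c \<odot>\<^bsub>M\<^esub> (x \<ominus>\<^bsub>M\<^esub> \<phi> x \<odot>\<^bsub>M\<^esub> z) \<in> N"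
      using \<phi>' xc by (intro sub(4)) auto
    moreover have "c \<odot>\<^bsub>M\<^esub> (x \<ominus>\<^bsub>M\<^esub> \<phi> x \<odot>\<^bsub>M\<^esub> z) = c \<odot>\<^bsub>M\<^esub> x \<ominus>\<^bsub>M\<^esub> (c \<otimes> \<phi> x) \<odot>\<^bsub>M\<^esub> z"
      using xc z \<phi>' by (simp add: a_minus_def smult_r_distr smult_assoc1 smult_r_minus)
    ultimately show "\<phi> (c \<odot>\<^bsub>M\<^esub> x) = c \<otimes> \<phi> x" using \<phi> \<phi>' xc by auto
  qed (use \<phi>' in auto)
  moreover have "\<phi> w = \<zero>" if "w \<in> W" for w
  proof (rule \<phi>)
    show "w \<in> carrier M" using that N sub by blast
    then show "w \<ominus>\<^bsub>M\<^esub> \<zero> \<odot>\<^bsub>M\<^esub> z \<in> N" using that N z by (auto simp: a_minus_def minus_zero)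
  qed simp
  moreover have "\<phi> z = \<one>"
    using z zero by (intro \<phi>) (auto simp: a_minus_def M.r_neg)
  ultimately show ?thesis using that by blast
qed

definition hom_module :: "('b, 'm) ring_scheme \<Rightarrow> ('a \<Rightarrow> 'b) \<Rightarrow> ('a, 'b) module" where
  "hom_module F e = \<lparr>carrier = carrier F, monoid.mult = monoid.mult F, one = one F,
     ring.zero = ring.zero F, ring.add = ring.add F, module.smult = (\<lambda>c x. e c \<otimes>\<^bsub>F\<^esub> x)\<rparr>"

lemma hom_module_simps [simp]:
  "carrier (hom_module F e) = carrier F" "\<zero>\<^bsub>hom_module F e\<^esub> = \<zero>\<^bsub>F\<^esub>"
  "x \<oplus>\<^bsub>hom_module F e\<^esub> y = x \<oplus>\<^bsub>F\<^esub> y" "c \<odot>\<^bsub>hom_module F e\<^esub> x = e c \<otimes>\<^bsub>F\<^esub> x"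
  by (simp_all add: hom_module_def)

lemma module_hom_module:
  assumes "cring K" "cring F" "e \<in> Ring.ring_hom K F"
  shows "module K (hom_module F e)"
proof -
  interpret K: cring K by fact
  interpret F: cring F by fact
  interpret ring_hom_cring K F e by unfold_locales fact
  show ?thesis
  proof (intro moduleI abelian_groupI)
    fix x assume "x \<in> carrier (hom_module F e)"
    then show "\<exists>y\<in>carrier (hom_module F e). y \<oplus>\<^bsub>hom_module F e\<^esub> x = \<zero>\<^bsub>hom_module F e\<^esub>"
      by (auto intro!: bexI[of _ "\<ominus>\<^bsub>F\<^esub> x"] F.l_neg)
  qed (auto simp: F.a_ac F.m_ac F.l_distr F.r_distr K.cring_axioms)
qed

text \<open>It serves twice: over \<open>U\<close> itself, for the finitely many unknowns of a
  linear system, and over \<open>K\<close> by way of \<open>\<iota>\<close>, for the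
  \<open>U\<close>-valued functions on the group.\<close>

definition fun_module :: "('b, 'm) ring_scheme \<Rightarrow> ('a \<Rightarrow> 'b) \<Rightarrow> 'i set \<Rightarrow> ('a, 'i \<Rightarrow> 'b) module" where
  "fun_module F e I = \<lparr>carrier = I \<rightarrow>\<^sub>E carrier F, monoid.mult = undefined, one = undefined,
     ring.zero = (\<lambda>i\<in>I. \<zero>\<^bsub>F\<^esub>), ring.add = (\<lambda>x y. \<lambda>i\<in>I. x i \<oplus>\<^bsub>F\<^esub> y i),
     module.smult = (\<lambda>c x. \<lambda>i\<in>I. e c \<otimes>\<^bsub>F\<^esub> x i)\<rparr>"

lemma fun_module_simps [simp]:
  "carrier (fun_module F e I) = I \<rightarrow>\<^sub>E carrier F" "\<zero>\<^bsub>fun_module F e I\<^esub> = (\<lambda>i\<in>I. \<zero>\<^bsub>F\<^esub>)"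
  "x \<oplus>\<^bsub>fun_module F e I\<^esub> y = (\<lambda>i\<in>I. x i \<oplus>\<^bsub>F\<^esub> y i)"
  "c \<odot>\<^bsub>fun_module F e I\<^esub> x = (\<lambda>i\<in>I. e c \<otimes>\<^bsub>F\<^esub> x i)"
  by (simp_all add: fun_module_def)

lemma module_fun_module:
  assumes "cring K" "cring F" "e \<in> Ring.ring_hom K F"
  shows "module K (fun_module F e I)"
proof -
  interpret K: cring K by fact
  interpret F: cring F by fact
  interpret ring_hom_cring K F e by unfold_locales fact
  show ?thesis
  proof (intro moduleI abelian_groupI)
    fix x assume "x \<in> carrier (fun_module F e I)"
    then show "\<exists>y\<in>carrier (fun_module F e I). y \<oplus>\<^bsub>fun_module F e I\<^esub> x = \<zero>\<^bsub>fun_module F e I\<^esub>"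
      by (intro bexI[of _ "\<lambda>i\<in>I. \<ominus>\<^bsub>F\<^esub> x i"]) (auto intro!: F.l_neg simp: PiE_def Pi_def fun_eq_iff)
  qed (auto simp: F.a_ac F.m_ac F.l_distr F.r_distr K.cring_axioms PiE_def Pi_def fun_eq_iff extensional_def)
qed

section \<open>Differential fields\<close>

context differential_field
begin

lemma der_zero: "der R \<zero> = \<zero>"
proof -
  have "der R \<zero> \<oplus> der R \<zero> = der R \<zero>" using der_add[of \<zero> \<zero>] by simp
  then show ?thesis by (metis add.l_cancel_one' der_closed zero_closed)
qed

lemma der_one: "der R \<one> = \<zero>"
proof -
  have "der R \<one> \<oplus> der R \<one> = der R \<one>" using der_mult[of \<one> \<one>] der_closed[of \<one>] by simp
  then show ?thesis by (metis add.l_cancel_one' der_closed one_closed)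
qed

lemma der_finsum: "f \<in> I \<rightarrow> carrier R \<Longrightarrow> der R (\<Oplus>i\<in>I. f i) = (\<Oplus>i\<in>I. der R (f i))"
proof (induction I rule: infinite_finite_induct)
  case (insert i I)
  then show ?case by (simp add: der_add der_closed Pi_def)
qed (simp_all add: der_zero)

lemma der_pow_closed: "x \<in> carrier R \<Longrightarrow> (der R ^^ k) x \<in> carrier R"
  by (induction k) (auto simp: der_closed)

end

lemma diff_hom_compose:
  "g \<in> diff_hom A B \<Longrightarrow> h \<in> diff_hom B C \<Longrightarrow> (\<lambda>x. h (g x)) \<in> diff_hom A C"
  using ring_hom_trans[of g A B h C] ring_hom_closed[of g A B]
  by (auto simp: diff_hom_def comp_def)

locale diff_field_map = A: differential_field A + B: differential_field B
  for A :: "'a diff_ring" and B :: "'b diff_ring" +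
  fixes h
  assumes hom: "h \<in> diff_hom A B"
begin

sublocale ring_hom_cring A B h
  using hom by unfold_locales (simp add: diff_hom_def)

lemma hom_der: "x \<in> carrier A \<Longrightarrow> h (der A x) = der B (h x)"
  using hom by (simp add: diff_hom_def)

lemma hom_inv:
  assumes "x \<in> carrier A" "x \<noteq> \<zero>\<^bsub>A\<^esub>"
  shows "h (inv\<^bsub>A\<^esub> x) = inv\<^bsub>B\<^esub> (h x)" and "h x \<noteq> \<zero>\<^bsub>B\<^esub>"
proof -
  have u: "x \<in> Units A" using assms by (simp add: A.field_Units)
  then have 1: "h x \<otimes>\<^bsub>B\<^esub> h (inv\<^bsub>A\<^esub> x) = \<one>\<^bsub>B\<^esub>"
    using assms by (metis A.Units_inv_closed A.Units_r_inv hom_mult hom_one)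
  then show "h (inv\<^bsub>A\<^esub> x) = inv\<^bsub>B\<^esub> (h x)"
    using u assms by (metis A.Units_inv_closed B.comm_inv_char hom_closed)
  show "h x \<noteq> \<zero>\<^bsub>B\<^esub>" using 1 u by (metis A.Units_inv_closed B.l_null B.one_not_zero hom_closed)
qed

lemma hom_eq_zero_iff: "x \<in> carrier A \<Longrightarrow> h x = \<zero>\<^bsub>B\<^esub> \<longleftrightarrow> x = \<zero>\<^bsub>A\<^esub>"
  using hom_inv(2) by auto

lemma hom_eq_iff:
  assumes "x \<in> carrier A" "y \<in> carrier A" shows "h x = h y \<longleftrightarrow> x = y"
proof
  assume "h x = h y"
  then have "h (x \<ominus>\<^bsub>A\<^esub> y) = \<zero>\<^bsub>B\<^esub>" using assms by (simp add: a_minus_def B.r_neg)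
  then have "x \<ominus>\<^bsub>A\<^esub> y = \<zero>\<^bsub>A\<^esub>" using assms by (subst (asm) hom_eq_zero_iff) auto
  then show "x = y" using assms by simp
qed simp

end

lemma diff_extension_map: "diff_extension K L e \<Longrightarrow> diff_field_map K L e"
  by (simp add: diff_extension_def diff_field_map_def diff_field_map_axioms_def)

text \<open>The differential subfield generated by \<open>S\<close>, built from below so that its
  image under an embedding and its cardinality can be found by induction.\<close>

inductive_set diff_span :: "'b diff_ring \<Rightarrow> 'b set \<Rightarrow> 'b set" for L S where
  span_incl: "x \<in> S \<Longrightarrow> x \<in> diff_span L S"
| span_one: "\<one>\<^bsub>L\<^esub> \<in> diff_span L S"
| span_a_inv: "x \<in> diff_span L S \<Longrightarrow> \<ominus>\<^bsub>L\<^esub> x \<in> diff_span L S"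
| span_m_inv: "x \<in> diff_span L S \<Longrightarrow> x \<noteq> \<zero>\<^bsub>L\<^esub> \<Longrightarrow> inv\<^bsub>L\<^esub> x \<in> diff_span L S"
| span_add: "x \<in> diff_span L S \<Longrightarrow> y \<in> diff_span L S \<Longrightarrow> x \<oplus>\<^bsub>L\<^esub> y \<in> diff_span L S"
| span_mult: "x \<in> diff_span L S \<Longrightarrow> y \<in> diff_span L S \<Longrightarrow> x \<otimes>\<^bsub>L\<^esub> y \<in> diff_span L S"
| span_der: "x \<in> diff_span L S \<Longrightarrow> der L x \<in> diff_span L S"

context differential_field
begin

lemma diff_span_closed:
  assumes "S \<subseteq> carrier R" shows "diff_span R S \<subseteq> carrier R"
proof
  fix x assume "x \<in> diff_span R S"
  then show "x \<in> carrier R"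
    by induction (use assms field_Units in \<open>auto simp: der_closed\<close>)
qed

lemma subfield_diff_span:
  assumes "S \<subseteq> carrier R" shows "subfield (diff_span R S) R"
  by (intro subfieldI' subringI diff_span_closed[OF assms]) (auto intro: diff_span.intros)

lemma diff_span_least:
  assumes "subfield F R" "der R ` F \<subseteq> F" "S \<subseteq> F" shows "diff_span R S \<subseteq> F"
proof
  note E = subringE[OF subfieldE(1)[OF assms(1)]]
  fix x assume "x \<in> diff_span R S"
  then show "x \<in> F"
  proof induction
    case (span_m_inv x) then show ?case using subfield_m_inv(1)[OF assms(1)] by blast
  qed (use assms E in auto)
qed

lemma differential_field_diff_span:
  assumes "S \<subseteq> carrier R" shows "differential_field (R\<lparr>carrier := diff_span R S\<rparr>)"
proof -
  interpret F: field "R\<lparr>carrier := diff_span R S\<rparr>"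
    by (rule subfield_iff(2)[OF subfield_diff_span[OF assms]])
  show ?thesis
    by unfold_locales
      (use diff_span_closed[OF assms] in \<open>auto intro: span_der simp: der_add der_mult subset_iff\<close>)
qed

end

lemma (in diff_field_map) image_diff_span:
  assumes "S \<subseteq> carrier A" shows "h ` diff_span A S \<subseteq> diff_span B (h ` S)"
proof safe
  fix x assume "x \<in> diff_span A S"
  then show "h x \<in> diff_span B (h ` S)"
  proof induction
    case (span_m_inv x)
    then show ?case
      using A.diff_span_closed[OF assms] by (metis diff_span.span_m_inv hom_inv subsetD)
  qed (use A.diff_span_closed[OF assms] in \<open>auto intro: diff_span.intros simp: subset_iff hom_der\<close>)
qed

lemma diff_fin_genI:
  assumes "diff_extension K L e" "finite S" "S \<subseteq> carrier L"
    "carrier L \<subseteq> diff_span L (e ` carrier K \<union> S)"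
  shows "diff_fin_gen K L e"
proof -
  interpret differential_field L using assms(1) by (simp add: diff_extension_def)
  have *: "F = carrier L" if "subfield F L" "der L ` F \<subseteq> F" "e ` carrier K \<subseteq> F" "S \<subseteq> F" for F
    using diff_span_least[OF that(1,2), of "e ` carrier K \<union> S"] assms(4) that(3,4) subfieldE(3)[OF that(1)]
    by auto
  show ?thesis
    unfolding diff_fin_gen_def
    by (intro conjI exI[of _ S] allI impI assms(1-3); elim conjE; rule *)
qed

lemma diff_fin_genE:
  assumes "diff_fin_gen K L e"
  obtains S where "finite S" "S \<subseteq> carrier L" "carrier L = diff_span L (e ` carrier K \<union> S)"
proof -
  have ext: "diff_extension K L e" using assms by (simp add: diff_fin_gen_def)
  interpret diff_field_map K L e by (rule diff_extension_map[OF ext])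
  obtain S where S: "finite S" "S \<subseteq> carrier L" and
    *: "\<forall>F. subfield F L \<and> der L ` F \<subseteq> F \<and> e ` carrier K \<subseteq> F \<and> S \<subseteq> F \<longrightarrow> F = carrier L"
    using assms unfolding diff_fin_gen_def by (elim conjE exE)
  have "e ` carrier K \<union> S \<subseteq> carrier L" using S(2) by auto
  then have "diff_span L (e ` carrier K \<union> S) = carrier L"
    by (intro *[rule_format] conjI B.subfield_diff_span) (auto intro: diff_span.intros)
  then show ?thesis using that[OF S] by simp
qed

section \<open>Cardinality of generated fields and embeddings into the universal field\<close>

lemma card_of_diff_span:
  assumes inf: "infinite B" and S: "|S| \<le>o |B|"
  shows "|diff_span L S| \<le>o |B|"
proof -
  \<comment> \<open>One round of all operations. Countably many rounds exhaust the generated field,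
    and none of them leaves the bound by the infinite set \<open>B\<close>.\<close>
  define step where "step T = (T \<union> a_inv L ` T) \<union> (m_inv L ` T \<union> der L ` T) \<union>
    ((\<lambda>(x, y). x \<oplus>\<^bsub>L\<^esub> y) ` (T \<times> T) \<union> (\<lambda>(x, y). x \<otimes>\<^bsub>L\<^esub> y) ` (T \<times> T))" for T
  define T where "T k = (step ^^ k) (insert \<one>\<^bsub>L\<^esub> S)" for k
  note un = card_of_Un_ordLeq_infinite_Field[of "|B|", OF _ _ _ card_of_Card_order, unfolded Field_card_of, OF inf]
  note prod = card_of_Times_ordLeq_infinite_Field[of "|B|", OF _ _ _ card_of_Card_order, unfolded Field_card_of, OF inf]
  have im: "|f ` A| \<le>o |B|" if "|A| \<le>o |B|" for f :: "'c \<Rightarrow> 'b" and A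
    using card_of_image ordLeq_transitive that by blast
  have im2: "|f ` A| \<le>o |B|" if "|A| \<le>o |B|" for f :: "'b \<times> 'b \<Rightarrow> 'b" and A
    using card_of_image ordLeq_transitive that by blast
  have im1: "|f ` A| \<le>o |B|" if "|A| \<le>o |B|" for f :: "'b \<Rightarrow> 'b" and A
    using card_of_image ordLeq_transitive that by blast
  have step: "|step A| \<le>o |B|" if "|A| \<le>o |B|" for A
    unfolding step_def by (intro un im1 im2 prod that)
  have one: "|{\<one>\<^bsub>L\<^esub>}| \<le>o |B|" using inf by (simp add: card_of_singl_ordLeq infinite_imp_nonempty)
  have T: "|T k| \<le>o |B|" for k
  proof (induction k)
    case 0 show ?case using un[OF one S] by (simp add: T_def)
  next
    case (Suc k) then show ?case using step by (simp add: T_def)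
  qed
  have mono: "T k \<subseteq> T m" if "k \<le> m" for k m
    by (rule lift_Suc_mono_le[OF _ that]) (auto simp: T_def step_def)
  have "diff_span L S \<subseteq> (\<Union>k. T k)"
  proof
    have stepI: "x \<in> (\<Union>k. T k)" if "x \<in> step (T k)" for x k
      using that by (intro UN_I[of "Suc k"]) (auto simp: T_def)
    fix x assume "x \<in> diff_span L S"
    then show "x \<in> (\<Union>k. T k)"
    proof induction
      case (span_incl x) then show ?case by (intro UN_I[of 0]) (auto simp: T_def)
    next
      case span_one then show ?case by (intro UN_I[of 0]) (auto simp: T_def)
    next
      case (span_a_inv x)
      then obtain k where "x \<in> T k" by blast
      then show ?case by (intro stepI[of _ k]) (auto simp: step_def)
    next
      case (span_m_inv x)
      then obtain k where "x \<in> T k" by blast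
      then show ?case by (intro stepI[of _ k]) (auto simp: step_def)
    next
      case (span_der x)
      then obtain k where "x \<in> T k" by blast
      then show ?case by (intro stepI[of _ k]) (auto simp: step_def)
    next
      case (span_add x y)
      then obtain k m where "x \<in> T k" "y \<in> T m" by blast
      then have "(x, y) \<in> T (max k m) \<times> T (max k m)"
        using mono[of k "max k m"] mono[of m "max k m"] by auto
      then show ?case by (intro stepI[of _ "max k m"]) (auto simp: step_def)
    next
      case (span_mult x y)
      then obtain k m where "x \<in> T k" "y \<in> T m" by blast
      then have "(x, y) \<in> T (max k m) \<times> T (max k m)"
        using mono[of k "max k m"] mono[of m "max k m"] by auto
      then show ?case by (intro stepI[of _ "max k m"]) (auto simp: step_def)
    qed
  qed
  moreover have "|\<Union>k. T k| \<le>o |B|"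
    using T inf infinite_iff_card_of_nat by (intro card_of_UNION_ordLeq_infinite) auto
  ultimately show ?thesis using card_of_mono1 ordLeq_transitive by blast
qed

lemma (in differential_field) infinite_carrier:
  assumes "char_zero R" shows "infinite (carrier R)"
proof -
  have "inj (\<lambda>k::nat. add_pow R k \<one>)"
  proof (rule linorder_injI)
    fix k m :: nat assume "k < m"
    have "add_pow R m \<one> = add_pow R k \<one> \<oplus> add_pow R (m - k) \<one>"
      using \<open>k < m\<close> by (simp add: add.nat_pow_mult)
    moreover have "add_pow R (m - k) \<one> \<noteq> \<zero>" using assms \<open>k < m\<close> by (simp add: char_zero_def)
    ultimately show "add_pow R k \<one> \<noteq> add_pow R m \<one>"
      by (metis add.l_cancel_one add.nat_pow_closed one_closed)
  qed
  then have "infinite (range (\<lambda>k::nat. add_pow R k \<one>))" by (rule range_inj_infinite)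
  then show ?thesis by (rule contrapos_nn) (auto elim: finite_subset[rotated])
qed

text \<open>Transport of structure along an injection. It brings a field of arbitrary type into the
  type over which \<open>semi_universal\<close> quantifies.\<close>

definition image_diff_ring :: "('a \<Rightarrow> 'b) \<Rightarrow> 'a diff_ring \<Rightarrow> 'b diff_ring" where
  "image_diff_ring g M = (let r = inv_into (carrier M) g in
     \<lparr>carrier = g ` carrier M, monoid.mult = (\<lambda>x y. g (r x \<otimes>\<^bsub>M\<^esub> r y)), one = g \<one>\<^bsub>M\<^esub>,
      ring.zero = g \<zero>\<^bsub>M\<^esub>, ring.add = (\<lambda>x y. g (r x \<oplus>\<^bsub>M\<^esub> r y)), der = (\<lambda>x. g (der M (r x)))\<rparr>)"

lemma image_diff_ring_carrier: "carrier (image_diff_ring g M) = g ` carrier M"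
  by (simp add: image_diff_ring_def Let_def)

lemma (in differential_field) image_diff_ring:
  assumes inj: "inj_on g (carrier R)"
  shows "differential_field (image_diff_ring g R)" and "g \<in> diff_hom R (image_diff_ring g R)"
proof -
  let ?N = "image_diff_ring g R"
  have iso: "g \<in> ring_iso R ?N"
    by (rule ring_iso_memI) (use inj in \<open>auto simp: image_diff_ring_def Let_def bij_betw_def\<close>)
  have "?N\<lparr>zero := g \<zero>\<rparr> = ?N" by (simp add: image_diff_ring_def Let_def)
  then have f: "field ?N" using ring_iso_imp_img_field[OF iso] by simp
  then interpret N: field ?N .
  show hom: "g \<in> diff_hom R ?N"
    using iso inj by (auto simp: diff_hom_def ring_iso_def image_diff_ring_def Let_def)
  interpret ring_hom_cring R ?N g
    using hom by unfold_locales (simp add: diff_hom_def)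
  have d: "der ?N (g x) = g (der R x)" if "x \<in> carrier R" for x
    by (simp only: image_diff_ring_def Let_def diff_ring.simps inv_into_f_f[OF inj that])
  note c = image_diff_ring_carrier[of g R]
  show "differential_field ?N"
  proof unfold_locales
    fix x y assume "x \<in> carrier ?N"
    then obtain x' where x: "x = g x'" "x' \<in> carrier R" by (auto simp: c)
    then show "der ?N x \<in> carrier ?N" by (auto simp: d der_closed)
    assume "y \<in> carrier ?N"
    then obtain y' where y: "y = g y'" "y' \<in> carrier R" by (auto simp: c)
    show "der ?N (x \<oplus>\<^bsub>?N\<^esub> y) = der ?N x \<oplus>\<^bsub>?N\<^esub> der ?N y"
      using x y by (simp add: d der_add der_closed flip: hom_add)
    show "der ?N (x \<otimes>\<^bsub>?N\<^esub> y) = der ?N x \<otimes>\<^bsub>?N\<^esub> y \<oplus>\<^bsub>?N\<^esub> x \<otimes>\<^bsub>?N\<^esub> der ?N y"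
      using x y by (simp add: d der_mult der_closed flip: hom_add hom_mult)
  qed
qed

text \<open>The definition of \<open>semi_universal\<close> speaks about extensions with elements in \<open>nat \<Rightarrow> 'a\<close>; by
  cardinality it applies to finitely generated extensions of any type.\<close>

lemma semi_universal_embedding:
  fixes K :: "'a diff_ring" and M :: "'m diff_ring"
  assumes "semi_universal K U \<iota>" and "char_zero K" and fg: "diff_fin_gen K M j"
  obtains h where "h \<in> diff_hom M U" "\<And>x. x \<in> carrier K \<Longrightarrow> h (j x) = \<iota> x"
proof -
  have ext: "diff_extension K M j" using fg by (simp add: diff_fin_gen_def)
  interpret diff_field_map K M j by (rule diff_extension_map[OF ext])
  obtain S where S: "finite S" "S \<subseteq> carrier M" "carrier M = diff_span M (j ` carrier K \<union> S)"
    using fg by (rule diff_fin_genE)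
  have inf: "infinite (carrier K)" by (rule A.infinite_carrier) fact
  have "|j ` carrier K \<union> S| \<le>o |carrier K|"
  proof (rule card_of_Un_ordLeq_infinite_Field[of "|carrier K|", OF _ _ _ card_of_Card_order])
    show "|S| \<le>o |carrier K|"
      using S(1) inf finite_iff_ordLess_natLeq[of S] infinite_iff_natLeq_ordLeq[of "carrier K"]
        ordLess_ordLeq_trans ordLess_imp_ordLeq by blast
  qed (use inf in \<open>auto simp: card_of_image\<close>)
  then have "|carrier M| \<le>o |carrier K|"
    using card_of_diff_span[OF inf] S(3) by metis
  then obtain g0 where g0: "inj_on g0 (carrier M)" "g0 ` carrier M \<subseteq> carrier K"
    by (metis card_of_ordLeq)
  \<comment> \<open>The constant functions place the carrier inside
    \<open>nat \<Rightarrow> 'a\<close>.\<close>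
  define g :: "'m \<Rightarrow> nat \<Rightarrow> 'a" where "g x = (\<lambda>_. g0 x)" for x
  have inj: "inj_on g (carrier M)" using g0 by (auto simp: g_def inj_on_def fun_eq_iff)
  let ?N = "image_diff_ring g M"
  note N = B.image_diff_ring[OF inj]
  interpret g: diff_field_map M ?N g
    by (intro diff_field_map.intro diff_field_map_axioms.intro B.differential_field_axioms N)
  have ext': "diff_extension K ?N (\<lambda>x. g (j x))"
    using ext N diff_hom_compose unfolding diff_extension_def by blast
  have "diff_fin_gen K ?N (\<lambda>x. g (j x))"
  proof (rule diff_fin_genI[OF ext'])
    show "finite (g ` S)" using S by simp
    show "g ` S \<subseteq> carrier ?N" using S(2) by auto
    have "carrier ?N = g ` carrier M" by (rule image_diff_ring_carrier)
    also have "\<dots> \<subseteq> diff_span ?N (g ` (j ` carrier K \<union> S))"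
      using S(2) by (subst S(3), intro g.image_diff_span) auto
    finally show "carrier ?N \<subseteq> diff_span ?N ((\<lambda>x. g (j x)) ` carrier K \<union> g ` S)"
      by (simp add: image_Un image_image)
  qed
  then obtain h where "h \<in> diff_hom ?N U" "\<forall>x\<in>carrier K. h (g (j x)) = \<iota> x"
    using assms(1) unfolding semi_universal_def by blast
  then show ?thesis by (intro that[of "\<lambda>x. h (g x)"] diff_hom_compose[OF N(2)]) auto
qed

text \<open>If \<open>\<chi>\<close> is a ring homomorphism modulo \<open>P\<close> that commutes with the derivations, then it is one
  modulo \<open>diff_core d P\<close>.\<close>

locale residue_copy = derivation d + prime_ideal P + E: differential_field E
  for d :: "'r::comm_ring_1 \<Rightarrow> 'r" and P and E :: "'b diff_ring" +
  fixes \<chi> :: "'b \<Rightarrow> 'r"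
  assumes \<chi>_add: "a \<in> carrier E \<Longrightarrow> b \<in> carrier E \<Longrightarrow> \<chi> (a \<oplus>\<^bsub>E\<^esub> b) - (\<chi> a + \<chi> b) \<in> P"
    and \<chi>_mult: "a \<in> carrier E \<Longrightarrow> b \<in> carrier E \<Longrightarrow> \<chi> (a \<otimes>\<^bsub>E\<^esub> b) - \<chi> a * \<chi> b \<in> P"
    and \<chi>_one: "\<chi> \<one>\<^bsub>E\<^esub> - 1 \<in> P"
    and \<chi>_der: "a \<in> carrier E \<Longrightarrow> d (\<chi> a) = \<chi> (der E a)"
    and char0: "char_zero E"
begin

lemma \<chi>_zero: "\<chi> \<zero>\<^bsub>E\<^esub> \<in> P"
  using \<chi>_add[of "\<zero>\<^bsub>E\<^esub>" "\<zero>\<^bsub>E\<^esub>"] uminus_mem by force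

lemma \<chi>_of_nat: "\<chi> (add_pow E (n::nat) \<one>\<^bsub>E\<^esub>) - of_nat n \<in> P"
proof (induction n)
  case 0 then show ?case using \<chi>_zero by simp
next
  case (Suc n)
  let ?n = "add_pow E (n) \<one>\<^bsub>E\<^esub>"
  have "(\<chi> (?n \<oplus>\<^bsub>E\<^esub> \<one>\<^bsub>E\<^esub>) - (\<chi> ?n + \<chi> \<one>\<^bsub>E\<^esub>)) + (\<chi> ?n - of_nat n) + (\<chi> \<one>\<^bsub>E\<^esub> - 1) \<in> P"
    using Suc \<chi>_add \<chi>_one by (intro add_mem) auto
  then show ?case by (simp add: algebra_simps)
qed

text \<open>A positive integer is a unit of \<open>E\<close>. If its residue were zero, then
  multiplying by the image of its inverse would put 1 into \<open>P\<close>.\<close>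

lemma of_nat_not_mem:
  assumes "n > 0" shows "of_nat n \<notin> P"
proof
  let ?n = "add_pow E (n) \<one>\<^bsub>E\<^esub>"
  assume "of_nat n \<in> P"
  then have "(\<chi> ?n - of_nat n) + of_nat n \<in> P" using \<chi>_of_nat by (intro add_mem) auto
  then have n: "\<chi> ?n \<in> P" by simp
  have "?n \<in> Units E" using char0 assms by (simp add: E.field_Units char_zero_def)
  then obtain m where m: "m \<in> carrier E" "?n \<otimes>\<^bsub>E\<^esub> m = \<one>\<^bsub>E\<^esub>" by (meson E.Units_inv_closed E.Units_r_inv)
  have "(\<chi> \<one>\<^bsub>E\<^esub> - \<chi> ?n * \<chi> m) + \<chi> ?n * \<chi> m \<in> P"
    using \<chi>_mult[of ?n m] m by (intro add_mem mult_mem_right n) simp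
  then have "\<chi> \<one>\<^bsub>E\<^esub> - (\<chi> \<one>\<^bsub>E\<^esub> - 1) \<in> P" by (intro minus_mem \<chi>_one) simp
  then show False using one_not_mem by simp
qed

lemma prime_diff_core: "prime_ideal (diff_core d P)"
  by (intro diff_core_prime derivation_axioms prime_ideal_axioms of_nat_not_mem)

lemma diff_core_der: "d ` diff_core d P \<subseteq> diff_core d P"
  by (intro image_subsetI diff_core_closed)

text \<open>A relation between values of \<open>\<chi>\<close> stays in \<open>P\<close> under all
  powers of \<open>d\<close>, because \<open>d\<close> passes through \<open>\<chi>\<close> to the
  arguments: the derivative of an additive relation is an additive one, that of a multiplicative
  relation is the sum of an additive and two multiplicative ones.\<close>

lemma residue_hom:
  "(\<lambda>a. frac (diff_core d P) (\<chi> a) 1) \<in> diff_hom E (residue_field d (diff_core d P))"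
proof -
  interpret Q: prime_ideal "diff_core d P" by (rule prime_diff_core)
  note d_pow = funpow_Suc_right o_apply
  have add: "(d ^^ k) (\<chi> (a \<oplus>\<^bsub>E\<^esub> b) - (\<chi> a + \<chi> b)) \<in> P" if "a \<in> carrier E" "b \<in> carrier E" for a b k
    using that
  proof (induction k arbitrary: a b)
    case (Suc k)
    have "d (\<chi> (a \<oplus>\<^bsub>E\<^esub> b) - (\<chi> a + \<chi> b)) =
        \<chi> (der E a \<oplus>\<^bsub>E\<^esub> der E b) - (\<chi> (der E a) + \<chi> (der E b))"
      using Suc.prems by (simp add: d_minus d_add \<chi>_der E.der_add)
    then show ?case using Suc.IH Suc.prems by (simp add: d_pow E.der_closed del: funpow.simps)
  qed (simp add: \<chi>_add)
  have mult: "(d ^^ k) (\<chi> (a \<otimes>\<^bsub>E\<^esub> b) - \<chi> a * \<chi> b) \<in> P" if "a \<in> carrier E" "b \<in> carrier E" for a b k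
    using that
  proof (induction k arbitrary: a b)
    case (Suc k)
    let ?x = "der E a \<otimes>\<^bsub>E\<^esub> b" and ?y = "a \<otimes>\<^bsub>E\<^esub> der E b"
    have "d (\<chi> (a \<otimes>\<^bsub>E\<^esub> b) - \<chi> a * \<chi> b) = (\<chi> (?x \<oplus>\<^bsub>E\<^esub> ?y) - (\<chi> ?x + \<chi> ?y))
        + ((\<chi> ?x - \<chi> (der E a) * \<chi> b) + (\<chi> ?y - \<chi> a * \<chi> (der E b)))"
      using Suc.prems by (simp add: d_minus d_mult \<chi>_der E.der_mult)
    moreover have "(d ^^ k) (\<dots>) \<in> P"
      unfolding d_pow_add using Suc by (intro add_mem add Suc.IH) (auto simp: E.der_closed)
    ultimately show ?case by (simp add: d_pow del: funpow.simps)
  qed (simp add: \<chi>_mult)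
  have one: "(d ^^ k) (\<chi> \<one>\<^bsub>E\<^esub> - 1) \<in> P" for k
  proof (cases k)
    case (Suc k)
    have "(d ^^ k) (\<chi> \<zero>\<^bsub>E\<^esub>) \<in> P" for k
    proof (induction k)
      case (Suc k)
      then show ?case by (simp add: d_pow \<chi>_der E.der_zero del: funpow.simps)
    qed (simp add: \<chi>_zero)
    then show ?thesis using Suc by (simp add: d_pow d_minus d_one \<chi>_der E.der_one del: funpow.simps)
  qed (simp add: \<chi>_one)
  have core: "r \<in> diff_core d P" if "\<And>k. (d ^^ k) r \<in> P" for r
    using that by (simp add: diff_core_def)
  show ?thesis
    unfolding diff_hom_def
  proof (intro CollectI conjI ring_hom_memI ballI)
    show "frac (diff_core d P) (\<chi> (der E a)) 1 =
        der (residue_field d (diff_core d P)) (frac (diff_core d P) (\<chi> a) 1)" if "a \<in> carrier E" for a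
      using that by (simp add: Q.residue_der_of[OF derivation_axioms diff_core_der] \<chi>_der)
  qed (auto simp: Q.residue_mult Q.residue_add Q.residue_one Q.frac_eq_iff Q.one_not_mem add mult one intro!: core)
qed

end

lemma residue_field_generated:
  fixes Q :: "'g free_ring set"
  assumes "prime_ideal Q" "derivation d" "d ` Q \<subseteq> Q"
  shows "carrier (residue_field d Q) \<subseteq> diff_span (residue_field d Q) (range (\<lambda>g. frac Q (gen g) 1))"
proof
  interpret prime_ideal Q by fact
  let ?M = "residue_field d Q"
  interpret M: differential_field ?M by (rule differential_field_residue_field) fact+
  interpret cring_map ?M "\<lambda>r. frac Q r 1" by (rule residue_map)
  let ?S = "diff_span ?M (range (\<lambda>g. frac Q (gen g) 1))"
  have r: "frac Q r 1 \<in> ?S" for r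
  proof (induction r rule: free_ring_induct)
    case zero
    have "\<one>\<^bsub>?M\<^esub> \<oplus>\<^bsub>?M\<^esub> \<ominus>\<^bsub>?M\<^esub> \<one>\<^bsub>?M\<^esub> \<in> ?S" by (intro diff_span.intros)
    then show ?case by (simp add: map_zero M.r_neg)
  next
    case one
    have "\<one>\<^bsub>?M\<^esub> \<in> ?S" by (rule span_one)
    then show ?case by (simp add: map_one)
  qed (auto simp: map_uminus map_add map_mult intro: diff_span.intros)
  fix x assume "x \<in> carrier ?M"
  then obtain a b where x: "x = frac Q a b" "b \<notin> Q" by (meson residue_carrierE)
  have nz: "frac Q b 1 \<noteq> \<zero>\<^bsub>?M\<^esub>" using x by (simp add: residue_eq_zero_iff)
  have "x \<otimes>\<^bsub>?M\<^esub> frac Q b 1 = frac Q a 1"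
    using x zero_mem by (simp add: residue_mult one_not_mem frac_eq_iff algebra_simps)
  then have "x = frac Q a 1 \<otimes>\<^bsub>?M\<^esub> inv\<^bsub>?M\<^esub> (frac Q b 1)"
    using nz x M.field_Units
    by (metis (no_types, lifting) DiffI M.Units_inv_closed M.Units_r_inv M.m_assoc M.r_one frac_closed map_closed singletonD)
  also have "\<dots> \<in> ?S" by (intro diff_span.intros r nz)
  finally show "x \<in> ?S" .
qed

section \<open>Embeddings that move a given element\<close>

definition ideal_set :: "'r::comm_ring_1 set \<Rightarrow> bool" where
  "ideal_set I \<longleftrightarrow> 0 \<in> I \<and> (\<forall>a\<in>I. \<forall>b\<in>I. a + b \<in> I) \<and> (\<forall>a\<in>I. \<forall>r. r * a \<in> I)"

text \<open>An ideal \<open>P\<close> maximal among those that contain \<open>J\<close> and no power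
  of \<open>w\<close> is prime: if \<open>a\<close> and \<open>b\<close> are outside
  \<open>P\<close>, powers of \<open>w\<close> lie in \<open>P + (a)\<close> and in
  \<open>P + (b)\<close>, and their product lies in \<open>P + (a b)\<close>.\<close>

lemma prime_ideal_avoiding:
  fixes w :: "'r::comm_ring_1"
  assumes J: "ideal_set J" and w: "\<And>N. w ^ N \<notin> J"
  obtains P where "prime_ideal P" "J \<subseteq> P" "w \<notin> P"
proof -
  let ?A = "{I. ideal_set I \<and> J \<subseteq> I \<and> (\<forall>N. w ^ N \<notin> I)}"
  have "\<exists>P\<in>?A. \<forall>I\<in>?A. P \<subseteq> I \<longrightarrow> I = P"
  proof (rule subset_Zorn_nonempty)
    show "?A \<noteq> {}" using J w by blast
    fix C assume C: "C \<noteq> {}" "subset.chain ?A C"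
    have I: "ideal_set I" "J \<subseteq> I" "w ^ N \<notin> I" if "I \<in> C" for I N
      using C(2) that by (auto simp: subset_chain_def)
    have "ideal_set (\<Union>C)"
      unfolding ideal_set_def
    proof (intro conjI ballI allI)
      show "0 \<in> \<Union>C" using C(1) I(1) by (fastforce simp: ideal_set_def)
      fix a assume a: "a \<in> \<Union>C"
      show "r * a \<in> \<Union>C" for r using a I(1) by (fastforce simp: ideal_set_def)
      fix b assume "b \<in> \<Union>C"
      then obtain I1 I2 where *: "I1 \<in> C" "I2 \<in> C" "a \<in> I1" "b \<in> I2" using a by blast
      then consider "I1 \<subseteq> I2" | "I2 \<subseteq> I1" using C(2) by (auto simp: subset_chain_def)
      then show "a + b \<in> \<Union>C"
      proof cases
        case 1 then have "a + b \<in> I2" using * I(1)[OF *(2)] by (auto simp: ideal_set_def)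
        then show ?thesis using * by blast
      next
        case 2 then have "a + b \<in> I1" using * I(1)[OF *(1)] by (auto simp: ideal_set_def)
        then show ?thesis using * by blast
      qed
    qed
    then show "\<Union>C \<in> ?A" using C(1) I(2,3) by fastforce
  qed
  then obtain P where P: "ideal_set P" "J \<subseteq> P" "\<And>N. w ^ N \<notin> P"
    and max: "\<forall>I\<in>?A. P \<subseteq> I \<longrightarrow> I = P" by blast
  have zero: "0 \<in> P" and add: "a + b \<in> P" if "a \<in> P" "b \<in> P" for a b
    using P(1) that by (auto simp: ideal_set_def)
  have zero: "0 \<in> P" using P(1) by (auto simp: ideal_set_def)
  have mult: "r * a \<in> P" if "a \<in> P" for a r using P(1) that by (auto simp: ideal_set_def)
  have power: "\<exists>N i r. i \<in> P \<and> w ^ N = i + r * a" if "a \<notin> P" for a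
  proof (rule ccontr)
    assume no: "\<not> ?thesis"
    let ?I = "{i + r * a | i r. i \<in> P}"
    have "ideal_set ?I"
      unfolding ideal_set_def
    proof (intro conjI ballI allI)
      show "0 \<in> ?I" using zero by (intro CollectI exI[of _ 0]) auto
      fix x assume "x \<in> ?I"
      then obtain i r where x: "x = i + r * a" "i \<in> P" by blast
      show "s * x \<in> ?I" for s
        using x mult by (intro CollectI exI[of _ "s * i"] exI[of _ "s * r"]) (auto simp: algebra_simps)
      fix y assume "y \<in> ?I"
      then obtain i' r' where y: "y = i' + r' * a" "i' \<in> P" by blast
      show "x + y \<in> ?I"
        using x y add by (intro CollectI exI[of _ "i + i'"] exI[of _ "r + r'"]) (auto simp: algebra_simps)
    qed
    moreover have sub: "P \<subseteq> ?I"
    proof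
      fix i assume "i \<in> P"
      then show "i \<in> ?I" by (intro CollectI exI[of _ i] exI[of _ 0]) auto
    qed
    moreover have "w ^ N \<notin> ?I" for N using no by blast
    ultimately have "?I = P" using max P(2) by auto
    moreover have "a \<in> ?I" using zero by (intro CollectI exI[of _ 0] exI[of _ 1]) auto
    ultimately show False using \<open>a \<notin> P\<close> by simp
  qed
  have "prime_ideal P"
  proof
    show "1 \<notin> P" using P(3)[of 0] by simp
    fix a b assume ab: "a * b \<in> P"
    show "a \<in> P \<or> b \<in> P"
    proof (rule ccontr)
      assume "\<not> ?thesis"
      then obtain N i r M j s where
        *: "i \<in> P" "w ^ N = i + r * a" "j \<in> P" "w ^ M = j + s * b"
        using power[of a] power[of b] by blast
      have "w ^ (N + M) = w ^ M * i + ((r * a) * j + (r * s) * (a * b))"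
        unfolding power_add *(2) *(4) by (simp add: algebra_simps)
      moreover have "\<dots> \<in> P" by (intro add mult ab *)
      ultimately show False using P(3) by metis
    qed
  qed (use zero add mult in auto)
  then show ?thesis using P(2) P(3)[of 1] that by auto
qed

section \<open>Linear endomorphisms of a field and commutators with a multiplication\<close>

context field
begin

definition lin :: "'a set \<Rightarrow> ('a \<Rightarrow> 'a) set" where
  "lin C = {\<phi> \<in> carrier R \<rightarrow> carrier R.
     (\<forall>x\<in>carrier R. \<forall>y\<in>carrier R. \<phi> (x \<oplus> y) = \<phi> x \<oplus> \<phi> y) \<and>
     (\<forall>c\<in>C. \<forall>x\<in>carrier R. \<phi> (c \<otimes> x) = c \<otimes> \<phi> x)}"

lemma linI:
  assumes "\<And>x. x \<in> carrier R \<Longrightarrow> \<phi> x \<in> carrier R"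
    "\<And>x y. x \<in> carrier R \<Longrightarrow> y \<in> carrier R \<Longrightarrow> \<phi> (x \<oplus> y) = \<phi> x \<oplus> \<phi> y"
    "\<And>c x. c \<in> C \<Longrightarrow> x \<in> carrier R \<Longrightarrow> \<phi> (c \<otimes> x) = c \<otimes> \<phi> x"
  shows "\<phi> \<in> lin C"
  using assms by (auto simp: lin_def)

lemma lin_closed: "\<phi> \<in> lin C \<Longrightarrow> x \<in> carrier R \<Longrightarrow> \<phi> x \<in> carrier R"
  and lin_add: "\<phi> \<in> lin C \<Longrightarrow> x \<in> carrier R \<Longrightarrow> y \<in> carrier R \<Longrightarrow> \<phi> (x \<oplus> y) = \<phi> x \<oplus> \<phi> y"
  and lin_scale: "\<phi> \<in> lin C \<Longrightarrow> c \<in> C \<Longrightarrow> x \<in> carrier R \<Longrightarrow> \<phi> (c \<otimes> x) = c \<otimes> \<phi> x"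
  by (auto simp: lin_def)

lemma lin_zero: "\<phi> \<in> lin C \<Longrightarrow> \<phi> \<zero> = \<zero>"
  using lin_add[of \<phi> C \<zero> \<zero>] lin_closed[of \<phi> C \<zero>] by (metis add.l_cancel_one' r_zero zero_closed)

lemma lin_uminus: "\<phi> \<in> lin C \<Longrightarrow> x \<in> carrier R \<Longrightarrow> \<phi> (\<ominus> x) = \<ominus> \<phi> x"
  using lin_add[of \<phi> C "\<ominus> x" x] lin_closed[of \<phi> C] by (simp add: l_neg lin_zero minus_equality)

lemma lin_minus: "\<phi> \<in> lin C \<Longrightarrow> x \<in> carrier R \<Longrightarrow> y \<in> carrier R \<Longrightarrow> \<phi> (x \<ominus> y) = \<phi> x \<ominus> \<phi> y"
  by (simp add: a_minus_def lin_add lin_uminus)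

lemma lin_add_pow: "\<phi> \<in> lin C \<Longrightarrow> x \<in> carrier R \<Longrightarrow> \<phi> (add_pow R (k::nat) x) = add_pow R k (\<phi> x)"
  by (induction k) (simp_all add: lin_zero lin_add lin_closed)

lemma lin_compose: "\<phi> \<in> lin C \<Longrightarrow> \<psi> \<in> lin C \<Longrightarrow> (\<lambda>x. \<phi> (\<psi> x)) \<in> lin C"
  by (intro linI) (simp_all add: lin_add lin_scale lin_closed)

text \<open>The commutator of the multiplication by \<open>u\<close> with \<open>\<phi>\<close>. It
  is a derivation with respect to composition, and it is how
  \<open>u \<otimes> 1 - 1 \<otimes> u\<close> acts.\<close>

definition ad :: "'a \<Rightarrow> ('a \<Rightarrow> 'a) \<Rightarrow> 'a \<Rightarrow> 'a" where
  "ad u \<phi> x = u \<otimes> \<phi> x \<ominus> \<phi> (u \<otimes> x)"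

lemma ad_lin:
  assumes "u \<in> carrier R" "C \<subseteq> carrier R" "\<phi> \<in> lin C"
  shows "ad u \<phi> \<in> lin C"
proof (rule linI)
  note lin = lin_closed[OF assms(3)] lin_add[OF assms(3)] lin_scale[OF assms(3)]
  fix x y assume xy: "x \<in> carrier R" "y \<in> carrier R"
  show "ad u \<phi> (x \<oplus> y) = ad u \<phi> x \<oplus> ad u \<phi> y"
    using xy assms by (simp add: ad_def lin r_distr a_minus_def minus_add a_ac)
next
  note lin = lin_closed[OF assms(3)] lin_add[OF assms(3)] lin_scale[OF assms(3)]
  fix c x assume "c \<in> C" "x \<in> carrier R"
  then show "ad u \<phi> (c \<otimes> x) = c \<otimes> ad u \<phi> x"
    using assms by (simp add: ad_def lin r_distr a_minus_def r_minus m_lcomm[of u c] subset_iff)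
qed (use assms in \<open>simp add: ad_def lin_closed\<close>)

lemma ad_pow_lin:
  assumes "u \<in> carrier R" "C \<subseteq> carrier R" "\<phi> \<in> lin C"
  shows "(ad u ^^ k) \<phi> \<in> lin C"
  by (induction k) (use ad_lin[OF assms(1,2)] assms(3) in auto)

lemma ad_pow_zero:
  assumes u: "u \<in> carrier R" and "\<And>x. x \<in> carrier R \<Longrightarrow> \<phi> x = \<zero>" "x \<in> carrier R"
  shows "(ad u ^^ k) \<phi> x = \<zero>"
  using assms(3)
proof (induction k arbitrary: x)
  case (Suc k) then show ?case using u by (simp add: ad_def a_minus_def r_neg)
qed (use assms(2) in simp)

text \<open>The Leibniz rule for powers of \<open>ad u\<close> on a composition. Two terms survive,
  as the second commutator of \<open>\<psi>\<close> vanishes, and the second of them carries the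
  factor \<open>Suc m\<close>.\<close>

lemma ad_pow_compose:
  assumes u: "u \<in> carrier R" and C: "C \<subseteq> carrier R"
    and lin: "\<psi> \<in> lin C" "\<chi> \<in> lin C" "\<eta> \<in> lin C"
    and ad1: "\<And>x. x \<in> carrier R \<Longrightarrow> ad u \<psi> x = \<eta> x"
    and ad2: "\<And>x. x \<in> carrier R \<Longrightarrow> ad u \<eta> x = \<zero>"
    and x: "x \<in> carrier R"
  shows "(ad u ^^ Suc m) (\<lambda>x. \<psi> (\<chi> x)) x =
    \<psi> ((ad u ^^ Suc m) \<chi> x) \<oplus> add_pow R (Suc m) (\<eta> ((ad u ^^ m) \<chi> x))"
proof -
  have base: "u \<otimes> \<psi> (\<phi> x) \<ominus> \<psi> (\<phi> (u \<otimes> x)) = \<psi> (ad u \<phi> x) \<oplus> \<eta> (\<phi> x)"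
    if "\<phi> \<in> lin C" "x \<in> carrier R" for \<phi> x
  proof -
    let ?p = "\<psi> (u \<otimes> \<phi> x)" and ?q = "\<psi> (\<phi> (u \<otimes> x))"
    have cl: "?p \<in> carrier R" "?q \<in> carrier R" "\<psi> (\<phi> x) \<in> carrier R"
      using that u lin by (simp_all add: lin_closed)
    have "\<psi> (ad u \<phi> x) \<oplus> \<eta> (\<phi> x) = (?p \<ominus> ?q) \<oplus> (u \<otimes> \<psi> (\<phi> x) \<ominus> ?p)"
      using that u lin by (simp add: ad1[symmetric] ad_def lin_minus lin_closed)
    also have "\<dots> = (u \<otimes> \<psi> (\<phi> x) \<ominus> ?q) \<oplus> (?p \<oplus> \<ominus> ?p)"
      using cl u by (simp add: a_minus_def a_ac)
    also have "\<dots> = u \<otimes> \<psi> (\<phi> x) \<ominus> ?q" using cl u by (simp add: r_neg)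
    finally show ?thesis by simp
  qed
  have \<eta>: "u \<otimes> \<eta> y = \<eta> (u \<otimes> y)" if "y \<in> carrier R" for y
    using ad2[OF that] that u lin by (simp add: ad_def lin_closed)
  show ?thesis
    using x
  proof (induction m arbitrary: x)
    case 0
    then show ?case using base[OF lin(2)] lin by (simp add: ad_def lin_closed)
  next
    case (Suc m)
    let ?A = "(ad u ^^ Suc m) \<chi>" and ?B = "(ad u ^^ m) \<chi>" and ?k = "Suc m"
    have AB: "?A \<in> lin C" "?B \<in> lin C" using ad_pow_lin[OF u C lin(2)] by blast+
    have ux: "u \<otimes> x \<in> carrier R" using u Suc.prems by simp
    have cl: "?A x \<in> carrier R" "?B x \<in> carrier R" "?A (u \<otimes> x) \<in> carrier R" "?B (u \<otimes> x) \<in> carrier R"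
      using AB ux Suc.prems by (simp_all only: lin_closed)
    note cl' = cl lin_closed[OF lin(1) cl(1)] lin_closed[OF lin(1) cl(3)]
      lin_closed[OF lin(3) cl(1)] lin_closed[OF lin(3) cl(2)] lin_closed[OF lin(3) cl(4)]
      lin_closed[OF lin(3) m_closed[OF u cl(2)]]
    let ?F = "(ad u ^^ ?k) (\<lambda>x. \<psi> (\<chi> x))"
    have "(ad u ^^ Suc ?k) (\<lambda>x. \<psi> (\<chi> x)) x = ad u ?F x" by simp
    also have "\<dots> = u \<otimes> ?F x \<ominus> ?F (u \<otimes> x)" by (rule ad_def)
    also have "\<dots> = u \<otimes> (\<psi> (?A x) \<oplus> add_pow R ?k (\<eta> (?B x))) \<ominus> (\<psi> (?A (u \<otimes> x)) \<oplus> add_pow R ?k (\<eta> (?B (u \<otimes> x))))"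
      by (simp only: Suc.IH[OF Suc.prems] Suc.IH[OF ux])
    also have "\<dots> = (u \<otimes> \<psi> (?A x) \<ominus> \<psi> (?A (u \<otimes> x))) \<oplus>
       (add_pow R ?k (\<eta> (u \<otimes> ?B x)) \<ominus> add_pow R ?k (\<eta> (?B (u \<otimes> x))))"
      using cl' u by (simp add: r_distr add_pow_rdistr \<eta> a_minus_def minus_add a_ac del: funpow.simps add.nat_pow_Suc)
    also have "add_pow R ?k (\<eta> (u \<otimes> ?B x)) \<ominus> add_pow R ?k (\<eta> (?B (u \<otimes> x)))
       = add_pow R ?k (\<eta> (u \<otimes> ?B x \<ominus> ?B (u \<otimes> x)))"
      using lin(3) cl u by (simp add: lin_add_pow[symmetric] lin_minus[symmetric] del: funpow.simps add.nat_pow_Suc)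
        (simp add: lin_add_pow a_minus_def add.nat_pow_distrib add.nat_pow_inv lin_add lin_uminus lin_closed del: funpow.simps add.nat_pow_Suc)
    also have "u \<otimes> ?B x \<ominus> ?B (u \<otimes> x) = ?A x" by (simp add: ad_def)
    also have "u \<otimes> \<psi> (?A x) \<ominus> \<psi> (?A (u \<otimes> x)) = \<psi> ((ad u ^^ Suc ?k) \<chi> x) \<oplus> \<eta> (?A x)"
      using base[OF AB(1) Suc.prems] by simp
    finally show ?case
      using cl' lin_closed[OF lin(1) lin_closed[OF ad_pow_lin[OF u C lin(2), of "Suc ?k"] Suc.prems]]
      by (simp add: a_ac add.nat_pow_Suc2 del: funpow.simps)
  qed
qed

text \<open>Suppose the \<open>N\<close>-th commutator kills all linear maps. Let
  \<open>\<theta>\<close> be the last nonzero iterated commutator of \<open>\<phi>0\<close>, and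
  \<open>\<phi>\<close> the one before it. Precomposition with a multiplication turns them into
  \<open>\<psi>\<close> and \<open>\<eta>\<close> such that \<open>\<eta>\<close> fixes some nonzero
  \<open>z\<close>. Then the \<open>m\<close>-th commutator of \<open>\<psi>^m\<close> is
  \<open>m! \<eta>^m\<close>, with value \<open>m! z\<close> at \<open>z\<close>, which is nonzero
  in characteristic 0.\<close>

lemma ad_not_nilpotent:
  assumes u: "u \<in> carrier R" and C: "C \<subseteq> carrier R" and char0: "char_zero R"
    and \<phi>0: "\<phi>0 \<in> lin C" "\<phi>0 \<one> = \<zero>" "\<phi>0 u = \<one>"
  obtains \<phi> x where "\<phi> \<in> lin C" "x \<in> carrier R" "(ad u ^^ N) \<phi> x \<noteq> \<zero>"
proof -
  have False if nil: "\<And>\<phi> x. \<phi> \<in> lin C \<Longrightarrow> x \<in> carrier R \<Longrightarrow> (ad u ^^ N) \<phi> x = \<zero>"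
  proof -
    define k where "k = (LEAST k. \<forall>x\<in>carrier R. (ad u ^^ k) \<phi>0 x = \<zero>)"
    have k: "(ad u ^^ k) \<phi>0 x = \<zero>" if "x \<in> carrier R" for x
      using LeastI[of "\<lambda>k. \<forall>x\<in>carrier R. (ad u ^^ k) \<phi>0 x = \<zero>" N] nil[OF \<phi>0(1)] that
      by (auto simp: k_def)
    have k': "\<exists>x\<in>carrier R. (ad u ^^ j) \<phi>0 x \<noteq> \<zero>" if "j < k" for j
      using not_less_Least[of j "\<lambda>k. \<forall>x\<in>carrier R. (ad u ^^ k) \<phi>0 x = \<zero>"] that by (auto simp: k_def)
    have "k \<noteq> 0"
    proof
      assume "k = 0" then have "\<phi>0 u = \<zero>" using k[OF u] by simp
      then show False using \<phi>0 by simp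
    qed
    \<comment> \<open>At 1 the first commutator is \<open>u \<phi>0(1) - \<phi>0(u) = -1\<close>.
      With \<open>k\<close> at least 2, both \<open>\<phi>\<close> and \<open>\<theta>\<close> below
      exist in the chain.\<close>
    moreover have "k \<noteq> 1"
    proof
      assume "k = 1"
      then have "ad u \<phi>0 \<one> = \<zero>" using k[OF one_closed] by simp
      moreover have "ad u \<phi>0 \<one> = \<ominus> \<one>" using \<phi>0 u by (simp add: ad_def a_minus_def)
      ultimately show False by (metis add.inv_eq_1_iff one_closed one_not_zero)
    qed
    ultimately obtain j where j: "k = Suc (Suc j)" by (metis One_nat_def not0_implies_Suc)
    define \<phi> where "\<phi> = (ad u ^^ j) \<phi>0"
    define \<theta> where "\<theta> = ad u \<phi>"
    have \<phi>: "\<phi> \<in> lin C" unfolding \<phi>_def by (rule ad_pow_lin[OF u C \<phi>0(1)])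
    have \<theta>: "\<theta> \<in> lin C" unfolding \<theta>_def by (rule ad_lin[OF u C \<phi>])
    have ad\<theta>: "ad u \<theta> x = \<zero>" if "x \<in> carrier R" for x
      using k[OF that] by (simp add: j \<theta>_def \<phi>_def)
    obtain y where y: "y \<in> carrier R" "\<theta> y \<noteq> \<zero>"
      using k'[of "Suc j"] by (auto simp: j \<theta>_def \<phi>_def)
    define z where "z = \<theta> y"
    have z: "z \<in> carrier R" "z \<in> Units R" using y \<theta> by (simp_all add: z_def lin_closed field_Units)
    \<comment> \<open>Chosen so that \<open>\<theta> (c z) = \<theta> y = z\<close>; hence
      \<open>\<eta>\<close> fixes \<open>z\<close>.\<close>
    define c where "c = y \<otimes> inv z"
    have c: "c \<in> carrier R" "c \<otimes> z = y" using y z by (simp_all add: c_def m_assoc)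
    have mult_c: "(\<lambda>x. c \<otimes> x) \<in> lin C"
      using c C by (intro linI) (auto simp: r_distr m_lcomm subset_iff)
    define \<psi> where "\<psi> x = \<phi> (c \<otimes> x)" for x
    define \<eta> where "\<eta> x = \<theta> (c \<otimes> x)" for x
    have \<psi>: "\<psi> \<in> lin C" and \<eta>: "\<eta> \<in> lin C"
      unfolding \<psi>_def \<eta>_def by (intro lin_compose[OF _ mult_c] \<phi> \<theta>)+
    have ad1: "ad u \<psi> x = \<eta> x" if "x \<in> carrier R" for x
      using that c u by (simp add: ad_def \<psi>_def \<eta>_def \<theta>_def m_lcomm)
    have ad2: "ad u \<eta> x = \<zero>" if "x \<in> carrier R" for x
      using ad\<theta>[of "c \<otimes> x"] that c u by (simp add: ad_def \<eta>_def m_lcomm)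
    have pow: "(\<psi> ^^ m) \<in> lin C" "(\<eta> ^^ m) \<in> lin C" for m
      by (induction m) (use \<psi> \<eta> lin_compose in \<open>auto simp: comp_def intro!: linI\<close>)
    \<comment> \<open>The second conjunct, the vanishing of the next commutator, removes the first
      summand of the Leibniz rule in the induction.\<close>
    have main: "\<forall>x\<in>carrier R. (ad u ^^ m) (\<psi> ^^ m) x = add_pow R (fact m :: nat) ((\<eta> ^^ m) x) \<and>
        (ad u ^^ Suc m) (\<psi> ^^ m) x = \<zero>" for m
    proof (induction m)
      case 0
      show ?case using u by (auto simp: ad_def a_minus_def r_neg)
    next
      case (Suc m)
      have comp: "\<psi> ^^ Suc m = (\<lambda>x. \<psi> ((\<psi> ^^ m) x))" by (simp add: comp_def)
      have step: "(ad u ^^ Suc j) (\<psi> ^^ Suc m) x =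
          \<psi> ((ad u ^^ Suc j) (\<psi> ^^ m) x) \<oplus> add_pow R (Suc j) (\<eta> ((ad u ^^ j) (\<psi> ^^ m) x))"
        if "x \<in> carrier R" for j x
        unfolding comp by (rule ad_pow_compose[OF u C \<psi> pow(1) \<eta> ad1 ad2 that])
      show ?case
      proof (intro ballI conjI)
        fix x assume x: "x \<in> carrier R"
        have e: "(\<eta> ^^ m) x \<in> carrier R" using lin_closed[OF pow(2) x] .
        have "(ad u ^^ Suc m) (\<psi> ^^ Suc m) x = \<psi> \<zero> \<oplus> add_pow R (Suc m) (\<eta> (add_pow R (fact m :: nat) ((\<eta> ^^ m) x)))"
          unfolding step[OF x] using Suc x by (simp del: funpow.simps add.nat_pow_Suc)
        also have "\<dots> = add_pow R (fact (Suc m) :: nat) (\<eta> ((\<eta> ^^ m) x))"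
          using e lin_closed[OF \<eta> e] lin_zero[OF \<psi>] by (simp add: lin_add_pow[OF \<eta>] add.nat_pow_pow mult.commute del: add.nat_pow_Suc)
        finally show "(ad u ^^ Suc m) (\<psi> ^^ Suc m) x = add_pow R (fact (Suc m) :: nat) ((\<eta> ^^ Suc m) x)" by simp
        have "(ad u ^^ Suc (Suc m)) (\<psi> ^^ m) x = \<zero>"
        proof -
          have "(ad u ^^ 1) ((ad u ^^ Suc m) (\<psi> ^^ m)) x = \<zero>"
            using Suc by (intro ad_pow_zero[OF u _ x]) auto
          then show ?thesis by simp
        qed
        moreover have "(ad u ^^ Suc m) (\<psi> ^^ m) x = \<zero>" using Suc x by blast
        ultimately show "(ad u ^^ Suc (Suc m)) (\<psi> ^^ Suc m) x = \<zero>"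
          unfolding step[OF x] by (simp add: lin_zero[OF \<psi>] lin_zero[OF \<eta>] del: add.nat_pow_Suc funpow.simps)
      qed
    qed
    have \<eta>z: "(\<eta> ^^ m) z = z" for m by (induction m) (auto simp: \<eta>_def c(2) z_def[symmetric])
    have "add_pow R (fact N :: nat) z = \<zero>" using main[of N] nil[OF pow(1)] z \<eta>z by metis
    moreover have "add_pow R (fact N :: nat) z = add_pow R (fact N :: nat) \<one> \<otimes> z"
      using z by (simp add: add_pow_ldistr)
    ultimately have "add_pow R (fact N :: nat) \<one> \<otimes> z = \<zero>" by simp
    then have "add_pow R (fact N :: nat) \<one> = \<zero>"
      using integral[OF _ _ z(1)] y(2) by (auto simp: z_def)
    then show False using char0 by (simp add: char_zero_def)
  qed
  then show ?thesis using that by blast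
qed

text \<open>The free ring on two copies of the field acts on linear maps: the first copy multiplies the
  value, the second one the argument. Modulo the kernel it is the tensor square of the field over
  the scalars.\<close>

definition trim :: "'a \<Rightarrow> 'a" where
  "trim a = (if a \<in> carrier R then a else \<zero>)"

lemma trim [simp]: "trim a \<in> carrier R" "a \<in> carrier R \<Longrightarrow> trim a = a"
  by (auto simp: trim_def)

text \<open>A product acts by composition, which is legitimate because all these operators commute
  on linear maps. On such maps a generator outside the carrier acts as 0, and results matter only on
  the carrier.\<close>

primrec act :: "('a + 'a) ring_term \<Rightarrow> ('a \<Rightarrow> 'a) \<Rightarrow> 'a \<Rightarrow> 'a" where
  "act (Var g) \<phi> = (case g of Inl a \<Rightarrow> (\<lambda>x. trim a \<otimes> \<phi> x) | Inr b \<Rightarrow> (\<lambda>x. \<phi> (trim b \<otimes> x)))"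
| "act Zero \<phi> = (\<lambda>x. \<zero>)"
| "act One \<phi> = \<phi>"
| "act (Neg s) \<phi> = (\<lambda>x. \<ominus> act s \<phi> x)"
| "act (Plus s t) \<phi> = (\<lambda>x. act s \<phi> x \<oplus> act t \<phi> x)"
| "act (Times s t) \<phi> = act s (act t \<phi>)"

lemma act_lin: "C \<subseteq> carrier R \<Longrightarrow> \<phi> \<in> lin C \<Longrightarrow> act t \<phi> \<in> lin C"
proof (induction t arbitrary: \<phi>)
  case (Var g)
  then show ?case
    by (cases g) (auto intro!: linI simp: lin_closed lin_add lin_scale r_distr m_lcomm subset_iff)
next
  case (Neg s)
  note IH = Neg.IH[OF Neg.prems]
  show ?case
    using Neg.prems(1)
    by (auto intro!: linI simp: lin_closed[OF IH] lin_add[OF IH] lin_scale[OF IH] minus_add r_minus subset_iff)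
next
  case (Plus s t)
  note 1 = Plus.IH(1)[OF Plus.prems] and 2 = Plus.IH(2)[OF Plus.prems]
  show ?case
    using Plus.prems(1)
    by (auto intro!: linI simp: lin_closed[OF 1] lin_closed[OF 2] lin_add[OF 1] lin_add[OF 2]
        lin_scale[OF 1] lin_scale[OF 2] r_distr a_ac subset_iff)
qed (auto intro!: linI)

lemma act_cong:
  assumes "\<And>x. x \<in> carrier R \<Longrightarrow> \<phi> x = \<psi> x" "x \<in> carrier R"
  shows "act t \<phi> x = act t \<psi> x"
  using assms
proof (induction t arbitrary: \<phi> \<psi> x)
  case (Var g) then show ?case by (cases g) auto
next
  case (Neg s) show ?case using Neg.IH[OF Neg.prems] by simp
next
  case (Plus s t) show ?case using Plus.IH(1)[OF Plus.prems] Plus.IH(2)[OF Plus.prems] by simp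
next
  case (Times s t)
  have "act t \<phi> y = act t \<psi> y" if "y \<in> carrier R" for y
    using Times.IH(2)[OF Times.prems(1) that] .
  then have "act s (act t \<phi>) x = act s (act t \<psi>) x"
    by (rule Times.IH(1)[OF _ Times.prems(2)])
  then show ?case by simp
qed simp_all

lemma act_add:
  assumes "C \<subseteq> carrier R" "\<phi> \<in> lin C" "\<psi> \<in> lin C" "x \<in> carrier R"
  shows "act t (\<lambda>x. \<phi> x \<oplus> \<psi> x) x = act t \<phi> x \<oplus> act t \<psi> x"
  using assms
proof (induction t arbitrary: \<phi> \<psi> x)
  case (Var g)
  then show ?case by (cases g) (auto simp: lin_closed r_distr)
next
  case (Neg s)
  then show ?case
    using lin_closed[OF act_lin[OF Neg.prems(1,2)]] lin_closed[OF act_lin[OF Neg.prems(1,3)]]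
    by (simp add: minus_add)
next
  case (Plus s t)
  note cl = act_lin[OF Plus.prems(1,2)] act_lin[OF Plus.prems(1,3)]
  show ?case using Plus.prems Plus.IH cl by (simp add: a_ac lin_closed[of _ C])
next
  case (Times s t)
  have "act s (act t (\<lambda>x. \<phi> x \<oplus> \<psi> x)) x = act s (\<lambda>x. act t \<phi> x \<oplus> act t \<psi> x) x"
    using Times by (intro act_cong) auto
  then show ?case using Times.IH(1)[OF Times.prems(1) act_lin act_lin] Times.prems by simp
qed auto

lemma act_uminus:
  assumes "C \<subseteq> carrier R" "\<phi> \<in> lin C" "x \<in> carrier R"
  shows "act t (\<lambda>x. \<ominus> \<phi> x) x = \<ominus> act t \<phi> x"
proof -
  have n: "(\<lambda>x. \<ominus> \<phi> x) \<in> lin C"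
    using act_lin[OF assms(1,2), of "Neg One"] by simp
  have "act t (\<lambda>x. \<ominus> \<phi> x \<oplus> \<phi> x) x = act t (\<lambda>x. \<zero>) x"
    using assms by (intro act_cong) (auto simp: lin_closed l_neg)
  also have "act t (\<lambda>x. \<zero>) x = \<zero>"
    using assms(3)
  proof (induction t arbitrary: x)
    case (Var g) then show ?case by (cases g) auto
  next
    case (Times s t) then show ?case using act_cong[of "act t (\<lambda>x. \<zero>)" "\<lambda>x. \<zero>"] by simp
  qed auto
  finally have "act t (\<lambda>x. \<ominus> \<phi> x) x \<oplus> act t \<phi> x = \<zero>"
    using act_add[OF assms(1) n assms(2,3)] by simp
  then show ?thesis
    using lin_closed[OF act_lin[OF assms(1) n]] lin_closed[OF act_lin[OF assms(1,2)]] assms(3)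
    by (simp add: minus_equality)
qed

text \<open>An operator on values commutes with one on arguments, and two operators of the same kind
  commute because the field is commutative. For this reason the commutative free ring acts.\<close>

lemma act_commute:
  assumes C: "C \<subseteq> carrier R" and "\<phi> \<in> lin C" "x \<in> carrier R"
  shows "act s (act t \<phi>) x = act t (act s \<phi>) x"
  using assms(2,3)
proof (induction s arbitrary: \<phi> x t)
  case (Var g)
  show ?case
    using Var
  proof (induction t arbitrary: \<phi> x)
    case (Var g')
    then show ?case by (cases g; cases g') (auto simp: lin_closed m_lcomm)
  next
    case (Neg s)
    then show ?case using act_uminus[OF C act_lin[OF C], of \<phi> x "Var g" s]
        act_lin[OF C] by (cases g) (auto simp: lin_closed r_minus)
  next
    case (Plus s t)
    then show ?case using act_add[OF C act_lin[OF C] act_lin[OF C], of \<phi> \<phi> x "Var g" s t]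
      by simp
  next
    case (Times s t)
    have "act (Var g) (act s (act t \<phi>)) x = act s (act (Var g) (act t \<phi>)) x"
      using Times.IH(1)[OF act_lin[OF C Times.prems(1)] Times.prems(2)] .
    also have "\<dots> = act s (act t (act (Var g) \<phi>)) x"
      using Times by (intro act_cong) auto
    finally show ?case by simp
  next
    case Zero
    then show ?case by (cases g) auto
  qed auto
next
  case (Neg s)
  then show ?case using act_uminus[OF C act_lin[OF C], of \<phi> x t s] by simp
next
  case (Plus s s')
  then show ?case using act_add[OF C act_lin[OF C] act_lin[OF C], of \<phi> \<phi> x t s s'] by simp
next
  case (Times s s')
  have "act s (act s' (act t \<phi>)) x = act s (act t (act s' \<phi>)) x"
    using Times by (intro act_cong) auto
  also have "\<dots> = act t (act s (act s' \<phi>)) x"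
    using Times.IH(1)[OF act_lin[OF C Times.prems(1)] Times.prems(2)] .
  finally show ?case by simp
next
  case Zero
  have "act t (\<lambda>x. \<zero>) x = act t (\<lambda>x. \<zero> \<oplus> \<zero>) x" by simp
  also have "\<dots> = act t (\<lambda>x. \<zero>) x \<oplus> act t (\<lambda>x. \<zero>) x"
    using Zero by (intro act_add[OF C]) (auto intro!: linI simp: C[THEN subsetD])
  finally show ?case
    using lin_closed[OF act_lin[OF C, of "\<lambda>x. \<zero>" t]] Zero C
    by (simp add: linI subset_iff)
qed auto

lemma act_ring_eq:
  assumes C: "C \<subseteq> carrier R"
  shows "ring_eq s t \<Longrightarrow> \<phi> \<in> lin C \<Longrightarrow> x \<in> carrier R \<Longrightarrow> act s \<phi> x = act t \<phi> x"
proof (induction arbitrary: \<phi> x rule: ring_eq.induct)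
  case (times_cong s t s' t')
  have "act s (act s' \<phi>) x = act t (act s' \<phi>) x"
    using times_cong act_lin[OF C] by blast
  also have "\<dots> = act t (act t' \<phi>) x"
    using times_cong by (intro act_cong) auto
  finally show ?case by simp
next
  case (times_comm s t)
  then show ?case using act_commute[OF C] by simp
qed (use lin_closed[OF act_lin[OF C]] in \<open>auto simp: a_ac r_neg\<close>)

text \<open>It contains the defining relations of the tensor square: each copy is additive and
  multiplicative, and the two copies agree on \<open>C\<close>.\<close>

definition act_ker :: "'a set \<Rightarrow> ('a + 'a) free_ring set" where
  "act_ker C = {r. \<forall>\<phi>\<in>lin C. \<forall>x\<in>carrier R. act (rep_free_ring r) \<phi> x = \<zero>}"

lemma act_rep:
  assumes "C \<subseteq> carrier R" "\<phi> \<in> lin C" "x \<in> carrier R"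
  shows "act (rep_free_ring (gen g)) \<phi> x = act (Var g) \<phi> x"
    "act (rep_free_ring 0) \<phi> x = \<zero>"
    "act (rep_free_ring 1) \<phi> x = \<phi> x"
    "act (rep_free_ring (- r)) \<phi> x = \<ominus> act (rep_free_ring r) \<phi> x"
    "act (rep_free_ring (r + s)) \<phi> x = act (rep_free_ring r) \<phi> x \<oplus> act (rep_free_ring s) \<phi> x"
    "act (rep_free_ring (r - s)) \<phi> x = act (rep_free_ring r) \<phi> x \<ominus> act (rep_free_ring s) \<phi> x"
    "act (rep_free_ring (r * s)) \<phi> x = act (rep_free_ring r) (act (rep_free_ring s) \<phi>) x"
proof -
  note eq = act_ring_eq[OF assms(1) _ assms(2,3)]
  show "act (rep_free_ring (gen g)) \<phi> x = act (Var g) \<phi> x" by (rule eq) (rule rep_free_ring_simps)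
  show "act (rep_free_ring 0) \<phi> x = \<zero>" using eq[OF rep_free_ring_simps(2)] by simp
  show "act (rep_free_ring 1) \<phi> x = \<phi> x" using eq[OF rep_free_ring_simps(3)] by simp
  show u: "act (rep_free_ring (- r)) \<phi> x = \<ominus> act (rep_free_ring r) \<phi> x" for r
    using eq[OF rep_free_ring_simps(4)] by simp
  show p: "act (rep_free_ring (r + s)) \<phi> x = act (rep_free_ring r) \<phi> x \<oplus> act (rep_free_ring s) \<phi> x" for r s
    using eq[OF rep_free_ring_simps(5)] by simp
  show "act (rep_free_ring (r - s)) \<phi> x = act (rep_free_ring r) \<phi> x \<ominus> act (rep_free_ring s) \<phi> x"
    using p[of r "- s"] u[of s] by (simp add: a_minus_def)
  show "act (rep_free_ring (r * s)) \<phi> x = act (rep_free_ring r) (act (rep_free_ring s) \<phi>) x"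
    using eq[OF rep_free_ring_simps(6)] by simp
qed

lemma ideal_act_ker:
  assumes C: "C \<subseteq> carrier R" shows "ideal_set (act_ker C)"
  unfolding ideal_set_def
proof (intro conjI ballI allI)
  fix a r assume a: "a \<in> act_ker C"
  have "act (rep_free_ring (r * a)) \<phi> x = \<zero>" if "\<phi> \<in> lin C" "x \<in> carrier R" for \<phi> x
    using a act_lin[OF C that(1)] that act_commute[OF C that]
    by (simp add: act_rep[OF C that] act_ker_def)
  then show "r * a \<in> act_ker C" by (simp add: act_ker_def)
qed (auto simp: act_ker_def act_rep[OF C])

end

text \<open>In characteristic 0 the tensor square of a field \<open>E\<close> over a subfield has a prime ideal that
  does not contain \<open>u \<otimes> 1 - 1 \<otimes> u\<close>, whenever \<open>u\<close> is not in the subfield.\<close>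

lemma two_embeddings:
  fixes K :: "'a diff_ring" and E :: "'b diff_ring"
  assumes "diff_field_map K E e" and char0: "char_zero E"
    and u: "u \<in> carrier E" "u \<notin> e ` carrier K"
  obtains M :: "(('b + 'b) free_ring \<times> ('b + 'b) free_ring) set diff_ring" and \<tau>1 \<tau>2
  where "differential_field M" "\<tau>1 \<in> diff_hom E M" "\<tau>2 \<in> diff_hom E M"
    "\<And>c. c \<in> carrier K \<Longrightarrow> \<tau>1 (e c) = \<tau>2 (e c)" "\<tau>1 u \<noteq> \<tau>2 u"
    "carrier M \<subseteq> diff_span M (\<tau>1 ` carrier E \<union> \<tau>2 ` carrier E)"
proof -
  interpret diff_field_map K E e by fact
  let ?C = "e ` carrier K"
  have C: "?C \<subseteq> carrier E" by auto
  let ?J = "B.act_ker ?C"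
  \<comment> \<open>Each copy of \<open>E\<close> carries the derivation of \<open>E\<close>;
    generators outside the carrier get derivative 0.\<close>
  let ?D = "case_sum (\<lambda>a. if a \<in> carrier E then gen (Inl (der E a)) else 0)
    (\<lambda>a. if a \<in> carrier E then gen (Inr (der E a)) else 0 :: ('b + 'b) free_ring)"
  define d where "d = free_der ?D"
  interpret derivation d unfolding d_def by (rule free_der_derivation)
  define w where "w = gen (Inl u) - gen (Inr u)"
  \<comment> \<open>A \<open>K\<close>-linear functional that is 0 at 1 and 1 at \<open>u\<close>,
    read as an endomorphism of \<open>E\<close>. It exists because \<open>u\<close> is outside the
    image of \<open>K\<close>, a subspace containing 1.\<close>
  obtain \<phi>0 where \<phi>0: "\<phi>0 \<in> B.lin ?C" "\<phi>0 \<one>\<^bsub>E\<^esub> = \<zero>\<^bsub>E\<^esub>" "\<phi>0 u = \<one>\<^bsub>E\<^esub>"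
  proof -
    interpret Mod: module K "hom_module E e"
      by (rule module_hom_module) (unfold_locales, use homh in simp)
    have W: "submodule ?C K (hom_module E e)"
    proof (rule Mod.submoduleI)
      have inv: "\<ominus>\<^bsub>hom_module E e\<^esub> x = \<ominus>\<^bsub>E\<^esub> x" if "x \<in> carrier E" for x
        using that by (intro Mod.minus_equality) (auto simp: B.l_neg)
      show "\<ominus>\<^bsub>hom_module E e\<^esub> a \<in> ?C" if "a \<in> ?C" for a
        using that inv by (auto simp flip: hom_a_inv)
      show "\<zero>\<^bsub>hom_module E e\<^esub> \<in> ?C" by (auto intro!: image_eqI[of _ _ "\<zero>\<^bsub>K\<^esub>"])
    qed (auto simp flip: hom_add hom_mult)
    obtain \<phi> where \<phi>: "\<phi> \<in> functionals K (hom_module E e)" "\<And>w. w \<in> ?C \<Longrightarrow> \<phi> w = \<zero>\<^bsub>K\<^esub>" "\<phi> u = \<one>\<^bsub>K\<^esub>"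
      using Mod.functional_separating[OF A.field_axioms W, of u] u by auto
    have "\<one>\<^bsub>E\<^esub> \<in> ?C" by (auto intro!: image_eqI[of _ _ "\<one>\<^bsub>K\<^esub>"])
    then have "(\<lambda>x. e (\<phi> x)) \<one>\<^bsub>E\<^esub> = \<zero>\<^bsub>E\<^esub>" using \<phi>(2) by simp
    moreover have "(\<lambda>x. e (\<phi> x)) \<in> B.lin ?C"
      using \<phi>(1) by (intro B.linI) (auto simp: functionals_def Pi_def)
    ultimately show ?thesis using \<phi>(3) that[of "\<lambda>x. e (\<phi> x)"] by simp
  qed
  have act_w1: "B.act (rep_free_ring w) \<psi> y = B.ad u \<psi> y" if "\<psi> \<in> B.lin ?C" "y \<in> carrier E" for \<psi> y
    using u(1) that(2) by (simp add: w_def B.act_rep[OF C that] B.ad_def)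
  have act_w: "B.act (rep_free_ring (w ^ k)) \<phi> x = (B.ad u ^^ k) \<phi> x"
    if "\<phi> \<in> B.lin ?C" "x \<in> carrier E" for \<phi> x k
    using that
  proof (induction k arbitrary: x)
    case (Suc k)
    let ?\<psi> = "B.act (rep_free_ring (w ^ k)) \<phi>"
    have *: "?\<psi> \<in> B.lin ?C" by (rule B.act_lin[OF C Suc.prems(1)])
    have "B.act (rep_free_ring (w ^ Suc k)) \<phi> x = B.act (rep_free_ring w) ?\<psi> x"
      by (simp add: B.act_rep[OF C Suc.prems])
    also have "\<dots> = B.ad u ?\<psi> x"
      by (rule act_w1[OF * Suc.prems(2)])
    also have "\<dots> = B.ad u ((B.ad u ^^ k) \<phi>) x"
      using Suc.IH[OF Suc.prems] Suc.IH[OF Suc.prems(1), of "u \<otimes>\<^bsub>E\<^esub> x"] Suc.prems(2) u(1)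
      by (simp only: B.ad_def[of u "_ :: 'b \<Rightarrow> 'b" x] B.m_closed)
    finally show ?case by simp
  qed (simp add: B.act_rep[OF C])
  have "w ^ N \<notin> ?J" for N
  proof
    assume "w ^ N \<in> ?J"
    moreover obtain \<phi> x where "\<phi> \<in> B.lin ?C" "x \<in> carrier E" "(B.ad u ^^ N) \<phi> x \<noteq> \<zero>\<^bsub>E\<^esub>"
      by (rule B.ad_not_nilpotent[OF u(1) C char0 \<phi>0])
    ultimately show False using act_w by (auto simp: B.act_ker_def)
  qed
  \<comment> \<open>No power of \<open>w\<close> acts as zero, so some prime ideal above the kernel
    avoids \<open>w\<close>; its differential core is contained in it and avoids \<open>w\<close> as
    well.\<close>
  then obtain P where P: "prime_ideal P" "?J \<subseteq> P" "w \<notin> P"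
    using prime_ideal_avoiding[OF B.ideal_act_ker[OF C]] by blast
  interpret prime_ideal P by fact
  let ?Q = "diff_core d P"
  let ?M = "residue_field d ?Q"
  have mem: "r \<in> P" if "\<And>\<phi> x. \<phi> \<in> B.lin ?C \<Longrightarrow> x \<in> carrier E \<Longrightarrow> B.act (rep_free_ring r) \<phi> x = \<zero>\<^bsub>E\<^esub>" for r
    using that P(2) by (auto simp: B.act_ker_def)
  note act = B.act_rep[OF C] B.lin_closed B.lin_closed[OF B.act_lin[OF C]]
  interpret L: residue_copy d P E "\<lambda>a. gen (Inl a)"
  proof
    fix a b assume ab: "a \<in> carrier E" "b \<in> carrier E"
    show "gen (Inl (a \<oplus>\<^bsub>E\<^esub> b)) - (gen (Inl a) + gen (Inl b)) \<in> P"
      using ab by (intro mem) (simp add: act B.l_distr a_minus_def B.r_neg)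
    show "gen (Inl (a \<otimes>\<^bsub>E\<^esub> b)) - gen (Inl a) * gen (Inl b) \<in> P"
      using ab by (intro mem) (simp add: act B.act_lin[OF C] B.m_assoc a_minus_def B.r_neg)
  next
    show "gen (Inl \<one>\<^bsub>E\<^esub>) - 1 \<in> P"
      by (intro mem) (simp add: act a_minus_def B.r_neg)
  qed (simp_all add: d_def free_der_gen char0)
  interpret R: residue_copy d P E "\<lambda>a. gen (Inr a)"
  proof
    fix a b assume ab: "a \<in> carrier E" "b \<in> carrier E"
    show "gen (Inr (a \<oplus>\<^bsub>E\<^esub> b)) - (gen (Inr a) + gen (Inr b)) \<in> P"
      using ab by (intro mem) (simp add: act B.l_distr B.lin_add a_minus_def B.r_neg)
    show "gen (Inr (a \<otimes>\<^bsub>E\<^esub> b)) - gen (Inr a) * gen (Inr b) \<in> P"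
      using ab by (intro mem) (simp add: act B.act_lin[OF C] B.m_ac a_minus_def B.r_neg)
  next
    show "gen (Inr \<one>\<^bsub>E\<^esub>) - 1 \<in> P"
      by (intro mem) (simp add: act a_minus_def B.r_neg)
  qed (simp_all add: d_def free_der_gen char0)
  interpret Q: prime_ideal ?Q by (rule L.prime_diff_core)
  let ?\<tau>1 = "\<lambda>a. frac ?Q (gen (Inl a)) 1" and ?\<tau>2 = "\<lambda>a. frac ?Q (gen (Inr a)) 1"
  have M: "differential_field ?M"
    by (rule Q.differential_field_residue_field[OF derivation_axioms L.diff_core_der])
  then interpret M: differential_field ?M .
  show ?thesis
  proof (rule that[OF M])
    show "?\<tau>1 \<in> diff_hom E ?M" by (rule L.residue_hom)
    show "?\<tau>2 \<in> diff_hom E ?M" by (rule R.residue_hom)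
    show "?\<tau>1 u \<noteq> ?\<tau>2 u"
      using P(3) diff_core_subset[of d P] by (auto simp: Q.frac_eq_iff Q.one_not_mem w_def)
    \<comment> \<open>Linearity over \<open>K\<close> makes such a difference act as zero, and
      \<open>d\<close> sends it to the difference for the derivative of \<open>c\<close>.\<close>
    have eq: "(d ^^ k) (gen (Inl (e c)) - gen (Inr (e c))) \<in> P" if "c \<in> carrier K" for c k
      using that
    proof (induction k arbitrary: c)
      case 0
      then show ?case
        by (intro mem) (simp add: act B.lin_scale a_minus_def B.r_neg)
    next
      case (Suc k)
      have "d (gen (Inl (e c)) - gen (Inr (e c))) = gen (Inl (e (der K c))) - gen (Inr (e (der K c)))"
        using Suc.prems by (simp add: d_minus L.\<chi>_der R.\<chi>_der hom_der)
      then show ?case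
        using Suc by (simp add: funpow_Suc_right A.der_closed del: funpow.simps)
    qed
    show "?\<tau>1 (e c) = ?\<tau>2 (e c)" if "c \<in> carrier K" for c
    proof -
      have "gen (Inl (e c)) - gen (Inr (e c)) \<in> ?Q" using eq[OF that] by (simp add: diff_core_def)
      then show ?thesis by (simp add: Q.frac_eq_iff Q.one_not_mem)
    qed
    have rng: "range (\<lambda>g. frac ?Q (gen g) 1) \<subseteq> ?\<tau>1 ` carrier E \<union> ?\<tau>2 ` carrier E"
    proof safe
      fix g assume no: "frac ?Q (gen g) 1 \<notin> ?\<tau>2 ` carrier E"
      \<comment> \<open>Generators outside the carrier vanish in the residue field, since they act
        as zero and have derivative 0; so the two copies of \<open>E\<close> generate it.\<close>
      have "frac ?Q (gen g) 1 = ?\<tau>1 \<zero>\<^bsub>E\<^esub>" if g: "g \<notin> Inl ` carrier E" "g \<notin> Inr ` carrier E"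
      proof -
        have "d (gen g) = 0" using g by (cases g) (auto simp: d_def free_der_gen)
        then have "(d ^^ k) (gen g) = (if k = 0 then gen g else 0)" for k
          by (induction k) (auto simp: d_zero)
        moreover have "gen g \<in> P"
          using g by (intro mem) (cases g; auto simp: act B.trim_def B.lin_zero)
        ultimately have "gen g \<in> ?Q" using zero_mem by (simp add: diff_core_def)
        moreover have "?\<tau>1 \<zero>\<^bsub>E\<^esub> = \<zero>\<^bsub>?M\<^esub>"
        proof -
          interpret T: diff_field_map E ?M ?\<tau>1
            by (intro diff_field_map.intro diff_field_map_axioms.intro B.differential_field_axioms M L.residue_hom)
          show ?thesis by (rule T.hom_zero)
        qed
        ultimately show ?thesis
          by (simp add: Q.residue_eq_zero_iff Q.frac_eq_iff Q.one_not_mem Q.minus_mem)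
      qed
      then show "frac ?Q (gen g) 1 \<in> ?\<tau>1 ` carrier E"
        using no by (cases "g \<in> Inl ` carrier E"; cases "g \<in> Inr ` carrier E") auto
    qed
    have "diff_span ?M (range (\<lambda>g. frac ?Q (gen g) 1)) \<subseteq> diff_span ?M (?\<tau>1 ` carrier E \<union> ?\<tau>2 ` carrier E)"
    proof (intro M.diff_span_least M.subfield_diff_span)
      show "?\<tau>1 ` carrier E \<union> ?\<tau>2 ` carrier E \<subseteq> carrier ?M" by (auto simp: Q.frac_closed Q.one_not_mem)
      show "range (\<lambda>g. frac ?Q (gen g) 1) \<subseteq> diff_span ?M (?\<tau>1 ` carrier E \<union> ?\<tau>2 ` carrier E)"
        using rng by (rule order_trans) (auto intro: diff_span.span_incl)
    qed (auto intro: diff_span.intros)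
    then show "carrier ?M \<subseteq> diff_span ?M (?\<tau>1 ` carrier E \<union> ?\<tau>2 ` carrier E)"
      using residue_field_generated[OF L.prime_diff_core derivation_axioms L.diff_core_der] by blast
  qed
qed

text \<open>\<open>a_inv\<close> and \<open>m_inv\<close> depend on the carrier, hence the detour through uniqueness of inverses.\<close>

lemma restricted_hom_span:
  assumes "differential_field U" "differential_field M" "S \<subseteq> carrier U"
    and \<tau>: "\<tau> \<in> diff_hom (U\<lparr>carrier := diff_span U S\<rparr>) M"
  shows "\<tau> ` diff_span U S \<subseteq> diff_span M (\<tau> ` S)"
proof safe
  interpret U: differential_field U by fact
  interpret M: differential_field M by fact
  let ?E = "U\<lparr>carrier := diff_span U S\<rparr>"
  interpret E: differential_field ?E by (rule U.differential_field_diff_span) fact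
  interpret diff_field_map ?E M \<tau> by unfold_locales fact
  note cl = U.diff_span_closed[OF assms(3), THEN subsetD]
  have add: "\<tau> (x \<oplus>\<^bsub>U\<^esub> y) = \<tau> x \<oplus>\<^bsub>M\<^esub> \<tau> y" and mult: "\<tau> (x \<otimes>\<^bsub>U\<^esub> y) = \<tau> x \<otimes>\<^bsub>M\<^esub> \<tau> y"
    and der: "\<tau> (der U x) = der M (\<tau> x)" and closed: "\<tau> x \<in> carrier M"
    if "x \<in> diff_span U S" "y \<in> diff_span U S" for x y
    using hom_add[of x y] hom_mult[of x y] hom_der[of x] hom_closed[of x] that by auto
  have zero: "\<tau> \<zero>\<^bsub>U\<^esub> = \<zero>\<^bsub>M\<^esub>" and one: "\<tau> \<one>\<^bsub>U\<^esub> = \<one>\<^bsub>M\<^esub>"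
    using hom_zero hom_one by simp_all
  fix x assume "x \<in> diff_span U S"
  then show "\<tau> x \<in> diff_span M (\<tau> ` S)"
  proof induction
    case span_one then show ?case by (simp add: one diff_span.intros)
  next
    case (span_a_inv x)
    have n: "\<ominus>\<^bsub>U\<^esub> x \<in> diff_span U S" by (rule diff_span.span_a_inv) fact
    have "\<tau> (\<ominus>\<^bsub>U\<^esub> x) \<oplus>\<^bsub>M\<^esub> \<tau> x = \<zero>\<^bsub>M\<^esub>"
      using add[OF n span_a_inv(1)] cl[OF span_a_inv(1)] by (simp add: U.l_neg zero)
    then have "\<tau> (\<ominus>\<^bsub>U\<^esub> x) = \<ominus>\<^bsub>M\<^esub> \<tau> x"
      using closed[OF n n] closed[OF span_a_inv(1,1)] by (simp add: M.minus_equality)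
    then show ?case using span_a_inv by (simp add: diff_span.intros)
  next
    case (span_m_inv x)
    have n: "inv\<^bsub>U\<^esub> x \<in> diff_span U S" by (rule diff_span.span_m_inv) fact+
    have x: "x \<in> Units U" using span_m_inv cl by (simp add: U.field_Units)
    have 1: "\<tau> x \<otimes>\<^bsub>M\<^esub> \<tau> (inv\<^bsub>U\<^esub> x) = \<one>\<^bsub>M\<^esub>"
      using mult[OF span_m_inv(1) n] x by (simp add: one)
    then have 2: "\<tau> (inv\<^bsub>U\<^esub> x) = inv\<^bsub>M\<^esub> \<tau> x"
      using closed[OF n n] closed[OF span_m_inv(1,1)] by (simp add: M.comm_inv_char)
    have "\<tau> x \<noteq> \<zero>\<^bsub>M\<^esub>" using 1 closed[OF n n] by auto
    then show ?case using 2 span_m_inv by (simp add: diff_span.intros)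
  next
    case (span_add x y)
    then show ?case using add[of x y] by (simp add: diff_span.intros)
  next
    case (span_mult x y)
    then show ?case using mult[of x y] by (simp add: diff_span.intros)
  next
    case (span_der x)
    then show ?case using der[of x x] by (simp add: diff_span.intros)
  qed (auto intro: diff_span.intros)
qed

lemma (in diff_field_map) char_zero_image: "char_zero A \<Longrightarrow> char_zero B"
proof -
  have "h (add_pow A (k::nat) \<one>\<^bsub>A\<^esub>) = add_pow B k \<one>\<^bsub>B\<^esub>" for k
    by (induction k) simp_all
  moreover assume "char_zero A"
  ultimately show "char_zero B"
    using hom_eq_zero_iff[of "add_pow A (_::nat) \<one>\<^bsub>A\<^esub>"] by (auto simp: char_zero_def)
qed

text \<open>Let \<open>E\<close> be the differential field generated by the image of
  \<open>K\<close> and \<open>S\<close>. Two embeddings of \<open>E\<close> into one field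
  \<open>M\<close> differ at \<open>u\<close>. As \<open>M\<close> is generated over
  \<open>K\<close> by the two copies of the finite set \<open>S\<close>, it embeds into
  \<open>U\<close>; of the two resulting embeddings of \<open>E\<close> into \<open>U\<close>, at
  least one moves \<open>u\<close>.\<close>

lemma moving_embedding:
  fixes K :: "'a diff_ring" and U :: "'c diff_ring"
  assumes U: "semi_universal K U \<iota>" and char0: "char_zero K"
    and S: "finite S" "S \<subseteq> carrier U"
    and u: "u \<in> diff_span U (\<iota> ` carrier K \<union> S)" "u \<notin> \<iota> ` carrier K"
  obtains \<sigma> where "\<sigma> \<in> diff_hom (U\<lparr>carrier := diff_span U (\<iota> ` carrier K \<union> S)\<rparr>) U"
    "\<And>c. c \<in> carrier K \<Longrightarrow> \<sigma> (\<iota> c) = \<iota> c" "\<sigma> u \<noteq> u"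
proof -
  have ext: "diff_extension K U \<iota>" using U by (simp add: semi_universal_def)
  interpret diff_field_map K U \<iota> by (rule diff_extension_map[OF ext])
  let ?S = "\<iota> ` carrier K \<union> S"
  let ?E = "U\<lparr>carrier := diff_span U ?S\<rparr>"
  have S': "?S \<subseteq> carrier U" using S by auto
  have incl: "?S \<subseteq> diff_span U ?S" by (auto intro: diff_span.intros)
  interpret E: differential_field ?E by (rule B.differential_field_diff_span[OF S'])
  have \<iota>E: "\<iota> \<in> diff_hom K ?E"
    unfolding diff_hom_def
    by (intro CollectI conjI ballI ring_hom_memI) (use incl in \<open>auto simp: hom_der\<close>)
  interpret E: diff_field_map K ?E \<iota> by unfold_locales (rule \<iota>E)
  obtain M :: "(('c + 'c) free_ring \<times> ('c + 'c) free_ring) set diff_ring" and \<tau>1 \<tau>2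
    where M: "differential_field M" "\<tau>1 \<in> diff_hom ?E M" "\<tau>2 \<in> diff_hom ?E M"
      "\<And>c. c \<in> carrier K \<Longrightarrow> \<tau>1 (\<iota> c) = \<tau>2 (\<iota> c)" "\<tau>1 u \<noteq> \<tau>2 u"
      "carrier M \<subseteq> diff_span M (\<tau>1 ` carrier ?E \<union> \<tau>2 ` carrier ?E)"
    by (rule two_embeddings[OF E.diff_field_map_axioms E.char_zero_image[OF char0], of u])
      (use u in auto)
  interpret M: differential_field M by fact
  interpret T1: diff_field_map ?E M \<tau>1 by unfold_locales fact
  interpret T2: diff_field_map ?E M \<tau>2 by unfold_locales fact
  let ?T = "(\<lambda>c. \<tau>1 (\<iota> c)) ` carrier K \<union> (\<tau>1 ` S \<union> \<tau>2 ` S)"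
  have SE: "?S \<subseteq> carrier ?E" using incl by simp
  have T: "?T \<subseteq> carrier M" using SE T1.hom_closed T2.hom_closed by (auto simp del: partial_object.simps)
  have fg: "diff_fin_gen K M (\<lambda>c. \<tau>1 (\<iota> c))"
  proof (rule diff_fin_genI)
    show "diff_extension K M (\<lambda>c. \<tau>1 (\<iota> c))"
      unfolding diff_extension_def
      using M(1) A.differential_field_axioms diff_hom_compose[OF \<iota>E M(2)] by simp
    show "finite (\<tau>1 ` S \<union> \<tau>2 ` S)" using S by simp
    show "\<tau>1 ` S \<union> \<tau>2 ` S \<subseteq> carrier M" using T by blast
    have sub: "diff_span M V \<subseteq> diff_span M ?T" if "V \<subseteq> diff_span M ?T" for V
      using that by (intro M.diff_span_least M.subfield_diff_span T) (auto intro: diff_span.intros)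
    have "\<tau>1 ` ?S \<subseteq> diff_span M ?T" using M(4) by (auto intro!: diff_span.span_incl)
    then have 1: "\<tau>1 ` carrier ?E \<subseteq> diff_span M ?T"
      using order_trans[OF restricted_hom_span[OF B.differential_field_axioms M(1) S' M(2)] sub] by simp
    have "\<tau>2 ` ?S \<subseteq> diff_span M ?T" using M(4) by (auto intro!: diff_span.span_incl)
    then have 2: "\<tau>2 ` carrier ?E \<subseteq> diff_span M ?T"
      using order_trans[OF restricted_hom_span[OF B.differential_field_axioms M(1) S' M(3)] sub] by simp
    show "carrier M \<subseteq> diff_span M ?T" by (rule order_trans[OF M(6) sub]) (intro Un_least 1 2)
  qed
  obtain h where h: "h \<in> diff_hom M U" "\<And>c. c \<in> carrier K \<Longrightarrow> h (\<tau>1 (\<iota> c)) = \<iota> c"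
    by (rule semi_universal_embedding[OF U char0 fg]) (rule that)
  interpret h: diff_field_map M U h by unfold_locales fact
  have uE: "u \<in> carrier ?E" using u by simp
  have "h (\<tau>1 u) \<noteq> h (\<tau>2 u)"
    using M(5) h.hom_eq_iff[OF T1.hom_closed[OF uE] T2.hom_closed[OF uE]] by simp
  then consider "h (\<tau>1 u) \<noteq> u" | "h (\<tau>2 u) \<noteq> u" by metis
  then show ?thesis
  proof cases
    case 1
    then show ?thesis using that[OF diff_hom_compose[OF M(2) h(1)]] h(2) by simp
  next
    case 2
    then show ?thesis using that[OF diff_hom_compose[OF M(3) h(1)]] h(2) M(4) by simp
  qed
qed

section \<open>Matrices\<close>

lemma (in comm_monoid) finprod_swap:
  assumes "finite I" "finite J" "\<And>i j. i \<in> I \<Longrightarrow> j \<in> J \<Longrightarrow> f i j \<in> carrier G"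
  shows "(\<Otimes>i\<in>I. \<Otimes>j\<in>J. f i j) = (\<Otimes>j\<in>J. \<Otimes>i\<in>I. f i j)"
  using assms(1,3)
proof (induction I rule: finite_induct)
  case (insert i I)
  have "(\<Otimes>i\<in>insert i I. \<Otimes>j\<in>J. f i j) = (\<Otimes>j\<in>J. f i j) \<otimes> (\<Otimes>j\<in>J. \<Otimes>i\<in>I. f i j)"
    using insert by (subst finprod_insert) (auto intro!: finprod_closed)
  also have "\<dots> = (\<Otimes>j\<in>J. f i j \<otimes> (\<Otimes>i\<in>I. f i j))"
    using insert by (subst finprod_multf) (auto intro!: finprod_closed)
  also have "\<dots> = (\<Otimes>j\<in>J. \<Otimes>i\<in>insert i I. f i j)"
    using insert by (intro finprod_cong) (auto intro!: finprod_closed simp: simp_implies_def)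
  finally show ?case .
qed simp

lemma mats_iff:
  "A \<in> mats R I J \<longleftrightarrow> A \<in> extensional I \<and> (\<forall>i\<in>I. A i \<in> extensional J) \<and> (\<forall>i\<in>I. \<forall>j\<in>J. A i j \<in> carrier R)"
  by (auto simp: mats_def PiE_def Pi_def extensional_def)

lemma mats_closed: "A \<in> mats R I J \<Longrightarrow> i \<in> I \<Longrightarrow> j \<in> J \<Longrightarrow> A i j \<in> carrier R"
  by (simp add: mats_iff)

lemma mats_restrict: "(\<And>i j. i \<in> I \<Longrightarrow> j \<in> J \<Longrightarrow> f i j \<in> carrier R) \<Longrightarrow> (\<lambda>i\<in>I. \<lambda>j\<in>J. f i j) \<in> mats R I J"
  by (simp add: mats_iff)

lemma mats_eqI:
  assumes "A \<in> mats R I J" "B \<in> mats R' I J" "\<And>i j. i \<in> I \<Longrightarrow> j \<in> J \<Longrightarrow> A i j = B i j"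
  shows "A = B"
proof (rule extensionalityI[of _ I])
  fix i assume "i \<in> I"
  then show "A i = B i" using assms by (intro extensionalityI[of _ J]) (auto simp: mats_iff)
qed (use assms in \<open>auto simp: mats_iff\<close>)

definition mat_ring :: "('a, 'm) ring_scheme \<Rightarrow> 'i set \<Rightarrow> ('i \<Rightarrow> 'i \<Rightarrow> 'a) ring" where
  "mat_ring R I = \<lparr>carrier = mats R I I, monoid.mult = mat_mult R I I I, one = mat_one R I,
     ring.zero = (\<lambda>i\<in>I. \<lambda>j\<in>I. \<zero>\<^bsub>R\<^esub>), ring.add = (\<lambda>A B. \<lambda>i\<in>I. \<lambda>j\<in>I. A i j \<oplus>\<^bsub>R\<^esub> B i j)\<rparr>"

lemma carrier_mat_ring: "carrier (mat_ring R I) = mats R I I"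
  and mult_mat_ring: "monoid.mult (mat_ring R I) = mat_mult R I I I"
  and one_mat_ring: "one (mat_ring R I) = mat_one R I"
  and add_entry: "i \<in> I \<Longrightarrow> j \<in> I \<Longrightarrow> (A \<oplus>\<^bsub>mat_ring R I\<^esub> B) i j = A i j \<oplus>\<^bsub>R\<^esub> B i j"
  and zero_entry: "i \<in> I \<Longrightarrow> j \<in> I \<Longrightarrow> \<zero>\<^bsub>mat_ring R I\<^esub> i j = \<zero>\<^bsub>R\<^esub>"
  and mult_entry: "i \<in> I \<Longrightarrow> j \<in> I \<Longrightarrow> (A \<otimes>\<^bsub>mat_ring R I\<^esub> B) i j = (\<Oplus>\<^bsub>R\<^esub>k\<in>I. A i k \<otimes>\<^bsub>R\<^esub> B k j)"
  and one_entry: "i \<in> I \<Longrightarrow> j \<in> I \<Longrightarrow> \<one>\<^bsub>mat_ring R I\<^esub> i j = (if i = j then \<one>\<^bsub>R\<^esub> else \<zero>\<^bsub>R\<^esub>)"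
  by (simp_all add: mat_ring_def mat_mult_def mat_one_def)

lemma mat_mult_entry: "i \<in> I \<Longrightarrow> k \<in> L \<Longrightarrow> mat_mult R I J L A B i k = (\<Oplus>\<^bsub>R\<^esub>j\<in>J. A i j \<otimes>\<^bsub>R\<^esub> B j k)"
  by (simp add: mat_mult_def)

context ring
begin

lemma mat_mult_closed:
  "A \<in> mats R I J \<Longrightarrow> B \<in> mats R J L \<Longrightarrow> mat_mult R I J L A B \<in> mats R I L"
  unfolding mat_mult_def by (intro mats_restrict finsum_closed) (auto simp: mats_closed)

lemma mat_mult_assoc:
  assumes fin: "finite J" "finite L" and A: "A \<in> mats R I J" and B: "B \<in> mats R J L" and C: "C \<in> mats R L N"
  shows "mat_mult R I L N (mat_mult R I J L A B) C = mat_mult R I J N A (mat_mult R J L N B C)"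
proof (rule mats_eqI[OF mat_mult_closed[OF mat_mult_closed] mat_mult_closed[OF _ mat_mult_closed]])
  note cl = mats_closed[OF A] mats_closed[OF B] mats_closed[OF C]
  fix i k assume ik: "i \<in> I" "k \<in> N"
  have "mat_mult R I L N (mat_mult R I J L A B) C i k = (\<Oplus>l\<in>L. (\<Oplus>j\<in>J. A i j \<otimes> B j l) \<otimes> C l k)"
    using ik cl by (simp add: mat_mult_entry cong: finsum_cong)
  also have "\<dots> = (\<Oplus>l\<in>L. \<Oplus>j\<in>J. A i j \<otimes> (B j l \<otimes> C l k))"
    using ik cl fin by (intro finsum_cong') (auto simp: finsum_ldistr Pi_def m_assoc intro!: finsum_cong')
  also have "\<dots> = (\<Oplus>j\<in>J. \<Oplus>l\<in>L. A i j \<otimes> (B j l \<otimes> C l k))"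
    using ik cl fin by (intro add.finprod_swap) auto
  also have "\<dots> = (\<Oplus>j\<in>J. A i j \<otimes> (\<Oplus>l\<in>L. B j l \<otimes> C l k))"
    using ik cl fin by (intro finsum_cong') (auto simp: finsum_rdistr Pi_def)
  also have "\<dots> = mat_mult R I J N A (mat_mult R J L N B C) i k"
    using ik cl by (simp add: mat_mult_entry) (auto intro!: finsum_cong' simp: mat_mult_entry Pi_def)
  finally show "mat_mult R I L N (mat_mult R I J L A B) C i k = mat_mult R I J N A (mat_mult R J L N B C) i k" .
qed (fact A B C)+

lemma finsum_delta:
  assumes "finite I" "i \<in> I" "\<And>j. j \<in> I \<Longrightarrow> f j \<in> carrier R"
  shows "(\<Oplus>j\<in>I. if i = j then f j else \<zero>) = f i"
  using assms by (simp add: finsum_singleton Pi_def)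

lemma mat_mult_one:
  assumes "finite J" "A \<in> mats R I J"
  shows "mat_mult R I J J A (mat_one R J) = A"
proof (rule mats_eqI[OF mat_mult_closed])
  show "mat_one R J \<in> mats R J J" unfolding mat_one_def by (intro mats_restrict) auto
  fix i j assume ij: "i \<in> I" "j \<in> J"
  have "(\<Oplus>k\<in>J. A i k \<otimes> mat_one R J k j) = (\<Oplus>k\<in>J. if j = k then A i k else \<zero>)"
    using ij assms(2) by (intro finsum_cong') (auto simp: mat_one_def mats_closed)
  also have "\<dots> = A i j" using ij assms by (intro finsum_delta) (auto simp: mats_closed)
  finally show "mat_mult R I J J A (mat_one R J) i j = A i j" using ij by (simp add: mat_mult_entry)
qed (use assms in auto)

lemma mat_one_mult:
  assumes "finite I" "A \<in> mats R I J"
  shows "mat_mult R I I J (mat_one R I) A = A"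
proof (rule mats_eqI[OF mat_mult_closed])
  show "mat_one R I \<in> mats R I I" unfolding mat_one_def by (intro mats_restrict) auto
  fix i j assume ij: "i \<in> I" "j \<in> J"
  have "(\<Oplus>k\<in>I. mat_one R I i k \<otimes> A k j) = (\<Oplus>k\<in>I. if i = k then A k j else \<zero>)"
    using ij assms(2) by (intro finsum_cong') (auto simp: mat_one_def mats_closed)
  also have "\<dots> = A i j" using ij assms by (intro finsum_delta) (auto simp: mats_closed)
  finally show "mat_mult R I I J (mat_one R I) A i j = A i j" using ij by (simp add: mat_mult_entry)
qed (use assms in auto)

lemma ring_mat_ring:
  assumes fin: "finite I" shows "ring (mat_ring R I)" (is "ring ?M")
proof -
  have add: "A \<oplus>\<^bsub>?M\<^esub> B \<in> mats R I I" if "A \<in> mats R I I" "B \<in> mats R I I" for A B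
    unfolding mat_ring_def using that by (simp add: mats_iff)
  have zero: "\<zero>\<^bsub>?M\<^esub> \<in> mats R I I" unfolding mat_ring_def by (simp add: mats_iff)
  have one: "mat_one R I \<in> mats R I I" unfolding mat_one_def by (intro mats_restrict) auto
  show ?thesis
  proof (intro ringI abelian_groupI monoidI)
    fix A B C assume A: "A \<in> carrier ?M" and B: "B \<in> carrier ?M" and C: "C \<in> carrier ?M"
    note ABC = A[unfolded carrier_mat_ring] B[unfolded carrier_mat_ring] C[unfolded carrier_mat_ring]
    note cl = mats_closed[OF ABC(1)] mats_closed[OF ABC(2)] mats_closed[OF ABC(3)]
    show "A \<oplus>\<^bsub>?M\<^esub> B \<in> carrier ?M" "A \<otimes>\<^bsub>?M\<^esub> B \<in> carrier ?M"
      using add ABC mat_mult_closed by (auto simp: carrier_mat_ring mult_mat_ring)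
    show "A \<oplus>\<^bsub>?M\<^esub> B \<oplus>\<^bsub>?M\<^esub> C = A \<oplus>\<^bsub>?M\<^esub> (B \<oplus>\<^bsub>?M\<^esub> C)" "A \<oplus>\<^bsub>?M\<^esub> B = B \<oplus>\<^bsub>?M\<^esub> A"
      by (rule mats_eqI[of _ R I I _ R]; use ABC cl add in \<open>auto simp: add_entry a_ac\<close>)+
    show "\<zero>\<^bsub>?M\<^esub> \<oplus>\<^bsub>?M\<^esub> A = A"
      by (rule mats_eqI[of _ R I I _ R]) (use ABC cl add zero in \<open>auto simp: add_entry zero_entry\<close>)
    show "\<exists>B\<in>carrier ?M. B \<oplus>\<^bsub>?M\<^esub> A = \<zero>\<^bsub>?M\<^esub>"
    proof
      show n: "(\<lambda>i\<in>I. \<lambda>j\<in>I. \<ominus> A i j) \<in> carrier ?M"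
        unfolding carrier_mat_ring using cl by (intro mats_restrict) auto
      show "(\<lambda>i\<in>I. \<lambda>j\<in>I. \<ominus> A i j) \<oplus>\<^bsub>?M\<^esub> A = \<zero>\<^bsub>?M\<^esub>"
        using n[unfolded carrier_mat_ring] ABC cl add zero
        by (intro mats_eqI[of _ R I I _ R]) (auto simp: add_entry zero_entry l_neg)
    qed
    show "A \<otimes>\<^bsub>?M\<^esub> B \<otimes>\<^bsub>?M\<^esub> C = A \<otimes>\<^bsub>?M\<^esub> (B \<otimes>\<^bsub>?M\<^esub> C)"
      using ABC by (simp add: mult_mat_ring mat_mult_assoc fin)
    show "\<one>\<^bsub>?M\<^esub> \<otimes>\<^bsub>?M\<^esub> A = A" "A \<otimes>\<^bsub>?M\<^esub> \<one>\<^bsub>?M\<^esub> = A"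
      using ABC by (simp_all add: mult_mat_ring one_mat_ring mat_mult_one mat_one_mult fin)
    show "(A \<oplus>\<^bsub>?M\<^esub> B) \<otimes>\<^bsub>?M\<^esub> C = A \<otimes>\<^bsub>?M\<^esub> C \<oplus>\<^bsub>?M\<^esub> B \<otimes>\<^bsub>?M\<^esub> C"
    proof (rule mats_eqI[of _ R I I _ R])
      fix i j assume ij: "i \<in> I" "j \<in> I"
      have "(\<Oplus>k\<in>I. (A \<oplus>\<^bsub>?M\<^esub> B) i k \<otimes> C k j) = (\<Oplus>k\<in>I. A i k \<otimes> C k j \<oplus> B i k \<otimes> C k j)"
        using ij cl by (intro finsum_cong') (auto simp: add_entry l_distr)
      also have "\<dots> = (\<Oplus>k\<in>I. A i k \<otimes> C k j) \<oplus> (\<Oplus>k\<in>I. B i k \<otimes> C k j)"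
        using ij cl by (intro finsum_addf) auto
      finally show "((A \<oplus>\<^bsub>?M\<^esub> B) \<otimes>\<^bsub>?M\<^esub> C) i j = (A \<otimes>\<^bsub>?M\<^esub> C \<oplus>\<^bsub>?M\<^esub> B \<otimes>\<^bsub>?M\<^esub> C) i j"
        using ij by (simp add: mult_entry add_entry)
    qed (use ABC in \<open>simp_all add: mult_mat_ring mat_mult_closed add\<close>)
    show "C \<otimes>\<^bsub>?M\<^esub> (A \<oplus>\<^bsub>?M\<^esub> B) = C \<otimes>\<^bsub>?M\<^esub> A \<oplus>\<^bsub>?M\<^esub> C \<otimes>\<^bsub>?M\<^esub> B"
    proof (rule mats_eqI[of _ R I I _ R])
      fix i j assume ij: "i \<in> I" "j \<in> I"
      have "(\<Oplus>k\<in>I. C i k \<otimes> (A \<oplus>\<^bsub>?M\<^esub> B) k j) = (\<Oplus>k\<in>I. C i k \<otimes> A k j \<oplus> C i k \<otimes> B k j)"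
        using ij cl by (intro finsum_cong') (auto simp: add_entry r_distr)
      also have "\<dots> = (\<Oplus>k\<in>I. C i k \<otimes> A k j) \<oplus> (\<Oplus>k\<in>I. C i k \<otimes> B k j)"
        using ij cl by (intro finsum_addf) auto
      finally show "(C \<otimes>\<^bsub>?M\<^esub> (A \<oplus>\<^bsub>?M\<^esub> B)) i j = (C \<otimes>\<^bsub>?M\<^esub> A \<oplus>\<^bsub>?M\<^esub> C \<otimes>\<^bsub>?M\<^esub> B) i j"
        using ij by (simp add: mult_entry add_entry)
    qed (use ABC in \<open>simp_all add: mult_mat_ring mat_mult_closed add\<close>)
  qed (use zero one in \<open>auto simp: carrier_mat_ring one_mat_ring\<close>)
qed

lemma uminus_entry:
  assumes "finite I" "A \<in> mats R I I" "i \<in> I" "j \<in> I"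
  shows "(\<ominus>\<^bsub>mat_ring R I\<^esub> A) i j = \<ominus> A i j"
proof -
  interpret M: ring "mat_ring R I" by (rule ring_mat_ring) fact
  have A: "A \<in> carrier (mat_ring R I)" using assms by (simp add: carrier_mat_ring)
  then have "\<ominus>\<^bsub>mat_ring R I\<^esub> A \<in> mats R I I" using M.a_inv_closed by (simp add: carrier_mat_ring)
  moreover have "(\<ominus>\<^bsub>mat_ring R I\<^esub> A \<oplus>\<^bsub>mat_ring R I\<^esub> A) i j = \<zero>"
    using A assms by (simp add: M.l_neg zero_entry)
  ultimately show ?thesis
    using assms by (simp add: add_entry mats_closed minus_equality)
qed

lemma finsum_entry:
  assumes "finite I" "i \<in> I" "j \<in> I" "A \<in> T \<rightarrow> mats R I I"
  shows "(\<Oplus>\<^bsub>mat_ring R I\<^esub>t\<in>T. A t) i j = (\<Oplus>t\<in>T. A t i j)"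
proof -
  interpret M: ring "mat_ring R I" by (rule ring_mat_ring) fact
  show ?thesis
    using assms(4)
  proof (induction T rule: infinite_finite_induct)
    case (insert t T)
    then have "A \<in> T \<rightarrow> carrier (mat_ring R I)" "A t \<in> carrier (mat_ring R I)"
      by (auto simp: carrier_mat_ring)
    then show ?case
      using insert assms by (simp add: add_entry) (subst finsum_insert, auto simp: mats_closed Pi_def)
  qed (use assms in \<open>simp_all add: zero_entry\<close>)
qed

lemma add_pow_entry:
  assumes "finite I" "i \<in> I" "j \<in> I" "A \<in> mats R I I"
  shows "add_pow (mat_ring R I) (k::nat) A i j = add_pow R k (A i j)"
proof -
  interpret M: ring "mat_ring R I" by (rule ring_mat_ring) fact
  show ?thesis by (induction k) (use assms in \<open>simp_all add: add_entry zero_entry\<close>)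
qed

end

subsection \<open>Determinants\<close>

context cring
begin

lemma mat_det_cong:
  assumes "\<And>i j. i < n \<Longrightarrow> j < n \<Longrightarrow> A i j = B i j" "\<And>i j. i < n \<Longrightarrow> j < n \<Longrightarrow> B i j \<in> carrier R"
  shows "mat_det R n A = mat_det R n B"
proof -
  have p: "p i < n" if "p permutes {..<n}" "i < n" for p i
    using that permutes_in_image[OF that(1), of i] by auto
  have "(\<Otimes>i\<in>{..<n}. A i (p i)) = (\<Otimes>i\<in>{..<n}. B i (p i))" if "p permutes {..<n}" for p
    using p[OF that] assms by (intro finprod_cong') auto
  then show ?thesis
    unfolding mat_det_def using p assms(2) by (intro finsum_cong') (auto intro!: finprod_closed)
qed

lemma mat_det_closed:
  assumes "\<And>i j. i < n \<Longrightarrow> j < n \<Longrightarrow> A i j \<in> carrier R"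
  shows "mat_det R n A \<in> carrier R"
proof -
  have p: "p i < n" if "p permutes {..<n}" "i < n" for p i
    using that permutes_in_image[OF that(1), of i] by auto
  then show ?thesis unfolding mat_det_def using assms by (intro finsum_closed) (auto intro!: finprod_closed)
qed

text \<open>Identities between determinants hold in the free ring on the entries.\<close>

lemma mat_det_mult:
  assumes A: "A \<in> mats R {..<n} {..<n}" and B: "B \<in> mats R {..<n} {..<n}"
  shows "mat_det R n (mat_mult R {..<n} {..<n} {..<n} A B) = mat_det R n A \<otimes> mat_det R n B"
proof -
  \<comment> \<open>The generators are the entries of two generic matrices, told apart by the
    Boolean. Indices out of range go to 0, which keeps all values in the carrier.\<close>
  define s where "s = (\<lambda>(b, i, j). if i < n \<and> j < n then if b then A i j else B i j else \<zero>)"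
  have s: "s g \<in> carrier R" for g
    using A B by (auto simp: s_def mats_closed split: prod.split)
  define f where "f = free_eval R s"
  interpret cring_map R f unfolding f_def by (rule free_eval_map) (rule s)
  have gen: "f (gen (b, i, j)) = (if b then A i j else B i j)" if "i < n" "j < n" for b i j
    using that s by (simp add: f_def free_eval_gen) (simp add: s_def)
  define A' where "A' = mat n n (\<lambda>(i, j). gen (True, i, j))"
  define B' where "B' = mat n n (\<lambda>(i, j). gen (False, i, j))"
  have carr: "A' \<in> carrier_mat n n" "B' \<in> carrier_mat n n" by (auto simp: A'_def B'_def)
  have "f (det A') = mat_det R n A" "f (det B') = mat_det R n B"
    unfolding A'_def B'_def map_det by (rule mat_det_cong; use A B in \<open>simp add: gen mats_closed\<close>)+
  moreover have "f (det (A' * B')) = mat_det R n (mat_mult R {..<n} {..<n} {..<n} A B)"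
  proof -
    have "A' * B' = mat n n (\<lambda>(i, j). \<Sum>k<n. gen (True, i, k) * gen (False, k, j))"
      by (rule eq_matI) (auto simp: A'_def B'_def scalar_prod_def lessThan_atLeast0)
    then show ?thesis
      by (simp only: map_det map_sum map_mult)
        (rule mat_det_cong; use A B in \<open>auto simp: gen mat_mult_entry mats_closed intro!: finsum_cong' finsum_closed\<close>)
  qed
  ultimately show ?thesis using carr by (simp add: det_mult map_mult)
qed

lemma mat_det_one: "mat_det R n (mat_one R {..<n}) = \<one>"
proof -
  interpret cring_map R "free_eval R (\<lambda>_::unit. \<one>)" by (rule free_eval_map) simp
  let ?f = "free_eval R (\<lambda>_::unit. \<one>)"
  have "1\<^sub>m n = mat n n (\<lambda>(i, j). if i = j then 1 else 0 :: unit free_ring)"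
    by (rule eq_matI) auto
  then have "\<one> = mat_det R n (\<lambda>i j. ?f (if i = j then 1 else 0))"
    using map_det[of n "\<lambda>i j. if i = j then 1 else 0"] det_one[of n, where 'a = "unit free_ring"] map_one
    by metis
  also have "\<dots> = mat_det R n (mat_one R {..<n})"
    by (rule mat_det_cong) (auto simp: mat_one_def map_one map_zero)
  finally show ?thesis by simp
qed

text \<open>The adjugate identities of the generic matrix over the free ring, evaluated at the
  entries of \<open>A\<close>.\<close>

lemma adjugate:
  assumes A: "A \<in> mats R {..<n} {..<n}"
  obtains C where "\<And>i j. C i j \<in> carrier R"
    "\<And>i j. i < n \<Longrightarrow> j < n \<Longrightarrow> (\<Oplus>k\<in>{..<n}. A i k \<otimes> C k j) = (if i = j then mat_det R n A else \<zero>)"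
    "\<And>i j. i < n \<Longrightarrow> j < n \<Longrightarrow> (\<Oplus>k\<in>{..<n}. C i k \<otimes> A k j) = (if i = j then mat_det R n A else \<zero>)"
proof -
  define s where "s = (\<lambda>(i, j). if i < n \<and> j < n then A i j else \<zero>)"
  have s: "s g \<in> carrier R" for g
    using A by (auto simp: s_def mats_closed split: prod.split)
  define f where "f = free_eval R s"
  interpret cring_map R f unfolding f_def by (rule free_eval_map) (rule s)
  have gen: "f (gen (i, j)) = A i j" if "i < n" "j < n" for i j
    using that s by (simp add: f_def free_eval_gen) (simp add: s_def)
  define A' where "A' = mat n n (\<lambda>(i, j). gen (i, j))"
  have carr: "A' \<in> carrier_mat n n" by (auto simp: A'_def)
  note adj = adj_mat[OF carr]
  have det: "f (det A') = mat_det R n A"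
    unfolding A'_def map_det by (rule mat_det_cong; use A in \<open>simp add: gen mats_closed\<close>)
  define C where "C i j = f (adj_mat A' $$ (i, j))" for i j
  have ent: "f (A' $$ (i, j)) = A i j" if "i < n" "j < n" for i j
    using that by (simp add: A'_def gen)
  have dim: "dim_row A' = n" "dim_col A' = n" "dim_row (adj_mat A') = n" "dim_col (adj_mat A') = n"
    using carr adj(1) by auto
  have "(\<Oplus>k\<in>{..<n}. A i k \<otimes> C k j) = (if i = j then mat_det R n A else \<zero>)" if "i < n" "j < n" for i j
  proof -
    have "(\<Oplus>k\<in>{..<n}. A i k \<otimes> C k j) = (\<Oplus>k\<in>{..<n}. f (A' $$ (i, k)) \<otimes> C k j)"
      using that by (intro finsum_cong') (auto simp: ent C_def)
    also have "\<dots> = f (\<Sum>k<n. A' $$ (i, k) * adj_mat A' $$ (k, j))"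
      by (simp add: C_def map_sum map_mult)
    also have "(\<Sum>k<n. A' $$ (i, k) * adj_mat A' $$ (k, j)) = (A' * adj_mat A') $$ (i, j)"
      using that dim by (simp add: scalar_prod_def lessThan_atLeast0)
    also have "f \<dots> = (if i = j then mat_det R n A else \<zero>)"
      using that by (simp add: adj(2) det map_zero)
    finally show ?thesis .
  qed
  moreover have "(\<Oplus>k\<in>{..<n}. C i k \<otimes> A k j) = (if i = j then mat_det R n A else \<zero>)" if "i < n" "j < n" for i j
  proof -
    have "(\<Oplus>k\<in>{..<n}. C i k \<otimes> A k j) = (\<Oplus>k\<in>{..<n}. C i k \<otimes> f (A' $$ (k, j)))"
      using that by (intro finsum_cong') (auto simp: ent C_def)
    also have "\<dots> = f (\<Sum>k<n. adj_mat A' $$ (i, k) * A' $$ (k, j))"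
      by (simp add: C_def map_sum map_mult)
    also have "(\<Sum>k<n. adj_mat A' $$ (i, k) * A' $$ (k, j)) = (adj_mat A' * A') $$ (i, j)"
      using that dim by (simp add: scalar_prod_def lessThan_atLeast0)
    also have "f \<dots> = (if i = j then mat_det R n A else \<zero>)"
      using that by (simp add: adj(3) det map_zero)
    finally show ?thesis .
  qed
  ultimately show ?thesis using that[of C] by (simp add: C_def)
qed

end

lemma GL_simps:
  "A \<in> carrier (GL R n) \<longleftrightarrow> A \<in> mats R {..<n} {..<n} \<and> mat_det R n A \<noteq> \<zero>\<^bsub>R\<^esub>"
  "A \<otimes>\<^bsub>GL R n\<^esub> B = A \<otimes>\<^bsub>mat_ring R {..<n}\<^esub> B"
  "\<one>\<^bsub>GL R n\<^esub> = \<one>\<^bsub>mat_ring R {..<n}\<^esub>"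
  by (auto simp: GL_def mat_ring_def)

lemma (in field) GL_group: "group (GL R n)"
proof -
  interpret M: ring "mat_ring R {..<n}" by (rule ring_mat_ring) simp
  note M = carrier_mat_ring[of R "{..<n}"]
  show ?thesis
  proof (rule groupI)
    fix A B C assume "A \<in> carrier (GL R n)" "B \<in> carrier (GL R n)" "C \<in> carrier (GL R n)"
    then have *: "A \<in> mats R {..<n} {..<n}" "B \<in> mats R {..<n} {..<n}" "C \<in> mats R {..<n} {..<n}"
      and det: "mat_det R n A \<noteq> \<zero>" "mat_det R n B \<noteq> \<zero>" by (simp_all add: GL_simps)
    have detc: "mat_det R n A \<in> carrier R" "mat_det R n B \<in> carrier R"
      using * by (auto intro!: mat_det_closed simp: mats_closed)
    show "A \<otimes>\<^bsub>GL R n\<^esub> B \<in> carrier (GL R n)"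
      using * det detc integral by (auto simp: GL_simps mult_mat_ring mat_mult_closed mat_det_mult)
    show "A \<otimes>\<^bsub>GL R n\<^esub> B \<otimes>\<^bsub>GL R n\<^esub> C = A \<otimes>\<^bsub>GL R n\<^esub> (B \<otimes>\<^bsub>GL R n\<^esub> C)"
      using * by (simp add: GL_simps M.m_assoc M)
    show "\<one>\<^bsub>GL R n\<^esub> \<otimes>\<^bsub>GL R n\<^esub> A = A" using * by (simp add: GL_simps M)
    obtain D where D: "\<And>i j. D i j \<in> carrier R"
      "\<And>i j. i < n \<Longrightarrow> j < n \<Longrightarrow> (\<Oplus>k\<in>{..<n}. D i k \<otimes> A k j) = (if i = j then mat_det R n A else \<zero>)"
      using adjugate[OF *(1)] by metis
    let ?d = "inv (mat_det R n A)"
    have d: "?d \<in> carrier R" "?d \<otimes> mat_det R n A = \<one>"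
      using det(1) detc(1) by (simp_all add: field_Units)
    let ?D = "\<lambda>i\<in>{..<n}. \<lambda>j\<in>{..<n}. ?d \<otimes> D i j"
    have Dc: "?D \<in> mats R {..<n} {..<n}" using D d by (intro mats_restrict) auto
    have "?D \<otimes>\<^bsub>mat_ring R {..<n}\<^esub> A = \<one>\<^bsub>mat_ring R {..<n}\<^esub>"
    proof (rule mats_eqI[of _ R "{..<n}" "{..<n}" _ R])
      fix i j assume ij: "i \<in> {..<n}" "j \<in> {..<n}"
      have "(\<Oplus>k\<in>{..<n}. ?D i k \<otimes> A k j) = (\<Oplus>k\<in>{..<n}. ?d \<otimes> (D i k \<otimes> A k j))"
        using ij d D * by (intro finsum_cong') (auto simp: mats_closed m_assoc)
      also have "\<dots> = ?d \<otimes> (\<Oplus>k\<in>{..<n}. D i k \<otimes> A k j)"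
        using ij d D * by (intro finsum_rdistr[symmetric]) (auto simp: mats_closed)
      finally show "(?D \<otimes>\<^bsub>mat_ring R {..<n}\<^esub> A) i j = \<one>\<^bsub>mat_ring R {..<n}\<^esub> i j"
        using ij D d by (simp add: mult_entry one_entry)
    qed (use M.m_closed[of ?D A] M.one_closed Dc * in \<open>simp_all add: M\<close>)
    moreover have "mat_det R n ?D \<noteq> \<zero>"
    proof
      assume "mat_det R n ?D = \<zero>"
      then have "mat_det R n (?D \<otimes>\<^bsub>mat_ring R {..<n}\<^esub> A) = \<zero>"
        using mat_det_mult[OF Dc *(1)] detc by (simp add: mult_mat_ring)
      then show False using calculation mat_det_one by (simp add: one_mat_ring)
    qed
    ultimately show "\<exists>D\<in>carrier (GL R n). D \<otimes>\<^bsub>GL R n\<^esub> A = \<one>\<^bsub>GL R n\<^esub>"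
      using Dc by (intro bexI[of _ ?D]) (simp_all add: GL_simps)
  next
    show "\<one>\<^bsub>GL R n\<^esub> \<in> carrier (GL R n)"
      using M.one_closed mat_det_one by (simp add: GL_simps M one_mat_ring)
  qed
qed

subsection \<open>The derivation on matrices\<close>

definition mat_der :: "'a diff_ring \<Rightarrow> 'i set \<Rightarrow> ('i \<Rightarrow> 'i \<Rightarrow> 'a) \<Rightarrow> 'i \<Rightarrow> 'i \<Rightarrow> 'a" where
  "mat_der R I A = (\<lambda>i\<in>I. \<lambda>j\<in>I. der R (A i j))"

text \<open>Commutativity is not assumed, so that matrices with the entrywise derivation are an
  instance: the computations with \<open>g\<close>, \<open>x\<close> and \<open>B\<close> are then
  done without indices.\<close>

locale der_ring = ring R for R (structure) +
  fixes D :: "'a \<Rightarrow> 'a"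
  assumes D_closed: "x \<in> carrier R \<Longrightarrow> D x \<in> carrier R"
    and D_add: "x \<in> carrier R \<Longrightarrow> y \<in> carrier R \<Longrightarrow> D (x \<oplus> y) = D x \<oplus> D y"
    and D_mult: "x \<in> carrier R \<Longrightarrow> y \<in> carrier R \<Longrightarrow> D (x \<otimes> y) = D x \<otimes> y \<oplus> x \<otimes> D y"
begin

lemma D_zero: "D \<zero> = \<zero>"
  using D_add[of \<zero> \<zero>] by (metis add.l_cancel_one' D_closed r_zero zero_closed)

lemma D_one: "D \<one> = \<zero>"
  using D_mult[of \<one> \<one>] D_closed[of \<one>] by (metis add.l_cancel_one' l_one one_closed r_one)

lemma D_finsum: "f \<in> T \<rightarrow> carrier R \<Longrightarrow> D (\<Oplus>t\<in>T. f t) = (\<Oplus>t\<in>T. D (f t))"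
proof (induction T rule: infinite_finite_induct)
  case (insert t T)
  then show ?case by (simp add: D_add D_closed Pi_def)
qed (simp_all add: D_zero)

lemma D_add_pow: "x \<in> carrier R \<Longrightarrow> D (add_pow R (k::nat) x) = add_pow R k (D x)"
  by (induction k) (simp_all add: D_zero D_add)

lemma D_pow_closed: "x \<in> carrier R \<Longrightarrow> (D ^^ k) x \<in> carrier R"
  by (induction k) (auto simp: D_closed)

end

lemma (in differential_field) der_ring_mat_ring:
  assumes fin: "finite I"
  shows "der_ring (mat_ring R I) (mat_der R I)"
proof -
  interpret M: ring "mat_ring R I" by (rule ring_mat_ring) fact
  note M = carrier_mat_ring[of R I]
  have cl: "mat_der R I A \<in> mats R I I" if "A \<in> mats R I I" for A
    unfolding mat_der_def using that by (intro mats_restrict) (auto simp: mats_closed der_closed)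
  show ?thesis
  proof
    fix A B assume "A \<in> carrier (mat_ring R I)" "B \<in> carrier (mat_ring R I)"
    then have AB: "A \<in> mats R I I" "B \<in> mats R I I" by (simp_all add: M)
    note cl' = mats_closed[OF AB(1)] mats_closed[OF AB(2)]
    have closed: "A \<oplus>\<^bsub>mat_ring R I\<^esub> B \<in> mats R I I" "A \<otimes>\<^bsub>mat_ring R I\<^esub> B \<in> mats R I I"
      if "A \<in> mats R I I" "B \<in> mats R I I" for A B
      using that M.a_closed[of A B] M.m_closed[of A B] by (simp_all add: M)
    show "mat_der R I (A \<oplus>\<^bsub>mat_ring R I\<^esub> B) = mat_der R I A \<oplus>\<^bsub>mat_ring R I\<^esub> mat_der R I B"
    proof (rule mats_eqI[of _ R I I _ R])
      fix i j assume "i \<in> I" "j \<in> I"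
      then show "mat_der R I (A \<oplus>\<^bsub>mat_ring R I\<^esub> B) i j = (mat_der R I A \<oplus>\<^bsub>mat_ring R I\<^esub> mat_der R I B) i j"
        using cl' by (simp add: add_entry mat_der_def der_add)
    qed (use AB cl closed in auto)
    show "mat_der R I (A \<otimes>\<^bsub>mat_ring R I\<^esub> B) =
        mat_der R I A \<otimes>\<^bsub>mat_ring R I\<^esub> B \<oplus>\<^bsub>mat_ring R I\<^esub> A \<otimes>\<^bsub>mat_ring R I\<^esub> mat_der R I B"
    proof (rule mats_eqI[of _ R I I _ R])
      fix i j assume ij: "i \<in> I" "j \<in> I"
      have "der R (\<Oplus>k\<in>I. A i k \<otimes> B k j) = (\<Oplus>k\<in>I. der R (A i k) \<otimes> B k j \<oplus> A i k \<otimes> der R (B k j))"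
        using ij cl' by (intro trans[OF der_finsum finsum_cong']) (auto simp: der_mult der_closed)
      also have "\<dots> = (\<Oplus>k\<in>I. der R (A i k) \<otimes> B k j) \<oplus> (\<Oplus>k\<in>I. A i k \<otimes> der R (B k j))"
        using ij cl' by (intro finsum_addf) (auto simp: der_closed)
      also have "\<dots> = (\<Oplus>k\<in>I. mat_der R I A i k \<otimes> B k j) \<oplus> (\<Oplus>k\<in>I. A i k \<otimes> mat_der R I B k j)"
        using ij cl' by (intro arg_cong2[of _ _ _ _ "add R"] finsum_cong') (auto simp: mat_der_def der_closed)
      finally show "mat_der R I (A \<otimes>\<^bsub>mat_ring R I\<^esub> B) i j =
        (mat_der R I A \<otimes>\<^bsub>mat_ring R I\<^esub> B \<oplus>\<^bsub>mat_ring R I\<^esub> A \<otimes>\<^bsub>mat_ring R I\<^esub> mat_der R I B) i j"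
        using ij by (simp add: mult_entry add_entry mat_der_def[of R I "A \<otimes>\<^bsub>mat_ring R I\<^esub> B"])
    qed (use AB cl closed in auto)
  qed (use cl in \<open>simp add: M\<close>)
qed

section \<open>Linear systems over a semi-universal extension\<close>

definition unit_vec :: "('a, 'm) ring_scheme \<Rightarrow> 'i set \<Rightarrow> 'i \<Rightarrow> 'i \<Rightarrow> 'a" where
  "unit_vec R I i = (\<lambda>j\<in>I. if i = j then \<one>\<^bsub>R\<^esub> else \<zero>\<^bsub>R\<^esub>)"

lemma (in field) functional_expand:
  assumes fin: "finite I" and \<phi>: "\<phi> \<in> functionals R (fun_module R (\<lambda>x. x) I)" and a: "a \<in> I \<rightarrow>\<^sub>E carrier R"
  shows "\<phi> a = (\<Oplus>i\<in>I. a i \<otimes> \<phi> (unit_vec R I i))"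
proof -
  have cl: "\<phi> x \<in> carrier R" if "x \<in> I \<rightarrow>\<^sub>E carrier R" for x
    using \<phi> that by (auto simp: functionals_def)
  have add: "\<phi> (\<lambda>i\<in>I. x i \<oplus> y i) = \<phi> x \<oplus> \<phi> y" if "x \<in> I \<rightarrow>\<^sub>E carrier R" "y \<in> I \<rightarrow>\<^sub>E carrier R" for x y
    using \<phi> that by (simp add: functionals_def)
  have sm: "\<phi> (\<lambda>i\<in>I. c \<otimes> x i) = c \<otimes> \<phi> x" if "x \<in> I \<rightarrow>\<^sub>E carrier R" "c \<in> carrier R" for x c
    using \<phi> that by (simp add: functionals_def)
  have u: "unit_vec R I i \<in> I \<rightarrow>\<^sub>E carrier R" for i by (auto simp: unit_vec_def)
  have "\<phi> (\<lambda>i\<in>I. if i \<in> J then a i else \<zero>) = (\<Oplus>i\<in>J. a i \<otimes> \<phi> (unit_vec R I i))" if "J \<subseteq> I" for J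
    using finite_subset[OF that fin] that
  proof (induction J rule: finite_induct)
    case empty
    have "\<phi> (\<lambda>i\<in>I. \<zero> \<otimes> a i) = \<zero>" using sm[OF a, of \<zero>] cl[OF a] by simp
    moreover have "(\<lambda>i\<in>I. \<zero> \<otimes> a i) = (\<lambda>i\<in>I. \<zero>)" using a by (auto simp: fun_eq_iff PiE_def Pi_def)
    ultimately show ?case by (simp add: restrict_def)
  next
    case (insert k J)
    let ?x = "\<lambda>i\<in>I. if i \<in> J then a i else \<zero>" and ?y = "\<lambda>i\<in>I. a k \<otimes> unit_vec R I k i"
    have ak: "a k \<in> carrier R" using a insert by auto
    have eq: "(\<lambda>i\<in>I. if i \<in> insert k J then a i else \<zero>) = (\<lambda>i\<in>I. ?x i \<oplus> ?y i)"
      using insert a ak by (auto simp: fun_eq_iff unit_vec_def PiE_def Pi_def)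
    have "\<phi> (\<lambda>i\<in>I. ?x i \<oplus> ?y i) = \<phi> ?x \<oplus> a k \<otimes> \<phi> (unit_vec R I k)"
    proof -
      have "?x \<in> I \<rightarrow>\<^sub>E carrier R" "?y \<in> I \<rightarrow>\<^sub>E carrier R" using a ak u by auto
      then show ?thesis by (simp only: add sm[OF u ak])
    qed
    moreover have "\<phi> ?x = (\<Oplus>i\<in>J. a i \<otimes> \<phi> (unit_vec R I i))"
      by (rule insert.IH) (use insert.prems in simp)
    moreover have f: "a i \<otimes> \<phi> (unit_vec R I i) \<in> carrier R" if "i \<in> insert k J" for i
      using that insert.prems a cl[OF u] by (intro m_closed) auto
    ultimately show ?case
      unfolding eq using insert.hyps f[of k] f finsum_closed[of "\<lambda>i. a i \<otimes> \<phi> (unit_vec R I i)" J]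
      by (subst finsum_insert) (auto simp: a_comm)
  qed
  moreover have "(\<lambda>i\<in>I. if i \<in> I then a i else \<zero>) = a"
    using a by (auto simp: fun_eq_iff PiE_def extensional_def)
  ultimately show ?thesis by (metis order_refl)
qed

text \<open>Choose a maximal set of coordinates at which some point of \<open>B\<close> vanishes. If
  two points vanished there, some point of the line through them would vanish in addition at a
  coordinate where they differ.\<close>

lemma (in field) vanishing_maximal:
  assumes fin: "finite I" and b: "b \<in> B" and B: "B \<subseteq> I \<rightarrow>\<^sub>E carrier R"
    and affine: "\<And>x y c. x \<in> B \<Longrightarrow> y \<in> B \<Longrightarrow> c \<in> carrier R \<Longrightarrow> (\<lambda>i\<in>I. x i \<oplus> c \<otimes> (x i \<ominus> y i)) \<in> B"
  obtains T x where "T \<subseteq> I" "x \<in> B" "\<And>t. t \<in> T \<Longrightarrow> x t = \<zero>"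
    "\<And>y. y \<in> B \<Longrightarrow> (\<And>t. t \<in> T \<Longrightarrow> y t = \<zero>) \<Longrightarrow> y = x"
proof -
  let ?A = "{T. T \<subseteq> I \<and> (\<exists>x\<in>B. \<forall>t\<in>T. x t = \<zero>)}"
  have fin: "finite ?A" and ne: "{} \<in> ?A" using fin b by auto
  obtain T where T: "T \<in> ?A" and max: "\<forall>T'\<in>?A. T \<subseteq> T' \<longrightarrow> T = T'"
    using finite_has_maximal2[OF fin ne] by (elim bexE conjE)
  from T obtain x where x: "T \<subseteq> I" "x \<in> B" "\<And>t. t \<in> T \<Longrightarrow> x t = \<zero>" by blast
  have "y = x" if y: "y \<in> B" "\<And>t. t \<in> T \<Longrightarrow> y t = \<zero>" for y
  proof (rule ccontr)
    assume "y \<noteq> x"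
    then obtain s where s: "s \<in> I" "x s \<noteq> y s"
      using x(2) y(1) B by (metis PiE_ext subsetD)
    have cl: "x i \<in> carrier R" "y i \<in> carrier R" if "i \<in> I" for i using x(2) y(1) B that by auto
    have u: "x s \<ominus> y s \<in> Units R" using s cl by (simp add: field_Units)
    \<comment> \<open>The parameter at which the line through \<open>x\<close> and \<open>y\<close>
      meets the hyperplane of vanishing \<open>s\<close>-coordinate.\<close>
    define c where "c = \<ominus> (x s \<otimes> inv (x s \<ominus> y s))"
    have c: "c \<in> carrier R" using u cl s by (simp add: c_def)
    have "c \<otimes> (x s \<ominus> y s) = \<ominus> x s"
      using u cl[OF s(1)] by (simp add: c_def l_minus m_assoc)
    then have 0: "x s \<oplus> c \<otimes> (x s \<ominus> y s) = \<zero>" using cl s by (simp add: r_neg)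
    let ?z = "\<lambda>i\<in>I. x i \<oplus> c \<otimes> (x i \<ominus> y i)"
    have "?z \<in> B" by (rule affine[OF x(2) y(1) c])
    moreover have "\<forall>t\<in>insert s T. ?z t = \<zero>"
      using 0 x y c s by (auto simp: a_minus_def)
    ultimately have "insert s T \<in> ?A" using x(1) s(1) by blast
    then have "T = insert s T" using max[rule_format, of "insert s T"] by auto
    then have "s \<in> T" by blast
    then show False using s x y by auto
  qed
  then show ?thesis using that[OF x] by blast
qed

locale universal_domain = diff_field_map K U \<iota>
  for K :: "'a diff_ring" and U :: "'c diff_ring" and \<iota> +
  assumes universal: "semi_universal K U \<iota>" and char0: "char_zero K"
begin

text \<open>A differential embedding over \<open>K\<close> of the field generated by
  \<open>S\<close>. The generators are kept explicit because they have to be enlarged by the scalars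
  of each linear combination, while the embeddings that move a given element exist for finite
  \<open>S\<close>.\<close>

definition specialization :: "'c set \<Rightarrow> ('c \<Rightarrow> 'c) \<Rightarrow> bool" where
  "specialization S \<sigma> \<longleftrightarrow> \<sigma> \<in> diff_hom (U\<lparr>carrier := diff_span U (\<iota> ` carrier K \<union> S)\<rparr>) U \<and>
     (\<forall>c\<in>carrier K. \<sigma> (\<iota> c) = \<iota> c)"

abbreviation span :: "'c set \<Rightarrow> 'c set" where
  "span S \<equiv> diff_span U (\<iota> ` carrier K \<union> S)"

lemma span_mono: "S \<subseteq> S' \<Longrightarrow> S' \<subseteq> carrier U \<Longrightarrow> span S \<subseteq> span S'"
  by (intro B.diff_span_least B.subfield_diff_span) (auto intro: diff_span.intros)

lemma span_closed: "S \<subseteq> carrier U \<Longrightarrow> x \<in> span S \<Longrightarrow> x \<in> carrier U"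
  using B.diff_span_closed[of "\<iota> ` carrier K \<union> S"] by auto

lemma specialization_map:
  assumes "S \<subseteq> carrier U" "specialization S \<sigma>"
  shows "diff_field_map (U\<lparr>carrier := span S\<rparr>) U \<sigma>"
  using assms B.differential_field_diff_span[of "\<iota> ` carrier K \<union> S"]
  by (auto simp: specialization_def diff_field_map_def diff_field_map_axioms_def B.differential_field_axioms)

lemma specialization_simps:
  assumes "S \<subseteq> carrier U" "specialization S \<sigma>" "x \<in> span S" "y \<in> span S"
  shows "\<sigma> x \<in> carrier U" "\<sigma> (x \<oplus>\<^bsub>U\<^esub> y) = \<sigma> x \<oplus>\<^bsub>U\<^esub> \<sigma> y" "\<sigma> (x \<otimes>\<^bsub>U\<^esub> y) = \<sigma> x \<otimes>\<^bsub>U\<^esub> \<sigma> y"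
    "\<sigma> \<zero>\<^bsub>U\<^esub> = \<zero>\<^bsub>U\<^esub>" "\<sigma> \<one>\<^bsub>U\<^esub> = \<one>\<^bsub>U\<^esub>" "\<sigma> (\<ominus>\<^bsub>U\<^esub> x) = \<ominus>\<^bsub>U\<^esub> \<sigma> x"
proof -
  interpret \<sigma>: diff_field_map "U\<lparr>carrier := span S\<rparr>" U \<sigma> by (rule specialization_map[OF assms(1,2)])
  show cl: "\<sigma> x \<in> carrier U" and "\<sigma> (x \<otimes>\<^bsub>U\<^esub> y) = \<sigma> x \<otimes>\<^bsub>U\<^esub> \<sigma> y"
    and zero: "\<sigma> \<zero>\<^bsub>U\<^esub> = \<zero>\<^bsub>U\<^esub>" and "\<sigma> \<one>\<^bsub>U\<^esub> = \<one>\<^bsub>U\<^esub>"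
    using \<sigma>.hom_closed[of x] \<sigma>.hom_mult[of x y] \<sigma>.hom_zero \<sigma>.hom_one assms by simp_all
  have add: "\<sigma> (x \<oplus>\<^bsub>U\<^esub> y) = \<sigma> x \<oplus>\<^bsub>U\<^esub> \<sigma> y" if "x \<in> span S" "y \<in> span S" for x y
    using \<sigma>.hom_add[of x y] that by simp
  then show "\<sigma> (x \<oplus>\<^bsub>U\<^esub> y) = \<sigma> x \<oplus>\<^bsub>U\<^esub> \<sigma> y" using assms by simp
  have n: "\<ominus>\<^bsub>U\<^esub> x \<in> span S" by (rule diff_span.span_a_inv) fact
  have "\<sigma> (\<ominus>\<^bsub>U\<^esub> x) \<oplus>\<^bsub>U\<^esub> \<sigma> x = \<zero>\<^bsub>U\<^esub>"
    using add[OF n assms(3)] span_closed[OF assms(1,3)] zero by (simp add: B.l_neg)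
  then show "\<sigma> (\<ominus>\<^bsub>U\<^esub> x) = \<ominus>\<^bsub>U\<^esub> \<sigma> x"
    using cl \<sigma>.hom_closed[of "\<ominus>\<^bsub>U\<^esub> x"] n by (simp add: B.minus_equality)
qed

lemma specialization_id:
  assumes "S \<subseteq> carrier U" shows "specialization S (\<lambda>x. x)"
  using span_closed[OF assms] by (auto simp: specialization_def diff_hom_def intro!: ring_hom_memI)

lemma specialization_moving:
  assumes "finite S" "S \<subseteq> carrier U" "u \<in> span S" "u \<notin> \<iota> ` carrier K"
  obtains \<sigma> where "specialization S \<sigma>" "\<sigma> u \<noteq> u"
  using moving_embedding[OF universal char0 assms] unfolding specialization_def by metis

text \<open>A solution with as many zero coordinates as possible is unique, its coordinates are linear
  combinations of the equations, and hence it is fixed by all specializations.\<close>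

lemma linear_system_descent:
  assumes fin: "finite I"
    and \<alpha>: "\<And>q i. q \<in> Q \<Longrightarrow> i \<in> I \<Longrightarrow> \<alpha> q i \<in> supp q"
    and \<beta>: "\<And>q. q \<in> Q \<Longrightarrow> \<beta> q \<in> supp q"
    and supp: "\<And>q. q \<in> Q \<Longrightarrow> finite (supp q) \<and> supp q \<subseteq> carrier U"
    and stable: "\<And>q S \<sigma>. q \<in> Q \<Longrightarrow> S \<subseteq> carrier U \<Longrightarrow> supp q \<subseteq> S \<Longrightarrow> specialization S \<sigma> \<Longrightarrow>
      \<exists>q'\<in>Q. (\<forall>i\<in>I. \<alpha> q' i = \<sigma> (\<alpha> q i)) \<and> \<beta> q' = \<sigma> (\<beta> q)"
    and b: "b \<in> I \<rightarrow>\<^sub>E carrier U" "\<And>q. q \<in> Q \<Longrightarrow> (\<Oplus>\<^bsub>U\<^esub>i\<in>I. \<alpha> q i \<otimes>\<^bsub>U\<^esub> b i) = \<beta> q"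
  obtains c where "\<And>i. i \<in> I \<Longrightarrow> c i \<in> carrier K"
    "\<And>q. q \<in> Q \<Longrightarrow> (\<Oplus>\<^bsub>U\<^esub>i\<in>I. \<alpha> q i \<otimes>\<^bsub>U\<^esub> \<iota> (c i)) = \<beta> q"
proof -
  have \<alpha>c: "\<alpha> q i \<in> carrier U" if "q \<in> Q" "i \<in> I" for q i using \<alpha> supp that by blast
  have \<beta>c: "\<beta> q \<in> carrier U" if "q \<in> Q" for q using \<beta> supp that by blast
  define B where "B = {b \<in> I \<rightarrow>\<^sub>E carrier U. \<forall>q\<in>Q. (\<Oplus>\<^bsub>U\<^esub>i\<in>I. \<alpha> q i \<otimes>\<^bsub>U\<^esub> b i) = \<beta> q}"
  have Bc: "x i \<in> carrier U" if "x \<in> B" "i \<in> I" for x i using that by (auto simp: B_def)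
  have comb: "(\<lambda>i\<in>I. x i \<oplus>\<^bsub>U\<^esub> c \<otimes>\<^bsub>U\<^esub> y i) \<in> B"
    if x: "x \<in> B" and y: "y \<in> I \<rightarrow>\<^sub>E carrier U" "\<And>q. q \<in> Q \<Longrightarrow> (\<Oplus>\<^bsub>U\<^esub>i\<in>I. \<alpha> q i \<otimes>\<^bsub>U\<^esub> y i) = \<zero>\<^bsub>U\<^esub>"
      and c: "c \<in> carrier U" for x y c
  proof -
    have yc: "y i \<in> carrier U" if "i \<in> I" for i using y that by auto
    have "(\<Oplus>\<^bsub>U\<^esub>i\<in>I. \<alpha> q i \<otimes>\<^bsub>U\<^esub> (\<lambda>i\<in>I. x i \<oplus>\<^bsub>U\<^esub> c \<otimes>\<^bsub>U\<^esub> y i) i) = \<beta> q" if q: "q \<in> Q" for q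
    proof -
      have "(\<Oplus>\<^bsub>U\<^esub>i\<in>I. \<alpha> q i \<otimes>\<^bsub>U\<^esub> (\<lambda>i\<in>I. x i \<oplus>\<^bsub>U\<^esub> c \<otimes>\<^bsub>U\<^esub> y i) i) =
          (\<Oplus>\<^bsub>U\<^esub>i\<in>I. \<alpha> q i \<otimes>\<^bsub>U\<^esub> x i \<oplus>\<^bsub>U\<^esub> c \<otimes>\<^bsub>U\<^esub> (\<alpha> q i \<otimes>\<^bsub>U\<^esub> y i))"
        using \<alpha>c[OF q] Bc[OF x] yc c by (intro B.finsum_cong') (auto simp: B.r_distr B.m_lcomm)
      also have "\<dots> = (\<Oplus>\<^bsub>U\<^esub>i\<in>I. \<alpha> q i \<otimes>\<^bsub>U\<^esub> x i) \<oplus>\<^bsub>U\<^esub> (\<Oplus>\<^bsub>U\<^esub>i\<in>I. c \<otimes>\<^bsub>U\<^esub> (\<alpha> q i \<otimes>\<^bsub>U\<^esub> y i))"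
        using \<alpha>c[OF q] Bc[OF x] yc c by (intro B.finsum_addf) auto
      also have "(\<Oplus>\<^bsub>U\<^esub>i\<in>I. c \<otimes>\<^bsub>U\<^esub> (\<alpha> q i \<otimes>\<^bsub>U\<^esub> y i)) = c \<otimes>\<^bsub>U\<^esub> (\<Oplus>\<^bsub>U\<^esub>i\<in>I. \<alpha> q i \<otimes>\<^bsub>U\<^esub> y i)"
        using \<alpha>c[OF q] yc c by (intro B.finsum_rdistr[symmetric] fin) auto
      finally show ?thesis using x y q c \<beta>c by (simp add: B_def)
    qed
    then show ?thesis using Bc[OF x] yc c by (auto simp: B_def)
  qed
  have diff: "(\<Oplus>\<^bsub>U\<^esub>i\<in>I. \<alpha> q i \<otimes>\<^bsub>U\<^esub> (x i \<ominus>\<^bsub>U\<^esub> y i)) = \<zero>\<^bsub>U\<^esub>" if "x \<in> B" "y \<in> B" "q \<in> Q" for x y q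
  proof -
    have "(\<Oplus>\<^bsub>U\<^esub>i\<in>I. \<alpha> q i \<otimes>\<^bsub>U\<^esub> (x i \<ominus>\<^bsub>U\<^esub> y i)) =
        (\<Oplus>\<^bsub>U\<^esub>i\<in>I. \<alpha> q i \<otimes>\<^bsub>U\<^esub> x i \<oplus>\<^bsub>U\<^esub> (\<ominus>\<^bsub>U\<^esub> \<one>\<^bsub>U\<^esub>) \<otimes>\<^bsub>U\<^esub> (\<alpha> q i \<otimes>\<^bsub>U\<^esub> y i))"
      using \<alpha>c that Bc by (intro B.finsum_cong') (auto simp: a_minus_def B.r_distr B.r_minus B.l_minus)
    also have "\<dots> = (\<Oplus>\<^bsub>U\<^esub>i\<in>I. \<alpha> q i \<otimes>\<^bsub>U\<^esub> x i) \<oplus>\<^bsub>U\<^esub> (\<Oplus>\<^bsub>U\<^esub>i\<in>I. (\<ominus>\<^bsub>U\<^esub> \<one>\<^bsub>U\<^esub>) \<otimes>\<^bsub>U\<^esub> (\<alpha> q i \<otimes>\<^bsub>U\<^esub> y i))"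
      using \<alpha>c that Bc by (intro B.finsum_addf) auto
    also have "(\<Oplus>\<^bsub>U\<^esub>i\<in>I. (\<ominus>\<^bsub>U\<^esub> \<one>\<^bsub>U\<^esub>) \<otimes>\<^bsub>U\<^esub> (\<alpha> q i \<otimes>\<^bsub>U\<^esub> y i)) = (\<ominus>\<^bsub>U\<^esub> \<one>\<^bsub>U\<^esub>) \<otimes>\<^bsub>U\<^esub> (\<Oplus>\<^bsub>U\<^esub>i\<in>I. \<alpha> q i \<otimes>\<^bsub>U\<^esub> y i)"
      using \<alpha>c that Bc by (intro B.finsum_rdistr[symmetric] fin) auto
    finally show ?thesis using that \<beta>c by (simp add: B_def B.l_minus B.r_neg)
  qed
  have bB: "b \<in> B" using b by (simp add: B_def)
  have affine: "(\<lambda>i\<in>I. x i \<oplus>\<^bsub>U\<^esub> c \<otimes>\<^bsub>U\<^esub> (x i \<ominus>\<^bsub>U\<^esub> y i)) \<in> B"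
    if "x \<in> B" "y \<in> B" "c \<in> carrier U" for x y c
  proof -
    have "(\<lambda>i\<in>I. x i \<oplus>\<^bsub>U\<^esub> c \<otimes>\<^bsub>U\<^esub> (\<lambda>i\<in>I. x i \<ominus>\<^bsub>U\<^esub> y i) i) \<in> B"
    proof (rule comb[OF that(1) _ _ that(3)])
      show "(\<lambda>i\<in>I. x i \<ominus>\<^bsub>U\<^esub> y i) \<in> I \<rightarrow>\<^sub>E carrier U" using that Bc by auto
      fix q assume "q \<in> Q"
      then have "(\<Oplus>\<^bsub>U\<^esub>i\<in>I. \<alpha> q i \<otimes>\<^bsub>U\<^esub> (\<lambda>i\<in>I. x i \<ominus>\<^bsub>U\<^esub> y i) i) = (\<Oplus>\<^bsub>U\<^esub>i\<in>I. \<alpha> q i \<otimes>\<^bsub>U\<^esub> (x i \<ominus>\<^bsub>U\<^esub> y i))"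
        using that Bc \<alpha>c by (intro B.finsum_cong') auto
      then show "(\<Oplus>\<^bsub>U\<^esub>i\<in>I. \<alpha> q i \<otimes>\<^bsub>U\<^esub> (\<lambda>i\<in>I. x i \<ominus>\<^bsub>U\<^esub> y i) i) = \<zero>\<^bsub>U\<^esub>" using diff that \<open>q \<in> Q\<close> by simp
    qed
    then show ?thesis by (simp cong: restrict_cong)
  qed
  obtain T x where T: "T \<subseteq> I" "x \<in> B" "\<And>t. t \<in> T \<Longrightarrow> x t = \<zero>\<^bsub>U\<^esub>"
    and uniq: "\<And>y. y \<in> B \<Longrightarrow> (\<And>t. t \<in> T \<Longrightarrow> y t = \<zero>\<^bsub>U\<^esub>) \<Longrightarrow> y = x"
    using B.vanishing_maximal[OF fin bB _ affine] unfolding B_def by (smt (verit) mem_Collect_eq subsetI)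
  let ?M = "fun_module U (\<lambda>x. x) I"
  \<comment> \<open>The linear form \<open>w\<close> has the value \<open>v\<close> at
    \<open>x\<close>, and this persists when an embedding is applied to \<open>w\<close> and
    \<open>v\<close> while \<open>x\<close> stays fixed. Larger domains \<open>S'\<close> are
    included so that forms with different \<open>S\<close> can be added.\<close>
  define good where "good w S v \<longleftrightarrow> finite S \<and> S \<subseteq> carrier U \<and> (\<forall>i\<in>I. w i \<in> span S) \<and> v \<in> span S \<and>
    (\<forall>S' \<sigma>. S \<subseteq> S' \<longrightarrow> S' \<subseteq> carrier U \<longrightarrow> specialization S' \<sigma> \<longrightarrow> (\<Oplus>\<^bsub>U\<^esub>i\<in>I. \<sigma> (w i) \<otimes>\<^bsub>U\<^esub> x i) = \<sigma> v)"
    for w S v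
  define W where "W = {w \<in> I \<rightarrow>\<^sub>E carrier U. \<exists>S v. good w S v}"
  have xc: "x i \<in> carrier U" if "i \<in> I" for i using Bc[OF T(2) that] .
  interpret Mod: module U ?M
    by (rule module_fun_module) (unfold_locales, auto intro: ring_hom_memI)
  \<comment> \<open>A scalar from \<open>U\<close> is itself moved by embeddings, so it joins the
    generators.\<close>
  have smult: "good (\<lambda>i\<in>I. c \<otimes>\<^bsub>U\<^esub> w i) (insert c S) (c \<otimes>\<^bsub>U\<^esub> v)" if g: "good w S v" and c: "c \<in> carrier U" for w S v c
  proof -
    have S: "finite S" "S \<subseteq> carrier U" "\<And>i. i \<in> I \<Longrightarrow> w i \<in> span S" "v \<in> span S"
      and sp: "\<And>S' \<sigma>. S \<subseteq> S' \<Longrightarrow> S' \<subseteq> carrier U \<Longrightarrow> specialization S' \<sigma> \<Longrightarrow> (\<Oplus>\<^bsub>U\<^esub>i\<in>I. \<sigma> (w i) \<otimes>\<^bsub>U\<^esub> x i) = \<sigma> v"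
      using g by (auto simp: good_def)
    have mono: "span S \<subseteq> span (insert c S)" using S c by (intro span_mono) auto
    have cs: "c \<in> span (insert c S)" by (rule diff_span.span_incl) simp
    show ?thesis
      unfolding good_def
    proof (intro conjI ballI allI impI)
      fix S' \<sigma> assume *: "insert c S \<subseteq> S'" "S' \<subseteq> carrier U" "specialization S' \<sigma>"
      have mono': "span (insert c S) \<subseteq> span S'" using * by (intro span_mono) auto
      note simps = specialization_simps[OF *(2,3)]
      have in': "c \<in> span S'" "v \<in> span S'" "\<And>i. i \<in> I \<Longrightarrow> w i \<in> span S'"
        using cs S mono mono' by blast+
      have "(\<Oplus>\<^bsub>U\<^esub>i\<in>I. \<sigma> ((\<lambda>i\<in>I. c \<otimes>\<^bsub>U\<^esub> w i) i) \<otimes>\<^bsub>U\<^esub> x i) = (\<Oplus>\<^bsub>U\<^esub>i\<in>I. \<sigma> c \<otimes>\<^bsub>U\<^esub> (\<sigma> (w i) \<otimes>\<^bsub>U\<^esub> x i))"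
        using in' xc simps by (intro B.finsum_cong') (auto simp: B.m_assoc)
      also have "\<dots> = \<sigma> c \<otimes>\<^bsub>U\<^esub> (\<Oplus>\<^bsub>U\<^esub>i\<in>I. \<sigma> (w i) \<otimes>\<^bsub>U\<^esub> x i)"
        using in' xc simps by (intro B.finsum_rdistr[symmetric] fin) auto
      also have "\<dots> = \<sigma> (c \<otimes>\<^bsub>U\<^esub> v)" using sp[of S' \<sigma>] * in' simps by simp
      finally show "(\<Oplus>\<^bsub>U\<^esub>i\<in>I. \<sigma> ((\<lambda>i\<in>I. c \<otimes>\<^bsub>U\<^esub> w i) i) \<otimes>\<^bsub>U\<^esub> x i) = \<sigma> (c \<otimes>\<^bsub>U\<^esub> v)" .
    qed (use S c cs mono in \<open>auto intro!: diff_span.span_mult\<close>)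
  qed
  have add: "good (\<lambda>i\<in>I. w i \<oplus>\<^bsub>U\<^esub> w' i) (S \<union> S') (v \<oplus>\<^bsub>U\<^esub> v')" if g: "good w S v" "good w' S' v'" for w S v w' S' v'
  proof -
    have S: "finite S" "S \<subseteq> carrier U" "\<And>i. i \<in> I \<Longrightarrow> w i \<in> span S" "v \<in> span S"
      and sp: "\<And>S' \<sigma>. S \<subseteq> S' \<Longrightarrow> S' \<subseteq> carrier U \<Longrightarrow> specialization S' \<sigma> \<Longrightarrow> (\<Oplus>\<^bsub>U\<^esub>i\<in>I. \<sigma> (w i) \<otimes>\<^bsub>U\<^esub> x i) = \<sigma> v"
      using g(1) by (auto simp: good_def)
    have S': "finite S'" "S' \<subseteq> carrier U" "\<And>i. i \<in> I \<Longrightarrow> w' i \<in> span S'" "v' \<in> span S'"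
      and sp': "\<And>S \<sigma>. S' \<subseteq> S \<Longrightarrow> S \<subseteq> carrier U \<Longrightarrow> specialization S \<sigma> \<Longrightarrow> (\<Oplus>\<^bsub>U\<^esub>i\<in>I. \<sigma> (w' i) \<otimes>\<^bsub>U\<^esub> x i) = \<sigma> v'"
      using g(2) by (auto simp: good_def)
    have mono: "span S \<subseteq> span (S \<union> S')" "span S' \<subseteq> span (S \<union> S')" using S(2) S'(2) by (simp_all add: span_mono)
    show ?thesis
      unfolding good_def
    proof (intro conjI ballI allI impI)
      fix S'' \<sigma> assume *: "S \<union> S' \<subseteq> S''" "S'' \<subseteq> carrier U" "specialization S'' \<sigma>"
      have mono': "span (S \<union> S') \<subseteq> span S''" using * by (intro span_mono) auto
      note simps = specialization_simps[OF *(2,3)]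
      have in': "v \<in> span S''" "v' \<in> span S''" "\<And>i. i \<in> I \<Longrightarrow> w i \<in> span S''" "\<And>i. i \<in> I \<Longrightarrow> w' i \<in> span S''"
        using S S' mono mono' by blast+
      have "(\<Oplus>\<^bsub>U\<^esub>i\<in>I. \<sigma> ((\<lambda>i\<in>I. w i \<oplus>\<^bsub>U\<^esub> w' i) i) \<otimes>\<^bsub>U\<^esub> x i) =
          (\<Oplus>\<^bsub>U\<^esub>i\<in>I. \<sigma> (w i) \<otimes>\<^bsub>U\<^esub> x i \<oplus>\<^bsub>U\<^esub> \<sigma> (w' i) \<otimes>\<^bsub>U\<^esub> x i)"
        using in' xc simps by (intro B.finsum_cong') (auto simp: B.l_distr)
      also have "\<dots> = (\<Oplus>\<^bsub>U\<^esub>i\<in>I. \<sigma> (w i) \<otimes>\<^bsub>U\<^esub> x i) \<oplus>\<^bsub>U\<^esub> (\<Oplus>\<^bsub>U\<^esub>i\<in>I. \<sigma> (w' i) \<otimes>\<^bsub>U\<^esub> x i)"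
        using in' xc simps by (intro B.finsum_addf) auto
      also have "\<dots> = \<sigma> (v \<oplus>\<^bsub>U\<^esub> v')" using sp[of S'' \<sigma>] sp'[of S'' \<sigma>] * in' simps by simp
      finally show "(\<Oplus>\<^bsub>U\<^esub>i\<in>I. \<sigma> ((\<lambda>i\<in>I. w i \<oplus>\<^bsub>U\<^esub> w' i) i) \<otimes>\<^bsub>U\<^esub> x i) = \<sigma> (v \<oplus>\<^bsub>U\<^esub> v')" .
    qed (use S S' mono in \<open>auto intro!: diff_span.span_add\<close>)
  qed
  have zero_span: "\<zero>\<^bsub>U\<^esub> \<in> span S" for S
    by (rule diff_span.span_incl) (auto intro!: image_eqI[of _ _ "\<zero>\<^bsub>K\<^esub>"])
  have unit_good: "good (unit_vec U I t) {} \<zero>\<^bsub>U\<^esub>" if "t \<in> T" for t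
    unfolding good_def
  proof (intro conjI ballI allI impI)
    fix S' \<sigma> assume *: "{} \<subseteq> S'" "S' \<subseteq> carrier U" "specialization S' \<sigma>"
    note simps = specialization_simps[OF *(2,3) zero_span zero_span]
    have "(\<Oplus>\<^bsub>U\<^esub>i\<in>I. \<sigma> (unit_vec U I t i) \<otimes>\<^bsub>U\<^esub> x i) = (\<Oplus>\<^bsub>U\<^esub>i\<in>I. if t = i then x i else \<zero>\<^bsub>U\<^esub>)"
      using xc simps by (intro B.finsum_cong') (auto simp: unit_vec_def)
    also have "\<dots> = x t" using that T(1) xc by (intro B.finsum_delta fin) auto
    finally show "(\<Oplus>\<^bsub>U\<^esub>i\<in>I. \<sigma> (unit_vec U I t i) \<otimes>\<^bsub>U\<^esub> x i) = \<sigma> \<zero>\<^bsub>U\<^esub>" using T(3)[OF that] simps by simp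
  qed (use zero_span[of "{}"] diff_span.span_one[of U "\<iota> ` carrier K \<union> {}"] in \<open>auto simp: unit_vec_def\<close>)
  have zero_good: "good (\<lambda>i\<in>I. \<zero>\<^bsub>U\<^esub>) {} \<zero>\<^bsub>U\<^esub>"
    unfolding good_def
  proof (intro conjI ballI allI impI)
    fix S' \<sigma> assume *: "{} \<subseteq> S'" "S' \<subseteq> carrier U" "specialization S' \<sigma>"
    note simps = specialization_simps[OF *(2,3) zero_span zero_span]
    have "(\<Oplus>\<^bsub>U\<^esub>i\<in>I. \<sigma> ((\<lambda>i\<in>I. \<zero>\<^bsub>U\<^esub>) i) \<otimes>\<^bsub>U\<^esub> x i) = (\<Oplus>\<^bsub>U\<^esub>i\<in>I. \<zero>\<^bsub>U\<^esub>)"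
      using xc simps by (intro B.finsum_cong') auto
    then show "(\<Oplus>\<^bsub>U\<^esub>i\<in>I. \<sigma> ((\<lambda>i\<in>I. \<zero>\<^bsub>U\<^esub>) i) \<otimes>\<^bsub>U\<^esub> x i) = \<sigma> \<zero>\<^bsub>U\<^esub>" using simps by simp
  qed (use zero_span[of "{}"] in auto)
  \<comment> \<open>By \<open>stable\<close>, the image of an equation under an embedding is again
    an equation of the system, and the unmoved \<open>x\<close> satisfies it.\<close>
  have eq_good: "good (\<lambda>i\<in>I. \<alpha> q i) (supp q) (\<beta> q)" if q: "q \<in> Q" for q
    unfolding good_def
  proof (intro conjI ballI allI impI)
    fix S' \<sigma> assume *: "supp q \<subseteq> S'" "S' \<subseteq> carrier U" "specialization S' \<sigma>"
    obtain q' where q': "q' \<in> Q" "\<And>i. i \<in> I \<Longrightarrow> \<alpha> q' i = \<sigma> (\<alpha> q i)" "\<beta> q' = \<sigma> (\<beta> q)"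
      using stable[OF q *(2,1,3)] by blast
    have "(\<Oplus>\<^bsub>U\<^esub>i\<in>I. \<sigma> ((\<lambda>i\<in>I. \<alpha> q i) i) \<otimes>\<^bsub>U\<^esub> x i) = (\<Oplus>\<^bsub>U\<^esub>i\<in>I. \<alpha> q' i \<otimes>\<^bsub>U\<^esub> x i)"
      using xc \<alpha>c[OF q'(1)] q' by (intro B.finsum_cong') auto
    also have "\<dots> = \<beta> q'" using T(2) q'(1) by (simp add: B_def)
    finally show "(\<Oplus>\<^bsub>U\<^esub>i\<in>I. \<sigma> ((\<lambda>i\<in>I. \<alpha> q i) i) \<otimes>\<^bsub>U\<^esub> x i) = \<sigma> (\<beta> q)" using q' by simp
  qed (use supp q \<alpha> \<beta> in \<open>auto intro!: diff_span.span_incl\<close>)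
  have sub: "submodule W U ?M"
  proof (rule Mod.submoduleI)
    fix w assume w: "w \<in> W"
    then obtain S v where g: "good w S v" "w \<in> I \<rightarrow>\<^sub>E carrier U" by (auto simp: W_def)
    show sm: "c \<odot>\<^bsub>?M\<^esub> w \<in> W" if "c \<in> carrier U" for c
      using smult[OF g(1) that] g(2) that by (auto simp: W_def)
    show "\<ominus>\<^bsub>?M\<^esub> w \<in> W"
      using sm[of "\<ominus>\<^bsub>U\<^esub> \<one>\<^bsub>U\<^esub>"] g(2) Mod.smult_l_minus[of "\<one>\<^bsub>U\<^esub>" w] Mod.smult_one[of w]
      by (simp del: fun_module_simps(4))
    fix w' assume "w' \<in> W"
    then obtain S' v' where g': "good w' S' v'" "w' \<in> I \<rightarrow>\<^sub>E carrier U" by (auto simp: W_def)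
    show "w \<oplus>\<^bsub>?M\<^esub> w' \<in> W"
      using add[OF g(1) g'(1)] g(2) g'(2) by (auto simp: W_def)
  qed (use zero_good in \<open>auto simp: W_def\<close>)
  \<comment> \<open>Otherwise a functional that vanishes on \<open>W\<close> but not on the unit
    vector yields a vector \<open>?y\<close>: it solves the homogeneous system because the equations
    are in \<open>W\<close>, it vanishes on \<open>T\<close> because those unit vectors are in
    \<open>W\<close>, and adding it to \<open>x\<close> contradicts uniqueness.\<close>
  have unitW: "unit_vec U I k \<in> W" if k: "k \<in> I" for k
  proof (rule ccontr)
    assume no: "unit_vec U I k \<notin> W"
    have uc: "unit_vec U I k \<in> I \<rightarrow>\<^sub>E carrier U" for k by (auto simp: unit_vec_def)
    obtain \<phi> where \<phi>: "\<phi> \<in> functionals U ?M" "\<And>w. w \<in> W \<Longrightarrow> \<phi> w = \<zero>\<^bsub>U\<^esub>" "\<phi> (unit_vec U I k) = \<one>\<^bsub>U\<^esub>"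
      using Mod.functional_separating[OF B.field_axioms sub, of "unit_vec U I k"] no uc by auto
    let ?y = "\<lambda>i\<in>I. \<phi> (unit_vec U I i)"
    have yc: "\<phi> (unit_vec U I i) \<in> carrier U" for i
    proof -
      have "\<phi> \<in> carrier ?M \<rightarrow> carrier U" using \<phi>(1) by (simp add: functionals_def)
      then show ?thesis by (rule funcset_mem) (use uc in simp)
    qed
    have "(\<lambda>i\<in>I. x i \<oplus>\<^bsub>U\<^esub> \<one>\<^bsub>U\<^esub> \<otimes>\<^bsub>U\<^esub> ?y i) \<in> B"
    proof (rule comb[OF T(2)])
      fix q assume q: "q \<in> Q"
      have a: "(\<lambda>i\<in>I. \<alpha> q i) \<in> I \<rightarrow>\<^sub>E carrier U" using \<alpha>c[OF q] by auto
      then have "(\<lambda>i\<in>I. \<alpha> q i) \<in> W" using eq_good[OF q] by (auto simp: W_def)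
      then have "\<zero>\<^bsub>U\<^esub> = (\<Oplus>\<^bsub>U\<^esub>i\<in>I. (\<lambda>i\<in>I. \<alpha> q i) i \<otimes>\<^bsub>U\<^esub> \<phi> (unit_vec U I i))"
        using \<phi>(2) B.functional_expand[OF fin \<phi>(1) a] by simp
      also have "\<dots> = (\<Oplus>\<^bsub>U\<^esub>i\<in>I. \<alpha> q i \<otimes>\<^bsub>U\<^esub> ?y i)"
        using \<alpha>c[OF q] yc by (intro B.finsum_cong') auto
      finally show "(\<Oplus>\<^bsub>U\<^esub>i\<in>I. \<alpha> q i \<otimes>\<^bsub>U\<^esub> ?y i) = \<zero>\<^bsub>U\<^esub>" by simp
    qed (use yc in auto)
    moreover have "unit_vec U I t \<in> W" if "t \<in> T" for t
      using unit_good[OF that] uc by (auto simp: W_def)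
    ultimately have "(\<lambda>i\<in>I. x i \<oplus>\<^bsub>U\<^esub> \<one>\<^bsub>U\<^esub> \<otimes>\<^bsub>U\<^esub> ?y i) = x"
      using T \<phi>(2) by (intro uniq) auto
    then have "(\<lambda>i\<in>I. x i \<oplus>\<^bsub>U\<^esub> \<one>\<^bsub>U\<^esub> \<otimes>\<^bsub>U\<^esub> ?y i) k = x k" by simp
    then have "x k \<oplus>\<^bsub>U\<^esub> \<one>\<^bsub>U\<^esub> = x k" using k \<phi>(3) by simp
    then show False using xc[OF k] B.add.l_cancel_one'[of "x k" "\<one>\<^bsub>U\<^esub>"] by simp
  qed
  \<comment> \<open>The \<open>k\<close>-th coordinate form is good, so
    \<open>x k = \<sigma> v\<close> for every embedding of one finitely generated field. The
    identity gives \<open>v = x k\<close>; an element outside \<open>K\<close> would be moved by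
    some \<open>\<sigma>\<close>.\<close>
  have "x k \<in> \<iota> ` carrier K" if k: "k \<in> I" for k
  proof (rule ccontr)
    assume no: "x k \<notin> \<iota> ` carrier K"
    obtain S v where g: "good (unit_vec U I k) S v" using unitW[OF k] by (auto simp: W_def)
    then have S: "finite S" "S \<subseteq> carrier U" "v \<in> span S" by (auto simp: good_def)
    have *: "x k = \<sigma> v" if \<sigma>: "specialization S \<sigma>" for \<sigma>
    proof -
      note simps = specialization_simps[OF S(2) \<sigma> zero_span zero_span]
      have "(\<Oplus>\<^bsub>U\<^esub>i\<in>I. \<sigma> (unit_vec U I k i) \<otimes>\<^bsub>U\<^esub> x i) = (\<Oplus>\<^bsub>U\<^esub>i\<in>I. if k = i then x i else \<zero>\<^bsub>U\<^esub>)"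
        using xc simps by (intro B.finsum_cong') (auto simp: unit_vec_def)
      also have "\<dots> = x k" using k xc by (intro B.finsum_delta fin) auto
      finally show ?thesis using g \<sigma> S by (auto simp: good_def)
    qed
    have v: "x k = v" using *[OF specialization_id[OF S(2)]] .
    then have "v \<notin> \<iota> ` carrier K" using no by simp
    then obtain \<sigma> where "specialization S \<sigma>" "\<sigma> v \<noteq> v"
      by (rule specialization_moving[OF S])
    then show False using *[of \<sigma>] v by simp
  qed
  then have "\<forall>i\<in>I. \<exists>c. c \<in> carrier K \<and> x i = \<iota> c" by blast
  then obtain c where c: "\<forall>i\<in>I. c i \<in> carrier K \<and> x i = \<iota> (c i)"
    by (rule bchoice[THEN exE])
  show ?thesis
  proof (rule that)
    fix q assume q: "q \<in> Q"
    have "(\<Oplus>\<^bsub>U\<^esub>i\<in>I. \<alpha> q i \<otimes>\<^bsub>U\<^esub> \<iota> (c i)) = (\<Oplus>\<^bsub>U\<^esub>i\<in>I. \<alpha> q i \<otimes>\<^bsub>U\<^esub> x i)"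
      using c \<alpha>c[OF q] xc by (intro B.finsum_cong') auto
    then show "(\<Oplus>\<^bsub>U\<^esub>i\<in>I. \<alpha> q i \<otimes>\<^bsub>U\<^esub> \<iota> (c i)) = \<beta> q" using T(2) q by (simp add: B_def)
  qed (use c in blast)
qed

end

section \<open>Groups of constant matrices\<close>

lemma (in comm_monoid) finprod_Times:
  assumes "finite A" "finite B" "\<And>a b. a \<in> A \<Longrightarrow> b \<in> B \<Longrightarrow> f (a, b) \<in> carrier G"
  shows "(\<Otimes>p\<in>A \<times> B. f p) = (\<Otimes>a\<in>A. \<Otimes>b\<in>B. f (a, b))"
  using assms(1,3)
proof (induction A rule: finite_induct)
  case (insert a A)
  have eq: "insert a A \<times> B = Pair a ` B \<union> A \<times> B" by auto
  have "(\<Otimes>p\<in>insert a A \<times> B. f p) = (\<Otimes>p\<in>Pair a ` B. f p) \<otimes> (\<Otimes>p\<in>A \<times> B. f p)"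
    unfolding eq using insert assms(2) by (intro finprod_Un_disjoint) auto
  also have "(\<Otimes>p\<in>Pair a ` B. f p) = (\<Otimes>b\<in>B. f (a, b))"
    using insert by (intro finprod_reindex) (auto intro: inj_onI)
  finally show ?case
    using insert by (subst finprod_insert) (auto intro!: finprod_closed)
qed simp

lemma (in ring_hom_cring) hom_mat_det:
  assumes "\<And>i j. i < n \<Longrightarrow> j < n \<Longrightarrow> A i j \<in> carrier R"
  shows "h (mat_det R n A) = mat_det S n (\<lambda>i j. h (A i j))"
proof -
  have p: "p i < n" if "p permutes {..<n}" "i < n" for p i
    using that permutes_in_image[OF that(1), of i] by auto
  have *: "h (\<Otimes>i\<in>{..<n}. A i (p i)) = (\<Otimes>\<^bsub>S\<^esub>i\<in>{..<n}. h (A i (p i)))" if "p permutes {..<n}" for p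
    using p[OF that] assms by (subst hom_finprod) (auto simp: comp_def)
  show ?thesis
    unfolding mat_det_def using p assms
    by (subst hom_finsum) (auto simp: comp_def * intro!: finprod_closed S.finsum_cong' S.finprod_closed)
qed

section \<open>Conjugation into the constants in a ring with a derivation\<close>

context der_ring
begin

lemma D_inverse:
  assumes "x \<in> carrier R" "y \<in> carrier R" "x \<otimes> y = \<one>" "y \<otimes> x = \<one>"
  shows "D y = \<ominus> (y \<otimes> D x \<otimes> y)"
proof -
  have cl: "D x \<in> carrier R" "D y \<in> carrier R" using assms D_closed by auto
  have "D x \<otimes> y \<oplus> x \<otimes> D y = \<zero>"
    using D_mult[OF assms(1,2)] assms by (simp add: D_one)
  then have "y \<otimes> (D x \<otimes> y \<oplus> x \<otimes> D y) = \<zero>" using assms by simp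
  then have "y \<otimes> D x \<otimes> y \<oplus> D y = \<zero>"
    using assms cl by (simp add: r_distr m_assoc[symmetric])
  then show ?thesis using assms cl by (metis a_comm m_closed minus_equality)
qed

lemma conjugate_constant:
  assumes x: "x \<in> carrier R" "y \<in> carrier R" "x \<otimes> y = \<one>" "y \<otimes> x = \<one>"
    and g: "g \<in> carrier R" "\<beta> \<in> carrier R" "D x = x \<otimes> \<beta>" "D g = g \<otimes> \<beta> \<ominus> \<beta> \<otimes> g"
  shows "D (x \<otimes> g \<otimes> y) = \<zero>"
proof -
  have "D y = \<ominus> (\<beta> \<otimes> y)"
    using D_inverse[OF x] x g by (simp add: m_assoc[symmetric])
  then have "D (x \<otimes> g \<otimes> y) =
      (x \<otimes> \<beta> \<otimes> g \<oplus> x \<otimes> (g \<otimes> \<beta> \<ominus> \<beta> \<otimes> g)) \<otimes> y \<oplus> x \<otimes> g \<otimes> \<ominus> (\<beta> \<otimes> y)"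
    using x g by (simp add: D_mult D_closed)
  also have "x \<otimes> \<beta> \<otimes> g \<oplus> x \<otimes> (g \<otimes> \<beta> \<ominus> \<beta> \<otimes> g) = x \<otimes> g \<otimes> \<beta>"
  proof -
    have "x \<otimes> \<beta> \<otimes> g \<oplus> x \<otimes> (g \<otimes> \<beta> \<ominus> \<beta> \<otimes> g) = x \<otimes> \<beta> \<otimes> g \<oplus> (x \<otimes> g \<otimes> \<beta> \<oplus> \<ominus> (x \<otimes> \<beta> \<otimes> g))"
      using x g by (simp add: a_minus_def r_distr r_minus m_assoc)
    also have "\<dots> = (x \<otimes> \<beta> \<otimes> g \<oplus> \<ominus> (x \<otimes> \<beta> \<otimes> g)) \<oplus> x \<otimes> g \<otimes> \<beta>"
      using x g by (simp add: a_ac)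
    finally show ?thesis using x g by (simp add: r_neg)
  qed
  finally show ?thesis using x g by (simp add: r_minus m_assoc r_neg)
qed

text \<open>Differentiate \<open>x g y\<close>, multiply by \<open>y\<close> on the left and by
  \<open>x\<close> on the right, and replace \<open>(D y) x\<close> by
  \<open>- y (D x)\<close>.\<close>

lemma conjugate_constant_converse:
  assumes x: "x \<in> carrier R" "y \<in> carrier R" "x \<otimes> y = \<one>" "y \<otimes> x = \<one>"
    and g: "g \<in> carrier R" "D (x \<otimes> g \<otimes> y) = \<zero>"
  shows "D g = g \<otimes> (y \<otimes> D x) \<ominus> (y \<otimes> D x) \<otimes> g"
proof -
  have cl: "D x \<in> carrier R" "D y \<in> carrier R" "D g \<in> carrier R" using x g D_closed by auto
  have "y \<otimes> D (x \<otimes> g \<otimes> y) \<otimes> x = \<zero>" using x g by simp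
  moreover have "D (x \<otimes> g \<otimes> y) = D x \<otimes> g \<otimes> y \<oplus> x \<otimes> D g \<otimes> y \<oplus> x \<otimes> g \<otimes> D y"
    using x g cl by (simp add: D_mult l_distr)
  moreover have "y \<otimes> (D x \<otimes> g \<otimes> y \<oplus> x \<otimes> D g \<otimes> y \<oplus> x \<otimes> g \<otimes> D y) \<otimes> x =
      y \<otimes> D x \<otimes> g \<oplus> D g \<oplus> g \<otimes> (D y \<otimes> x)"
  proof -
    have 1: "y \<otimes> (D x \<otimes> g \<otimes> y) \<otimes> x = y \<otimes> D x \<otimes> g"
      using x g cl by (simp add: m_assoc)
    have 2: "y \<otimes> (x \<otimes> D g \<otimes> y) \<otimes> x = D g"
      using x g cl by (simp add: m_assoc) (simp add: m_assoc[symmetric])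
    have 3: "y \<otimes> (x \<otimes> g \<otimes> D y) \<otimes> x = g \<otimes> (D y \<otimes> x)"
      using x g cl by (simp add: m_assoc) (simp add: m_assoc[symmetric])
    show ?thesis using x g cl 1 2 3 by (simp add: r_distr l_distr)
  qed
  moreover have "D y \<otimes> x = \<ominus> (y \<otimes> D x)"
    using D_inverse[OF x] x cl by (simp add: l_minus m_assoc)
  ultimately have "y \<otimes> D x \<otimes> g \<oplus> D g \<oplus> \<ominus> (g \<otimes> (y \<otimes> D x)) = \<zero>"
    using x g cl by (simp add: r_minus)
  then have "D g \<oplus> (y \<otimes> D x \<otimes> g \<oplus> \<ominus> (g \<otimes> (y \<otimes> D x))) = \<zero>"
    using x g cl by (simp add: a_ac)
  then have "D g = \<ominus> (y \<otimes> D x \<otimes> g \<oplus> \<ominus> (g \<otimes> (y \<otimes> D x)))"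
    using x g cl by (simp add: minus_equality)
  then show ?thesis using x g cl by (simp add: minus_add a_minus_def a_comm)
qed

end

lemma (in group) subgroup_conjugate:
  assumes x: "x \<in> carrier G" and H: "subgroup H G"
  shows "subgroup (conjugate_by G x H) G"
proof -
  have "(\<lambda>g. x \<otimes> g \<otimes> inv x) \<in> hom G G"
    using x by (auto intro!: homI simp: m_assoc) (simp add: m_assoc[symmetric])
  then interpret group_hom G G "\<lambda>g. x \<otimes> g \<otimes> inv x" by unfold_locales
  show ?thesis unfolding conjugate_by_def by (rule subgroup_img_is_subgroup[OF H])
qed

context universal_domain
begin

text \<open>Equivalently, the operator \<open>\<partial> + B\<close> on column vectors commutes with
  every \<open>g\<close> of the group. The same \<open>B\<close> serves for all \<open>g\<close>,
  and its entries are in \<open>K\<close>.\<close>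

definition gauge :: "nat \<Rightarrow> (nat \<Rightarrow> nat \<Rightarrow> 'c) set \<Rightarrow> (nat \<Rightarrow> nat \<Rightarrow> 'a) \<Rightarrow> bool" where
  "gauge n G B \<longleftrightarrow> (\<forall>i<n. \<forall>j<n. B i j \<in> carrier K) \<and>
     (\<forall>g\<in>G. \<forall>i<n. \<forall>j<n. der U (g i j) =
        (\<Oplus>\<^bsub>U\<^esub>l\<in>{..<n}. g i l \<otimes>\<^bsub>U\<^esub> \<iota> (B l j)) \<ominus>\<^bsub>U\<^esub> (\<Oplus>\<^bsub>U\<^esub>l\<in>{..<n}. \<iota> (B i l) \<otimes>\<^bsub>U\<^esub> g l j))"

text \<open>The equation \<open>x' = x B\<close> is solved in the ring of power series over \<open>K\<close> with \<open>x(0) = 1\<close>; the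
  ideal \<open>P\<close> below is the kernel of the evaluation at \<open>0\<close>, so that \<open>diff_core d P\<close> is the kernel of
  the Taylor expansion.\<close>

lemma fundamental_matrix:
  assumes B: "\<And>i j. i < n \<Longrightarrow> j < n \<Longrightarrow> B i j \<in> carrier K"
  obtains x where "x \<in> carrier (GL U n)"
    "\<And>i j. i < n \<Longrightarrow> j < n \<Longrightarrow> der U (x i j) = (\<Oplus>\<^bsub>U\<^esub>l\<in>{..<n}. x i l \<otimes>\<^bsub>U\<^esub> \<iota> (B l j))"
proof -
  \<comment> \<open>The value at 0: elements of \<open>K\<close> are kept and the unknown matrix
    becomes the identity.\<close>
  define s where "s = case_sum (\<lambda>c. if c \<in> carrier K then c else \<zero>\<^bsub>K\<^esub>)
    (\<lambda>(i::nat, j). if i < n \<and> j < n \<and> i = j then \<one>\<^bsub>K\<^esub> else \<zero>\<^bsub>K\<^esub>)"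
  have s: "s g \<in> carrier K" for g by (cases g) (auto simp: s_def split: prod.split)
  define f where "f = free_eval K s"
  interpret F: cring_map K f unfolding f_def by (rule A.free_eval_map[OF s])
  have fgen: "f (gen g) = s g" for g unfolding f_def by (rule A.free_eval_gen[OF s])
  define P where "P = {r. f r = \<zero>\<^bsub>K\<^esub>}"
  \<comment> \<open>On the new generators the derivation is prescribed by \<open>x' = x B\<close>,
    on the others by the derivation of \<open>K\<close>.\<close>
  define d where "d = free_der (case_sum (\<lambda>c. if c \<in> carrier K then gen (Inl (der K c)) else 0)
    (\<lambda>(i, j). if i < n \<and> j < n then \<Sum>l<n. gen (Inr (i, l)) * gen (Inl (B l j)) else 0))"
  interpret derivation d unfolding d_def by (rule free_der_derivation)
  interpret prime_ideal P
  proof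
    fix a b assume "a * b \<in> P"
    then show "a \<in> P \<or> b \<in> P" using A.integral by (simp add: P_def F.map_mult)
  qed (auto simp: P_def F.map_zero F.map_add F.map_mult F.map_one)
  interpret L: residue_copy d P K "\<lambda>c. gen (Inl c)"
    by unfold_locales
      (simp_all add: P_def F.map_minus F.map_add F.map_mult F.map_one fgen s_def d_def free_der_gen char0
        A.minus_eq A.r_neg)
  let ?Q = "diff_core d P"
  let ?M = "residue_field d ?Q"
  interpret Q: prime_ideal ?Q by (rule L.prime_diff_core)
  note dQ = derivation_axioms L.diff_core_der
  interpret M: differential_field ?M by (rule Q.differential_field_residue_field[OF dQ])
  interpret R: cring_map ?M "\<lambda>r. frac ?Q r 1" by (rule Q.residue_map)
  let ?\<tau> = "\<lambda>c. frac ?Q (gen (Inl c)) 1" and ?y = "\<lambda>i j. frac ?Q (gen (Inr (i, j))) 1"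
  interpret T: diff_field_map K ?M ?\<tau> by unfold_locales (rule L.residue_hom)
  let ?S = "(\<lambda>(i, j). ?y i j) ` ({..<n} \<times> {..<n})"
  have fg: "diff_fin_gen K ?M ?\<tau>"
  proof (rule diff_fin_genI)
    show "diff_extension K ?M ?\<tau>"
      using A.differential_field_axioms M.differential_field_axioms L.residue_hom
      by (simp add: diff_extension_def)
    show S: "?S \<subseteq> carrier ?M" by auto
    let ?V = "diff_span ?M (?\<tau> ` carrier K \<union> ?S)"
    have "frac ?Q (gen g) 1 \<in> ?V" for g
    proof -
      have zero: "\<zero>\<^bsub>?M\<^esub> \<in> ?V"
        by (rule diff_span.span_incl) (auto intro!: image_eqI[of _ _ "\<zero>\<^bsub>K\<^esub>"] simp flip: T.hom_zero)
      \<comment> \<open>For generators that name neither an element of \<open>K\<close> nor an entry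
        of the matrix: value and derivative 0 make all their Taylor coefficients vanish.\<close>
      have *: "frac ?Q (gen g) 1 \<in> ?V" if "d (gen g) = 0" "s g = \<zero>\<^bsub>K\<^esub>"
      proof -
        have "(d ^^ k) (gen g) = (if k = 0 then gen g else 0)" for k
          using that(1) by (induction k) (auto simp: d_zero)
        moreover have "gen g \<in> P" using that(2) by (simp add: P_def fgen)
        ultimately have "gen g \<in> ?Q" using zero_mem by (simp add: diff_core_def)
        then have "frac ?Q (gen g) 1 = \<zero>\<^bsub>?M\<^esub>" by (simp add: Q.residue_eq_zero_iff)
        then show ?thesis using zero by (simp only:)
      qed
      show ?thesis
      proof (cases g)
        case (Inl c)
        show ?thesis
        proof (cases "c \<in> carrier K")
          case True
          then show ?thesis using Inl by (auto intro: diff_span.span_incl)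
        next
          case False
          then show ?thesis using Inl by (intro *) (simp_all add: s_def d_def free_der_gen)
        qed
      next
        case (Inr p)
        obtain i j where p: "p = (i, j)" by (cases p)
        show ?thesis
        proof (cases "i < n \<and> j < n")
          case True
          then have "frac ?Q (gen g) 1 \<in> ?S" using Inr p by (intro image_eqI[of _ _ "(i, j)"]) auto
          then show ?thesis by (auto intro: diff_span.span_incl)
        next
          case False
          then show ?thesis using Inr p by (intro *) (auto simp: s_def d_def free_der_gen)
        qed
      qed
    qed
    then have "diff_span ?M (range (\<lambda>g. frac ?Q (gen g) 1)) \<subseteq> ?V"
      using S by (intro M.diff_span_least M.subfield_diff_span) (auto intro: diff_span.span_der)
    then show "carrier ?M \<subseteq> ?V" using residue_field_generated[OF L.prime_diff_core dQ] by (rule order_trans[rotated])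
  qed auto
  obtain h where h: "h \<in> diff_hom ?M U" "\<And>c. c \<in> carrier K \<Longrightarrow> h (?\<tau> c) = \<iota> c"
    by (rule semi_universal_embedding[OF universal char0 fg]) (rule that)
  interpret h: diff_field_map ?M U h by unfold_locales (rule h)
  let ?x = "\<lambda>i\<in>{..<n}. \<lambda>j\<in>{..<n}. h (?y i j)"
  show ?thesis
  proof (rule that)
    \<comment> \<open>At 0 the determinant is 1. It is therefore outside \<open>P\<close>, hence
      outside the smaller core, and stays nonzero in the residue field.\<close>
    have "f (det (mat n n (\<lambda>(i, j). gen (Inr (i, j))))) = mat_det K n (\<lambda>i j. s (Inr (i, j)))"
      by (simp add: F.map_det fgen)
    also have "\<dots> = mat_det K n (mat_one K {..<n})"
      by (rule A.mat_det_cong) (auto simp: s_def mat_one_def)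
    finally have "det (mat n n (\<lambda>(i, j). gen (Inr (i, j)))) \<notin> ?Q"
      using diff_core_subset[of d P] A.mat_det_one by (auto simp: P_def)
    then have "mat_det ?M n ?y \<noteq> \<zero>\<^bsub>?M\<^esub>"
      using R.map_det[of n "\<lambda>i j. gen (Inr (i, j))"] by (simp add: Q.residue_eq_zero_iff flip: R.map_det)
    then have "h (mat_det ?M n ?y) \<noteq> \<zero>\<^bsub>U\<^esub>"
      by (subst h.hom_eq_zero_iff) (auto intro!: M.mat_det_closed)
    moreover have "h (mat_det ?M n ?y) = mat_det U n (\<lambda>i j. h (?y i j))"
      by (rule h.hom_mat_det) auto
    moreover have "mat_det U n ?x = mat_det U n (\<lambda>i j. h (?y i j))"
      by (rule B.mat_det_cong) auto
    ultimately show "?x \<in> carrier (GL U n)"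
      by (auto simp: GL_simps intro!: mats_restrict)
    fix i j assume ij: "i < n" "j < n"
    have "der ?M (?y i j) = frac ?Q (\<Sum>l<n. gen (Inr (i, l)) * gen (Inl (B l j))) 1"
      using ij by (simp add: Q.residue_der_of[OF dQ]) (simp add: d_def free_der_gen)
    also have "\<dots> = (\<Oplus>\<^bsub>?M\<^esub>l\<in>{..<n}. ?y i l \<otimes>\<^bsub>?M\<^esub> ?\<tau> (B l j))"
      by (simp only: R.map_sum R.map_mult)
    finally have "h (der ?M (?y i j)) = (\<Oplus>\<^bsub>U\<^esub>l\<in>{..<n}. h (?y i l) \<otimes>\<^bsub>U\<^esub> h (?\<tau> (B l j)))"
      by (simp add: comp_def)
    moreover have "(\<Oplus>\<^bsub>U\<^esub>l\<in>{..<n}. h (?y i l) \<otimes>\<^bsub>U\<^esub> h (?\<tau> (B l j))) = (\<Oplus>\<^bsub>U\<^esub>l\<in>{..<n}. ?x i l \<otimes>\<^bsub>U\<^esub> \<iota> (B l j))"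
      using ij B h(2) by (intro B.finsum_cong') auto
    ultimately show "der U (?x i j) = (\<Oplus>\<^bsub>U\<^esub>l\<in>{..<n}. ?x i l \<otimes>\<^bsub>U\<^esub> \<iota> (B l j))"
      using ij by (simp add: h.hom_der)
  qed
qed

lemma GL_inverse:
  assumes "x \<in> carrier (GL U n)"
  shows "inv\<^bsub>GL U n\<^esub> x \<in> carrier (GL U n)"
    "x \<otimes>\<^bsub>mat_ring U {..<n}\<^esub> inv\<^bsub>GL U n\<^esub> x = \<one>\<^bsub>mat_ring U {..<n}\<^esub>"
    "inv\<^bsub>GL U n\<^esub> x \<otimes>\<^bsub>mat_ring U {..<n}\<^esub> x = \<one>\<^bsub>mat_ring U {..<n}\<^esub>"
proof -
  interpret group "GL U n" by (rule B.GL_group)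
  show "inv\<^bsub>GL U n\<^esub> x \<in> carrier (GL U n)" using assms by simp
  show "x \<otimes>\<^bsub>mat_ring U {..<n}\<^esub> inv\<^bsub>GL U n\<^esub> x = \<one>\<^bsub>mat_ring U {..<n}\<^esub>"
    using r_inv[OF assms] by (simp add: GL_simps)
  show "inv\<^bsub>GL U n\<^esub> x \<otimes>\<^bsub>mat_ring U {..<n}\<^esub> x = \<one>\<^bsub>mat_ring U {..<n}\<^esub>"
    using l_inv[OF assms] by (simp add: GL_simps)
qed

lemma gauge_mat_der:
  assumes B: "gauge n G B" and g: "g \<in> G" "g \<in> mats U {..<n} {..<n}"
  shows "mat_der U {..<n} g = g \<otimes>\<^bsub>mat_ring U {..<n}\<^esub> (\<lambda>i\<in>{..<n}. \<lambda>j\<in>{..<n}. \<iota> (B i j))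
    \<ominus>\<^bsub>mat_ring U {..<n}\<^esub> (\<lambda>i\<in>{..<n}. \<lambda>j\<in>{..<n}. \<iota> (B i j)) \<otimes>\<^bsub>mat_ring U {..<n}\<^esub> g"
proof -
  let ?I = "{..<n}"
  let ?M = "mat_ring U ?I"
  interpret D: der_ring ?M "mat_der U ?I" by (rule B.der_ring_mat_ring) simp
  have BK: "B i j \<in> carrier K" if "i < n" "j < n" for i j using B that by (simp add: gauge_def)
  let ?b = "\<lambda>i\<in>?I. \<lambda>j\<in>?I. \<iota> (B i j)"
  have b: "?b \<in> carrier ?M" unfolding carrier_mat_ring using BK by (intro mats_restrict) auto
  have gM: "g \<in> carrier ?M" using g(2) by (simp add: carrier_mat_ring)
  show ?thesis
  proof (rule mats_eqI[of _ U ?I ?I _ U])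
    fix i j assume ij: "i \<in> ?I" "j \<in> ?I"
    note gc = mats_closed[OF g(2)]
    have bg: "?b \<otimes>\<^bsub>?M\<^esub> g \<in> mats U ?I ?I" using D.m_closed[OF b gM] by (simp add: carrier_mat_ring)
    have 1: "(\<Oplus>\<^bsub>U\<^esub>k\<in>?I. g i k \<otimes>\<^bsub>U\<^esub> ?b k j) = (\<Oplus>\<^bsub>U\<^esub>l\<in>?I. g i l \<otimes>\<^bsub>U\<^esub> \<iota> (B l j))"
      and 2: "(\<Oplus>\<^bsub>U\<^esub>k\<in>?I. ?b i k \<otimes>\<^bsub>U\<^esub> g k j) = (\<Oplus>\<^bsub>U\<^esub>l\<in>?I. \<iota> (B i l) \<otimes>\<^bsub>U\<^esub> g l j)"
      using ij gc BK by (auto intro!: B.finsum_cong')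
    have "(g \<otimes>\<^bsub>?M\<^esub> ?b \<ominus>\<^bsub>?M\<^esub> ?b \<otimes>\<^bsub>?M\<^esub> g) i j = (g \<otimes>\<^bsub>?M\<^esub> ?b) i j \<ominus>\<^bsub>U\<^esub> (?b \<otimes>\<^bsub>?M\<^esub> g) i j"
      using ij bg by (simp add: D.minus_eq B.minus_eq add_entry B.uminus_entry)
    also have "\<dots> = der U (g i j)"
      using B g(1) ij by (simp only: mult_entry 1 2) (simp add: gauge_def)
    finally show "mat_der U ?I g i j = (g \<otimes>\<^bsub>?M\<^esub> ?b \<ominus>\<^bsub>?M\<^esub> ?b \<otimes>\<^bsub>?M\<^esub> g) i j"
      using ij by (simp add: mat_der_def)
  qed (use D.D_closed[OF gM] D.m_closed[OF gM b] D.m_closed[OF b gM] D.minus_closed in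
      \<open>simp_all add: carrier_mat_ring\<close>)
qed

lemma conjugate_to_constants_if_gauge:
  assumes G: "subgroup G (GL U n)" and B: "gauge n G B"
  shows "\<exists>x\<in>carrier (GL U n). conjugate_by (GL U n) x G \<subseteq> GL_const U n"
proof -
  interpret GL: group "GL U n" by (rule B.GL_group)
  let ?I = "{..<n}"
  let ?M = "mat_ring U ?I"
  interpret D: der_ring ?M "mat_der U ?I" by (rule B.der_ring_mat_ring) simp
  have BK: "B i j \<in> carrier K" if "i < n" "j < n" for i j using B that by (simp add: gauge_def)
  obtain x where x: "x \<in> carrier (GL U n)"
    and dx: "\<And>i j. i < n \<Longrightarrow> j < n \<Longrightarrow> der U (x i j) = (\<Oplus>\<^bsub>U\<^esub>l\<in>?I. x i l \<otimes>\<^bsub>U\<^esub> \<iota> (B l j))"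
  proof (rule fundamental_matrix[of n B])
    show "B i j \<in> carrier K" if "i < n" "j < n" for i j by (rule BK[OF that])
  qed (rule that)
  let ?b = "\<lambda>i\<in>?I. \<lambda>j\<in>?I. \<iota> (B i j)"
  have b: "?b \<in> carrier ?M" unfolding carrier_mat_ring using BK by (intro mats_restrict) auto
  have xM: "x \<in> carrier ?M" using x by (simp add: GL_simps carrier_mat_ring)
  note y = GL_inverse[OF x]
  have yM: "inv\<^bsub>GL U n\<^esub> x \<in> carrier ?M" using y(1) by (simp add: GL_simps carrier_mat_ring)
  have Dx: "mat_der U ?I x = x \<otimes>\<^bsub>?M\<^esub> ?b"
  proof (rule mats_eqI[of _ U ?I ?I _ U])
    fix i j assume "i \<in> ?I" "j \<in> ?I"
    then show "mat_der U ?I x i j = (x \<otimes>\<^bsub>?M\<^esub> ?b) i j"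
      using dx mats_closed[OF xM[unfolded carrier_mat_ring]] BK
      by (simp add: mat_der_def mult_entry) (intro B.finsum_cong', auto)
  qed (use D.D_closed[OF xM] D.m_closed[OF xM b] in \<open>simp_all add: carrier_mat_ring\<close>)
  have "conjugate_by (GL U n) x G \<subseteq> GL_const U n"
  proof
    fix h assume "h \<in> conjugate_by (GL U n) x G"
    then obtain g where g: "g \<in> G" "h = x \<otimes>\<^bsub>GL U n\<^esub> g \<otimes>\<^bsub>GL U n\<^esub> inv\<^bsub>GL U n\<^esub> x"
      by (auto simp: conjugate_by_def)
    have gGL: "g \<in> carrier (GL U n)" using g(1) subgroup.subset[OF G] by blast
    then have gM: "g \<in> carrier ?M" by (simp add: GL_simps carrier_mat_ring)
    have gm: "g \<in> mats U ?I ?I" using gM by (simp add: carrier_mat_ring)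
    have "mat_der U ?I g = g \<otimes>\<^bsub>?M\<^esub> ?b \<ominus>\<^bsub>?M\<^esub> ?b \<otimes>\<^bsub>?M\<^esub> g"
      by (rule gauge_mat_der[OF B g(1) gm])
    then have D0: "mat_der U ?I (x \<otimes>\<^bsub>?M\<^esub> g \<otimes>\<^bsub>?M\<^esub> inv\<^bsub>GL U n\<^esub> x) = \<zero>\<^bsub>?M\<^esub>"
      by (intro D.conjugate_constant[OF xM yM y(2,3) gM b Dx])
    have hGL: "h \<in> carrier (GL U n)" using g x gGL by simp
    have "der U (h i j) = \<zero>\<^bsub>U\<^esub>" if "i < n" "j < n" for i j
      using fun_cong[OF fun_cong[OF D0, of i], of j] that g(2)
      by (simp add: GL_simps zero_entry mat_der_def)
    then show "h \<in> GL_const U n"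
      using hGL mats_closed[of h U ?I ?I] by (auto simp: GL_const_def constants_def GL_simps)
  qed
  then show ?thesis using x by blast
qed

lemma gauge_if_conjugate_to_constants:
  assumes G: "subgroup G (GL U n)"
    and stable: "\<And>g S \<sigma>. g \<in> G \<Longrightarrow> S \<subseteq> carrier U \<Longrightarrow> specialization S \<sigma> \<Longrightarrow>
      (\<And>i j. i < n \<Longrightarrow> j < n \<Longrightarrow> g i j \<in> S) \<Longrightarrow> (\<lambda>i\<in>{..<n}. \<lambda>j\<in>{..<n}. \<sigma> (g i j)) \<in> G"
    and x: "x \<in> carrier (GL U n)" and const: "conjugate_by (GL U n) x G \<subseteq> GL_const U n"
  obtains B where "gauge n G B"
proof -
  interpret GL: group "GL U n" by (rule B.GL_group)
  let ?I = "{..<n}"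
  let ?M = "mat_ring U ?I"
  interpret D: der_ring ?M "mat_der U ?I" by (rule B.der_ring_mat_ring) simp
  have xM: "x \<in> carrier ?M" using x by (simp add: GL_simps carrier_mat_ring)
  note y = GL_inverse[OF x]
  have yM: "inv\<^bsub>GL U n\<^esub> x \<in> carrier ?M" using y(1) by (simp add: GL_simps carrier_mat_ring)
  define b where "b = inv\<^bsub>GL U n\<^esub> x \<otimes>\<^bsub>?M\<^esub> mat_der U ?I x"
  have bM: "b \<in> carrier ?M" unfolding b_def by (intro D.m_closed yM D.D_closed xM)
  note bc = mats_closed[OF bM[unfolded carrier_mat_ring]]
  have gM: "g \<in> carrier ?M" if "g \<in> G" for g
    using that subgroup.subset[OF G] by (auto simp: GL_simps carrier_mat_ring)
  have gc: "g i j \<in> carrier U" if "g \<in> G" "i < n" "j < n" for g i j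
    using mats_closed[OF gM[OF that(1), unfolded carrier_mat_ring]] that by simp
  have dg: "der U (g i j) = (\<Oplus>\<^bsub>U\<^esub>l\<in>?I. g i l \<otimes>\<^bsub>U\<^esub> b l j) \<ominus>\<^bsub>U\<^esub> (\<Oplus>\<^bsub>U\<^esub>l\<in>?I. b i l \<otimes>\<^bsub>U\<^esub> g l j)"
    if g: "g \<in> G" and ij: "i < n" "j < n" for g i j
  proof -
    let ?h = "x \<otimes>\<^bsub>?M\<^esub> g \<otimes>\<^bsub>?M\<^esub> inv\<^bsub>GL U n\<^esub> x"
    have hM: "?h \<in> carrier ?M" using xM yM gM[OF g] by simp
    have "?h \<in> GL_const U n"
      using const g by (auto simp: conjugate_by_def GL_simps)
    then have "mat_der U ?I ?h = \<zero>\<^bsub>?M\<^esub>"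
      using D.D_closed[OF hM] D.zero_closed
      by (intro mats_eqI[of _ U ?I ?I _ U]) (auto simp: carrier_mat_ring GL_const_def constants_def mat_der_def zero_entry)
    then have "mat_der U ?I g = g \<otimes>\<^bsub>?M\<^esub> b \<ominus>\<^bsub>?M\<^esub> b \<otimes>\<^bsub>?M\<^esub> g"
      unfolding b_def by (rule D.conjugate_constant_converse[OF xM yM y(2,3) gM[OF g]])
    then have "mat_der U ?I g i j = (g \<otimes>\<^bsub>?M\<^esub> b \<ominus>\<^bsub>?M\<^esub> b \<otimes>\<^bsub>?M\<^esub> g) i j" by simp
    moreover have "b \<otimes>\<^bsub>?M\<^esub> g \<in> mats U ?I ?I" using D.m_closed[OF bM gM[OF g]] by (simp add: carrier_mat_ring)
    ultimately show ?thesis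
      using ij by (simp add: D.minus_eq B.minus_eq add_entry B.uminus_entry mult_entry mat_der_def)
  qed
  \<comment> \<open>The coefficient of the unknown with index \<open>(k, l)\<close> in the entry
    \<open>(i, j)\<close> of \<open>g c - c g\<close>, where \<open>c\<close> is the matrix of
    unknowns; the right-hand side \<open>\<beta>\<close> is the entry of \<open>g'\<close>.\<close>
  define \<alpha> where "\<alpha> = (\<lambda>(g :: nat \<Rightarrow> nat \<Rightarrow> 'c, i :: nat, j :: nat) (k, l).
    (if l = j then g i k else \<zero>\<^bsub>U\<^esub>) \<ominus>\<^bsub>U\<^esub> (if k = i then g l j else \<zero>\<^bsub>U\<^esub>))"
  define \<beta> where "\<beta> = (\<lambda>(g :: nat \<Rightarrow> nat \<Rightarrow> 'c, i :: nat, j :: nat). der U (g i j))"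
  define Q where "Q = G \<times> (?I \<times> ?I)"
  \<comment> \<open>Besides the coefficients and the right-hand side it contains all entries of
    \<open>g\<close>, so that an embedding whose generators include \<open>supp\<close> acts on the
    whole matrix.\<close>
  define supp where "supp = (\<lambda>(g, i, j).
    (\<lambda>(k, l). g k l) ` (?I \<times> ?I) \<union> \<alpha> (g, i, j) ` (?I \<times> ?I) \<union> {der U (g i j)})"
  have expand: "(\<Oplus>\<^bsub>U\<^esub>p\<in>?I \<times> ?I. \<alpha> (g, i, j) p \<otimes>\<^bsub>U\<^esub> c p) =
      (\<Oplus>\<^bsub>U\<^esub>l\<in>?I. g i l \<otimes>\<^bsub>U\<^esub> c (l, j)) \<ominus>\<^bsub>U\<^esub> (\<Oplus>\<^bsub>U\<^esub>l\<in>?I. c (i, l) \<otimes>\<^bsub>U\<^esub> g l j)"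
    if g: "g \<in> G" and ij: "i < n" "j < n" and c: "\<And>p. p \<in> ?I \<times> ?I \<Longrightarrow> c p \<in> carrier U" for g i j c
  proof -
    have c': "c (k, l) \<in> carrier U" if "k < n" "l < n" for k l using c that by auto
    note gc' = gc[OF g]
    let ?one = "\<ominus>\<^bsub>U\<^esub> \<one>\<^bsub>U\<^esub>"
    have "(\<Oplus>\<^bsub>U\<^esub>p\<in>?I \<times> ?I. \<alpha> (g, i, j) p \<otimes>\<^bsub>U\<^esub> c p) = (\<Oplus>\<^bsub>U\<^esub>k\<in>?I. \<Oplus>\<^bsub>U\<^esub>l\<in>?I. \<alpha> (g, i, j) (k, l) \<otimes>\<^bsub>U\<^esub> c (k, l))"
      using ij c' gc' by (intro B.add.finprod_Times) (auto simp: \<alpha>_def)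
    also have "\<dots> = (\<Oplus>\<^bsub>U\<^esub>k\<in>?I. \<Oplus>\<^bsub>U\<^esub>l\<in>?I. (if j = l then g i k \<otimes>\<^bsub>U\<^esub> c (k, l) else \<zero>\<^bsub>U\<^esub>) \<oplus>\<^bsub>U\<^esub>
        (if i = k then ?one \<otimes>\<^bsub>U\<^esub> (g l j \<otimes>\<^bsub>U\<^esub> c (k, l)) else \<zero>\<^bsub>U\<^esub>))"
      using ij c' gc'
      by (intro B.finsum_cong')
        (auto simp: \<alpha>_def B.minus_eq B.l_distr B.l_minus intro!: B.finsum_cong')
    also have "\<dots> = (\<Oplus>\<^bsub>U\<^esub>k\<in>?I. (\<Oplus>\<^bsub>U\<^esub>l\<in>?I. (if j = l then g i k \<otimes>\<^bsub>U\<^esub> c (k, l) else \<zero>\<^bsub>U\<^esub>)) \<oplus>\<^bsub>U\<^esub>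
        (\<Oplus>\<^bsub>U\<^esub>l\<in>?I. (if i = k then ?one \<otimes>\<^bsub>U\<^esub> (g l j \<otimes>\<^bsub>U\<^esub> c (k, l)) else \<zero>\<^bsub>U\<^esub>)))"
      using ij c' gc' by (intro B.finsum_cong' B.finsum_addf) (auto intro!: B.finsum_closed)
    also have "\<dots> = (\<Oplus>\<^bsub>U\<^esub>k\<in>?I. g i k \<otimes>\<^bsub>U\<^esub> c (k, j) \<oplus>\<^bsub>U\<^esub>
        (if i = k then (\<Oplus>\<^bsub>U\<^esub>l\<in>?I. ?one \<otimes>\<^bsub>U\<^esub> (g l j \<otimes>\<^bsub>U\<^esub> c (k, l))) else \<zero>\<^bsub>U\<^esub>))"
      using ij c' gc' by (intro B.finsum_cong' arg_cong2[of _ _ _ _ "ring.add U"])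
        (auto intro!: B.finsum_closed B.finsum_delta)
    also have "\<dots> = (\<Oplus>\<^bsub>U\<^esub>k\<in>?I. g i k \<otimes>\<^bsub>U\<^esub> c (k, j)) \<oplus>\<^bsub>U\<^esub>
        (\<Oplus>\<^bsub>U\<^esub>k\<in>?I. if i = k then (\<Oplus>\<^bsub>U\<^esub>l\<in>?I. ?one \<otimes>\<^bsub>U\<^esub> (g l j \<otimes>\<^bsub>U\<^esub> c (k, l))) else \<zero>\<^bsub>U\<^esub>)"
      using ij c' gc' by (intro B.finsum_addf) (auto intro!: B.finsum_closed)
    also have "(\<Oplus>\<^bsub>U\<^esub>k\<in>?I. if i = k then (\<Oplus>\<^bsub>U\<^esub>l\<in>?I. ?one \<otimes>\<^bsub>U\<^esub> (g l j \<otimes>\<^bsub>U\<^esub> c (k, l))) else \<zero>\<^bsub>U\<^esub>) =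
        (\<Oplus>\<^bsub>U\<^esub>l\<in>?I. ?one \<otimes>\<^bsub>U\<^esub> (g l j \<otimes>\<^bsub>U\<^esub> c (i, l)))"
      using ij c' gc' by (intro B.finsum_delta) (auto intro!: B.finsum_closed)
    also have "\<dots> = ?one \<otimes>\<^bsub>U\<^esub> (\<Oplus>\<^bsub>U\<^esub>l\<in>?I. g l j \<otimes>\<^bsub>U\<^esub> c (i, l))"
      using ij c' gc' by (intro B.finsum_rdistr[symmetric]) auto
    also have "\<dots> = \<ominus>\<^bsub>U\<^esub> (\<Oplus>\<^bsub>U\<^esub>l\<in>?I. g l j \<otimes>\<^bsub>U\<^esub> c (i, l))"
      using ij c' gc' by (subst B.l_minus) (auto intro!: B.finsum_closed)
    also have "(\<Oplus>\<^bsub>U\<^esub>l\<in>?I. g l j \<otimes>\<^bsub>U\<^esub> c (i, l)) = (\<Oplus>\<^bsub>U\<^esub>l\<in>?I. c (i, l) \<otimes>\<^bsub>U\<^esub> g l j)"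
      using ij c' gc' by (intro B.finsum_cong') (auto simp: B.m_comm)
    finally show ?thesis by (simp add: B.minus_eq)
  qed
  obtain c where c: "\<And>p. p \<in> ?I \<times> ?I \<Longrightarrow> c p \<in> carrier K"
    "\<And>q. q \<in> Q \<Longrightarrow> (\<Oplus>\<^bsub>U\<^esub>p\<in>?I \<times> ?I. \<alpha> q p \<otimes>\<^bsub>U\<^esub> \<iota> (c p)) = \<beta> q"
  proof (rule linear_system_descent[of "?I \<times> ?I" Q \<alpha> supp \<beta> "\<lambda>p\<in>?I \<times> ?I. b (fst p) (snd p)"])
    show "finite (?I \<times> ?I)" by simp
    show "\<alpha> q p \<in> supp q" if "q \<in> Q" "p \<in> ?I \<times> ?I" for q p
      using that by (cases q) (auto simp: supp_def)
    show "\<beta> q \<in> supp q" for q by (cases q) (simp add: supp_def \<beta>_def)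
    show "finite (supp q) \<and> supp q \<subseteq> carrier U" if "q \<in> Q" for q
      using that gc by (cases q) (auto simp: supp_def Q_def \<alpha>_def B.der_closed)
    show "(\<lambda>p\<in>?I \<times> ?I. b (fst p) (snd p)) \<in> ?I \<times> ?I \<rightarrow>\<^sub>E carrier U"
      using bc by auto
    show "(\<Oplus>\<^bsub>U\<^esub>p\<in>?I \<times> ?I. \<alpha> q p \<otimes>\<^bsub>U\<^esub> (\<lambda>p\<in>?I \<times> ?I. b (fst p) (snd p)) p) = \<beta> q" if "q \<in> Q" for q
    proof -
      obtain g i j where q: "q = (g, i, j)" "g \<in> G" "i < n" "j < n" using \<open>q \<in> Q\<close> by (auto simp: Q_def)
      have "(\<Oplus>\<^bsub>U\<^esub>p\<in>?I \<times> ?I. \<alpha> q p \<otimes>\<^bsub>U\<^esub> (\<lambda>p\<in>?I \<times> ?I. b (fst p) (snd p)) p) =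
          (\<Oplus>\<^bsub>U\<^esub>p\<in>?I \<times> ?I. \<alpha> (g, i, j) p \<otimes>\<^bsub>U\<^esub> b (fst p) (snd p))"
        using bc gc q by (intro B.finsum_cong') (auto simp: \<alpha>_def)
      also have "\<dots> = \<beta> q"
        using expand[OF q(2-4), of "\<lambda>p. b (fst p) (snd p)"] bc dg[OF q(2-4)] by (auto simp: \<beta>_def q(1))
      finally show ?thesis .
    qed
    fix q S \<sigma> assume *: "q \<in> Q" "S \<subseteq> carrier U" "supp q \<subseteq> S" "specialization S \<sigma>"
    obtain g i j where q: "q = (g, i, j)" "g \<in> G" "i < n" "j < n" using *(1) by (auto simp: Q_def)
    have gS: "g k l \<in> S" if "k < n" "l < n" for k l
      using that *(3) by (auto simp: q supp_def)
    then have gs: "g k l \<in> span S" if "k < n" "l < n" for k l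
      using that by (auto intro: diff_span.span_incl)
    let ?g = "\<lambda>i\<in>?I. \<lambda>j\<in>?I. \<sigma> (g i j)"
    \<comment> \<open>The image of \<open>g\<close> supplies the equation that
      \<open>linear_system_descent\<close> asks for, at the same position
      \<open>(i, j)\<close>.\<close>
    have "?g \<in> G" by (rule stable[OF q(2) *(2,4) gS])
    note simps = specialization_simps[OF *(2,4)]
    have zero: "\<zero>\<^bsub>U\<^esub> \<in> span S" by (rule diff_span.span_incl) (auto intro!: image_eqI[of _ _ "\<zero>\<^bsub>K\<^esub>"])
    have minus: "\<sigma> (u \<ominus>\<^bsub>U\<^esub> v) = \<sigma> u \<ominus>\<^bsub>U\<^esub> \<sigma> v" if "u \<in> span S" "v \<in> span S" for u v
      using simps(2)[OF that(1) diff_span.span_a_inv[OF that(2)]] simps(6)[OF that(2,2)] by (simp add: B.minus_eq)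
    have "\<alpha> (?g, i, j) p = \<sigma> (\<alpha> q p)" if p: "p \<in> ?I \<times> ?I" for p
    proof -
      obtain k l where kl: "p = (k, l)" "k < n" "l < n" using p by auto
      have "\<sigma> (\<alpha> q p) = \<sigma> (if l = j then g i k else \<zero>\<^bsub>U\<^esub>) \<ominus>\<^bsub>U\<^esub> \<sigma> (if k = i then g l j else \<zero>\<^bsub>U\<^esub>)"
        unfolding \<alpha>_def q kl prod.case using gs q kl zero by (intro minus) auto
      then show ?thesis using simps(4)[OF zero zero] q kl by (simp add: \<alpha>_def)
    qed
    moreover have "\<beta> (?g, i, j) = \<sigma> (\<beta> q)"
      using *(4) gs[OF q(3,4)] q by (simp add: \<beta>_def specialization_def diff_hom_def)
    ultimately show "\<exists>q'\<in>Q. (\<forall>p\<in>?I \<times> ?I. \<alpha> q' p = \<sigma> (\<alpha> q p)) \<and> \<beta> q' = \<sigma> (\<beta> q)"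
      using \<open>?g \<in> G\<close> q by (intro bexI[of _ "(?g, i, j)"]) (auto simp: Q_def)
  qed (rule that)
  have "gauge n G (\<lambda>k l. c (k, l))"
    unfolding gauge_def
  proof (intro conjI ballI allI impI)
    fix g i j assume g: "g \<in> G" and ij: "i < n" "j < n"
    then show "der U (g i j) = (\<Oplus>\<^bsub>U\<^esub>l\<in>?I. g i l \<otimes>\<^bsub>U\<^esub> \<iota> (c (l, j))) \<ominus>\<^bsub>U\<^esub> (\<Oplus>\<^bsub>U\<^esub>l\<in>?I. \<iota> (c (i, l)) \<otimes>\<^bsub>U\<^esub> g l j)"
      using c(2)[of "(g, i, j)"] expand[OF g ij, of "\<lambda>p. \<iota> (c p)"] c(1) by (simp add: Q_def \<beta>_def)
  qed (use c(1) in simp)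
  then show ?thesis by (rule that)
qed

end

section \<open>Differential polynomials and the coordinate ring\<close>

definition letter_up :: "'v \<times> nat \<Rightarrow> 'v \<times> nat" where
  "letter_up x = (fst x, Suc (snd x))"

lemma letter_up_neq [simp]: "letter_up x \<noteq> x" "x \<noteq> letter_up x"
  by (cases x; simp add: letter_up_def)+

lemma inj_letter_up: "inj letter_up"
  by (rule injI) (auto simp: letter_up_def prod_eq_iff)

lemma finite_letters: "finite {x. letter_up x \<in># m}"
proof -
  have "finite (letter_up -` set_mset m)" by (rule finite_vimageI[OF _ inj_letter_up]) simp
  then show ?thesis by (simp add: vimage_def)
qed

text \<open>A name for the product in \<open>dpoly_ring\<close>; \<open>monom_val\<close> below
  names the monomial factor in \<open>dpoly_eval\<close>.\<close>

definition mpoly_mult :: "('a, 'm) ring_scheme \<Rightarrow> ('i multiset \<Rightarrow> 'a) \<Rightarrow> ('i multiset \<Rightarrow> 'a) \<Rightarrow> 'i multiset \<Rightarrow> 'a" where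
  "mpoly_mult R P Q m = (\<Oplus>\<^bsub>R\<^esub>l \<in> {l. l \<subseteq># m}. P l \<otimes>\<^bsub>R\<^esub> Q (m - l))"

definition monom_val :: "'b diff_ring \<Rightarrow> ('v \<Rightarrow> 'b) \<Rightarrow> ('v \<times> nat) multiset \<Rightarrow> 'b" where
  "monom_val S s m = (\<Otimes>\<^bsub>S\<^esub>x \<in> set_mset m. ((der S ^^ snd x) (s (fst x))) [^]\<^bsub>S\<^esub> count m x)"

lemma finite_submultisets: "finite {l. l \<subseteq># m}"
proof -
  have "{l. l \<subseteq># m} \<subseteq> {l. set_mset l \<subseteq> set_mset m \<and> size l \<le> size m}"
    by (auto dest: size_mset_mono set_mset_mono)
  moreover have "{l. set_mset l \<subseteq> set_mset m \<and> size l \<le> size m} \<subseteq>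
      mset ` {xs. set xs \<subseteq> set_mset m \<and> length xs \<le> size m}"
  proof
    fix l assume "l \<in> {l. set_mset l \<subseteq> set_mset m \<and> size l \<le> size m}"
    moreover obtain xs where "mset xs = l" using ex_mset by blast
    ultimately show "l \<in> mset ` {xs. set xs \<subseteq> set_mset m \<and> length xs \<le> size m}"
      by (intro image_eqI[of _ _ xs]) auto
  qed
  moreover have "finite (mset ` {xs. set xs \<subseteq> set_mset m \<and> length xs \<le> size m})"
    by (intro finite_imageI finite_lists_length_le) simp
  ultimately show ?thesis using finite_subset order_trans by (metis (lifting))
qed

lemma (in ring) pset_coeff: "P \<in> indexed_pset I (carrier R) \<Longrightarrow> P m \<in> carrier R"
  using indexed_pset_in_carrier[of "carrier R"] by (auto simp: carrier_coeff_def)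

lemma (in ring) pset_support:
  assumes "P \<in> indexed_pset I (carrier R)"
  shows "finite {m. P m \<noteq> \<zero>}" and "\<And>m. P m \<noteq> \<zero> \<Longrightarrow> set_mset m \<subseteq> I"
proof -
  from assms have "finite {m. P m \<noteq> \<zero>} \<and> (\<forall>m. P m \<noteq> \<zero> \<longrightarrow> set_mset m \<subseteq> I)"
  proof induction
    case (indexed_const k)
    have "finite {m. indexed_const k m \<noteq> \<zero>}"
      by (rule finite_subset[of _ "{{#}}"]) (auto simp: indexed_const_def)
    then show ?case by (auto simp: indexed_const_def)
  next
    case (indexed_padd P Q)
    have "finite {m. indexed_padd P Q m \<noteq> \<zero>}"
      by (rule finite_subset[of _ "{m. P m \<noteq> \<zero>} \<union> {m. Q m \<noteq> \<zero>}"])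
        (use indexed_padd in \<open>auto simp: indexed_padd_def\<close>)
    moreover have "set_mset m \<subseteq> I" if "indexed_padd P Q m \<noteq> \<zero>" for m
      using that indexed_padd.IH by (cases "P m = \<zero>"; cases "Q m = \<zero>") (auto simp: indexed_padd_def)
    ultimately show ?case by blast
  next
    case (indexed_pmult P i)
    have "finite {m. indexed_pmult P i m \<noteq> \<zero>}"
    proof (rule finite_subset[of _ "add_mset i ` {m. P m \<noteq> \<zero>}"])
      show "{m. indexed_pmult P i m \<noteq> \<zero>} \<subseteq> add_mset i ` {m. P m \<noteq> \<zero>}"
      proof
        fix m assume "m \<in> {m. indexed_pmult P i m \<noteq> \<zero>}"
        then show "m \<in> add_mset i ` {m. P m \<noteq> \<zero>}"
          by (intro image_eqI[of _ _ "m - {#i#}"]) (auto simp: indexed_pmult_def split: if_splits)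
      qed
    qed (use indexed_pmult in simp)
    moreover have "set_mset m \<subseteq> I" if m: "indexed_pmult P i m \<noteq> \<zero>" for m
    proof -
      have "i \<in># m" "set_mset (m - {#i#}) \<subseteq> I"
        using m indexed_pmult.IH by (auto simp: indexed_pmult_def split: if_splits)
      then show ?thesis using indexed_pmult.hyps(2) by (metis insert_DiffM set_mset_add_mset_insert insert_subset)
    qed
    ultimately show ?case by blast
  qed
  then show "finite {m. P m \<noteq> \<zero>}" and "\<And>m. P m \<noteq> \<zero> \<Longrightarrow> set_mset m \<subseteq> I" by auto
qed

subsection \<open>Operations on differential polynomials\<close>

context cring
begin

abbreviation polys :: "'i set \<Rightarrow> ('i multiset \<Rightarrow> 'a) set" where
  "polys I \<equiv> indexed_pset I (carrier R)"

lemma mpoly_mult_const: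
  fixes P :: "'i multiset \<Rightarrow> 'a"
  assumes "P \<in> polys I" "c \<in> carrier R"
  shows "mpoly_mult R P (indexed_const c) = (\<lambda>m. P m \<otimes> c)"
proof
  fix m :: "'i multiset"
  have empty: "m - l = {#} \<longleftrightarrow> m = l" if "l \<subseteq># m" for l
    using that by (metis Diff_eq_empty_iff_mset subset_mset.antisym subset_mset.order_refl)
  have "mpoly_mult R P (indexed_const c) m = (\<Oplus>l\<in>{l. l \<subseteq># m}. if m = l then P l \<otimes> c else \<zero>)"
    unfolding mpoly_mult_def using assms
    by (intro finsum_cong') (auto simp: indexed_const_def pset_coeff empty)
  also have "\<dots> = P m \<otimes> c"
    using assms by (subst finsum_singleton) (auto simp: finite_submultisets pset_coeff)
  finally show "mpoly_mult R P (indexed_const c) m = P m \<otimes> c" .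
qed

lemma mpoly_mult_padd:
  assumes "P \<in> polys I" "Q \<in> polys I" "Q' \<in> polys I"
  shows "mpoly_mult R P (indexed_padd Q Q') = indexed_padd (mpoly_mult R P Q) (mpoly_mult R P Q')"
proof
  fix m
  have "(\<Oplus>l\<in>{l. l \<subseteq># m}. P l \<otimes> indexed_padd Q Q' (m - l)) =
      (\<Oplus>l\<in>{l. l \<subseteq># m}. P l \<otimes> Q (m - l) \<oplus> P l \<otimes> Q' (m - l))"
    using assms by (intro finsum_cong') (auto simp: indexed_padd_def pset_coeff r_distr)
  also have "\<dots> = (\<Oplus>l\<in>{l. l \<subseteq># m}. P l \<otimes> Q (m - l)) \<oplus> (\<Oplus>l\<in>{l. l \<subseteq># m}. P l \<otimes> Q' (m - l))"
    using assms by (intro finsum_addf) (auto simp: pset_coeff)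
  finally show "mpoly_mult R P (indexed_padd Q Q') m = indexed_padd (mpoly_mult R P Q) (mpoly_mult R P Q') m"
    by (simp add: mpoly_mult_def indexed_padd_def)
qed

text \<open>A divisor \<open>l\<close> of \<open>m\<close> contributes only if \<open>m - l\<close>
  still contains \<open>i\<close>, that is, if \<open>l\<close> divides the monomial obtained from
  \<open>m\<close> by removing one \<open>i\<close>.\<close>

lemma mpoly_mult_pmult:
  assumes "P \<in> polys I" "Q \<in> polys I"
  shows "mpoly_mult R P (indexed_pmult Q i) = indexed_pmult (mpoly_mult R P Q) i"
proof
  fix m
  show "mpoly_mult R P (indexed_pmult Q i) m = indexed_pmult (mpoly_mult R P Q) i m"
  proof (cases "i \<in># m")
    case False
    then have "i \<notin># m - l" for l by (meson in_diffD)
    then have "mpoly_mult R P (indexed_pmult Q i) m = (\<Oplus>l\<in>{l. l \<subseteq># m}. \<zero>)"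
      unfolding mpoly_mult_def using assms by (intro finsum_cong') (auto simp: indexed_pmult_def pset_coeff)
    then show ?thesis using False by (simp add: indexed_pmult_def)
  next
    case True
    let ?f = "\<lambda>l. P l \<otimes> indexed_pmult Q i (m - l)"
    have "(\<Oplus>l\<in>{l. l \<subseteq># m - {#i#}}. P l \<otimes> Q (m - {#i#} - l)) = (\<Oplus>l\<in>{l. l \<subseteq># m}. ?f l)"
    proof (rule add.finprod_mono_neutral_cong_left[OF finite_submultisets])
      show "{l. l \<subseteq># m - {#i#}} \<subseteq> {l. l \<subseteq># m}" by (auto intro: subset_mset.order_trans)
      fix l assume l: "l \<in> {l. l \<subseteq># m} - {l. l \<subseteq># m - {#i#}}"
      have "i \<notin># m - l"
      proof
        assume "i \<in># m - l"
        then have "count l i < count m i" by (simp add: in_diff_count)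
        then have "l \<subseteq># m - {#i#}" using l by (auto simp: subseteq_mset_def)
        then show False using l by simp
      qed
      then show "?f l = \<zero>" using assms by (simp add: indexed_pmult_def pset_coeff)
    next
      fix l assume "l \<in> {l. l \<subseteq># m - {#i#}}"
      then have l: "l \<subseteq># m - {#i#}" by simp
      then have "count l i \<le> count m i - 1" by (metis count_diff count_single mset_subset_eq_count)
      moreover have "0 < count m i" using True by simp
      ultimately have "i \<in># m - l" unfolding in_diff_count by linarith
      moreover have "m - l - {#i#} = m - {#i#} - l" by (simp add: diff_right_commute)
      ultimately show "P l \<otimes> Q (m - {#i#} - l) = ?f l" by (simp add: indexed_pmult_def)
    qed (use assms in \<open>auto simp: indexed_pmult_def pset_coeff\<close>)
    then show ?thesis using True by (simp add: mpoly_mult_def indexed_pmult_def)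
  qed
qed

lemma scale_closed:
  assumes "P \<in> polys I" "c \<in> carrier R" shows "(\<lambda>m. P m \<otimes> c) \<in> polys I"
  using assms(1)
proof induction
  case (indexed_const k)
  have eq: "(\<lambda>m. indexed_const k m \<otimes> c) = indexed_const (k \<otimes> c)"
    using assms(2) by (auto simp: indexed_const_def)
  show ?case unfolding eq using indexed_const assms(2) by (auto intro!: indexed_pset.indexed_const)
next
  case (indexed_padd P Q)
  have eq: "(\<lambda>m. indexed_padd P Q m \<otimes> c) = indexed_padd (\<lambda>m. P m \<otimes> c) (\<lambda>m. Q m \<otimes> c)"
    using indexed_padd.hyps assms(2) by (auto simp: indexed_padd_def l_distr pset_coeff)
  show ?case unfolding eq using indexed_padd.IH by (auto intro!: indexed_pset.indexed_padd)
next
  case (indexed_pmult P i)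
  have eq: "(\<lambda>m. indexed_pmult P i m \<otimes> c) = indexed_pmult (\<lambda>m. P m \<otimes> c) i"
    using assms(2) by (auto simp: indexed_pmult_def)
  show ?case unfolding eq using indexed_pmult by (auto intro!: indexed_pset.indexed_pmult)
qed

lemma mpoly_mult_closed:
  assumes P: "P \<in> polys I" and Q: "Q \<in> polys I" shows "mpoly_mult R P Q \<in> polys I"
  using Q
proof induction
  case (indexed_const k)
  then show ?case using P by (simp add: mpoly_mult_const scale_closed)
next
  case (indexed_padd Q Q')
  then show ?case using P by (simp add: mpoly_mult_padd indexed_pset.indexed_padd)
next
  case (indexed_pmult Q i)
  then show ?case using P by (simp add: mpoly_mult_pmult indexed_pset.indexed_pmult)
qed

end

section \<open>The derivation of differential polynomials\<close>

context differential_field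
begin

lemma dpoly_der_alt:
  "dpoly_der R P m = der R (P m) \<oplus> (\<Oplus>x \<in> {x. letter_up x \<in># m}.
     add_pow R (count (m - {#letter_up x#} + {#x#}) x) (P (m - {#letter_up x#} + {#x#})))"
  by (simp add: dpoly_der_def letter_up_def Let_def)

lemma dpoly_der_const:
  assumes "c \<in> carrier R" shows "dpoly_der R (indexed_const c :: ('v \<times> nat) multiset \<Rightarrow> 'a) = indexed_const (der R c)"
proof
  fix m :: "('v \<times> nat) multiset"
  have "(\<Oplus>x \<in> {x. letter_up x \<in># m}. add_pow R (count (m - {#letter_up x#} + {#x#}) x)
      (indexed_const c (m - {#letter_up x#} + {#x#}))) = (\<Oplus>x \<in> {x. letter_up x \<in># m}. \<zero>)"
    by (intro finsum_cong') (auto simp: indexed_const_def)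
  then show "dpoly_der R (indexed_const c) m = indexed_const (der R c) m"
    using assms by (simp add: dpoly_der_alt) (simp add: indexed_const_def der_zero der_closed)
qed

lemma dpoly_der_padd:
  fixes P Q :: "('v \<times> nat) multiset \<Rightarrow> 'a"
  assumes "P \<in> polys I" "Q \<in> polys I"
  shows "dpoly_der R (indexed_padd P Q) = indexed_padd (dpoly_der R P) (dpoly_der R Q)"
proof
  fix m :: "('v \<times> nat) multiset"
  let ?m = "\<lambda>x. m - {#letter_up x#} + {#x#}"
  let ?t = "\<lambda>P x. add_pow R (count (?m x) x) (P (?m x))"
  let ?Y = "{x. letter_up x \<in># m}"
  have cl: "?t P x \<in> carrier R" "?t Q x \<in> carrier R" for x using assms by (auto simp: pset_coeff)
  have t: "?t (indexed_padd P Q) x = ?t P x \<oplus> ?t Q x" for x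
    unfolding indexed_padd_def by (rule add.nat_pow_distrib) (use assms in \<open>auto simp: pset_coeff\<close>)
  have "(\<Oplus>x\<in>?Y. ?t (indexed_padd P Q) x) = (\<Oplus>x\<in>?Y. ?t P x \<oplus> ?t Q x)"
    by (rule finsum_cong'[OF refl _ t]) (intro Pi_I a_closed cl)
  also have "\<dots> = (\<Oplus>x\<in>?Y. ?t P x) \<oplus> (\<Oplus>x\<in>?Y. ?t Q x)"
    using cl by (intro finsum_addf) auto
  finally have sum: "(\<Oplus>x\<in>?Y. ?t (indexed_padd P Q) x) = \<dots>" .
  have "(\<Oplus>x\<in>?Y. ?t P x) \<in> carrier R" "(\<Oplus>x\<in>?Y. ?t Q x) \<in> carrier R"
    using cl by (auto intro!: finsum_closed)
  then have "der R (P m \<oplus> Q m) \<oplus> ((\<Oplus>x\<in>?Y. ?t P x) \<oplus> (\<Oplus>x\<in>?Y. ?t Q x)) =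
      (der R (P m) \<oplus> (\<Oplus>x\<in>?Y. ?t P x)) \<oplus> (der R (Q m) \<oplus> (\<Oplus>x\<in>?Y. ?t Q x))"
    using der_add[of "P m" "Q m"] der_closed[of "P m"] der_closed[of "Q m"] assms[THEN pset_coeff]
    by (simp only: a_ac a_closed)
  then show "dpoly_der R (indexed_padd P Q) m = indexed_padd (dpoly_der R P) (dpoly_der R Q) m"
    unfolding dpoly_der_alt[of "indexed_padd P Q"] sum
    by (simp only: indexed_padd_def dpoly_der_alt)
qed

text \<open>The product rule for multiplication by a letter. In the coefficient of \<open>m\<close>,
  the summand at \<open>y = x\<close> has multiplicity \<open>count m x + 1\<close>: the first part
  belongs to the derivative of \<open>P\<close>, the extra 1 to the derivative of the letter. At all
  other \<open>y\<close> the multiplicities agree.\<close>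

lemma dpoly_der_pmult:
  fixes P :: "('v \<times> nat) multiset \<Rightarrow> 'a"
  assumes P: "P \<in> polys I"
  shows "dpoly_der R (indexed_pmult P x) =
    indexed_padd (indexed_pmult (dpoly_der R P) x) (indexed_pmult P (letter_up x))"
proof
  fix m :: "('v \<times> nat) multiset"
  note Pc = pset_coeff[OF P]
  let ?Y = "\<lambda>m. {y. letter_up y \<in># m}"
  let ?m = "\<lambda>m y. m - {#letter_up y#} + {#y#}"
  let ?t = "\<lambda>m y. add_pow R (count (?m m y) y) (P (?m m y))"
  let ?A = "\<lambda>y. if x \<in># m \<and> letter_up y \<in># m - {#x#} then ?t (m - {#x#}) y else \<zero>"
  let ?B = "\<lambda>y. if x = y then P (m - {#letter_up x#}) else \<zero>"
  have summand: "add_pow R (count (?m m y) y) (indexed_pmult P x (?m m y)) = ?A y \<oplus> ?B y"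
    if y: "letter_up y \<in># m" for y
  proof (cases "y = x")
    case True
    have 1: "?m m x - {#x#} = m - {#letter_up x#}" by simp
    have 2: "count (?m m x) x = Suc (count m x)" by simp
    have 3: "add_pow R (count (?m m x) x) (indexed_pmult P x (?m m x)) = add_pow R (count m x) (P (m - {#letter_up x#})) \<oplus> P (m - {#letter_up x#})"
      unfolding indexed_pmult_def 2 using Pc by simp
    show ?thesis
    proof (cases "x \<in># m")
      case xm: True
      have "letter_up x \<in># m - {#x#}" using y True by (simp add: in_diff_count)
      moreover have "?m (m - {#x#}) x = m - {#letter_up x#}"
        using xm by (intro multiset_eqI) auto
      moreover have "count (?m (m - {#x#}) x) x = count m x" using xm by simp
      ultimately show ?thesis using 3 True xm by (simp del: add_mset_add_single union_mset_add_mset_right)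
    next
      case False
      then have "count m x = 0" by (simp add: not_in_iff)
      then show ?thesis using 3 True Pc False by simp
    qed
  next
    case False
    have iff: "x \<in># ?m m y \<longleftrightarrow> x \<in># m \<and> letter_up y \<in># m - {#x#}"
    proof (cases "x = letter_up y")
      case True
      then show ?thesis using False y by (auto simp: in_diff_count)
    next
      case neq: False
      then show ?thesis using False y by (auto simp: in_diff_count)
    qed
    have eq: "?m m y - {#x#} = ?m (m - {#x#}) y" if "x \<in># m" "letter_up y \<in># m - {#x#}"
      using False that by (intro multiset_eqI) auto
    have cnt: "count (?m m y) y = count (?m (m - {#x#}) y) y" using False by simp
    show ?thesis
    proof (cases "x \<in># m \<and> letter_up y \<in># m - {#x#}")
      case True
      then have "indexed_pmult P x (?m m y) = P (?m (m - {#x#}) y)"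
        using iff eq by (simp add: indexed_pmult_def del: add_mset_add_single union_mset_add_mset_right)
      then show ?thesis using True False Pc unfolding cnt by simp
    next
      case no: False
      then have "x \<notin># ?m m y" using iff by blast
      then have "indexed_pmult P x (?m m y) = \<zero>"
        unfolding indexed_pmult_def by (rule if_not_P)
      moreover have "?A y = \<zero>" by (rule if_not_P[OF no])
      moreover have "?B y = \<zero>" using False by simp
      ultimately show ?thesis by (simp only: add.nat_pow_one r_zero zero_closed)
    qed
  qed
  have "(\<Oplus>y\<in>?Y m. add_pow R (count (?m m y) y) (indexed_pmult P x (?m m y))) = (\<Oplus>y\<in>?Y m. ?A y \<oplus> ?B y)"
    using summand Pc by (intro finsum_cong') auto
  also have "\<dots> = (\<Oplus>y\<in>?Y m. ?A y) \<oplus> (\<Oplus>y\<in>?Y m. ?B y)"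
    using Pc by (intro finsum_addf) auto
  also have "(\<Oplus>y\<in>?Y m. ?B y) = indexed_pmult P (letter_up x) m"
  proof (cases "letter_up x \<in># m")
    case True
    then have "(\<Oplus>y\<in>?Y m. ?B y) = P (m - {#letter_up x#})"
      using Pc by (subst finsum_singleton) (auto simp: finite_letters)
    then show ?thesis using True by (simp add: indexed_pmult_def)
  next
    case False
    then have "(\<Oplus>y\<in>?Y m. ?B y) = (\<Oplus>y\<in>?Y m. \<zero>)" by (intro finsum_cong') auto
    then show ?thesis using False by (simp add: indexed_pmult_def)
  qed
  finally have sum: "(\<Oplus>y\<in>?Y m. add_pow R (count (?m m y) y) (indexed_pmult P x (?m m y))) =
      (\<Oplus>y\<in>?Y m. ?A y) \<oplus> indexed_pmult P (letter_up x) m" .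
  have Bc: "indexed_pmult P (letter_up x) m \<in> carrier R" using Pc by (simp add: indexed_pmult_def)
  have Ac: "(\<Oplus>y\<in>?Y m. ?A y) \<in> carrier R" using Pc by (intro finsum_closed) auto
  have A: "der R (indexed_pmult P x m) \<oplus> (\<Oplus>y\<in>?Y m. ?A y) = indexed_pmult (dpoly_der R P) x m"
  proof (cases "x \<in># m")
    case True
    have "(\<Oplus>y\<in>?Y (m - {#x#}). ?t (m - {#x#}) y) = (\<Oplus>y\<in>?Y m. ?A y)"
      using True Pc
      by (intro add.finprod_mono_neutral_cong_left finite_letters) (auto dest: in_diffD)
    then show ?thesis using True by (simp add: indexed_pmult_def dpoly_der_alt)
  next
    case False
    then have "(\<Oplus>y\<in>?Y m. ?A y) = (\<Oplus>y\<in>?Y m. \<zero>)" by (intro finsum_cong') auto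
    then show ?thesis using False by (simp add: indexed_pmult_def der_zero)
  qed
  have dc: "der R (indexed_pmult P x m) \<in> carrier R" using Pc by (auto simp: indexed_pmult_def der_closed)
  show "dpoly_der R (indexed_pmult P x) m =
      indexed_padd (indexed_pmult (dpoly_der R P) x) (indexed_pmult P (letter_up x)) m"
    unfolding dpoly_der_alt[of "indexed_pmult P x"] sum indexed_padd_def A[symmetric]
    using Ac Bc dc by (simp add: a_assoc)
qed

lemma dpoly_der_closed:
  assumes "P \<in> polys (V \<times> UNIV)" shows "dpoly_der R P \<in> polys (V \<times> UNIV)"
  using assms
proof induction
  case (indexed_const k)
  then show ?case by (simp add: dpoly_der_const der_closed indexed_pset.indexed_const)
next
  case (indexed_padd P Q)
  then show ?case by (simp add: dpoly_der_padd indexed_pset.indexed_padd)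
next
  case (indexed_pmult P x)
  then have "letter_up x \<in> V \<times> UNIV" by (auto simp: letter_up_def)
  then show ?case
    using indexed_pmult by (simp add: dpoly_der_pmult indexed_pset.indexed_padd indexed_pset.indexed_pmult)
qed

lemma monom_val_superset:
  assumes s: "\<And>v. s v \<in> carrier R" and T: "finite T" "set_mset m \<subseteq> T"
  shows "monom_val R s m = (\<Otimes>x\<in>T. ((der R ^^ snd x) (s (fst x))) [^] count m x)"
  unfolding monom_val_def
  by (rule finprod_mono_neutral_cong_left) (use s T in \<open>auto simp: der_pow_closed not_in_iff\<close>)

lemma monom_val_closed:
  assumes "\<And>v. s v \<in> carrier R" shows "monom_val R s m \<in> carrier R"
  unfolding monom_val_def using assms by (intro finprod_closed) (auto simp: der_pow_closed)

lemma monom_val_add: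
  assumes s: "\<And>v. s v \<in> carrier R"
  shows "monom_val R s (add_mset x m) = monom_val R s m \<otimes> (der R ^^ snd x) (s (fst x))"
proof -
  let ?v = "\<lambda>x. (der R ^^ snd x) (s (fst x))" and ?T = "insert x (set_mset m)"
  have v: "?v y \<in> carrier R" for y using s by (simp add: der_pow_closed)
  have "monom_val R s (add_mset x m) = (\<Otimes>y\<in>?T. ?v y [^] count (add_mset x m) y)"
    by (rule monom_val_superset) (use s in auto)
  also have "\<dots> = (\<Otimes>y\<in>?T. ?v y [^] count m y \<otimes> (if x = y then ?v y else \<one>))"
    using v by (intro finprod_cong') auto
  also have "\<dots> = (\<Otimes>y\<in>?T. ?v y [^] count m y) \<otimes> (\<Otimes>y\<in>?T. if x = y then ?v y else \<one>)"
    using v by (intro finprod_multf) auto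
  also have "(\<Otimes>y\<in>?T. if x = y then ?v y else \<one>) = ?v x"
    using v by (subst finprod_singleton) auto
  also have "(\<Otimes>y\<in>?T. ?v y [^] count m y) = monom_val R s m"
    by (rule monom_val_superset[symmetric]) (use s in auto)
  finally show ?thesis .
qed

end

section \<open>Evaluation of differential polynomials at points of an extension\<close>

context diff_field_map
begin

lemma dpoly_eval_superset:
  assumes P: "P \<in> A.polys I" and s: "\<And>v. s v \<in> carrier B" and T: "finite T" "{m. P m \<noteq> \<zero>\<^bsub>A\<^esub>} \<subseteq> T"
  shows "dpoly_eval A B h s P = (\<Oplus>\<^bsub>B\<^esub>m\<in>T. h (P m) \<otimes>\<^bsub>B\<^esub> monom_val B s m)"
  unfolding dpoly_eval_def monom_val_def[symmetric]
  by (rule B.add.finprod_mono_neutral_cong_left)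
    (use T s in \<open>auto simp: B.monom_val_closed A.pset_coeff[OF P]\<close>)

lemma dpoly_eval_cong:
  assumes P: "P \<in> A.polys (V \<times> UNIV)" and "\<And>v. v \<in> V \<Longrightarrow> s v = s' v" "\<And>v. s' v \<in> carrier B"
  shows "dpoly_eval A B h s P = dpoly_eval A B h s' P"
proof -
  have "monom_val B s m = monom_val B s' m" if "P m \<noteq> \<zero>\<^bsub>A\<^esub>" for m
    unfolding monom_val_def using A.pset_support(2)[OF P that] assms(2,3)
    by (intro B.finprod_cong') (auto simp: B.der_pow_closed)
  then show ?thesis
    unfolding dpoly_eval_def monom_val_def[symmetric]
    by (intro B.finsum_cong') (use assms(3) in \<open>auto simp: B.monom_val_closed A.pset_coeff[OF P]\<close>)
qed

lemma dpoly_eval_closed_aux: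
  assumes "P \<in> A.polys I" "\<And>v. s v \<in> carrier B" shows "dpoly_eval A B h s P \<in> carrier B"
  by (subst dpoly_eval_superset[OF assms A.pset_support(1)[OF assms(1)] subset_refl])
    (auto intro!: B.finsum_closed simp: assms B.monom_val_closed A.pset_coeff[OF assms(1)])

lemma dpoly_eval_const_aux:
  assumes "c \<in> carrier A" "\<And>v. s v \<in> carrier B"
  shows "dpoly_eval A B h s (A.indexed_const c) = h c"
proof -
  have "A.indexed_const c \<in> A.polys {}" by (rule A.indexed_pset.indexed_const) fact
  then have "dpoly_eval A B h s (A.indexed_const c) =
      (\<Oplus>\<^bsub>B\<^esub>m\<in>{{#}}. h (A.indexed_const c m) \<otimes>\<^bsub>B\<^esub> monom_val B s m)"
    by (rule dpoly_eval_superset) (use assms in \<open>auto simp: A.indexed_const_def\<close>)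
  then show ?thesis using assms by (simp add: A.indexed_const_def monom_val_def)
qed

lemma dpoly_eval_add_aux:
  assumes PQ: "P \<in> A.polys I" "Q \<in> A.polys I" and s: "\<And>v. s v \<in> carrier B"
  shows "dpoly_eval A B h s (A.indexed_padd P Q) = dpoly_eval A B h s P \<oplus>\<^bsub>B\<^esub> dpoly_eval A B h s Q"
proof -
  let ?T = "{m. P m \<noteq> \<zero>\<^bsub>A\<^esub>} \<union> {m. Q m \<noteq> \<zero>\<^bsub>A\<^esub>}"
  have fin: "finite ?T" using PQ[THEN A.pset_support(1)] by simp
  note c = A.pset_coeff[OF PQ(1)] A.pset_coeff[OF PQ(2)]
  have "dpoly_eval A B h s (A.indexed_padd P Q) = (\<Oplus>\<^bsub>B\<^esub>m\<in>?T. h (A.indexed_padd P Q m) \<otimes>\<^bsub>B\<^esub> monom_val B s m)"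
    by (rule dpoly_eval_superset[OF A.indexed_pset.indexed_padd[OF PQ] s fin]) (auto simp: A.indexed_padd_def)
  also have "\<dots> = (\<Oplus>\<^bsub>B\<^esub>m\<in>?T. h (P m) \<otimes>\<^bsub>B\<^esub> monom_val B s m \<oplus>\<^bsub>B\<^esub> h (Q m) \<otimes>\<^bsub>B\<^esub> monom_val B s m)"
    using c s by (intro B.finsum_cong') (auto simp: A.indexed_padd_def B.l_distr B.monom_val_closed)
  also have "\<dots> = (\<Oplus>\<^bsub>B\<^esub>m\<in>?T. h (P m) \<otimes>\<^bsub>B\<^esub> monom_val B s m) \<oplus>\<^bsub>B\<^esub> (\<Oplus>\<^bsub>B\<^esub>m\<in>?T. h (Q m) \<otimes>\<^bsub>B\<^esub> monom_val B s m)"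
    using c s by (intro B.finsum_addf) (auto simp: B.monom_val_closed)
  also have "(\<Oplus>\<^bsub>B\<^esub>m\<in>?T. h (P m) \<otimes>\<^bsub>B\<^esub> monom_val B s m) = dpoly_eval A B h s P"
    by (rule dpoly_eval_superset[OF PQ(1) s fin, symmetric]) auto
  also have "(\<Oplus>\<^bsub>B\<^esub>m\<in>?T. h (Q m) \<otimes>\<^bsub>B\<^esub> monom_val B s m) = dpoly_eval A B h s Q"
    by (rule dpoly_eval_superset[OF PQ(2) s fin, symmetric]) auto
  finally show ?thesis .
qed

lemma dpoly_eval_pmult_aux:
  assumes P: "P \<in> A.polys I" and s: "\<And>v. s v \<in> carrier B"
  shows "dpoly_eval A B h s (A.indexed_pmult P x) = dpoly_eval A B h s P \<otimes>\<^bsub>B\<^esub> (der B ^^ snd x) (s (fst x))"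
proof -
  let ?S = "{m. P m \<noteq> \<zero>\<^bsub>A\<^esub>}"
  have fin: "finite ?S" by (rule A.pset_support(1)[OF P])
  note c = A.pset_coeff[OF P]
  have P': "P \<in> A.polys (insert x I)"
    using P
  proof induction
    case (indexed_pmult P i) then show ?case by (intro A.indexed_pset.indexed_pmult) auto
  qed (auto intro: A.indexed_pset.intros)
  have "A.indexed_pmult P x \<in> A.polys (insert x I)" by (rule A.indexed_pset.indexed_pmult[OF P']) simp
  then have "dpoly_eval A B h s (A.indexed_pmult P x) =
      (\<Oplus>\<^bsub>B\<^esub>m\<in>add_mset x ` ?S. h (A.indexed_pmult P x m) \<otimes>\<^bsub>B\<^esub> monom_val B s m)"
  proof (rule dpoly_eval_superset[OF _ s])
    show "{m. A.indexed_pmult P x m \<noteq> \<zero>\<^bsub>A\<^esub>} \<subseteq> add_mset x ` ?S"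
    proof
      fix m assume "m \<in> {m. A.indexed_pmult P x m \<noteq> \<zero>\<^bsub>A\<^esub>}"
      then show "m \<in> add_mset x ` ?S"
        by (intro image_eqI[of _ _ "m - {#x#}"]) (auto simp: A.indexed_pmult_def split: if_splits)
    qed
  qed (use fin in simp)
  also have "\<dots> = (\<Oplus>\<^bsub>B\<^esub>m\<in>?S. h (A.indexed_pmult P x (add_mset x m)) \<otimes>\<^bsub>B\<^esub> monom_val B s (add_mset x m))"
    using c s by (intro B.finsum_reindex) (auto simp: B.monom_val_closed A.indexed_pmult_def intro: inj_onI)
  also have "\<dots> = (\<Oplus>\<^bsub>B\<^esub>m\<in>?S. h (P m) \<otimes>\<^bsub>B\<^esub> monom_val B s m \<otimes>\<^bsub>B\<^esub> (der B ^^ snd x) (s (fst x)))"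
    using c s by (intro B.finsum_cong')
      (auto simp: A.indexed_pmult_def B.monom_val_add B.monom_val_closed B.der_pow_closed B.m_assoc)
  also have "\<dots> = (\<Oplus>\<^bsub>B\<^esub>m\<in>?S. h (P m) \<otimes>\<^bsub>B\<^esub> monom_val B s m) \<otimes>\<^bsub>B\<^esub> (der B ^^ snd x) (s (fst x))"
    using c s by (intro B.finsum_ldistr[symmetric] fin) (auto simp: B.monom_val_closed B.der_pow_closed)
  also have "(\<Oplus>\<^bsub>B\<^esub>m\<in>?S. h (P m) \<otimes>\<^bsub>B\<^esub> monom_val B s m) = dpoly_eval A B h s P"
    by (rule dpoly_eval_superset[OF P s fin subset_refl, symmetric])
  finally show ?thesis .
qed

end

text \<open>The values of a point outside the set of variables are arbitrary, so they are reset to \<open>0\<close>.\<close>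

locale dpoly_point = diff_field_map A B h
  for A :: "'a diff_ring" and B :: "'b diff_ring" and h +
  fixes V :: "'v set" and s :: "'v \<Rightarrow> 'b"
  assumes point: "v \<in> V \<Longrightarrow> s v \<in> carrier B"
begin

abbreviation "dpolys \<equiv> A.polys (V \<times> UNIV)"
abbreviation "ev \<equiv> dpoly_eval A B h s"

lemma ev_reset: "P \<in> dpolys \<Longrightarrow> ev P = dpoly_eval A B h (\<lambda>v. if v \<in> V then s v else \<zero>\<^bsub>B\<^esub>) P"
  by (rule dpoly_eval_cong) (use point in auto)

lemma reset: "(if v \<in> V then s v else \<zero>\<^bsub>B\<^esub>) \<in> carrier B"
  using point by auto

lemma ev_closed: "P \<in> dpolys \<Longrightarrow> ev P \<in> carrier B"
  by (simp add: ev_reset dpoly_eval_closed_aux reset)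

lemma ev_const: "c \<in> carrier A \<Longrightarrow> ev (A.indexed_const c) = h c"
  by (simp add: ev_reset dpoly_eval_const_aux reset A.indexed_pset.indexed_const)

lemma ev_padd: "P \<in> dpolys \<Longrightarrow> Q \<in> dpolys \<Longrightarrow> ev (A.indexed_padd P Q) = ev P \<oplus>\<^bsub>B\<^esub> ev Q"
  by (simp add: ev_reset dpoly_eval_add_aux reset A.indexed_pset.indexed_padd)

lemma ev_pmult:
  assumes "P \<in> dpolys" "v \<in> V"
  shows "ev (A.indexed_pmult P (v, k)) = ev P \<otimes>\<^bsub>B\<^esub> (der B ^^ k) (s v)"
proof -
  have "A.indexed_pmult P (v, k) \<in> dpolys" using assms by (intro A.indexed_pset.indexed_pmult) auto
  then show ?thesis using assms by (simp add: ev_reset dpoly_eval_pmult_aux reset)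
qed

lemma ev_scale:
  assumes "P \<in> dpolys" "c \<in> carrier A" shows "ev (\<lambda>m. P m \<otimes>\<^bsub>A\<^esub> c) = ev P \<otimes>\<^bsub>B\<^esub> h c"
  using assms(1)
proof induction
  case (indexed_const k)
  have eq: "(\<lambda>m. A.indexed_const k m \<otimes>\<^bsub>A\<^esub> c) = A.indexed_const (k \<otimes>\<^bsub>A\<^esub> c)"
    using assms(2) by (auto simp: A.indexed_const_def)
  show ?case unfolding eq using indexed_const assms(2) by (simp add: ev_const)
next
  case (indexed_padd P Q)
  have eq: "(\<lambda>m. A.indexed_padd P Q m \<otimes>\<^bsub>A\<^esub> c) = A.indexed_padd (\<lambda>m. P m \<otimes>\<^bsub>A\<^esub> c) (\<lambda>m. Q m \<otimes>\<^bsub>A\<^esub> c)"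
    using indexed_padd.hyps assms(2) by (auto simp: A.indexed_padd_def A.l_distr A.pset_coeff)
  show ?case unfolding eq
    using indexed_padd assms(2) by (simp add: ev_padd A.scale_closed B.l_distr ev_closed)
next
  case (indexed_pmult P x)
  obtain v k where x: "x = (v, k)" "v \<in> V" using indexed_pmult.hyps by auto
  have eq: "(\<lambda>m. A.indexed_pmult P x m \<otimes>\<^bsub>A\<^esub> c) = A.indexed_pmult (\<lambda>m. P m \<otimes>\<^bsub>A\<^esub> c) x"
    using assms(2) by (auto simp: A.indexed_pmult_def)
  show ?case unfolding eq
    using indexed_pmult x assms(2)
    by (simp add: ev_pmult A.scale_closed ev_closed B.m_ac B.der_pow_closed point)
qed

lemma ev_mult:
  assumes P: "P \<in> dpolys" and Q: "Q \<in> dpolys" shows "ev (mpoly_mult A P Q) = ev P \<otimes>\<^bsub>B\<^esub> ev Q"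
  using Q
proof induction
  case (indexed_const k)
  then show ?case using P by (simp add: A.mpoly_mult_const ev_scale ev_const)
next
  case (indexed_padd Q Q')
  then show ?case
    using P by (simp add: A.mpoly_mult_padd ev_padd A.mpoly_mult_closed B.r_distr ev_closed)
next
  case (indexed_pmult Q x)
  obtain v k where x: "x = (v, k)" "v \<in> V" using indexed_pmult.hyps by auto
  show ?case
    using indexed_pmult P x
    by (simp add: A.mpoly_mult_pmult ev_pmult A.mpoly_mult_closed ev_closed B.m_assoc B.der_pow_closed point)
qed

lemma ev_der:
  assumes "P \<in> dpolys" shows "ev (dpoly_der A P) = der B (ev P)"
  using assms
proof induction
  case (indexed_const k)
  then show ?case by (simp add: A.dpoly_der_const ev_const A.der_closed hom_der)
next
  case (indexed_padd P Q)
  then show ?case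
    by (simp add: A.dpoly_der_padd ev_padd A.dpoly_der_closed B.der_add ev_closed)
next
  case (indexed_pmult P x)
  obtain v k where x: "x = (v, k)" "v \<in> V" using indexed_pmult.hyps by auto
  have "A.indexed_pmult (dpoly_der A P) x \<in> dpolys" "A.indexed_pmult P (letter_up x) \<in> dpolys"
    using indexed_pmult.hyps x by (auto intro!: A.indexed_pset.indexed_pmult A.dpoly_der_closed simp: letter_up_def)
  then show ?case
    using indexed_pmult x
    by (simp add: A.dpoly_der_pmult ev_padd)
      (simp add: letter_up_def ev_pmult A.dpoly_der_closed B.der_mult ev_closed B.der_pow_closed point)
qed

lemma ev_var:
  assumes "v \<in> V" shows "A.indexed_var (v, 0) \<in> dpolys" "ev (A.indexed_var (v, 0)) = s v"
proof -
  have one: "A.indexed_const \<one>\<^bsub>A\<^esub> \<in> dpolys" by (rule A.indexed_pset.indexed_const) simp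
  then show "A.indexed_var (v, 0) \<in> dpolys"
    unfolding A.indexed_var_def using assms by (intro A.indexed_pset.indexed_pmult) auto
  show "ev (A.indexed_var (v, 0)) = s v"
    unfolding A.indexed_var_def using assms by (simp add: ev_pmult[OF one] ev_const point)
qed

end

subsection \<open>The coordinate ring as a ring of functions\<close>

locale linear_group = universal_domain K U \<iota>
  for K :: "'a diff_ring" and U :: "'c diff_ring" and \<iota> +
  fixes n :: nat and G :: "(nat \<Rightarrow> nat \<Rightarrow> 'c) set"
  assumes ldag: "linear_diff_alg_group K U \<iota> n G"
begin

lemma subgroup_G: "subgroup G (GL U n)"
  using ldag by (simp add: linear_diff_alg_group_def)

lemma G_GL: "g \<in> G \<Longrightarrow> g \<in> carrier (GL U n)"
  using subgroup.subset[OF subgroup_G] by blast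

lemma G_entry: "g \<in> G \<Longrightarrow> i < n \<Longrightarrow> j < n \<Longrightarrow> g i j \<in> carrier U"
  using G_GL[of g] mats_closed[of g U "{..<n}" "{..<n}" i j] by (simp add: GL_simps)

lemma GL_point:
  assumes "g \<in> carrier (GL U n)" shows "dpoly_point K U \<iota> (gl_vars n) (gl_point U n g)"
proof
  fix v assume v: "v \<in> gl_vars n"
  have g: "g i j \<in> carrier U" if "i < n" "j < n" for i j
    using assms that mats_closed[of g U "{..<n}" "{..<n}" i j] by (simp add: GL_simps)
  have "mat_det U n g \<in> Units U"
    using assms B.mat_det_closed[OF g] by (simp add: GL_simps B.field_Units)
  then show "gl_point U n g v \<in> carrier U"
    using v g by (auto simp: gl_vars_def)
qed

abbreviation "dpolys \<equiv> A.polys (gl_vars n \<times> UNIV)"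

abbreviation ev :: "(nat \<Rightarrow> nat \<Rightarrow> 'c) \<Rightarrow> ((gl_var \<times> nat) multiset \<Rightarrow> 'a) \<Rightarrow> 'c" where
  "ev g \<equiv> dpoly_eval K U \<iota> (gl_point U n g)"

lemma G_point: "g \<in> G \<Longrightarrow> dpoly_point K U \<iota> (gl_vars n) (gl_point U n g)"
  by (rule GL_point[OF G_GL])

abbreviation "\<P> \<equiv> dpoly_ring K (gl_vars n)"

lemma dpoly_ring_simps:
  "carrier \<P> = dpolys" "F \<oplus>\<^bsub>\<P>\<^esub> H = A.indexed_padd F H" "F \<otimes>\<^bsub>\<P>\<^esub> H = mpoly_mult K F H"
  "der \<P> F = dpoly_der K F"
  by (simp_all add: dpoly_ring_def mpoly_mult_def fun_eq_iff)

definition cl :: "((gl_var \<times> nat) multiset \<Rightarrow> 'a) \<Rightarrow> ((gl_var \<times> nat) multiset \<Rightarrow> 'a) set" where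
  "cl F = vanishing_ideal K U \<iota> n G +>\<^bsub>\<P>\<^esub> F"

text \<open>Elements of the coordinate ring are determined by their values on the group, and from
  here on they are handled as functions on \<open>G\<close>.\<close>

lemma cl_eq:
  assumes F: "F \<in> dpolys" shows "cl F = {H \<in> dpolys. \<forall>g\<in>G. ev g H = ev g F}"
proof (intro equalityI subsetI)
  fix H assume "H \<in> cl F"
  then obtain I where I: "I \<in> dpolys" "\<And>g. g \<in> G \<Longrightarrow> ev g I = \<zero>\<^bsub>U\<^esub>" and H: "H = A.indexed_padd I F"
    by (auto simp: cl_def a_r_coset_def' vanishing_ideal_def dpoly_ring_simps)
  have "H \<in> dpolys" unfolding H by (rule A.indexed_pset.indexed_padd) (fact I F)+
  moreover have "ev g H = ev g F" if g: "g \<in> G" for g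
  proof -
    interpret pt: dpoly_point K U \<iota> "gl_vars n" "gl_point U n g" by (rule G_point[OF g])
    show ?thesis using I F g pt.ev_closed[OF F] by (simp add: H pt.ev_padd)
  qed
  ultimately show "H \<in> {H \<in> dpolys. \<forall>g\<in>G. ev g H = ev g F}" by simp
next
  fix H assume "H \<in> {H \<in> dpolys. \<forall>g\<in>G. ev g H = ev g F}"
  then have H: "H \<in> dpolys" "\<And>g. g \<in> G \<Longrightarrow> ev g H = ev g F" by auto
  \<comment> \<open>The difference of two polynomials is formed as a sum with a multiple by -1, to
    which the rules \<open>ev_padd\<close> and \<open>ev_scale\<close> apply.\<close>
  let ?c = "\<ominus>\<^bsub>K\<^esub> \<one>\<^bsub>K\<^esub>"
  have c: "?c \<in> carrier K" by simp
  let ?I = "A.indexed_padd H (\<lambda>m. F m \<otimes>\<^bsub>K\<^esub> ?c)"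
  have sc: "(\<lambda>m. F m \<otimes>\<^bsub>K\<^esub> ?c) \<in> dpolys" by (rule A.scale_closed[OF F c])
  have I: "?I \<in> dpolys" by (rule A.indexed_pset.indexed_padd[OF H(1) sc])
  have "ev g ?I = \<zero>\<^bsub>U\<^esub>" if g: "g \<in> G" for g
  proof -
    interpret pt: dpoly_point K U \<iota> "gl_vars n" "gl_point U n g" by (rule G_point[OF g])
    have "ev g ?I = ev g F \<oplus>\<^bsub>U\<^esub> ev g F \<otimes>\<^bsub>U\<^esub> \<iota> ?c"
      using pt.ev_padd[OF H(1) sc] pt.ev_scale[OF F c] H(2)[OF g] by simp
    also have "\<dots> = \<zero>\<^bsub>U\<^esub>" using pt.ev_closed[OF F] by (simp add: B.r_minus B.r_neg)
    finally show ?thesis .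
  qed
  then have "?I \<in> vanishing_ideal K U \<iota> n G"
    using I by (simp add: vanishing_ideal_def dpoly_ring_simps)
  moreover have "H = A.indexed_padd ?I F"
  proof
    fix m
    show "H m = A.indexed_padd ?I F m"
      using A.pset_coeff[OF H(1)] A.pset_coeff[OF F]
      by (simp add: A.indexed_padd_def A.r_minus A.a_assoc A.l_neg)
  qed
  ultimately show "H \<in> cl F"
    by (auto simp: cl_def a_r_coset_def' dpoly_ring_simps)
qed

lemma cl_eq_iff:
  assumes "F \<in> dpolys" "H \<in> dpolys"
  shows "cl F = cl H \<longleftrightarrow> (\<forall>g\<in>G. ev g F = ev g H)"
  using assms by (auto simp: cl_eq)

abbreviation "\<A> \<equiv> coord_ring K U \<iota> n G"

lemma coord_ring_simps:
  "carrier \<A> = cl ` dpolys"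
  "a \<oplus>\<^bsub>\<A>\<^esub> b = (\<Union>F\<in>a. \<Union>H\<in>b. {A.indexed_padd F H})"
  "a \<otimes>\<^bsub>\<A>\<^esub> b = (\<Union>F\<in>a. \<Union>H\<in>b. cl (mpoly_mult K F H))"
  "\<zero>\<^bsub>\<A>\<^esub> = vanishing_ideal K U \<iota> n G"
  "der \<A> a = (\<Union>F\<in>a. cl (dpoly_der K F))"
  by (auto simp: coord_ring_def Let_def ring.defs diff_ring.defs FactRing_def A_RCOSETS_def' cl_def
      dpoly_ring_simps set_add_def' rcoset_mult_def)

lemma cl_add:
  assumes F: "F \<in> dpolys" and H: "H \<in> dpolys"
  shows "cl F \<oplus>\<^bsub>\<A>\<^esub> cl H = cl (A.indexed_padd F H)"
proof -
  have FH: "A.indexed_padd F H \<in> dpolys" by (rule A.indexed_pset.indexed_padd[OF F H])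
  show ?thesis
  proof (intro equalityI subsetI)
    fix I assume "I \<in> cl F \<oplus>\<^bsub>\<A>\<^esub> cl H"
    then obtain F' H' where I: "I = A.indexed_padd F' H'" and *: "F' \<in> dpolys" "H' \<in> dpolys"
      "\<And>g. g \<in> G \<Longrightarrow> ev g F' = ev g F" "\<And>g. g \<in> G \<Longrightarrow> ev g H' = ev g H"
      by (auto simp: coord_ring_simps cl_eq F H)
    have "ev g I = ev g (A.indexed_padd F H)" if g: "g \<in> G" for g
    proof -
      interpret pt: dpoly_point K U \<iota> "gl_vars n" "gl_point U n g" by (rule G_point[OF g])
      show ?thesis using * F H g by (simp add: I pt.ev_padd)
    qed
    then show "I \<in> cl (A.indexed_padd F H)"
      using * by (auto simp: cl_eq FH I intro: A.indexed_pset.indexed_padd)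
  next
    fix I assume "I \<in> cl (A.indexed_padd F H)"
    then have I: "I \<in> dpolys" "\<And>g. g \<in> G \<Longrightarrow> ev g I = ev g (A.indexed_padd F H)"
      by (auto simp: cl_eq FH)
    let ?c = "\<ominus>\<^bsub>K\<^esub> \<one>\<^bsub>K\<^esub>"
    have c: "?c \<in> carrier K" by simp
    let ?H = "A.indexed_padd I (\<lambda>m. F m \<otimes>\<^bsub>K\<^esub> ?c)"
    have sc: "(\<lambda>m. F m \<otimes>\<^bsub>K\<^esub> ?c) \<in> dpolys" by (rule A.scale_closed[OF F c])
    have H': "?H \<in> dpolys" by (rule A.indexed_pset.indexed_padd[OF I(1) sc])
    have "ev g ?H = ev g H" if g: "g \<in> G" for g
    proof -
      interpret pt: dpoly_point K U \<iota> "gl_vars n" "gl_point U n g" by (rule G_point[OF g])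
      have "ev g ?H = (ev g F \<oplus>\<^bsub>U\<^esub> ev g H) \<oplus>\<^bsub>U\<^esub> ev g F \<otimes>\<^bsub>U\<^esub> \<iota> ?c"
        using pt.ev_padd[OF I(1) sc] pt.ev_scale[OF F c] I(2)[OF g] pt.ev_padd[OF F H] by simp
      also have "\<dots> = ev g H \<oplus>\<^bsub>U\<^esub> (ev g F \<oplus>\<^bsub>U\<^esub> \<ominus>\<^bsub>U\<^esub> ev g F)"
        using pt.ev_closed[OF F] pt.ev_closed[OF H] by (simp add: B.r_minus B.a_ac)
      also have "\<dots> = ev g H" using pt.ev_closed[OF F] pt.ev_closed[OF H] by (simp add: B.r_neg)
      finally show ?thesis .
    qed
    moreover have "I = A.indexed_padd F ?H"
    proof
      fix m
      have "F m \<oplus>\<^bsub>K\<^esub> (I m \<oplus>\<^bsub>K\<^esub> F m \<otimes>\<^bsub>K\<^esub> ?c) = I m \<oplus>\<^bsub>K\<^esub> (F m \<oplus>\<^bsub>K\<^esub> \<ominus>\<^bsub>K\<^esub> F m)"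
        using A.pset_coeff[OF I(1)] A.pset_coeff[OF F] by (simp add: A.r_minus A.a_ac)
      then show "I m = A.indexed_padd F ?H m"
        using A.pset_coeff[OF I(1)] A.pset_coeff[OF F] by (simp add: A.indexed_padd_def A.r_neg)
    qed
    ultimately show "I \<in> cl F \<oplus>\<^bsub>\<A>\<^esub> cl H"
      using H' F H by (auto simp: coord_ring_simps cl_eq intro!: bexI[of _ F] bexI[of _ ?H])
  qed
qed

lemma cl_mult:
  assumes F: "F \<in> dpolys" and H: "H \<in> dpolys"
  shows "cl F \<otimes>\<^bsub>\<A>\<^esub> cl H = cl (mpoly_mult K F H)"
proof -
  have "cl (mpoly_mult K F' H') = cl (mpoly_mult K F H)" if "F' \<in> cl F" "H' \<in> cl H" for F' H'
  proof -
    have *: "F' \<in> dpolys" "H' \<in> dpolys" "\<And>g. g \<in> G \<Longrightarrow> ev g F' = ev g F" "\<And>g. g \<in> G \<Longrightarrow> ev g H' = ev g H"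
      using that F H by (auto simp: cl_eq)
    have "ev g (mpoly_mult K F' H') = ev g (mpoly_mult K F H)" if g: "g \<in> G" for g
    proof -
      interpret pt: dpoly_point K U \<iota> "gl_vars n" "gl_point U n g" by (rule G_point[OF g])
      show ?thesis using * F H g by (simp add: pt.ev_mult)
    qed
    then show ?thesis using * F H by (simp add: cl_eq_iff A.mpoly_mult_closed)
  qed
  moreover have "F \<in> cl F" "H \<in> cl H" using F H by (auto simp: cl_eq)
  ultimately show ?thesis unfolding coord_ring_simps by fast
qed

lemma cl_der:
  assumes F: "F \<in> dpolys" shows "der \<A> (cl F) = cl (dpoly_der K F)"
proof -
  have "cl (dpoly_der K F') = cl (dpoly_der K F)" if "F' \<in> cl F" for F'
  proof -
    have *: "F' \<in> dpolys" "\<And>g. g \<in> G \<Longrightarrow> ev g F' = ev g F" using that F by (auto simp: cl_eq)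
    have "ev g (dpoly_der K F') = ev g (dpoly_der K F)" if g: "g \<in> G" for g
    proof -
      interpret pt: dpoly_point K U \<iota> "gl_vars n" "gl_point U n g" by (rule G_point[OF g])
      show ?thesis using * F g by (simp add: pt.ev_der)
    qed
    then show ?thesis using * F by (simp add: cl_eq_iff A.dpoly_der_closed)
  qed
  moreover have "F \<in> cl F" using F by (auto simp: cl_eq)
  ultimately show ?thesis unfolding coord_ring_simps by fast
qed

text \<open>The value is taken at an arbitrary representative; by \<open>cl_eq\<close> all
  representatives agree on \<open>G\<close>.\<close>

definition val :: "((gl_var \<times> nat) multiset \<Rightarrow> 'a) set \<Rightarrow> (nat \<Rightarrow> nat \<Rightarrow> 'c) \<Rightarrow> 'c" where
  "val a g = ev g (SOME F. F \<in> a)"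

lemma val_cl:
  assumes "F \<in> dpolys" "g \<in> G" shows "val (cl F) g = ev g F"
proof -
  have "F \<in> cl F" using assms by (simp add: cl_eq)
  then have "(SOME H. H \<in> cl F) \<in> cl F" by (rule someI[of "\<lambda>H. H \<in> cl F"])
  then show ?thesis using assms by (simp add: val_def cl_eq)
qed

lemma val_closed: "a \<in> carrier \<A> \<Longrightarrow> g \<in> G \<Longrightarrow> val a g \<in> carrier U"
  by (auto simp: coord_ring_simps val_cl intro: dpoly_point.ev_closed[OF G_point])

lemma val_eqI:
  assumes "a \<in> carrier \<A>" "b \<in> carrier \<A>" "\<And>g. g \<in> G \<Longrightarrow> val a g = val b g"
  shows "a = b"
proof -
  obtain F H where *: "a = cl F" "b = cl H" "F \<in> dpolys" "H \<in> dpolys"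
    using assms by (auto simp: coord_ring_simps)
  then show ?thesis using assms(3) by (simp add: cl_eq_iff val_cl)
qed

lemma coord_add:
  assumes "a \<in> carrier \<A>" "b \<in> carrier \<A>"
  shows "a \<oplus>\<^bsub>\<A>\<^esub> b \<in> carrier \<A>" and "g \<in> G \<Longrightarrow> val (a \<oplus>\<^bsub>\<A>\<^esub> b) g = val a g \<oplus>\<^bsub>U\<^esub> val b g"
proof -
  obtain F H where *: "a = cl F" "b = cl H" "F \<in> dpolys" "H \<in> dpolys"
    using assms by (auto simp: coord_ring_simps)
  have FH: "A.indexed_padd F H \<in> dpolys" by (rule A.indexed_pset.indexed_padd) (fact *)+
  show "a \<oplus>\<^bsub>\<A>\<^esub> b \<in> carrier \<A>" using * FH by (simp add: cl_add coord_ring_simps(1))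
  show "val (a \<oplus>\<^bsub>\<A>\<^esub> b) g = val a g \<oplus>\<^bsub>U\<^esub> val b g" if "g \<in> G"
    using * FH that by (simp add: cl_add val_cl dpoly_point.ev_padd[OF G_point])
qed

lemma coord_zero:
  shows "\<zero>\<^bsub>\<A>\<^esub> \<in> carrier \<A>" and "g \<in> G \<Longrightarrow> val \<zero>\<^bsub>\<A>\<^esub> g = \<zero>\<^bsub>U\<^esub>"
proof -
  have 0: "A.indexed_const \<zero>\<^bsub>K\<^esub> \<in> dpolys" by (rule A.indexed_pset.indexed_const) simp
  have ev0: "ev g (A.indexed_const \<zero>\<^bsub>K\<^esub>) = \<zero>\<^bsub>U\<^esub>" if "g \<in> G" for g
    using dpoly_point.ev_const[OF G_point[OF that] A.zero_closed] by simp
  have eq: "\<zero>\<^bsub>\<A>\<^esub> = cl (A.indexed_const \<zero>\<^bsub>K\<^esub>)"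
    using ev0 by (auto simp: coord_ring_simps cl_eq[OF 0] vanishing_ideal_def dpoly_ring_simps)
  show "\<zero>\<^bsub>\<A>\<^esub> \<in> carrier \<A>" unfolding eq coord_ring_simps(1) using 0 by (rule imageI)
  show "val \<zero>\<^bsub>\<A>\<^esub> g = \<zero>\<^bsub>U\<^esub>" if "g \<in> G"
    unfolding eq val_cl[OF 0 that] by (rule ev0[OF that])
qed

lemma coord_scale:
  assumes "c \<in> carrier K" "a \<in> carrier \<A>"
  shows "coord_const K U \<iota> n G c \<otimes>\<^bsub>\<A>\<^esub> a \<in> carrier \<A>"
    and "g \<in> G \<Longrightarrow> val (coord_const K U \<iota> n G c \<otimes>\<^bsub>\<A>\<^esub> a) g = \<iota> c \<otimes>\<^bsub>U\<^esub> val a g"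
proof -
  obtain F where *: "a = cl F" "F \<in> dpolys" using assms by (auto simp: coord_ring_simps)
  have c: "A.indexed_const c \<in> dpolys" by (rule A.indexed_pset.indexed_const) fact
  have const: "coord_const K U \<iota> n G c = cl (A.indexed_const c)" by (simp add: coord_const_def cl_def)
  have cF: "mpoly_mult K (A.indexed_const c) F \<in> dpolys" by (rule A.mpoly_mult_closed[OF c *(2)])
  show "coord_const K U \<iota> n G c \<otimes>\<^bsub>\<A>\<^esub> a \<in> carrier \<A>"
    unfolding const *(1) cl_mult[OF c *(2)] coord_ring_simps(1) using cF by (rule imageI)
  show "val (coord_const K U \<iota> n G c \<otimes>\<^bsub>\<A>\<^esub> a) g = \<iota> c \<otimes>\<^bsub>U\<^esub> val a g" if "g \<in> G"
    unfolding const *(1) cl_mult[OF c *(2)] val_cl[OF cF that] val_cl[OF *(2) that]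
      dpoly_point.ev_mult[OF G_point[OF that] c *(2)] dpoly_point.ev_const[OF G_point[OF that] assms(1)] ..
qed

lemma coord_der:
  assumes "a \<in> carrier \<A>"
  shows "der \<A> a \<in> carrier \<A>" and "g \<in> G \<Longrightarrow> val (der \<A> a) g = der U (val a g)"
proof -
  obtain F where *: "a = cl F" "F \<in> dpolys" using assms by (auto simp: coord_ring_simps)
  have dF: "dpoly_der K F \<in> dpolys" by (rule A.dpoly_der_closed) fact
  show "der \<A> a \<in> carrier \<A>" using * dF by (simp add: cl_der coord_ring_simps(1))
  show "val (der \<A> a) g = der U (val a g)" if "g \<in> G"
    using * dF that by (simp add: cl_der val_cl dpoly_point.ev_der[OF G_point])
qed

lemma coord_der_pow:
  assumes "a \<in> carrier \<A>"
  shows "(der \<A> ^^ k) a \<in> carrier \<A>" and "g \<in> G \<Longrightarrow> val ((der \<A> ^^ k) a) g = (der U ^^ k) (val a g)"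
proof -
  show *: "(der \<A> ^^ k) a \<in> carrier \<A>" for k by (induction k) (auto simp: assms coord_der)
  show "val ((der \<A> ^^ k) a) g = (der U ^^ k) (val a g)" if "g \<in> G"
    by (induction k) (simp_all add: that coord_der *)
qed

lemma coord_add_pow:
  assumes "a \<in> carrier \<A>"
  shows "add_pow \<A> (k::nat) a \<in> carrier \<A>" and "g \<in> G \<Longrightarrow> val (add_pow \<A> k a) g = add_pow U k (val a g)"
proof -
  have Suc: "add_pow \<A> (Suc k) a = add_pow \<A> k a \<oplus>\<^bsub>\<A>\<^esub> a" and 0: "add_pow \<A> (0::nat) a = \<zero>\<^bsub>\<A>\<^esub>" for k :: nat
    by (simp_all add: add_pow_def nat_pow_def)
  show *: "add_pow \<A> k a \<in> carrier \<A>" for k :: nat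
    by (induction k) (simp_all add: Suc 0 assms coord_add coord_zero)
  show "val (add_pow \<A> k a) g = add_pow U k (val a g)" if "g \<in> G"
    by (induction k) (simp_all add: Suc 0 assms coord_add coord_zero that *)
qed

lemma coord_entry:
  assumes "i < n" "j < n"
  shows "coord_entry K U \<iota> n G i j \<in> carrier \<A>" and "g \<in> G \<Longrightarrow> val (coord_entry K U \<iota> n G i j) g = g i j"
proof -
  have v: "Entry i j \<in> gl_vars n" using assms by (auto simp: gl_vars_def)
  have eq: "coord_entry K U \<iota> n G i j = cl (A.indexed_var (Entry i j, 0))"
    by (simp add: coord_entry_def cl_def)
  have var: "A.indexed_var (Entry i j, 0) \<in> dpolys"
    unfolding A.indexed_var_def using v by (intro A.indexed_pset.intros) auto
  show "coord_entry K U \<iota> n G i j \<in> carrier \<A>" unfolding eq coord_ring_simps(1) using var by (rule imageI)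
  show "val (coord_entry K U \<iota> n G i j) g = g i j" if "g \<in> G"
    using var that v by (simp add: eq val_cl dpoly_point.ev_var[OF G_point])
qed

subsection \<open>Stability of the group under specializations\<close>

lemma specialization_sum_prod:
  assumes S: "S \<subseteq> carrier U" and \<sigma>: "specialization S \<sigma>" and f: "\<And>i. i \<in> I \<Longrightarrow> f i \<in> span S"
  shows "(\<Oplus>\<^bsub>U\<^esub>i\<in>I. f i) \<in> span S \<and> \<sigma> (\<Oplus>\<^bsub>U\<^esub>i\<in>I. f i) = (\<Oplus>\<^bsub>U\<^esub>i\<in>I. \<sigma> (f i))"
    and "(\<Otimes>\<^bsub>U\<^esub>i\<in>I. f i) \<in> span S \<and> \<sigma> (\<Otimes>\<^bsub>U\<^esub>i\<in>I. f i) = (\<Otimes>\<^bsub>U\<^esub>i\<in>I. \<sigma> (f i))"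
proof -
  have zero: "\<zero>\<^bsub>U\<^esub> \<in> span S" by (rule diff_span.span_incl) (auto intro!: image_eqI[of _ _ "\<zero>\<^bsub>K\<^esub>"])
  have one: "\<one>\<^bsub>U\<^esub> \<in> span S" by (rule diff_span.span_one)
  note simps = specialization_simps[OF S \<sigma>]
  have c: "f i \<in> carrier U" "\<sigma> (f i) \<in> carrier U" if "i \<in> I" for i
    using f[OF that] simps(1) span_closed[OF S] by auto
  show "(\<Oplus>\<^bsub>U\<^esub>i\<in>I. f i) \<in> span S \<and> \<sigma> (\<Oplus>\<^bsub>U\<^esub>i\<in>I. f i) = (\<Oplus>\<^bsub>U\<^esub>i\<in>I. \<sigma> (f i))"
    using f c
  proof (induction I rule: infinite_finite_induct)
    case (insert i I)
    then show ?case
      by (subst (1 2) B.finsum_insert) (auto simp: simps B.finsum_insert Pi_def intro!: diff_span.span_add)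
  qed (use zero simps(4)[OF zero zero] in auto)
  show "(\<Otimes>\<^bsub>U\<^esub>i\<in>I. f i) \<in> span S \<and> \<sigma> (\<Otimes>\<^bsub>U\<^esub>i\<in>I. f i) = (\<Otimes>\<^bsub>U\<^esub>i\<in>I. \<sigma> (f i))"
    using f c
  proof (induction I rule: infinite_finite_induct)
    case (insert i I)
    then show ?case
      by (subst (1 2) B.finprod_insert) (auto simp: simps B.finprod_insert Pi_def intro!: diff_span.span_mult)
  qed (use one simps(5)[OF zero zero] in auto)
qed

lemma specialization_det:
  assumes S: "S \<subseteq> carrier U" and \<sigma>: "specialization S \<sigma>"
    and g: "\<And>i j. i < n \<Longrightarrow> j < n \<Longrightarrow> g i j \<in> span S"
  shows "mat_det U n g \<in> span S" and "\<sigma> (mat_det U n g) = mat_det U n (\<lambda>i j. \<sigma> (g i j))"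
proof -
  have p: "p i < n" if "p permutes {..<n}" "i < n" for p i
    using that permutes_in_image[OF that(1), of i] by auto
  note simps = specialization_simps[OF S \<sigma>]
  have t: "(\<Otimes>\<^bsub>U\<^esub>i\<in>{..<n}. g i (p i)) \<in> span S"
    "\<sigma> (\<Otimes>\<^bsub>U\<^esub>i\<in>{..<n}. g i (p i)) = (\<Otimes>\<^bsub>U\<^esub>i\<in>{..<n}. \<sigma> (g i (p i)))" if "p permutes {..<n}" for p
    using specialization_sum_prod(2)[OF S \<sigma>, of "{..<n}" "\<lambda>i. g i (p i)"] g p[OF that] by auto
  let ?f = "\<lambda>p. if evenperm p then \<Otimes>\<^bsub>U\<^esub>i\<in>{..<n}. g i (p i) else \<ominus>\<^bsub>U\<^esub> (\<Otimes>\<^bsub>U\<^esub>i\<in>{..<n}. g i (p i))"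
  have f: "?f p \<in> span S" if "p \<in> {p. p permutes {..<n}}" for p
    using t that by (auto intro: diff_span.span_a_inv)
  note sum = specialization_sum_prod(1)[OF S \<sigma> f]
  show "mat_det U n g \<in> span S" unfolding mat_det_def by (rule conjunct1[OF sum])
  have "\<sigma> (mat_det U n g) = (\<Oplus>\<^bsub>U\<^esub>p\<in>{p. p permutes {..<n}}. \<sigma> (?f p))"
    unfolding mat_det_def by (rule conjunct2[OF sum])
  also have "\<dots> = mat_det U n (\<lambda>i j. \<sigma> (g i j))"
    unfolding mat_det_def using t p simps(1)[OF g g] simps(6)[OF t(1) t(1)]
    by (intro B.finsum_cong') (auto intro!: B.finprod_closed B.a_inv_closed)
  finally show "\<sigma> (mat_det U n g) = mat_det U n (\<lambda>i j. \<sigma> (g i j))" .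
qed

text \<open>The equations of the group have coefficients in \<open>K\<close>, which the embedding
  fixes, so evaluation commutes with it. The variable \<open>InvDet\<close> is covered because
  \<open>\<sigma>\<close> maps the inverse of the determinant to the inverse of its image.\<close>

lemma specialization_stable:
  assumes g: "g \<in> G" and S: "S \<subseteq> carrier U" and \<sigma>: "specialization S \<sigma>"
    and gS: "\<And>i j. i < n \<Longrightarrow> j < n \<Longrightarrow> g i j \<in> S"
  shows "(\<lambda>i\<in>{..<n}. \<lambda>j\<in>{..<n}. \<sigma> (g i j)) \<in> G" (is "?g \<in> G")
proof -
  have gs: "g i j \<in> span S" if "i < n" "j < n" for i j using gS[OF that] by (auto intro: diff_span.span_incl)
  note simps = specialization_simps[OF S \<sigma>]
  have K: "\<iota> c \<in> span S" "\<sigma> (\<iota> c) = \<iota> c" if "c \<in> carrier K" for c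
    using that \<sigma> by (auto intro: diff_span.span_incl simp: specialization_def)
  have zero: "\<zero>\<^bsub>U\<^esub> \<in> span S" using K(1)[OF A.zero_closed] by simp
  have der: "(der U ^^ k) u \<in> span S \<and> \<sigma> ((der U ^^ k) u) = (der U ^^ k) (\<sigma> u)" if "u \<in> span S" for u k
    by (induction k) (use that \<sigma> in \<open>auto simp: specialization_def diff_hom_def intro: diff_span.span_der\<close>)
  have det_eq: "mat_det U n ?g = \<sigma> (mat_det U n g)"
    using specialization_det(2)[OF S \<sigma> gs] simps(1)[OF gs gs]
    by simp (rule B.mat_det_cong, auto)
  let ?d = "mat_det U n g"
  have d: "?d \<in> span S" by (rule specialization_det(1)[OF S \<sigma> gs])
  have dU: "?d \<in> Units U"
    using G_GL[OF g] span_closed[OF S d] by (simp add: GL_simps B.field_Units)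
  have d0: "?d \<noteq> \<zero>\<^bsub>U\<^esub>" using G_GL[OF g] by (simp add: GL_simps)
  have i: "inv\<^bsub>U\<^esub> ?d \<in> span S" by (rule diff_span.span_m_inv[OF d d0])
  have prod: "\<sigma> ?d \<otimes>\<^bsub>U\<^esub> \<sigma> (inv\<^bsub>U\<^esub> ?d) = \<one>\<^bsub>U\<^esub>"
    using simps(3)[OF d i] simps(5)[OF zero zero] dU by simp
  have inv: "\<sigma> (inv\<^bsub>U\<^esub> ?d) = inv\<^bsub>U\<^esub> (\<sigma> ?d)"
    using B.comm_inv_char[OF simps(1)[OF d d] simps(1)[OF i i] prod] by simp
  have "\<sigma> ?d \<noteq> \<zero>\<^bsub>U\<^esub>" using prod simps(1)[OF i i] by auto
  then have GL: "?g \<in> carrier (GL U n)"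
    using det_eq simps(1)[OF gs gs] by (auto simp: GL_simps intro!: mats_restrict)
  interpret g: dpoly_point K U \<iota> "gl_vars n" "gl_point U n g" by (rule G_point[OF g])
  interpret g': dpoly_point K U \<iota> "gl_vars n" "gl_point U n ?g" by (rule GL_point[OF GL])
  have pt: "gl_point U n g v \<in> span S" "gl_point U n ?g v = \<sigma> (gl_point U n g v)" if "v \<in> gl_vars n" for v
    using that gs i det_eq inv by (auto simp: gl_vars_def)
  have ev: "ev g F \<in> span S \<and> ev ?g F = \<sigma> (ev g F)" if "F \<in> dpolys" for F
    using that
  proof induction
    case (indexed_const k)
    then show ?case using K[OF indexed_const] by (simp only: g.ev_const g'.ev_const)
  next
    case (indexed_padd P Q)
    then show ?case
      using simps(2)[of "ev g P" "ev g Q"]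
      by (simp only: g.ev_padd g'.ev_padd) (auto intro: diff_span.span_add)
  next
    case (indexed_pmult P x)
    then obtain v k where x: "x = (v, k)" "v \<in> gl_vars n" by auto
    note d = der[OF pt(1)[OF x(2)], of k]
    note IH = conjunct1[OF indexed_pmult.IH] conjunct2[OF indexed_pmult.IH]
    show ?case
      unfolding x(1) g.ev_pmult[OF indexed_pmult.hyps(1) x(2)] g'.ev_pmult[OF indexed_pmult.hyps(1) x(2)]
        pt(2)[OF x(2)] conjunct2[OF d, symmetric] IH(2)
      by (rule conjI[OF diff_span.span_mult[OF IH(1) conjunct1[OF d]] simps(3)[OF IH(1) conjunct1[OF d], symmetric]])
  qed
  obtain E where E: "E \<subseteq> carrier (dpoly_ring K (gl_vars n))"
    "G = {g \<in> carrier (GL U n). \<forall>F\<in>E. ev g F = \<zero>\<^bsub>U\<^esub>}"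
    using ldag by (auto simp: linear_diff_alg_group_def)
  have "ev ?g F = \<zero>\<^bsub>U\<^esub>" if "F \<in> E" for F
  proof -
    have "F \<in> dpolys" using that E(1) by (auto simp: dpoly_ring_simps)
    moreover have "ev g F = \<zero>\<^bsub>U\<^esub>" using g that E(2) by blast
    ultimately show ?thesis using ev simps(4)[OF zero zero] by simp
  qed
  then show ?thesis using GL E(2) by blast
qed

end

section \<open>Tensor products\<close>

lemma hom_finprod_comm_group:
  assumes "comm_group G" "comm_group H" "h \<in> hom G H" "f \<in> I \<rightarrow> carrier G"
  shows "h (finprod G f I) = finprod H (\<lambda>i. h (f i)) I"
proof -
  interpret G: comm_group G by fact
  interpret H: comm_group H by fact
  interpret group_hom G H h by unfold_locales fact
  show ?thesis
    using assms(4)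
  proof (induction I rule: infinite_finite_induct)
    case (insert i I)
    then have "f i \<in> carrier G" "f \<in> I \<rightarrow> carrier G" by auto
    moreover from this have "(\<lambda>i. h (f i)) \<in> I \<rightarrow> carrier H" by (auto simp: Pi_def)
    ultimately show ?case using insert by simp
  qed simp_all
qed

text \<open>These closure properties place the tensor relations in the free abelian group on the
  pairs.\<close>

locale tensor_pair =
  fixes K :: "('a, 'k) ring_scheme" and L :: "('b, 'l) ring_scheme" and e :: "'a \<Rightarrow> 'b"
    and A :: "('x, 'm) ring_scheme" and u :: "'a \<Rightarrow> 'x"
  assumes cring_L: "cring L"
    and e_closed: "c \<in> carrier K \<Longrightarrow> e c \<in> carrier L"
    and A_add: "a \<in> carrier A \<Longrightarrow> b \<in> carrier A \<Longrightarrow> a \<oplus>\<^bsub>A\<^esub> b \<in> carrier A"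
    and A_scale: "c \<in> carrier K \<Longrightarrow> a \<in> carrier A \<Longrightarrow> u c \<otimes>\<^bsub>A\<^esub> a \<in> carrier A"
begin

interpretation L: cring L by (rule cring_L)

abbreviation "\<F> \<equiv> free_Abelian_group (carrier L \<times> carrier A)"
abbreviation "\<N> \<equiv> tensor_null K L e A u"
abbreviation "\<T> \<equiv> tensor_product K L e A u"
abbreviation "pure \<equiv> pure_tensor K L e A u"

interpretation F: comm_group \<F> by (rule abelian_free_Abelian_group)

lemma frag_closed: "x \<in> carrier L \<Longrightarrow> a \<in> carrier A \<Longrightarrow> frag_of (x, a) \<in> carrier \<F>"
  by simp

lemma frag_diff: "p \<in> carrier \<F> \<Longrightarrow> q \<in> carrier \<F> \<Longrightarrow> p - q \<in> carrier \<F>"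
  using keys_diff[of p q] by auto

lemma relations_closed: "tensor_relations K L e A u \<subseteq> carrier \<F>"
  unfolding tensor_relations_def
  using e_closed A_add A_scale by (auto intro!: frag_diff simp del: carrier_free_Abelian_group_iff)

lemma subgroup_null: "subgroup \<N> \<F>"
  unfolding tensor_null_def by (rule F.generate_is_subgroup[OF relations_closed])

lemma normal_null: "\<N> \<lhd> \<F>"
  using F.normal_iff_subgroup subgroup_null by simp

lemma comm_group_tensor: "comm_group \<T>"
  unfolding tensor_product_def by (rule F.abelian_FactGroup[OF subgroup_null])

lemma coset_eqI:
  assumes "p \<in> carrier \<F>" "q \<in> carrier \<F>" "p - q \<in> tensor_relations K L e A u"
  shows "\<N> #>\<^bsub>\<F>\<^esub> p = \<N> #>\<^bsub>\<F>\<^esub> q"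
proof -
  have "p - q \<in> \<N>" unfolding tensor_null_def by (rule generate.incl) fact
  then have "p \<in> \<N> #>\<^bsub>\<F>\<^esub> q" by (auto simp: r_coset_def intro!: bexI[of _ "p - q"])
  then show ?thesis using F.repr_independence[OF _ assms(2) subgroup_null] by metis
qed

lemma pure_closed: "x \<in> carrier L \<Longrightarrow> a \<in> carrier A \<Longrightarrow> pure x a \<in> carrier \<T>"
  by (auto simp: pure_tensor_def tensor_product_def carrier_FactGroup simp del: carrier_free_Abelian_group_iff)

lemma pure_mult:
  assumes "x \<in> carrier L" "a \<in> carrier A" "y \<in> carrier L" "b \<in> carrier A"
  shows "pure x a \<otimes>\<^bsub>\<T>\<^esub> pure y b = \<N> #>\<^bsub>\<F>\<^esub> (frag_of (x, a) + frag_of (y, b))"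
  using normal.rcos_sum[OF normal_null frag_closed[OF assms(1,2)] frag_closed[OF assms(3,4)]]
  by (simp add: pure_tensor_def tensor_product_def)

lemma pure_add_right:
  assumes "x \<in> carrier L" "a \<in> carrier A" "b \<in> carrier A"
  shows "pure x a \<otimes>\<^bsub>\<T>\<^esub> pure x b = pure x (a \<oplus>\<^bsub>A\<^esub> b)"
proof -
  have "\<N> #>\<^bsub>\<F>\<^esub> frag_of (x, a \<oplus>\<^bsub>A\<^esub> b) = \<N> #>\<^bsub>\<F>\<^esub> (frag_of (x, a) + frag_of (x, b))"
  proof (rule coset_eqI)
    show "frag_of (x, a) + frag_of (x, b) \<in> carrier \<F>"
      using F.m_closed[OF frag_closed[OF assms(1,2)] frag_closed[OF assms(1,3)]] by simp
    show "frag_of (x, a \<oplus>\<^bsub>A\<^esub> b) - (frag_of (x, a) + frag_of (x, b)) \<in> tensor_relations K L e A u"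
      unfolding tensor_relations_def diff_diff_eq[symmetric] using assms by blast
  qed (use assms A_add in simp)
  then show ?thesis using pure_mult[OF assms(1,2,1,3)] by (simp add: pure_tensor_def)
qed

lemma pure_balanced:
  assumes "c \<in> carrier K" "x \<in> carrier L" "a \<in> carrier A"
  shows "pure (e c \<otimes>\<^bsub>L\<^esub> x) a = pure x (u c \<otimes>\<^bsub>A\<^esub> a)"
  unfolding pure_tensor_def
proof (rule coset_eqI)
  show "frag_of (e c \<otimes>\<^bsub>L\<^esub> x, a) - frag_of (x, u c \<otimes>\<^bsub>A\<^esub> a) \<in> tensor_relations K L e A u"
    unfolding tensor_relations_def using assms by blast
qed (use assms e_closed A_scale in simp_all)

text \<open>The universal property: extend \<open>\<beta>\<close> additively from pairs to the free
  abelian group. The relations lie in the kernel, so the extension factors through the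
  quotient.\<close>

lemma tensor_lift:
  assumes H: "comm_group H"
    and closed: "\<And>x a. x \<in> carrier L \<Longrightarrow> a \<in> carrier A \<Longrightarrow> \<beta> x a \<in> carrier H"
    and left: "\<And>x y a. x \<in> carrier L \<Longrightarrow> y \<in> carrier L \<Longrightarrow> a \<in> carrier A \<Longrightarrow> \<beta> (x \<oplus>\<^bsub>L\<^esub> y) a = \<beta> x a \<otimes>\<^bsub>H\<^esub> \<beta> y a"
    and right: "\<And>x a b. x \<in> carrier L \<Longrightarrow> a \<in> carrier A \<Longrightarrow> b \<in> carrier A \<Longrightarrow> \<beta> x (a \<oplus>\<^bsub>A\<^esub> b) = \<beta> x a \<otimes>\<^bsub>H\<^esub> \<beta> x b"
    and balanced: "\<And>c x a. c \<in> carrier K \<Longrightarrow> x \<in> carrier L \<Longrightarrow> a \<in> carrier A \<Longrightarrow> \<beta> (e c \<otimes>\<^bsub>L\<^esub> x) a = \<beta> x (u c \<otimes>\<^bsub>A\<^esub> a)"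
  obtains h where "h \<in> hom \<T> H" "\<And>x a. x \<in> carrier L \<Longrightarrow> a \<in> carrier A \<Longrightarrow> h (pure x a) = \<beta> x a"
proof -
  interpret H: comm_group H by fact
  obtain h0 where h0: "h0 \<in> hom \<F> H" "\<And>p. p \<in> carrier L \<times> carrier A \<Longrightarrow> h0 (frag_of p) = (\<lambda>(x, a). \<beta> x a) p"
    by (rule H.free_Abelian_group_universal[of "\<lambda>(x, a). \<beta> x a" "carrier L \<times> carrier A"])
      (use closed in auto)
  interpret h0: group_hom \<F> H h0 by unfold_locales fact
  have diff: "h0 (p - q) = h0 p \<otimes>\<^bsub>H\<^esub> inv\<^bsub>H\<^esub> h0 q" if "p \<in> carrier \<F>" "q \<in> carrier \<F>" for p q
  proof -
    have "p - q = p \<otimes>\<^bsub>\<F>\<^esub> inv\<^bsub>\<F>\<^esub> q" using that by simp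
    then show ?thesis using that by (simp only: h0.hom_mult h0.hom_inv F.inv_closed)
  qed
  have "tensor_relations K L e A u \<subseteq> kernel \<F> H h0"
  proof
    fix r assume r: "r \<in> tensor_relations K L e A u"
    then have rF: "r \<in> carrier \<F>" using relations_closed by blast
    have f: "h0 (frag_of (x, a)) = \<beta> x a" if "x \<in> carrier L" "a \<in> carrier A" for x a
      using h0(2) that by simp
    have "h0 r = \<one>\<^bsub>H\<^esub>"
      using r unfolding tensor_relations_def
    proof (elim UnE CollectE exE conjE)
      fix x y a assume *: "r = frag_of (x \<oplus>\<^bsub>L\<^esub> y, a) - frag_of (x, a) - frag_of (y, a)"
        "x \<in> carrier L" "y \<in> carrier L" "a \<in> carrier A"
      then show ?thesis
        using closed H.inv_mult[of "\<beta> x a" "\<beta> y a"] H.r_inv[of "\<beta> x a \<otimes>\<^bsub>H\<^esub> \<beta> y a"]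
        by (simp add: diff frag_diff f left H.m_assoc del: carrier_free_Abelian_group_iff H.r_inv)
    next
      fix x a b assume *: "r = frag_of (x, a \<oplus>\<^bsub>A\<^esub> b) - frag_of (x, a) - frag_of (x, b)"
        "x \<in> carrier L" "a \<in> carrier A" "b \<in> carrier A"
      then show ?thesis
        using closed A_add H.inv_mult[of "\<beta> x a" "\<beta> x b"] H.r_inv[of "\<beta> x a \<otimes>\<^bsub>H\<^esub> \<beta> x b"]
        by (simp add: diff frag_diff f right H.m_assoc del: carrier_free_Abelian_group_iff H.r_inv)
    next
      fix c x a assume *: "r = frag_of (e c \<otimes>\<^bsub>L\<^esub> x, a) - frag_of (x, u c \<otimes>\<^bsub>A\<^esub> a)"
        "c \<in> carrier K" "x \<in> carrier L" "a \<in> carrier A"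
      then show ?thesis
        using closed e_closed A_scale by (simp add: diff f balanced del: carrier_free_Abelian_group_iff)
    qed
    then show "r \<in> kernel \<F> H h0" using rF by (simp add: kernel_def)
  qed
  then have "\<N> \<subseteq> kernel \<F> H h0"
    unfolding tensor_null_def by (rule F.generate_subgroup_incl) (rule h0.subgroup_kernel)
  then obtain h where h: "h \<in> hom (\<F> Mod \<N>) H" "\<And>p. p \<in> carrier \<F> \<Longrightarrow> h (\<N> #>\<^bsub>\<F>\<^esub> p) = h0 p"
    using h0.FactGroup_universal_kernel[OF normal_null] by metis
  show ?thesis
  proof (rule that)
    show "h \<in> hom \<T> H" using h(1) by (simp add: tensor_product_def)
    fix x a assume "x \<in> carrier L" "a \<in> carrier A"
    then show "h (pure x a) = \<beta> x a"
      using h(2)[OF frag_closed] h0(2) by (simp add: pure_tensor_def)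
  qed
qed

end

section \<open>Prolongations of a group with a gauge matrix\<close>

context ring
begin

lemma add_pow_finsum:
  assumes "f \<in> T \<rightarrow> carrier R"
  shows "add_pow R (k::nat) (\<Oplus>t\<in>T. f t) = (\<Oplus>t\<in>T. add_pow R k (f t))"
  using assms
proof (induction T rule: infinite_finite_induct)
  case (insert t T)
  then show ?case by (simp add: Pi_def add.nat_pow_distrib)
qed simp_all

text \<open>The coefficients of the product of two exponential generating series;
  \<open>conv_Suc\<close> is the product rule for differentiating such a series, which shifts its
  coefficients.\<close>

definition conv :: "(nat \<Rightarrow> 'a) \<Rightarrow> (nat \<Rightarrow> 'a) \<Rightarrow> nat \<Rightarrow> 'a" where
  "conv v w k = (\<Oplus>r\<in>{..k}. add_pow R (k choose r) (v r \<otimes> w (k - r)))"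

lemma conv_closed: "(\<And>k. v k \<in> carrier R) \<Longrightarrow> (\<And>k. w k \<in> carrier R) \<Longrightarrow> conv v w k \<in> carrier R"
  unfolding conv_def by (intro finsum_closed) auto

lemma conv_Suc:
  assumes v: "\<And>k. v k \<in> carrier R" and w: "\<And>k. w k \<in> carrier R"
  shows "conv v w (Suc k) = conv (\<lambda>r. v (Suc r)) w k \<oplus> conv v (\<lambda>r. w (Suc r)) k"
proof -
  let ?f = "\<lambda>r. v r \<otimes> w (Suc k - r)"
  have cl: "add_pow R (j::nat) (v r \<otimes> w s) \<in> carrier R" for j r s using v w by simp
  have "conv v w (Suc k) = (\<Oplus>r\<in>{..k}. add_pow R ((k choose r) + (k choose Suc r)) (v (Suc r) \<otimes> w (k - r)))
      \<oplus> v 0 \<otimes> w (Suc k)"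
  proof -
    have "conv v w (Suc k) = (\<Oplus>r\<in>{..k}. add_pow R (Suc k choose Suc r) (?f (Suc r))) \<oplus> add_pow R (Suc k choose 0) (?f 0)"
      unfolding conv_def using v w by (intro finsum_Suc2) auto
    also have "(\<Oplus>r\<in>{..k}. add_pow R (Suc k choose Suc r) (?f (Suc r))) =
        (\<Oplus>r\<in>{..k}. add_pow R ((k choose r) + (k choose Suc r)) (v (Suc r) \<otimes> w (k - r)))"
      using v w by (intro finsum_cong') auto
    finally show ?thesis using v w by simp
  qed
  also have "(\<Oplus>r\<in>{..k}. add_pow R ((k choose r) + (k choose Suc r)) (v (Suc r) \<otimes> w (k - r))) =
      (\<Oplus>r\<in>{..k}. add_pow R (k choose r) (v (Suc r) \<otimes> w (k - r)) \<oplus>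
        add_pow R (k choose Suc r) (v (Suc r) \<otimes> w (k - r)))"
    using v w by (intro finsum_cong') (auto simp: add.nat_pow_mult)
  also have "\<dots> = conv (\<lambda>r. v (Suc r)) w k \<oplus> (\<Oplus>r\<in>{..k}. add_pow R (k choose Suc r) (v (Suc r) \<otimes> w (k - r)))"
    unfolding conv_def using cl by (intro finsum_addf) auto
  also have "\<dots> \<oplus> v 0 \<otimes> w (Suc k) = conv (\<lambda>r. v (Suc r)) w k \<oplus>
      ((\<Oplus>r\<in>{..k}. add_pow R (k choose Suc r) (v (Suc r) \<otimes> w (k - r))) \<oplus> v 0 \<otimes> w (Suc k))"
    using v w cl by (intro a_assoc conv_closed finsum_closed) auto
  also have "(\<Oplus>r\<in>{..k}. add_pow R (k choose Suc r) (v (Suc r) \<otimes> w (k - r))) \<oplus> v 0 \<otimes> w (Suc k) =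
      (\<Oplus>r\<in>{..Suc k}. add_pow R (k choose r) (?f r))"
    by (subst finsum_Suc2) (use v w in auto)
  also have "\<dots> = (\<Oplus>r\<in>{..k}. add_pow R (k choose r) (?f r))"
    by (subst finsum_Suc) (use v w in \<open>auto simp: binomial_eq_0\<close>)
  also have "\<dots> = conv v (\<lambda>r. w (Suc r)) k"
    unfolding conv_def using v w by (intro finsum_cong') (auto simp: Suc_diff_le)
  finally show ?thesis .
qed

lemma conv_linear:
  assumes "\<And>k. v k \<in> carrier R" "\<And>k. v' k \<in> carrier R" "\<And>k. w k \<in> carrier R" "\<And>k. w' k \<in> carrier R"
    and "c \<in> carrier R"
  shows "conv (\<lambda>k. v k \<oplus> v' k) w k = conv v w k \<oplus> conv v' w k"
    and "conv v (\<lambda>k. w k \<oplus> w' k) k = conv v w k \<oplus> conv v w' k"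
    and "conv (\<lambda>k. c \<otimes> v k) w k = c \<otimes> conv v w k"
    and "conv v (\<lambda>k. w k \<otimes> c) k = conv v w k \<otimes> c"
    and "conv (\<lambda>k. v k \<otimes> c) w k = conv v (\<lambda>k. c \<otimes> w k) k"
proof -
  show "conv (\<lambda>k. v k \<oplus> v' k) w k = conv v w k \<oplus> conv v' w k"
    unfolding conv_def using assms
    by (subst finsum_addf[symmetric]) (auto intro!: finsum_cong' simp: l_distr add.nat_pow_distrib)
  show "conv v (\<lambda>k. w k \<oplus> w' k) k = conv v w k \<oplus> conv v w' k"
    unfolding conv_def using assms
    by (subst finsum_addf[symmetric]) (auto intro!: finsum_cong' simp: r_distr add.nat_pow_distrib)
  show "conv (\<lambda>k. c \<otimes> v k) w k = c \<otimes> conv v w k"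
    unfolding conv_def using assms
    by (subst finsum_rdistr) (auto intro!: finsum_cong' simp: m_assoc add_pow_rdistr)
  show "conv v (\<lambda>k. w k \<otimes> c) k = conv v w k \<otimes> c"
    unfolding conv_def using assms
    by (subst finsum_ldistr) (auto intro!: finsum_cong' simp: m_assoc add_pow_ldistr)
  show "conv (\<lambda>k. v k \<otimes> c) w k = conv v (\<lambda>k. c \<otimes> w k) k"
    unfolding conv_def using assms by (intro finsum_cong') (auto simp: m_assoc)
qed

text \<open>Formally, the matrix in the basis \<open>t^m\<close> of the operator that sums
  \<open>(v k / k!) (d/dt)^k\<close> over \<open>k\<close>, on polynomials of degree at most
  \<open>p\<close>. Composition of such operators multiplies the series, hence products of matrices
  become convolutions.\<close>

definition binomial_mat :: "nat \<Rightarrow> (nat \<Rightarrow> 'a) \<Rightarrow> nat \<Rightarrow> nat \<Rightarrow> 'a" where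
  "binomial_mat p v = (\<lambda>s\<in>{..p}. \<lambda>m\<in>{..p}. if s \<le> m then add_pow R (m choose s) (v (m - s)) else \<zero>)"

lemma binomial_mat_closed: "(\<And>k. v k \<in> carrier R) \<Longrightarrow> binomial_mat p v \<in> mats R {..p} {..p}"
  unfolding binomial_mat_def by (intro mats_restrict) auto

lemma binomial_mat_mult:
  assumes v: "\<And>k. v k \<in> carrier R" and w: "\<And>k. w k \<in> carrier R"
  shows "mat_mult R {..p} {..p} {..p} (binomial_mat p v) (binomial_mat p w) = binomial_mat p (conv v w)"
proof (rule mats_eqI[OF mat_mult_closed])
  fix s m assume "s \<in> {..p}" "m \<in> {..p}"
  then have sm: "s \<le> p" "m \<le> p" by auto
  let ?f = "\<lambda>q. binomial_mat p v s q \<otimes> binomial_mat p w q m"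
  have f: "?f q \<in> carrier R" if "q \<le> p" for q using that sm v w by (simp add: binomial_mat_def)
  have f0: "?f q = \<zero>" if "q \<le> p" "q \<notin> {s..m}" for q
    using that sm v w by (auto simp: binomial_mat_def)
  have sub: "(\<Oplus>q\<in>{..p}. ?f q) = (\<Oplus>q\<in>{s..m}. ?f q)"
    using sm f f0 by (intro add.finprod_mono_neutral_cong_right) auto
  have "(\<Oplus>q\<in>{s..m}. ?f q) = binomial_mat p (conv v w) s m"
  proof (cases "s \<le> m")
    case True
    let ?k = "m - s"
    have eq: "{s..m} = (+) s ` {..?k}" using True by (simp add: atMost_atLeast0)
    have "(\<Oplus>q\<in>{s..m}. ?f q) = (\<Oplus>r\<in>{..?k}. ?f (s + r))"
      unfolding eq by (rule finsum_reindex) (use f sm in \<open>auto intro: inj_onI\<close>)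
    also have "\<dots> = (\<Oplus>r\<in>{..?k}. add_pow R (m choose s) (add_pow R (?k choose r) (v r \<otimes> w (?k - r))))"
    proof (intro finsum_cong' refl)
      fix r assume r: "r \<in> {..?k}"
      have "(s + r choose s) * (m choose (s + r)) = (?k choose r) * (m choose s)"
        using choose_mult[of s "s + r" m] r True by (simp add: mult.commute)
      moreover have "s + r \<le> m" "s + r \<le> p" using r True sm by auto
      ultimately show "?f (s + r) = add_pow R (m choose s) (add_pow R (?k choose r) (v r \<otimes> w (?k - r)))"
        using r sm True v w
        by (simp add: binomial_mat_def add_pow_ldistr add_pow_rdistr add.nat_pow_pow mult.commute)
    qed (use v w in auto)
    also have "\<dots> = add_pow R (m choose s) (conv v w ?k)"
      unfolding conv_def using v w by (subst add_pow_finsum) auto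
    finally show ?thesis using True sm by (simp add: binomial_mat_def)
  qed (use sm in \<open>simp add: binomial_mat_def\<close>)
  then show "mat_mult R {..p} {..p} {..p} (binomial_mat p v) (binomial_mat p w) s m = binomial_mat p (conv v w) s m"
    using sm sub by (simp add: mat_mult_entry)
qed (fact binomial_mat_closed[OF v] binomial_mat_closed[OF w] binomial_mat_closed[OF conv_closed[OF v w]])+

lemma binomial_mat_delta: "binomial_mat p (\<lambda>k. if k = 0 then \<one> else \<zero>) = mat_one R {..p}"
  by (auto simp: binomial_mat_def mat_one_def fun_eq_iff)

end

section \<open>Powers of the gauge operator\<close>

context der_ring
begin

text \<open>The operators \<open>(D + \<beta>)\<^sup>k\<close> and \<open>(D - \<sqdot> \<beta>)\<^sup>k\<close> applied to \<open>1\<close>.\<close>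

primrec gauge_pow :: "'a \<Rightarrow> nat \<Rightarrow> 'a" where
  "gauge_pow \<beta> 0 = \<one>"
| "gauge_pow \<beta> (Suc k) = \<beta> \<otimes> gauge_pow \<beta> k \<oplus> D (gauge_pow \<beta> k)"

primrec dual_gauge_pow :: "'a \<Rightarrow> nat \<Rightarrow> 'a" where
  "dual_gauge_pow \<beta> 0 = \<one>"
| "dual_gauge_pow \<beta> (Suc k) = D (dual_gauge_pow \<beta> k) \<oplus> dual_gauge_pow \<beta> k \<otimes> \<ominus> \<beta>"

lemma gauge_pow_closed: "\<beta> \<in> carrier R \<Longrightarrow> gauge_pow \<beta> k \<in> carrier R"
  by (induction k) (auto simp: D_closed)

lemma dual_gauge_pow_closed: "\<beta> \<in> carrier R \<Longrightarrow> dual_gauge_pow \<beta> k \<in> carrier R"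
  by (induction k) (auto simp: D_closed)

lemma D_conv:
  assumes v: "\<And>k. v k \<in> carrier R" and w: "\<And>k. w k \<in> carrier R"
  shows "D (conv v w k) = conv (\<lambda>k. D (v k)) w k \<oplus> conv v (\<lambda>k. D (w k)) k"
proof -
  have "D (conv v w k) = (\<Oplus>r\<in>{..k}. add_pow R (k choose r) (D (v r) \<otimes> w (k - r)) \<oplus>
      add_pow R (k choose r) (v r \<otimes> D (w (k - r))))"
    unfolding conv_def using v w
    by (subst D_finsum) (auto intro!: finsum_cong' simp: D_add_pow D_mult D_closed add.nat_pow_distrib)
  also have "\<dots> = conv (\<lambda>k. D (v k)) w k \<oplus> conv v (\<lambda>k. D (w k)) k"
    unfolding conv_def using v w by (intro finsum_addf) (auto simp: D_closed)
  finally show ?thesis .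
qed

lemma conv_0: "v 0 \<in> carrier R \<Longrightarrow> w 0 \<in> carrier R \<Longrightarrow> conv v w 0 = v 0 \<otimes> w 0"
  by (simp add: conv_def)

lemma conv_gauge_pow_Suc:
  assumes \<beta>: "\<beta> \<in> carrier R" and w: "\<And>k. w k \<in> carrier R"
  shows "conv (gauge_pow \<beta>) w (Suc k) =
    \<beta> \<otimes> conv (gauge_pow \<beta>) w k \<oplus> (conv (\<lambda>k. D (gauge_pow \<beta> k)) w k \<oplus> conv (gauge_pow \<beta>) (\<lambda>k. w (Suc k)) k)"
proof -
  note b = gauge_pow_closed[OF \<beta>]
  have Db: "D (gauge_pow \<beta> k) \<in> carrier R" and bb: "\<beta> \<otimes> gauge_pow \<beta> k \<in> carrier R" for k
    using b \<beta> by (simp_all add: D_closed)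
  have "conv (\<lambda>k. gauge_pow \<beta> (Suc k)) w k = \<beta> \<otimes> conv (gauge_pow \<beta>) w k \<oplus> conv (\<lambda>k. D (gauge_pow \<beta> k)) w k"
    using conv_linear(1)[OF bb Db w w \<beta>] conv_linear(3)[OF b b w w \<beta>] by simp
  then show ?thesis
    using conv_Suc[OF b w] conv_closed[OF b w] conv_closed[OF Db w] conv_closed[of "gauge_pow \<beta>" "\<lambda>k. w (Suc k)"] b w \<beta>
    by (simp add: a_assoc)
qed

text \<open>For the convolution \<open>c\<close> the two recursions give
  \<open>c (k + 1) = \<beta> c k + D (c k) - c k \<beta>\<close>. Starting from
  \<open>c 0 = 1\<close>, this is 0 from \<open>k + 1 = 1\<close> on.\<close>

lemma conv_gauge_dual:
  assumes \<beta>: "\<beta> \<in> carrier R"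
  shows "conv (gauge_pow \<beta>) (dual_gauge_pow \<beta>) k = (if k = 0 then \<one> else \<zero>)"
proof (induction k)
  case 0
  then show ?case by (simp add: conv_0)
next
  case (Suc k)
  let ?b = "gauge_pow \<beta>" and ?d = "dual_gauge_pow \<beta>"
  note b = gauge_pow_closed[OF \<beta>] and d = dual_gauge_pow_closed[OF \<beta>]
  have n: "\<ominus> \<beta> \<in> carrier R" using \<beta> by simp
  have Dd: "D (?d k) \<in> carrier R" and dn: "?d k \<otimes> \<ominus> \<beta> \<in> carrier R" and Db: "D (?b k) \<in> carrier R" for k
    using b d \<beta> by (simp_all add: D_closed)
  note cl = conv_closed[OF b d] conv_closed[OF Db d] conv_closed[OF b Dd]
  have "conv ?b (\<lambda>k. ?d (Suc k)) k = conv ?b (\<lambda>k. D (?d k)) k \<oplus> conv ?b ?d k \<otimes> \<ominus> \<beta>"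
    using conv_linear(2)[OF b b Dd dn \<beta>] conv_linear(4)[OF b b d d n] by simp
  then have "conv ?b ?d (Suc k) = \<beta> \<otimes> conv ?b ?d k \<oplus> (D (conv ?b ?d k) \<oplus> conv ?b ?d k \<otimes> \<ominus> \<beta>)"
    using conv_gauge_pow_Suc[where w = ?d, OF \<beta> d] D_conv[OF b d] cl \<beta> by (simp add: a_assoc)
  then show ?case using \<beta> unfolding Suc by (auto simp: D_one D_zero r_neg)
qed

text \<open>In this order the two contributions of \<open>\<beta>\<close> meet between the factors
  and cancel, which leaves \<open>c (k + 1) = D (c k)\<close> with \<open>c 0 = 1\<close>.\<close>

lemma conv_dual_gauge:
  assumes \<beta>: "\<beta> \<in> carrier R"
  shows "conv (dual_gauge_pow \<beta>) (gauge_pow \<beta>) k = (if k = 0 then \<one> else \<zero>)"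
proof (induction k)
  case 0
  then show ?case by (simp add: conv_0)
next
  case (Suc k)
  let ?b = "gauge_pow \<beta>" and ?d = "dual_gauge_pow \<beta>"
  note b = gauge_pow_closed[OF \<beta>] and d = dual_gauge_pow_closed[OF \<beta>]
  have n: "\<ominus> \<beta> \<in> carrier R" using \<beta> by simp
  have Dd: "D (?d k) \<in> carrier R" and dn: "?d k \<otimes> \<ominus> \<beta> \<in> carrier R" and Db: "D (?b k) \<in> carrier R"
    and bb: "\<beta> \<otimes> ?b k \<in> carrier R" and nb: "\<ominus> \<beta> \<otimes> ?b k \<in> carrier R" for k
    using b d \<beta> by (simp_all add: D_closed)
  note cl = conv_closed[OF d b] conv_closed[OF Dd b] conv_closed[OF d Db] conv_closed[OF d bb] conv_closed[OF d nb]
  have 1: "conv (\<lambda>k. ?d (Suc k)) ?b k = conv (\<lambda>k. D (?d k)) ?b k \<oplus> conv ?d (\<lambda>k. \<ominus> \<beta> \<otimes> ?b k) k"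
    using conv_linear(1)[OF Dd dn b b \<beta>] conv_linear(5)[OF d d b b n] by simp
  have 2: "conv ?d (\<lambda>k. ?b (Suc k)) k = conv ?d (\<lambda>k. \<beta> \<otimes> ?b k) k \<oplus> conv ?d (\<lambda>k. D (?b k)) k"
    using conv_linear(2)[OF d d bb Db \<beta>] by simp
  have "conv ?d (\<lambda>k. \<ominus> \<beta> \<otimes> ?b k) k \<oplus> conv ?d (\<lambda>k. \<beta> \<otimes> ?b k) k = conv ?d (\<lambda>k. \<ominus> \<beta> \<otimes> ?b k \<oplus> \<beta> \<otimes> ?b k) k"
    by (rule conv_linear(2)[OF d d nb bb \<beta>, symmetric])
  also have "(\<lambda>k. \<ominus> \<beta> \<otimes> ?b k \<oplus> \<beta> \<otimes> ?b k) = (\<lambda>k. \<zero>)"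
    using b \<beta> by (simp add: l_minus l_neg fun_eq_iff)
  also have "conv ?d (\<lambda>k. \<zero>) k = \<zero>" using d by (simp add: conv_def)
  finally have 3: "conv ?d (\<lambda>k. \<ominus> \<beta> \<otimes> ?b k) k \<oplus> conv ?d (\<lambda>k. \<beta> \<otimes> ?b k) k = \<zero>" .
  have "conv ?d ?b (Suc k) = conv (\<lambda>k. D (?d k)) ?b k \<oplus>
      ((conv ?d (\<lambda>k. \<ominus> \<beta> \<otimes> ?b k) k \<oplus> conv ?d (\<lambda>k. \<beta> \<otimes> ?b k) k) \<oplus> conv ?d (\<lambda>k. D (?b k)) k)"
    unfolding conv_Suc[OF d b] 1 2 using cl by (simp add: a_assoc)
  also have "\<dots> = D (conv ?d ?b k)" unfolding 3 using D_conv[OF d b] cl by simp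
  finally show ?case unfolding Suc by (simp add: D_one D_zero)
qed

text \<open>Both sides satisfy \<open>c (k + 1) = \<beta> c k + D (c k)\<close>; for the right-hand
  side this is \<open>\<beta> g + D g = g \<beta>\<close>. In terms of block matrices, the gauge
  powers intertwine the prolongation of \<open>g\<close> with copies of \<open>g\<close>.\<close>

lemma conv_gauge_derivatives:
  assumes \<beta>: "\<beta> \<in> carrier R" and g: "g \<in> carrier R" "D g = g \<otimes> \<beta> \<ominus> \<beta> \<otimes> g"
  shows "conv (gauge_pow \<beta>) (\<lambda>k. (D ^^ k) g) k = g \<otimes> gauge_pow \<beta> k"
proof (induction k)
  case 0
  then show ?case using g by (simp add: conv_0)
next
  case (Suc k)
  let ?b = "gauge_pow \<beta>"
  note b = gauge_pow_closed[OF \<beta>] and w = D_pow_closed[OF g(1)]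
  have Db: "D (?b k) \<in> carrier R" for k using b by (simp add: D_closed)
  have "conv ?b (\<lambda>k. (D ^^ k) g) (Suc k) = \<beta> \<otimes> (g \<otimes> ?b k) \<oplus> D (g \<otimes> ?b k)"
    using conv_gauge_pow_Suc[where w = "\<lambda>k. (D ^^ k) g", OF \<beta> w, of k]
      D_conv[where v = ?b and w = "\<lambda>k. (D ^^ k) g", OF b w, of k]
    by (simp only: Suc funpow.simps o_apply)
  also have "\<dots> = (\<beta> \<otimes> g \<oplus> (g \<otimes> \<beta> \<ominus> \<beta> \<otimes> g)) \<otimes> ?b k \<oplus> g \<otimes> D (?b k)"
    using \<beta> g b Db by (simp add: D_mult m_assoc l_distr a_assoc)
  also have "\<beta> \<otimes> g \<oplus> (g \<otimes> \<beta> \<ominus> \<beta> \<otimes> g) = g \<otimes> \<beta>"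
    using \<beta> g(1) a_lcomm[of "\<beta> \<otimes> g" "g \<otimes> \<beta>" "\<ominus> (\<beta> \<otimes> g)"] by (simp add: a_minus_def r_neg)
  also have "g \<otimes> \<beta> \<otimes> ?b k \<oplus> g \<otimes> D (?b k) = g \<otimes> ?b (Suc k)"
    using \<beta> g b Db by (simp add: m_assoc r_distr)
  finally show ?case .
qed

end

text \<open>Passes from matrices whose entries are blocks to matrices indexed by pairs, the form of
  the bases of the prolongation and of the direct sum.\<close>

definition flatten :: "'s set \<Rightarrow> 'i set \<Rightarrow> ('s \<Rightarrow> 's \<Rightarrow> 'i \<Rightarrow> 'i \<Rightarrow> 'a) \<Rightarrow> 's \<times> 'i \<Rightarrow> 's \<times> 'i \<Rightarrow> 'a" where
  "flatten S I A = (\<lambda>x\<in>S \<times> I. \<lambda>y\<in>S \<times> I. A (fst x) (fst y) (snd x) (snd y))"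

context ring
begin

lemma flatten_closed: "A \<in> mats (mat_ring R I) S S \<Longrightarrow> flatten S I A \<in> mats R (S \<times> I) (S \<times> I)"
  unfolding flatten_def
  by (intro mats_restrict) (auto intro!: mats_closed[of _ R I I] dest: mats_closed simp: carrier_mat_ring)

lemma flatten_mult_entry:
  assumes fin: "finite I" "finite S" and A: "A \<in> mats (mat_ring R I) S S" and C: "C \<in> mats (mat_ring R I) S S"
    and si: "s \<in> S" "i \<in> I" "m \<in> S" "j \<in> I"
  shows "(\<Oplus>x\<in>S \<times> I. A s (fst x) i (snd x) \<otimes> C (fst x) m (snd x) j) = mat_mult (mat_ring R I) S S S A C s m i j"
proof -
  interpret M: ring "mat_ring R I" by (rule ring_mat_ring[OF fin(1)])
  have cl: "A s q \<in> mats R I I" "C s q \<in> mats R I I" if "s \<in> S" "q \<in> S" for s q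
    using A C that by (auto dest: mats_closed simp: carrier_mat_ring)
  have cl': "A s q i l \<in> carrier R" "C s q i l \<in> carrier R" if "s \<in> S" "q \<in> S" "i \<in> I" "l \<in> I" for s q i l
    using cl[OF that(1,2)] that by (auto dest: mats_closed)
  have "(\<Oplus>x\<in>S \<times> I. A s (fst x) i (snd x) \<otimes> C (fst x) m (snd x) j) =
      (\<Oplus>q\<in>S. \<Oplus>l\<in>I. A s q i l \<otimes> C q m l j)"
    using si cl' by (subst add.finprod_Times[OF fin(2,1)]) auto
  also have "\<dots> = (\<Oplus>q\<in>S. (A s q \<otimes>\<^bsub>mat_ring R I\<^esub> C q m) i j)"
    using si cl' by (intro finsum_cong') (auto simp: mult_entry)
  also have "\<dots> = mat_mult (mat_ring R I) S S S A C s m i j"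
    using si cl M.m_closed by (subst finsum_entry[symmetric]) (auto simp: mat_mult_entry fin carrier_mat_ring)
  finally show ?thesis .
qed

lemma flatten_mult:
  assumes fin: "finite I" "finite S" and A: "A \<in> mats (mat_ring R I) S S" and C: "C \<in> mats (mat_ring R I) S S"
  shows "mat_mult R (S \<times> I) (S \<times> I) (S \<times> I) (flatten S I A) (flatten S I C) =
    flatten S I (mat_mult (mat_ring R I) S S S A C)"
proof (rule mats_eqI[OF mat_mult_closed])
  interpret M: ring "mat_ring R I" by (rule ring_mat_ring[OF fin(1)])
  show "flatten S I (mat_mult (mat_ring R I) S S S A C) \<in> mats R (S \<times> I) (S \<times> I)"
    by (rule flatten_closed[OF M.mat_mult_closed[OF A C]])
  note f = flatten_closed[OF A] flatten_closed[OF C]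
  fix x y assume xy: "x \<in> S \<times> I" "y \<in> S \<times> I"
  have "mat_mult R (S \<times> I) (S \<times> I) (S \<times> I) (flatten S I A) (flatten S I C) x y =
      (\<Oplus>z\<in>S \<times> I. A (fst x) (fst z) (snd x) (snd z) \<otimes> C (fst z) (fst y) (snd z) (snd y))"
  proof -
    have "(\<Oplus>z\<in>S \<times> I. flatten S I A x z \<otimes> flatten S I C z y) =
      (\<Oplus>z\<in>S \<times> I. A (fst x) (fst z) (snd x) (snd z) \<otimes> C (fst z) (fst y) (snd z) (snd y))"
    proof (rule finsum_cong')
      fix z assume z: "z \<in> S \<times> I"
      show "flatten S I A x z \<otimes> flatten S I C z y =
        A (fst x) (fst z) (snd x) (snd z) \<otimes> C (fst z) (fst y) (snd z) (snd y)"
        using xy z by (simp add: flatten_def)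
    next
      show "(\<lambda>z. A (fst x) (fst z) (snd x) (snd z) \<otimes> C (fst z) (fst y) (snd z) (snd y)) \<in> S \<times> I \<rightarrow> carrier R"
      proof
        fix z assume z: "z \<in> S \<times> I"
        have "flatten S I A x z \<in> carrier R" "flatten S I C z y \<in> carrier R"
          using mats_closed[OF f(1) xy(1) z] mats_closed[OF f(2) z xy(2)] by auto
        then show "A (fst x) (fst z) (snd x) (snd z) \<otimes> C (fst z) (fst y) (snd z) (snd y) \<in> carrier R"
          using xy z by (simp add: flatten_def)
      qed
    qed simp
    then show ?thesis by (simp only: mat_mult_entry[OF xy])
  qed
  also have "\<dots> = flatten S I (mat_mult (mat_ring R I) S S S A C) x y"
    using xy flatten_mult_entry[OF fin A C, of "fst x" "snd x" "fst y" "snd y"] by (auto simp: flatten_def)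
  finally show "mat_mult R (S \<times> I) (S \<times> I) (S \<times> I) (flatten S I A) (flatten S I C) x y =
      flatten S I (mat_mult (mat_ring R I) S S S A C) x y" .
qed (use flatten_closed[OF A] flatten_closed[OF C] in blast)+

lemma flatten_one: "flatten S I (mat_one (mat_ring R I) S) = mat_one R (S \<times> I)"
  by (auto simp: flatten_def mat_one_def one_mat_ring zero_entry fun_eq_iff restrict_def)

end

lemma (in ring_hom_cring) hom_mat_mult:
  assumes "M \<in> mats R I J" "N \<in> mats R J L"
  shows "mat_mult S I J L (\<lambda>i\<in>I. \<lambda>j\<in>J. h (M i j)) (\<lambda>j\<in>J. \<lambda>l\<in>L. h (N j l)) =
    (\<lambda>i\<in>I. \<lambda>l\<in>L. h (mat_mult R I J L M N i l))"
proof (intro ext)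
  fix i l
  show "mat_mult S I J L (\<lambda>i\<in>I. \<lambda>j\<in>J. h (M i j)) (\<lambda>j\<in>J. \<lambda>l\<in>L. h (N j l)) i l =
    (\<lambda>i\<in>I. \<lambda>l\<in>L. h (mat_mult R I J L M N i l)) i l"
  proof (cases "i \<in> I \<and> l \<in> L")
    case True
    then have il: "i \<in> I" "l \<in> L" by auto
    note cl = mats_closed[OF assms(1) il(1)] mats_closed[OF assms(2) _ il(2)]
    have "h (\<Oplus>\<^bsub>R\<^esub>j\<in>J. M i j \<otimes>\<^bsub>R\<^esub> N j l) = (\<Oplus>\<^bsub>S\<^esub>j\<in>J. h (M i j) \<otimes>\<^bsub>S\<^esub> h (N j l))"
      using cl by (subst hom_finsum) (auto intro!: S.finsum_cong')
    also have "\<dots> = (\<Oplus>\<^bsub>S\<^esub>j\<in>J. (\<lambda>i\<in>I. \<lambda>j\<in>J. h (M i j)) i j \<otimes>\<^bsub>S\<^esub> (\<lambda>j\<in>J. \<lambda>l\<in>L. h (N j l)) j l)"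
      using cl il by (intro S.finsum_cong') auto
    finally show ?thesis using il by (simp add: mat_mult_entry)
  qed (auto simp: mat_mult_def)
qed

lemma mat_der_entry: "i \<in> I \<Longrightarrow> j \<in> I \<Longrightarrow> mat_der R I M i j = der R (M i j)"
  by (simp add: mat_der_def)

lemma mat_der_pow_entry:
  assumes "i \<in> I" "j \<in> I" shows "(mat_der R I ^^ k) g i j = (der R ^^ k) (g i j)"
  by (induction k) (use assms in \<open>simp_all add: mat_der_entry\<close>)

lemma (in ring) conv_single:
  assumes "g \<in> carrier R" "\<And>k. w k \<in> carrier R"
  shows "conv (\<lambda>k. if k = 0 then g else \<zero>) w k = g \<otimes> w k"
proof -
  have "conv (\<lambda>k. if k = 0 then g else \<zero>) w k = (\<Oplus>r\<in>{..k}. if 0 = r then g \<otimes> w k else \<zero>)"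
    unfolding conv_def using assms by (intro finsum_cong') auto
  also have "\<dots> = g \<otimes> w k" using assms by (intro finsum_delta) auto
  finally show ?thesis .
qed

lemma (in ring_hom_cring) hom_add_pow: "x \<in> carrier R \<Longrightarrow> h (add_pow R (k::nat) x) = add_pow S k (h x)"
  by (induction k) simp_all

text \<open>The isomorphism is built over \<open>K\<close>, whereas its relation to the group
  elements holds over \<open>U\<close>; this compares the two.\<close>

lemma (in diff_field_map) hom_gauge_pow:
  assumes fin: "finite I" and M: "M \<in> mats A I I"
    and N: "\<And>i j. i \<in> I \<Longrightarrow> j \<in> I \<Longrightarrow> N i j = h (M i j)" and ij: "i \<in> I" "j \<in> I"
  shows "h (der_ring.gauge_pow (mat_ring A I) (mat_der A I) M k i j) =
    der_ring.gauge_pow (mat_ring B I) (mat_der B I) N k i j"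
  using ij
proof (induction k arbitrary: i j)
  interpret DA: der_ring "mat_ring A I" "mat_der A I" by (rule A.der_ring_mat_ring[OF fin])
  interpret DB: der_ring "mat_ring B I" "mat_der B I" by (rule B.der_ring_mat_ring[OF fin])
  case 0
  then show ?case by (simp add: one_entry)
next
  interpret DA: der_ring "mat_ring A I" "mat_der A I" by (rule A.der_ring_mat_ring[OF fin])
  interpret DB: der_ring "mat_ring B I" "mat_der B I" by (rule B.der_ring_mat_ring[OF fin])
  case (Suc k)
  let ?b = "DA.gauge_pow M k"
  have b: "?b \<in> mats A I I" using DA.gauge_pow_closed[of M k] M by (simp add: carrier_mat_ring)
  note cl = mats_closed[OF M] mats_closed[OF b]
  have "h (\<Oplus>\<^bsub>A\<^esub>l\<in>I. M i l \<otimes>\<^bsub>A\<^esub> ?b l j) = (\<Oplus>\<^bsub>B\<^esub>l\<in>I. h (M i l) \<otimes>\<^bsub>B\<^esub> h (?b l j))"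
    using Suc.prems cl by (subst hom_finsum) (auto intro!: B.finsum_cong')
  also have "\<dots> = (\<Oplus>\<^bsub>B\<^esub>l\<in>I. N i l \<otimes>\<^bsub>B\<^esub> DB.gauge_pow N k l j)"
    using Suc.prems cl by (intro B.finsum_cong') (auto simp: N simp flip: Suc.IH)
  finally show ?case
    using Suc.prems cl
    by (simp add: add_entry mult_entry mat_der_entry hom_der A.der_closed del: hom_finsum flip: Suc.IH)
qed

section \<open>The comodule equation evaluated at points of the group\<close>

context linear_group
begin

abbreviation "\<V> \<equiv> standard_rep K U \<iota> n G"
abbreviation "\<kappa> \<equiv> coord_const K U \<iota> n G"

lemma tensor_pair_coord:
  assumes "diff_field_map K L e" shows "tensor_pair K L e \<A> \<kappa>"
proof -
  interpret L: diff_field_map K L e by fact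
  show ?thesis by unfold_locales (auto simp: coord_add coord_scale L.B.cring_axioms intro: L.B.is_cring)
qed

text \<open>Coefficients from \<open>K\<close> move across the tensor sign and leave
  \<open>1 \<otimes> x\<close>. An equation between two such sums thus follows from an equation
  between functions on the group.\<close>

lemma tensor_collapse:
  assumes L: "diff_field_map K L e"
    and T: "finite T" "\<And>t. t \<in> T \<Longrightarrow> c t \<in> carrier K" "\<And>t. t \<in> T \<Longrightarrow> a t \<in> carrier \<A>"
  shows "\<exists>x\<in>carrier \<A>. (\<Otimes>\<^bsub>tensor_product K L e \<A> \<kappa>\<^esub>t\<in>T. pure_tensor K L e \<A> \<kappa> (e (c t)) (a t)) =
      pure_tensor K L e \<A> \<kappa> \<one>\<^bsub>L\<^esub> x \<and> (\<forall>g\<in>G. val x g = (\<Oplus>\<^bsub>U\<^esub>t\<in>T. \<iota> (c t) \<otimes>\<^bsub>U\<^esub> val (a t) g))"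
  using T
proof (induction T rule: finite_induct)
  interpret L: diff_field_map K L e by fact
  interpret T: tensor_pair K L e \<A> \<kappa> by (rule tensor_pair_coord[OF L])
  interpret T: comm_group "T.\<T>" by (rule T.comm_group_tensor)
  case empty
  have "T.pure \<one>\<^bsub>L\<^esub> \<zero>\<^bsub>\<A>\<^esub> \<otimes>\<^bsub>T.\<T>\<^esub> T.pure \<one>\<^bsub>L\<^esub> \<zero>\<^bsub>\<A>\<^esub> = T.pure \<one>\<^bsub>L\<^esub> (\<zero>\<^bsub>\<A>\<^esub> \<oplus>\<^bsub>\<A>\<^esub> \<zero>\<^bsub>\<A>\<^esub>)"
    by (rule T.pure_add_right) (simp_all add: coord_zero)
  also have "\<zero>\<^bsub>\<A>\<^esub> \<oplus>\<^bsub>\<A>\<^esub> \<zero>\<^bsub>\<A>\<^esub> = \<zero>\<^bsub>\<A>\<^esub>"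
    by (rule val_eqI) (simp_all add: coord_zero coord_add)
  finally have "T.pure \<one>\<^bsub>L\<^esub> \<zero>\<^bsub>\<A>\<^esub> = \<one>\<^bsub>T.\<T>\<^esub>"
    using T.pure_closed[of "\<one>\<^bsub>L\<^esub>" "\<zero>\<^bsub>\<A>\<^esub>"] by (simp add: coord_zero)
  then show ?case by (intro bexI[of _ "\<zero>\<^bsub>\<A>\<^esub>"]) (simp_all add: coord_zero)
next
  interpret L: diff_field_map K L e by fact
  interpret T: tensor_pair K L e \<A> \<kappa> by (rule tensor_pair_coord[OF L])
  interpret T: comm_group "T.\<T>" by (rule T.comm_group_tensor)
  case (insert t T)
  obtain x where x: "x \<in> carrier \<A>" "(\<Otimes>\<^bsub>T.\<T>\<^esub>t\<in>T. T.pure (e (c t)) (a t)) = T.pure \<one>\<^bsub>L\<^esub> x"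
    "\<And>g. g \<in> G \<Longrightarrow> val x g = (\<Oplus>\<^bsub>U\<^esub>t\<in>T. \<iota> (c t) \<otimes>\<^bsub>U\<^esub> val (a t) g)"
    using insert.IH insert.prems by auto
  have t: "c t \<in> carrier K" "a t \<in> carrier \<A>" using insert.prems by auto
  let ?y = "\<kappa> (c t) \<otimes>\<^bsub>\<A>\<^esub> a t"
  have y: "?y \<in> carrier \<A>" by (rule coord_scale(1)[OF t])
  have p: "T.pure (e (c t)) (a t) = T.pure \<one>\<^bsub>L\<^esub> ?y"
    using T.pure_balanced[OF t(1) _ t(2), of "\<one>\<^bsub>L\<^esub>"] t(1) by simp
  have "(\<Otimes>\<^bsub>T.\<T>\<^esub>t\<in>insert t T. T.pure (e (c t)) (a t)) = T.pure (e (c t)) (a t) \<otimes>\<^bsub>T.\<T>\<^esub> T.pure \<one>\<^bsub>L\<^esub> x"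
    unfolding x(2)[symmetric] using insert by (intro T.finprod_insert) (auto intro!: T.pure_closed)
  also have "\<dots> = T.pure \<one>\<^bsub>L\<^esub> (?y \<oplus>\<^bsub>\<A>\<^esub> x)" unfolding p using x(1) y by (intro T.pure_add_right) auto
  finally have eq: "(\<Otimes>\<^bsub>T.\<T>\<^esub>t\<in>insert t T. T.pure (e (c t)) (a t)) = T.pure \<one>\<^bsub>L\<^esub> (?y \<oplus>\<^bsub>\<A>\<^esub> x)" .
  have "val (?y \<oplus>\<^bsub>\<A>\<^esub> x) g = (\<Oplus>\<^bsub>U\<^esub>t\<in>insert t T. \<iota> (c t) \<otimes>\<^bsub>U\<^esub> val (a t) g)" if g: "g \<in> G" for g
    using insert g x y t by (subst B.finsum_insert) (auto simp: coord_add coord_scale val_closed)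
  then show ?case using eq coord_add(1)[OF y x(1)] by (intro bexI[of _ "?y \<oplus>\<^bsub>\<A>\<^esub> x"]) auto
qed

text \<open>At \<open>g\<close> the coaction of the prolongation is the binomial matrix of the
  successive derivatives of \<open>g\<close>, and by \<open>direct_sum_entry\<close> that of the
  direct sum is the binomial matrix of \<open>g\<close> in degree 0. Intertwining the two becomes an
  identity of convolutions.\<close>

lemma prolongation_entry:
  assumes i: "i < n" and j: "j < n" and qm: "q \<le> p" "m \<le> p"
  shows "coact (prolongation \<A> p \<V>) (q, i) (m, j) \<in> carrier \<A>"
    and "g \<in> G \<Longrightarrow> val (coact (prolongation \<A> p \<V>) (q, i) (m, j)) g =
      ring.binomial_mat (mat_ring U {..<n}) p (\<lambda>k. (mat_der U {..<n} ^^ k) g) q m i j"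
proof -
  let ?M = "mat_ring U {..<n}"
  interpret D: der_ring ?M "mat_der U {..<n}" by (rule B.der_ring_mat_ring) simp
  show "coact (prolongation \<A> p \<V>) (q, i) (m, j) \<in> carrier \<A>"
    using i j by (simp add: prolongation_def standard_rep_def coord_zero coord_add_pow coord_der_pow coord_entry)
  assume g: "g \<in> G"
  then have gM: "g \<in> carrier ?M" using G_GL by (simp add: GL_simps carrier_mat_ring)
  show "val (coact (prolongation \<A> p \<V>) (q, i) (m, j)) g =
      D.binomial_mat p (\<lambda>k. (mat_der U {..<n} ^^ k) g) q m i j"
    using i j qm g D.D_pow_closed[OF gM]
    by (simp add: prolongation_def standard_rep_def D.binomial_mat_def coord_zero coord_add_pow
        coord_der_pow coord_entry zero_entry B.add_pow_entry carrier_mat_ring mat_der_pow_entry)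
qed

lemma direct_sum_entry:
  assumes i: "i < n" and j: "j < n" and st: "s \<le> p" "t \<le> p"
  shows "coact (direct_sum_rep \<A> {..p} (\<lambda>_. \<V>)) (s, i) (t, j) \<in> carrier \<A>"
    and "g \<in> G \<Longrightarrow> val (coact (direct_sum_rep \<A> {..p} (\<lambda>_. \<V>)) (s, i) (t, j)) g =
      ring.binomial_mat (mat_ring U {..<n}) p (\<lambda>k. if k = 0 then g else \<zero>\<^bsub>mat_ring U {..<n}\<^esub>) s t i j"
proof -
  let ?M = "mat_ring U {..<n}"
  interpret D: der_ring ?M "mat_der U {..<n}" by (rule B.der_ring_mat_ring) simp
  show "coact (direct_sum_rep \<A> {..p} (\<lambda>_. \<V>)) (s, i) (t, j) \<in> carrier \<A>"
    using i j by (simp add: direct_sum_rep_def standard_rep_def coord_zero coord_entry)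
  assume g: "g \<in> G"
  then have gM: "g \<in> carrier ?M" using G_GL by (simp add: GL_simps carrier_mat_ring)
  show "val (coact (direct_sum_rep \<A> {..p} (\<lambda>_. \<V>)) (s, i) (t, j)) g =
      D.binomial_mat p (\<lambda>k. if k = 0 then g else \<zero>\<^bsub>?M\<^esub>) s t i j"
    using i j st g gM
    by (auto simp: direct_sum_rep_def standard_rep_def D.binomial_mat_def coord_zero coord_entry zero_entry)
qed

lemma basis_reps:
  "basis (prolongation \<A> p \<V>) = {..p} \<times> {..<n}"
  "basis (direct_sum_rep \<A> {..p} (\<lambda>_. \<V>)) = {..p} \<times> {..<n}"
  by (simp_all add: prolongation_def direct_sum_rep_def standard_rep_def)

lemma iso_if_gauge:
  assumes L: "diff_field_map K L e" and B: "gauge n G B"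
  shows "iso_rep_over K L e \<A> \<kappa> (prolongation \<A> p \<V>) (direct_sum_rep \<A> {..p} (\<lambda>_. \<V>))"
proof -
  interpret L: diff_field_map K L e by fact
  let ?N = "{..<n}" and ?J = "{..p} \<times> {..<n}"
  let ?MK = "mat_ring K ?N" and ?MU = "mat_ring U ?N"
  interpret DK: der_ring ?MK "mat_der K ?N" by (rule A.der_ring_mat_ring) simp
  interpret DU: der_ring ?MU "mat_der U ?N" by (rule B.der_ring_mat_ring) simp
  let ?B = "\<lambda>i\<in>?N. \<lambda>j\<in>?N. B i j" and ?BU = "\<lambda>i\<in>?N. \<lambda>j\<in>?N. \<iota> (B i j)"
  have BM: "?B \<in> mats K ?N ?N" using B by (intro mats_restrict) (simp add: gauge_def)
  have BU: "?BU \<in> carrier ?MU" unfolding carrier_mat_ring using B by (intro mats_restrict) (simp add: gauge_def)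
  have BK: "?B \<in> carrier ?MK" using BM by (simp add: carrier_mat_ring)
  note b = DK.gauge_pow_closed[OF BK] and d = DK.dual_gauge_pow_closed[OF BK] and bU = DU.gauge_pow_closed[OF BU]
  \<comment> \<open>The isomorphism comes from the gauge powers, its inverse from the dual ones;
    both have entries in \<open>K\<close> and are mapped to \<open>L\<close> by
    \<open>e\<close>.\<close>
  let ?b = "DK.binomial_mat p (DK.gauge_pow ?B)" and ?d = "DK.binomial_mat p (DK.dual_gauge_pow ?B)"
  let ?bU = "DU.binomial_mat p (DU.gauge_pow ?BU)"
  have bm: "?b \<in> mats ?MK {..p} {..p}" and dm: "?d \<in> mats ?MK {..p} {..p}" and bUm: "?bU \<in> mats ?MU {..p} {..p}"
    by (rule DK.binomial_mat_closed[OF b] DK.binomial_mat_closed[OF d] DU.binomial_mat_closed[OF bU])+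
  let ?P = "flatten {..p} ?N ?b" and ?Q = "flatten {..p} ?N ?d"
  have P: "?P \<in> mats K ?J ?J" and Q: "?Q \<in> mats K ?J ?J"
    using A.flatten_closed[OF bm] A.flatten_closed[OF dm] .
  have fin: "finite ?N" "finite {..p}" by simp_all
  have PQ: "mat_mult K ?J ?J ?J ?P ?Q = mat_one K ?J"
    unfolding A.flatten_mult[OF fin bm dm] DK.binomial_mat_mult[OF b d] DK.conv_gauge_dual[OF BK]
      DK.binomial_mat_delta A.flatten_one ..
  have QP: "mat_mult K ?J ?J ?J ?Q ?P = mat_one K ?J"
    unfolding A.flatten_mult[OF fin dm bm] DK.binomial_mat_mult[OF d b] DK.conv_dual_gauge[OF BK]
      DK.binomial_mat_delta A.flatten_one ..
  let ?map = "\<lambda>M. \<lambda>x\<in>?J. \<lambda>y\<in>?J. e (M x y)"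
  have one: "?map (mat_one K ?J) = mat_one L ?J" by (auto simp: mat_one_def fun_eq_iff)
  have \<iota>b: "\<iota> (?P (s, i) (m, j)) = ?bU s m i j" if "s \<le> p" "m \<le> p" "i < n" "j < n" for s i m j
    using that b[of "m - s"] bU[of "m - s"] hom_gauge_pow[OF fin(1) BM, of ?BU i j "m - s"]
    by (auto simp: flatten_def DK.binomial_mat_def DU.binomial_mat_def A.add_pow_entry B.add_pow_entry
        carrier_mat_ring zero_entry hom_add_pow mats_closed)
  show ?thesis
    unfolding iso_rep_over_def basis_reps
  proof (intro bexI conjI ballI)
    show "mat_mult L ?J ?J ?J (?map ?P) (?map ?Q) = mat_one L ?J"
      unfolding L.hom_mat_mult[OF P Q] PQ one ..
    show "mat_mult L ?J ?J ?J (?map ?Q) (?map ?P) = mat_one L ?J"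
      unfolding L.hom_mat_mult[OF Q P] QP one ..
    show "?map ?P \<in> mats L ?J ?J" "?map ?Q \<in> mats L ?J ?J"
      using mats_closed[OF P] mats_closed[OF Q] by (auto intro!: mats_restrict)
    fix x y assume x: "x \<in> ?J" and y: "y \<in> ?J"
    obtain s i m j where xy: "x = (s, i)" "y = (m, j)" and si: "s \<le> p" "i < n" "m \<le> p" "j < n"
      using x y by auto
    let ?a = "coact (prolongation \<A> p \<V>)" and ?a' = "coact (direct_sum_rep \<A> {..p} (\<lambda>_. \<V>))"
    have a: "?a z w \<in> carrier \<A>" "?a' z w \<in> carrier \<A>" if "z \<in> ?J" "w \<in> ?J" for z w
      using that prolongation_entry(1) direct_sum_entry(1) by auto
    obtain u where u: "u \<in> carrier \<A>"
      "(\<Otimes>\<^bsub>tensor_product K L e \<A> \<kappa>\<^esub>z\<in>?J. pure_tensor K L e \<A> \<kappa> (e (?P x z)) (?a z y)) = pure_tensor K L e \<A> \<kappa> \<one>\<^bsub>L\<^esub> u"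
      "\<And>g. g \<in> G \<Longrightarrow> val u g = (\<Oplus>\<^bsub>U\<^esub>z\<in>?J. \<iota> (?P x z) \<otimes>\<^bsub>U\<^esub> val (?a z y) g)"
      using tensor_collapse[OF L, of ?J "\<lambda>z. ?P x z" "\<lambda>z. ?a z y"] mats_closed[OF P x] a y by auto
    obtain u' where u': "u' \<in> carrier \<A>"
      "(\<Otimes>\<^bsub>tensor_product K L e \<A> \<kappa>\<^esub>z\<in>?J. pure_tensor K L e \<A> \<kappa> (e (?P z y)) (?a' x z)) = pure_tensor K L e \<A> \<kappa> \<one>\<^bsub>L\<^esub> u'"
      "\<And>g. g \<in> G \<Longrightarrow> val u' g = (\<Oplus>\<^bsub>U\<^esub>z\<in>?J. \<iota> (?P z y) \<otimes>\<^bsub>U\<^esub> val (?a' x z) g)"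
      using tensor_collapse[OF L, of ?J "\<lambda>z. ?P z y" "\<lambda>z. ?a' x z"] mats_closed[OF P _ y] a x by auto
    have "val u g = val u' g" if g: "g \<in> G" for g
    proof -
      have gm: "g \<in> mats U ?N ?N" using G_GL[OF g] by (simp add: GL_simps)
      then have gM: "g \<in> carrier ?MU" by (simp add: carrier_mat_ring)
      let ?g = "\<lambda>k. if k = 0 then g else \<zero>\<^bsub>?MU\<^esub>" and ?dg = "\<lambda>k. (mat_der U ?N ^^ k) g"
      have gk: "?g k \<in> carrier ?MU" for k using gM by simp
      note dgk = DU.D_pow_closed[OF gM]
      note gmat = DU.binomial_mat_closed[where v = ?g and p = p, OF gk]
      note dgmat = DU.binomial_mat_closed[where v = ?dg and p = p, OF dgk]
      have cl: "M s m i j \<in> carrier U" if "M \<in> mats ?MU {..p} {..p}" "s \<le> p" "m \<le> p" "i < n" "j < n" for M s m i j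
        using mats_closed[OF that(1), of s m] that mats_closed[of "M s m" U ?N ?N i j] by (simp add: carrier_mat_ring)
      have "val u g = (\<Oplus>\<^bsub>U\<^esub>z\<in>?J. ?bU s (fst z) i (snd z) \<otimes>\<^bsub>U\<^esub> DU.binomial_mat p ?dg (fst z) m (snd z) j)"
        unfolding u(3)[OF g] xy
      proof (intro B.finsum_cong' refl)
        fix z assume "z \<in> ?J"
        then obtain q l where z: "z = (q, l)" "q \<le> p" "l < n" by auto
        show "\<iota> (?P (s, i) z) \<otimes>\<^bsub>U\<^esub> val (?a z (m, j)) g =
            ?bU s (fst z) i (snd z) \<otimes>\<^bsub>U\<^esub> DU.binomial_mat p ?dg (fst z) m (snd z) j"
          unfolding z(1) \<iota>b[OF si(1) z(2) si(2) z(3)] prolongation_entry(2)[OF z(3) si(4) z(2) si(3) g] by simp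
      qed (use si cl[OF bUm] cl[OF dgmat] in auto)
      also have "\<dots> = DU.binomial_mat p (DU.conv (DU.gauge_pow ?BU) ?dg) s m i j"
        using si B.flatten_mult_entry[OF fin bUm dgmat, of s i m j] DU.binomial_mat_mult[where v = "DU.gauge_pow ?BU" and w = ?dg and p = p, OF bU dgk]
        by simp
      \<comment> \<open>Here the gauge equation enters: both convolutions equal \<open>g\<close>
        times the gauge powers.\<close>
      also have "DU.conv (DU.gauge_pow ?BU) ?dg = DU.conv ?g (DU.gauge_pow ?BU)"
        using DU.conv_gauge_derivatives[OF BU gM gauge_mat_der[OF B g gm]] DU.conv_single[OF gM bU] by auto
      also have "DU.binomial_mat p (DU.conv ?g (DU.gauge_pow ?BU)) s m i j =
          (\<Oplus>\<^bsub>U\<^esub>z\<in>?J. DU.binomial_mat p ?g s (fst z) i (snd z) \<otimes>\<^bsub>U\<^esub> ?bU (fst z) m (snd z) j)"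
        using si B.flatten_mult_entry[OF fin gmat bUm, of s i m j] DU.binomial_mat_mult[where v = ?g and w = "DU.gauge_pow ?BU" and p = p, OF gk bU]
        by simp
      also have "\<dots> = val u' g"
        unfolding u'(3)[OF g] xy
      proof (intro B.finsum_cong' refl)
        fix z assume z: "z \<in> ?J"
        then obtain q l where z: "z = (q, l)" "q \<le> p" "l < n" by auto
        show "DU.binomial_mat p ?g s (fst z) i (snd z) \<otimes>\<^bsub>U\<^esub> ?bU (fst z) m (snd z) j =
            \<iota> (?P z (m, j)) \<otimes>\<^bsub>U\<^esub> val (?a' (s, i) z) g"
          unfolding z(1) \<iota>b[OF z(2) si(3) z(3) si(4)] direct_sum_entry(2)[OF si(2) z(3) si(1) z(2) g]
          using cl[OF gmat si(1) z(2) si(2) z(3)] cl[OF bUm z(2) si(3) z(3) si(4)] by (simp add: B.m_comm)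
      qed (use mats_closed[OF P _ y] a x val_closed[OF _ g] xy in auto)
      finally show ?thesis .
    qed
    then have "u = u'" by (rule val_eqI[OF u(1) u'(1)])
    then have eq: "(\<Otimes>\<^bsub>tensor_product K L e \<A> \<kappa>\<^esub>z\<in>?J. pure_tensor K L e \<A> \<kappa> (e (?P x z)) (?a z y)) =
        (\<Otimes>\<^bsub>tensor_product K L e \<A> \<kappa>\<^esub>z\<in>?J. pure_tensor K L e \<A> \<kappa> (e (?P z y)) (?a' x z))"
      using u(2) u'(2) by simp
    interpret T: tensor_pair K L e \<A> \<kappa> by (rule tensor_pair_coord[OF L])
    interpret T: comm_group "T.\<T>" by (rule T.comm_group_tensor)
    have "(\<Otimes>\<^bsub>T.\<T>\<^esub>z\<in>?J. T.pure (?map ?P x z) (?a z y)) = (\<Otimes>\<^bsub>T.\<T>\<^esub>z\<in>?J. T.pure (e (?P x z)) (?a z y))"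
      using x a y mats_closed[OF P x] by (intro T.finprod_cong') (auto intro!: T.pure_closed)
    moreover have "(\<Otimes>\<^bsub>T.\<T>\<^esub>z\<in>?J. T.pure (?map ?P z y) (?a' x z)) = (\<Otimes>\<^bsub>T.\<T>\<^esub>z\<in>?J. T.pure (e (?P z y)) (?a' x z))"
      using x a y mats_closed[OF P _ y] by (intro T.finprod_cong') (auto intro!: T.pure_closed)
    ultimately show "(\<Otimes>\<^bsub>T.\<T>\<^esub>z\<in>?J. T.pure (?map ?P x z) (?a z y)) = (\<Otimes>\<^bsub>T.\<T>\<^esub>z\<in>?J. T.pure (?map ?P z y) (?a' x z))"
      using eq by simp
  qed
qed

end

section \<open>Splitting of extensions with isomorphic middle term\<close>

text \<open>\<open>comb c x y\<close> stands for \<open>x + c y\<close>. The last conjunct says that \<open>z\<close> is in the span of \<open>y\<close>; it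
  carries the elimination of one functional at a time.\<close>

lemma (in field) common_zero:
  fixes W :: "'v set" and comb :: "'a \<Rightarrow> 'v \<Rightarrow> 'v \<Rightarrow> 'v"
  assumes comb: "\<And>c x y. c \<in> carrier R \<Longrightarrow> x \<in> W \<Longrightarrow> y \<in> W \<Longrightarrow> comb c x y \<in> W"
  defines "Lin \<equiv> {\<phi>. \<phi> \<in> W \<rightarrow> carrier R \<and>
    (\<forall>c\<in>carrier R. \<forall>x\<in>W. \<forall>y\<in>W. \<phi> (comb c x y) = \<phi> x \<oplus> c \<otimes> \<phi> y)}"
  assumes "finite Q" "Q \<subseteq> Lin" "finite I" "card Q < card I"
    and "\<And>t. t \<in> I \<Longrightarrow> y t \<in> W" "\<And>t. t \<in> I \<Longrightarrow> dual t \<in> Lin"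
    and "\<And>s t. s \<in> I \<Longrightarrow> t \<in> I \<Longrightarrow> dual s (y t) = (if s = t then \<one> else \<zero>)"
  shows "\<exists>z\<in>W. (\<forall>\<phi>\<in>Q. \<phi> z = \<zero>) \<and> (\<exists>t\<in>I. dual t z \<noteq> \<zero>) \<and>
    (\<forall>\<psi>\<in>Lin. (\<forall>t\<in>I. \<psi> (y t) = \<zero>) \<longrightarrow> \<psi> z = \<zero>)"
  using assms(3-)
proof (induction Q arbitrary: I y rule: finite_induct)
  case empty
  then obtain t where t: "t \<in> I" by (metis card_gt_0_iff card.empty ex_in_conv)
  then show ?case using empty.prems by (intro bexI[of _ "y t"]) auto
next
  case (insert \<phi> Q)
  have Q: "Q \<subseteq> Lin" and \<phi>: "\<phi> \<in> Lin" and c: "card Q < card I" using insert by auto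
  show ?case
  proof (cases "\<forall>t\<in>I. \<phi> (y t) = \<zero>")
    case True
    obtain z where "z \<in> W" "\<forall>\<phi>\<in>Q. \<phi> z = \<zero>" "\<exists>t\<in>I. dual t z \<noteq> \<zero>"
      "\<forall>\<psi>\<in>Lin. (\<forall>t\<in>I. \<psi> (y t) = \<zero>) \<longrightarrow> \<psi> z = \<zero>"
      using insert.IH[OF Q insert.prems(2) c insert.prems(4,5,6)] by auto
    then show ?thesis using \<phi> True by (intro bexI[of _ z]) auto
  next
    case False
    then obtain s where s: "s \<in> I" "\<phi> (y s) \<noteq> \<zero>" by blast
    have lin: "\<psi> x \<in> carrier R" "\<psi> (comb c x x') = \<psi> x \<oplus> c \<otimes> \<psi> x'"
      if "\<psi> \<in> Lin" "x \<in> W" "x' \<in> W" "c \<in> carrier R" for \<psi> x x' c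
      using that by (auto simp: Lin_def)
    note yW = insert.prems(4)
    have u: "\<phi> (y s) \<in> Units R" using s lin(1)[OF \<phi> yW[OF s(1)] yW[OF s(1)] zero_closed] by (simp add: field_Units)
    \<comment> \<open>One step of elimination: a multiple of \<open>y s\<close> is subtracted from
      every other vector so that \<open>\<phi>\<close> vanishes on all of them. Without
      \<open>s\<close>, the functionals \<open>dual\<close> remain dual to the new vectors.\<close>
    define q where "q t = \<ominus> (\<phi> (y t) \<otimes> inv (\<phi> (y s)))" for t
    define y' where "y' t = comb (q t) (y t) (y s)" for t
    have \<phi>y: "\<phi> (y t) \<in> carrier R" if "t \<in> I" for t using lin(1)[OF \<phi> yW[OF that] yW[OF that] zero_closed] .
    have q: "q t \<in> carrier R" if "t \<in> I" for t using u \<phi>y[OF that] by (simp add: q_def)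
    have y'W: "y' t \<in> W" if "t \<in> I - {s}" for t using that q yW s comb by (simp add: y'_def)
    have y': "\<psi> (y' t) = \<psi> (y t) \<oplus> q t \<otimes> \<psi> (y s)" if "\<psi> \<in> Lin" "t \<in> I" for \<psi> t
      using lin(2)[OF that(1) yW yW q] that s by (simp add: y'_def)
    have delta: "dual r (y' t) = (if r = t then \<one> else \<zero>)" if "r \<in> I - {s}" "t \<in> I - {s}" for r t
      using that s q y'[OF insert.prems(5)] insert.prems(6)[of r] by auto
    have \<phi>0: "\<phi> (y' t) = \<zero>" if "t \<in> I" for t
      using y'[OF \<phi> that] \<phi>y[OF that] \<phi>y[OF s(1)] u by (simp add: q_def l_minus m_assoc r_neg)
    have "card Q < card (I - {s})" using insert.prems(2,3) insert.hyps s by simp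
    then obtain z where z: "z \<in> W" "\<forall>\<phi>\<in>Q. \<phi> z = \<zero>" "\<exists>t\<in>I - {s}. dual t z \<noteq> \<zero>"
      "\<forall>\<psi>\<in>Lin. (\<forall>t\<in>I - {s}. \<psi> (y' t) = \<zero>) \<longrightarrow> \<psi> z = \<zero>"
      using insert.IH[of "I - {s}" y', OF Q _ _ y'W _ delta] insert.prems(2,5) by auto
    have "\<psi> z = \<zero>" if "\<psi> \<in> Lin" "\<forall>t\<in>I. \<psi> (y t) = \<zero>" for \<psi>
      using z(4) that y'[OF that(1)] q s by auto
    then show ?thesis using z \<phi> \<phi>0 by (intro bexI[of _ z]) auto
  qed
qed

text \<open>An algebra \<open>M\<close> over \<open>L\<close>, with scalars \<open>s\<close>, embedded in a coordinate space by \<open>\<kappa>\<close>.\<close>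

locale coordinate_algebra = M: ring M + L: field L
  for M :: "('m, 'k) ring_scheme" (structure) and L :: "('l, 'n) ring_scheme" +
  fixes s :: "'l \<Rightarrow> 'm" and \<kappa> :: "'i \<Rightarrow> 'm \<Rightarrow> 'l" and I :: "'i set"
  assumes fin: "finite I"
    and s_closed: "c \<in> carrier L \<Longrightarrow> s c \<in> carrier M"
    and s_comm: "c \<in> carrier L \<Longrightarrow> x \<in> carrier M \<Longrightarrow> s c \<otimes> x = x \<otimes> s c"
    and \<kappa>_closed: "i \<in> I \<Longrightarrow> x \<in> carrier M \<Longrightarrow> \<kappa> i x \<in> carrier L"
    and \<kappa>_comb: "i \<in> I \<Longrightarrow> c \<in> carrier L \<Longrightarrow> x \<in> carrier M \<Longrightarrow> y \<in> carrier M \<Longrightarrow>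
      \<kappa> i (x \<oplus> s c \<otimes> y) = \<kappa> i x \<oplus>\<^bsub>L\<^esub> c \<otimes>\<^bsub>L\<^esub> \<kappa> i y"
    and \<kappa>_inj: "x \<in> carrier M \<Longrightarrow> y \<in> carrier M \<Longrightarrow> (\<And>i. i \<in> I \<Longrightarrow> \<kappa> i x = \<kappa> i y) \<Longrightarrow> x = y"
begin

lemma \<kappa>_zero: "i \<in> I \<Longrightarrow> \<kappa> i \<zero> = \<zero>\<^bsub>L\<^esub>"
  using \<kappa>_comb[of i "\<one>\<^bsub>L\<^esub>" \<zero> \<zero>] \<kappa>_closed[of i \<zero>] s_closed[of "\<one>\<^bsub>L\<^esub>"] by (simp add: L.add.l_cancel_one')

lemma \<kappa>_scale: "i \<in> I \<Longrightarrow> c \<in> carrier L \<Longrightarrow> x \<in> carrier M \<Longrightarrow> \<kappa> i (s c \<otimes> x) = c \<otimes>\<^bsub>L\<^esub> \<kappa> i x"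
  using \<kappa>_comb[of i c \<zero> x] s_closed[of c] by (simp add: \<kappa>_zero \<kappa>_closed)

definition combs :: "'m set \<Rightarrow> bool" where
  "combs E \<longleftrightarrow> E \<subseteq> carrier M \<and> \<zero> \<in> E \<and> (\<forall>c\<in>carrier L. \<forall>x\<in>E. \<forall>y\<in>E. x \<oplus> s c \<otimes> y \<in> E)"

text \<open>Take a minimal set \<open>T\<close> of coordinates that detects the nonzero elements of
  \<open>E\<close>. Without \<open>t\<close> some nonzero element goes undetected; among the
  coordinates in \<open>T\<close> only the one at \<open>t\<close> is nonzero on it, and scaling
  makes that 1.\<close>

lemma dual_family:
  assumes E: "combs E"
  obtains T x where "T \<subseteq> I" "\<And>t. t \<in> T \<Longrightarrow> x t \<in> E"
    "\<And>r t. r \<in> T \<Longrightarrow> t \<in> T \<Longrightarrow> \<kappa> r (x t) = (if r = t then \<one>\<^bsub>L\<^esub> else \<zero>\<^bsub>L\<^esub>)"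
    "\<And>y. y \<in> E \<Longrightarrow> (\<And>t. t \<in> T \<Longrightarrow> \<kappa> t y = \<zero>\<^bsub>L\<^esub>) \<Longrightarrow> y = \<zero>"
proof -
  have EM: "y \<in> carrier M" if "y \<in> E" for y using E that by (auto simp: combs_def)
  let ?A = "{T. T \<subseteq> I \<and> (\<forall>y\<in>E. (\<forall>t\<in>T. \<kappa> t y = \<zero>\<^bsub>L\<^esub>) \<longrightarrow> y = \<zero>)}"
  have IA: "I \<in> ?A" using \<kappa>_inj[OF EM M.zero_closed] by (auto simp: \<kappa>_zero)
  have finA: "finite ?A" using fin by auto
  then obtain T where T: "T \<in> ?A" and min: "\<forall>T'\<in>?A. T' \<subseteq> T \<longrightarrow> T = T'"
    using finite_has_minimal2[OF finA IA] by (elim bexE conjE)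
  have TI: "T \<subseteq> I" and inj: "\<And>y. y \<in> E \<Longrightarrow> (\<And>t. t \<in> T \<Longrightarrow> \<kappa> t y = \<zero>\<^bsub>L\<^esub>) \<Longrightarrow> y = \<zero>"
    using T by auto
  have "\<exists>x\<in>E. \<forall>r\<in>T. \<kappa> r x = (if r = t then \<one>\<^bsub>L\<^esub> else \<zero>\<^bsub>L\<^esub>)" if t: "t \<in> T" for t
  proof -
    have "T - {t} \<notin> ?A" using min t by blast
    then obtain y where y: "y \<in> E" "\<And>r. r \<in> T \<Longrightarrow> r \<noteq> t \<Longrightarrow> \<kappa> r y = \<zero>\<^bsub>L\<^esub>" "y \<noteq> \<zero>" using TI by auto
    have tI: "t \<in> I" using t TI by blast
    have "\<kappa> t y \<noteq> \<zero>\<^bsub>L\<^esub>" using inj[OF y(1)] y by metis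
    then have u: "\<kappa> t y \<in> Units L" using \<kappa>_closed[OF tI EM[OF y(1)]] by (simp add: L.field_Units)
    let ?x = "\<zero> \<oplus> s (inv\<^bsub>L\<^esub> \<kappa> t y) \<otimes> y"
    have "?x \<in> E" using E y(1) u by (auto simp: combs_def)
    moreover have "\<kappa> r ?x = (if r = t then \<one>\<^bsub>L\<^esub> else \<zero>\<^bsub>L\<^esub>)" if "r \<in> T" for r
      using that TI u y(2)[OF that] EM[OF y(1)] by (auto simp: \<kappa>_comb \<kappa>_zero)
    ultimately show ?thesis by blast
  qed
  then obtain x where "\<And>t. t \<in> T \<Longrightarrow> x t \<in> E"
    "\<And>r t. r \<in> T \<Longrightarrow> t \<in> T \<Longrightarrow> \<kappa> r (x t) = (if r = t then \<one>\<^bsub>L\<^esub> else \<zero>\<^bsub>L\<^esub>)"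
    by metis
  then show ?thesis using that[of T x] TI inj by blast
qed

text \<open>The matrix with rows \<open>(p0, q0)\<close> and \<open>(p1, q1)\<close> is an isomorphism from the extension of \<open>\<alpha>\<close> by \<open>\<alpha>\<close>
  with cocycle \<open>\<alpha>'\<close> to the split one. With \<open>E\<close> the commutant of the \<open>\<alpha>\<close>, the map \<open>(x, y) \<mapsto> x p0 + y p1\<close>
  from \<open>E \<times> E\<close> to \<open>E\<close> has a kernel that \<open>(x, y) \<mapsto> x q0 + y q1\<close> embeds into \<open>E\<close>, so it is onto by counting
  dimensions, and a preimage of \<open>1\<close> is a splitting.\<close>

lemma splitting:
  assumes \<Lambda>: "\<And>\<alpha> \<alpha>'. (\<alpha>, \<alpha>') \<in> \<Lambda> \<Longrightarrow> \<alpha> \<in> carrier M" "\<And>\<alpha> \<alpha>'. (\<alpha>, \<alpha>') \<in> \<Lambda> \<Longrightarrow> \<alpha>' \<in> carrier M"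
    and p: "p0 \<in> carrier M" "p1 \<in> carrier M" "q0 \<in> carrier M" "q1 \<in> carrier M"
    and comm: "\<And>\<alpha> \<alpha>'. (\<alpha>, \<alpha>') \<in> \<Lambda> \<Longrightarrow> p0 \<otimes> \<alpha> = \<alpha> \<otimes> p0" "\<And>\<alpha> \<alpha>'. (\<alpha>, \<alpha>') \<in> \<Lambda> \<Longrightarrow> p1 \<otimes> \<alpha> = \<alpha> \<otimes> p1"
    and cocycle: "\<And>\<alpha> \<alpha>'. (\<alpha>, \<alpha>') \<in> \<Lambda> \<Longrightarrow> p0 \<otimes> \<alpha>' \<oplus> q0 \<otimes> \<alpha> = \<alpha> \<otimes> q0"
      "\<And>\<alpha> \<alpha>'. (\<alpha>, \<alpha>') \<in> \<Lambda> \<Longrightarrow> p1 \<otimes> \<alpha>' \<oplus> q1 \<otimes> \<alpha> = \<alpha> \<otimes> q1"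
    and inj: "\<And>x y. x \<in> carrier M \<Longrightarrow> y \<in> carrier M \<Longrightarrow> x \<otimes> p0 \<oplus> y \<otimes> p1 = \<zero> \<Longrightarrow> x \<otimes> q0 \<oplus> y \<otimes> q1 = \<zero> \<Longrightarrow>
      x = \<zero> \<and> y = \<zero>"
  shows "\<exists>y\<in>carrier M. \<forall>(\<alpha>, \<alpha>')\<in>\<Lambda>. \<alpha>' \<oplus> y \<otimes> \<alpha> = \<alpha> \<otimes> y"
proof -
  define E where "E = {x \<in> carrier M. \<forall>(\<alpha>, \<alpha>')\<in>\<Lambda>. x \<otimes> \<alpha> = \<alpha> \<otimes> x}"
  have EM: "x \<in> carrier M" if "x \<in> E" for x using that by (simp add: E_def)
  have Ec: "x \<otimes> \<alpha> = \<alpha> \<otimes> x" if "x \<in> E" "(\<alpha>, \<alpha>') \<in> \<Lambda>" for x \<alpha> \<alpha>' using that by (auto simp: E_def)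
  have EI: "x \<in> E" if "x \<in> carrier M" "\<And>\<alpha> \<alpha>'. (\<alpha>, \<alpha>') \<in> \<Lambda> \<Longrightarrow> x \<otimes> \<alpha> = \<alpha> \<otimes> x" for x
    using that by (auto simp: E_def)
  have E_comb: "x \<oplus> s c \<otimes> y \<in> E" if "c \<in> carrier L" "x \<in> E" "y \<in> E" for c x y
  proof (rule EI)
    fix \<alpha> \<alpha>' assume \<alpha>: "(\<alpha>, \<alpha>') \<in> \<Lambda>"
    have "s c \<otimes> y \<otimes> \<alpha> = \<alpha> \<otimes> (s c \<otimes> y)"
      using that EM \<Lambda>(1)[OF \<alpha>] s_closed Ec[OF that(3) \<alpha>] s_comm[of c \<alpha>] by (simp add: M.m_assoc) (simp add: M.m_assoc[symmetric])
    then show "(x \<oplus> s c \<otimes> y) \<otimes> \<alpha> = \<alpha> \<otimes> (x \<oplus> s c \<otimes> y)"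
      using that EM \<Lambda>(1)[OF \<alpha>] s_closed Ec[OF that(2) \<alpha>] by (simp add: M.l_distr M.r_distr)
  qed (use that EM s_closed in auto)
  have E0: "\<zero> \<in> E" and E1: "\<one> \<in> E" using \<Lambda> by (auto intro!: EI)
  have E: "combs E" unfolding combs_def using EM E0 E_comb by auto
  obtain T x where T: "T \<subseteq> I" and x: "\<And>t. t \<in> T \<Longrightarrow> x t \<in> E"
    and dual: "\<And>r t. r \<in> T \<Longrightarrow> t \<in> T \<Longrightarrow> \<kappa> r (x t) = (if r = t then \<one>\<^bsub>L\<^esub> else \<zero>\<^bsub>L\<^esub>)"
    and sep: "\<And>y. y \<in> E \<Longrightarrow> (\<And>t. t \<in> T \<Longrightarrow> \<kappa> t y = \<zero>\<^bsub>L\<^esub>) \<Longrightarrow> y = \<zero>"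
    using dual_family[OF E] by metis
  have TI: "t \<in> I" if "t \<in> T" for t using T that by blast
  have finT: "finite T" using T fin by (rule finite_subset)
  define f where "f z = fst z \<otimes> p0 \<oplus> snd z \<otimes> p1" for z
  define g where "g z = fst z \<otimes> q0 \<oplus> snd z \<otimes> q1" for z
  define comb where "comb c z w = (fst z \<oplus> s c \<otimes> fst w, snd z \<oplus> s c \<otimes> snd w)" for c and z w :: "'m \<times> 'm"
  have fgM: "f z \<in> carrier M" "g z \<in> carrier M" if "z \<in> E \<times> E" for z
    using that EM p by (auto simp: f_def g_def)
  have combE: "comb c z w \<in> E \<times> E" if "c \<in> carrier L" "z \<in> E \<times> E" "w \<in> E \<times> E" for c z w
    using that E_comb by (auto simp: comb_def)
  have lin: "(a \<oplus> s c \<otimes> a') \<otimes> r \<oplus> (b \<oplus> s c \<otimes> b') \<otimes> r' = (a \<otimes> r \<oplus> b \<otimes> r') \<oplus> s c \<otimes> (a' \<otimes> r \<oplus> b' \<otimes> r')"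
    if "c \<in> carrier L" "a \<in> carrier M" "a' \<in> carrier M" "b \<in> carrier M" "b' \<in> carrier M" "r \<in> carrier M" "r' \<in> carrier M"
    for a a' b b' c r r'
    using that s_closed by (simp add: M.l_distr M.r_distr M.m_assoc M.a_ac)
  have f_comb: "f (comb c z w) = f z \<oplus> s c \<otimes> f w" and g_comb: "g (comb c z w) = g z \<oplus> s c \<otimes> g w"
    if "c \<in> carrier L" "z \<in> E \<times> E" "w \<in> E \<times> E" for c z w
    using that EM p by (auto simp: f_def g_def comb_def lin)
  have fE: "f z \<in> E" if z: "z \<in> E \<times> E" for z
  proof (rule EI)
    fix \<alpha> \<alpha>' assume \<alpha>: "(\<alpha>, \<alpha>') \<in> \<Lambda>"
    have "a \<otimes> p \<otimes> \<alpha> = \<alpha> \<otimes> (a \<otimes> p)" if "a \<in> E" "p \<in> carrier M" "p \<otimes> \<alpha> = \<alpha> \<otimes> p" for a p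
      using that EM \<Lambda>(1)[OF \<alpha>] Ec[OF that(1) \<alpha>] by (simp add: M.m_assoc) (simp add: M.m_assoc[symmetric])
    then show "f z \<otimes> \<alpha> = \<alpha> \<otimes> f z"
      using z EM p comm[OF \<alpha>] \<Lambda>(1)[OF \<alpha>] by (auto simp: f_def M.l_distr M.r_distr)
  qed (rule fgM[OF z])
  \<comment> \<open>A combination of the two cocycle equations with coefficients in the commutant;
    where \<open>f z = 1\<close>, it says that \<open>g z\<close> is a splitting.\<close>
  have fg: "f z \<otimes> \<alpha>' \<oplus> g z \<otimes> \<alpha> = \<alpha> \<otimes> g z" if z: "z \<in> E \<times> E" and \<alpha>: "(\<alpha>, \<alpha>') \<in> \<Lambda>" for z \<alpha> \<alpha>'
  proof -
    obtain a b where ab: "z = (a, b)" "a \<in> E" "b \<in> E" using z by auto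
    have *: "a \<otimes> (p \<otimes> \<alpha>') \<oplus> a \<otimes> (q \<otimes> \<alpha>) = \<alpha> \<otimes> (a \<otimes> q)"
      if "a \<in> E" "p \<in> carrier M" "q \<in> carrier M" "p \<otimes> \<alpha>' \<oplus> q \<otimes> \<alpha> = \<alpha> \<otimes> q" for a p q
    proof -
      have "a \<otimes> (p \<otimes> \<alpha>') \<oplus> a \<otimes> (q \<otimes> \<alpha>) = a \<otimes> (\<alpha> \<otimes> q)"
        using that EM \<Lambda>[OF \<alpha>] by (simp add: M.r_distr flip: that(4))
      also have "\<dots> = \<alpha> \<otimes> (a \<otimes> q)"
        using that EM \<Lambda>(1)[OF \<alpha>] Ec[OF that(1) \<alpha>] by (simp add: M.m_assoc[symmetric])
      finally show ?thesis .
    qed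
    note cl = EM[OF ab(2)] EM[OF ab(3)] p \<Lambda>[OF \<alpha>]
    have "f z \<otimes> \<alpha>' \<oplus> g z \<otimes> \<alpha> = (a \<otimes> (p0 \<otimes> \<alpha>') \<oplus> a \<otimes> (q0 \<otimes> \<alpha>)) \<oplus> (b \<otimes> (p1 \<otimes> \<alpha>') \<oplus> b \<otimes> (q1 \<otimes> \<alpha>))"
      using cl by (simp add: ab f_def g_def M.l_distr M.m_assoc M.a_ac)
    also have "\<dots> = \<alpha> \<otimes> g z"
      using cl *[OF ab(2) p(1,3) cocycle(1)[OF \<alpha>]] *[OF ab(3) p(2,4) cocycle(2)[OF \<alpha>]]
      by (simp add: ab g_def M.r_distr)
    finally show ?thesis .
  qed
  have im_comb: "\<exists>z\<in>E \<times> E. f z = u \<oplus> s c \<otimes> v"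
    if uv: "\<exists>z\<in>E \<times> E. f z = u" "\<exists>z\<in>E \<times> E. f z = v" and c: "c \<in> carrier L" for u v c
  proof -
    obtain z w where "z \<in> E \<times> E" "f z = u" "w \<in> E \<times> E" "f w = v" using uv by blast
    then show ?thesis using combE[OF c] f_comb[OF c] by (intro bexI[of _ "comb c z w"]) auto
  qed
  have x_im: "\<exists>z\<in>E \<times> E. f z = x r" if r: "r \<in> T" for r
  proof -
    let ?lin = "{\<phi>. \<phi> \<in> E \<times> E \<rightarrow> carrier L \<and>
      (\<forall>c\<in>carrier L. \<forall>x\<in>E \<times> E. \<forall>y\<in>E \<times> E. \<phi> (comb c x y) = \<phi> x \<oplus>\<^bsub>L\<^esub> c \<otimes>\<^bsub>L\<^esub> \<phi> y)}"
    \<comment> \<open>All coordinates of \<open>g\<close> in \<open>T\<close>, and those of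
      \<open>f\<close> except \<open>r\<close>: at most \<open>2 |T| - 1\<close> conditions on
      \<open>E \<times> E\<close>, which has a dual family of \<open>2 |T|\<close> vectors. A common
      zero has \<open>f z\<close> proportional to \<open>x r\<close>, and the factor remains to be
      shown nonzero.\<close>
    define Q where "Q = (\<lambda>t z. \<kappa> t (g z)) ` T \<union> (\<lambda>t z. \<kappa> t (f z)) ` (T - {r})"
    define y where "y = (\<lambda>(b, t). if b then (x t, \<zero>) else (\<zero>, x t))"
    define l where "l = (\<lambda>(b, t) z. \<kappa> t (if b then fst z else snd z))"
    have Q: "Q \<subseteq> ?lin"
      unfolding Q_def using TI fgM by (auto simp: f_comb g_comb \<kappa>_comb intro!: \<kappa>_closed)
    have "card Q \<le> card T + card (T - {r})"
      unfolding Q_def using finT by (intro order.trans[OF card_Un_le] add_mono card_image_le) auto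
    moreover have "card T > 0" using finT r by (auto simp: card_gt_0_iff)
    ultimately have card: "card Q < card ((UNIV :: bool set) \<times> T)"
      using r finT by (simp add: card_cartesian_product)
    have finQ: "finite Q" using finT by (simp add: Q_def)
    have yE: "y i \<in> E \<times> E" if "i \<in> UNIV \<times> T" for i using that x E0 by (auto simp: y_def)
    have l: "l i \<in> ?lin" if "i \<in> UNIV \<times> T" for i
      using that TI EM by (auto simp: l_def comb_def \<kappa>_comb intro!: \<kappa>_closed)
    have ly: "l i (y j) = (if i = j then \<one>\<^bsub>L\<^esub> else \<zero>\<^bsub>L\<^esub>)" if "i \<in> UNIV \<times> T" "j \<in> UNIV \<times> T" for i j
      using that TI by (auto simp: l_def y_def dual \<kappa>_zero split: if_splits)
    have finI: "finite ((UNIV :: bool set) \<times> T)" using finT by simp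
    obtain z where z: "z \<in> E \<times> E" "\<forall>\<phi>\<in>Q. \<phi> z = \<zero>\<^bsub>L\<^esub>" "\<exists>i\<in>UNIV \<times> T. l i z \<noteq> \<zero>\<^bsub>L\<^esub>"
      using L.common_zero[where comb = comb and W = "E \<times> E", OF combE finQ Q finI card yE l ly] by auto
    have gz: "\<kappa> t (g z) = \<zero>\<^bsub>L\<^esub>" if "t \<in> T" for t using z(2) that by (auto simp: Q_def)
    have fz: "\<kappa> t (f z) = \<zero>\<^bsub>L\<^esub>" if "t \<in> T" "t \<noteq> r" for t using z(2) that by (auto simp: Q_def)
    note fgz = fgM[OF z(1)]
    \<comment> \<open>If it vanished, then \<open>f z = 0\<close>. Only then does \<open>fg\<close>
      place \<open>g z\<close> in the commutant, where its vanishing coordinates give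
      \<open>g z = 0\<close>, so that \<open>z = 0\<close> by \<open>inj\<close>; but some
      coordinate of \<open>z\<close> is nonzero.\<close>
    have "\<kappa> r (f z) \<noteq> \<zero>\<^bsub>L\<^esub>"
    proof
      assume "\<kappa> r (f z) = \<zero>\<^bsub>L\<^esub>"
      then have f0: "f z = \<zero>" using fz by (intro sep[OF fE[OF z(1)]]) auto
      have "g z \<in> E"
        using fg[OF z(1)] f0 fgz \<Lambda> by (intro EI) auto
      then have g0: "g z = \<zero>" using gz by (rule sep)
      have "fst z = \<zero> \<and> snd z = \<zero>"
        using inj[of "fst z" "snd z"] f0 g0 z(1) EM by (auto simp: f_def g_def)
      then show False using z(3) TI by (auto simp: l_def \<kappa>_zero split: if_splits)
    qed
    then have u: "\<kappa> r (f z) \<in> Units L" using \<kappa>_closed[OF TI[OF r] fgz(1)] by (simp add: L.field_Units)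
    let ?c = "inv\<^bsub>L\<^esub> \<kappa> r (f z)" and ?m = "\<ominus>\<^bsub>L\<^esub> \<one>\<^bsub>L\<^esub>"
    have c: "?c \<in> carrier L" using u by simp
    let ?d = "(\<zero> \<oplus> s ?c \<otimes> f z) \<oplus> s ?m \<otimes> x r"
    have v: "\<zero> \<oplus> s ?c \<otimes> f z \<in> E" by (rule E_comb[OF c E0 fE[OF z(1)]])
    have "?d \<in> E" using E_comb[OF _ v x[OF r], of ?m] by simp
    then have "?d = \<zero>"
    proof (rule sep)
      fix t assume t: "t \<in> T"
      then show "\<kappa> t ?d = \<zero>\<^bsub>L\<^esub>"
        using r TI[OF t] u c EM[OF v] EM[OF x[OF r]] fz[OF t] fgz(1)
        by (cases "t = r") (auto simp: \<kappa>_comb \<kappa>_zero dual L.r_neg L.l_minus)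
    qed
    moreover have "\<kappa> i (\<zero> \<oplus> s ?c \<otimes> f z) = \<kappa> i (x r)" if i: "i \<in> I" and d0: "?d = \<zero>" for i
    proof -
      have "\<kappa> i (\<zero> \<oplus> s ?c \<otimes> f z) \<oplus>\<^bsub>L\<^esub> ?m \<otimes>\<^bsub>L\<^esub> \<kappa> i (x r) = \<zero>\<^bsub>L\<^esub>"
        using \<kappa>_comb[OF i _ EM[OF v] EM[OF x[OF r]], of ?m] d0 \<kappa>_zero[OF i] by simp
      then show ?thesis
        using \<kappa>_closed[OF i EM[OF v]] \<kappa>_closed[OF i EM[OF x[OF r]]]
        by (simp add: L.l_minus) (metis L.a_inv_closed L.minus_equality L.minus_minus)
    qed
    ultimately have "\<zero> \<oplus> s ?c \<otimes> f z = x r" using EM[OF v] EM[OF x[OF r]] by (intro \<kappa>_inj) auto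
    moreover have "\<exists>z\<in>E \<times> E. f z = \<zero>" using E0 p by (intro bexI[of _ "(\<zero>, \<zero>)"]) (auto simp: f_def)
    ultimately show ?thesis using im_comb[of \<zero> "f z" ?c] z(1) c by auto
  qed
  \<comment> \<open>Induction over the coordinates at which \<open>u\<close> may be nonzero;
    removing one of them subtracts a multiple of the corresponding \<open>x t\<close>, which is
    already known to be a value of \<open>f\<close>.\<close>
  have "\<exists>z\<in>E \<times> E. f z = u" if "S \<subseteq> T" "u \<in> E" "\<And>t. t \<in> T - S \<Longrightarrow> \<kappa> t u = \<zero>\<^bsub>L\<^esub>" for S u
    using finite_subset[OF that(1) finT] that
  proof (induction S arbitrary: u rule: finite_induct)
    case empty
    then have "u = \<zero>" by (intro sep) auto
    then show ?case using E0 p by (intro bexI[of _ "(\<zero>, \<zero>)"]) (auto simp: f_def)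
  next
    case (insert t S)
    have t: "t \<in> T" using insert.prems by blast
    let ?k = "\<kappa> t u"
    have k: "?k \<in> carrier L" "\<ominus>\<^bsub>L\<^esub> ?k \<in> carrier L" using \<kappa>_closed[OF TI[OF t] EM[OF insert.prems(2)]] by auto
    let ?v = "u \<oplus> s (\<ominus>\<^bsub>L\<^esub> ?k) \<otimes> x t"
    have v: "?v \<in> E" by (rule E_comb[OF k(2) insert.prems(2) x[OF t]])
    have "\<exists>z\<in>E \<times> E. f z = ?v"
    proof (rule insert.IH)
      fix r assume r: "r \<in> T - S"
      then show "\<kappa> r ?v = \<zero>\<^bsub>L\<^esub>"
        using insert.prems(3)[of r] TI[of r] t k EM[OF insert.prems(2)] EM[OF x[OF t]]
        by (cases "r = t") (auto simp: \<kappa>_comb dual L.r_neg)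
    qed (use insert.prems v in auto)
    then have "\<exists>z\<in>E \<times> E. f z = ?v \<oplus> s ?k \<otimes> x t" by (rule im_comb[OF _ x_im[OF t] k(1)])
    moreover have "?v \<oplus> s ?k \<otimes> x t = u"
    proof (rule \<kappa>_inj)
      fix i assume i: "i \<in> I"
      then show "\<kappa> i (?v \<oplus> s ?k \<otimes> x t) = \<kappa> i u"
        using k EM[OF v] EM[OF insert.prems(2)] EM[OF x[OF t]] \<kappa>_closed[OF i]
        by (simp add: \<kappa>_comb L.a_assoc L.l_minus L.l_neg)
    qed (use EM[OF E_comb[OF k(1) v x[OF t]]] EM[OF insert.prems(2)] in auto)
    ultimately show ?case by simp
  qed
  \<comment> \<open>The identity lies in the commutant, and a preimage \<open>z\<close> of it gives
    the splitting \<open>g z\<close>.\<close>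
  from this[of T \<one>] E1 obtain z where z: "z \<in> E \<times> E" "f z = \<one>" by auto
  then show ?thesis using fg[OF z(1)] fgM[OF z(1)] \<Lambda> by (intro bexI[of _ "g z"]) auto
qed

end

subsection \<open>Functionals and matrices\<close>

lemma (in module) functionals_eqI:
  assumes "field R" and xy: "x \<in> carrier M" "y \<in> carrier M"
    and eq: "\<And>\<phi>. \<phi> \<in> functionals R M \<Longrightarrow> \<phi> x = \<phi> y"
  shows "x = y"
proof (rule ccontr)
  interpret field R by fact
  assume "x \<noteq> y"
  have x: "x = (x \<ominus>\<^bsub>M\<^esub> y) \<oplus>\<^bsub>M\<^esub> y" using xy by (simp add: a_minus_def M.a_assoc M.l_neg)
  then have z: "x \<ominus>\<^bsub>M\<^esub> y \<in> carrier M" "x \<ominus>\<^bsub>M\<^esub> y \<notin> {\<zero>\<^bsub>M\<^esub>}"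
    using xy \<open>x \<noteq> y\<close> M.l_zero[of y] by auto
  have 0: "\<ominus>\<^bsub>M\<^esub> \<zero>\<^bsub>M\<^esub> = \<zero>\<^bsub>M\<^esub>" by (metis M.l_neg M.r_zero M.zero_closed M.a_inv_closed)
  have "submodule {\<zero>\<^bsub>M\<^esub>} R M" by (rule submoduleI) (auto simp: 0)
  then obtain \<phi> where \<phi>: "\<phi> \<in> functionals R M" "\<phi> (x \<ominus>\<^bsub>M\<^esub> y) = \<one>"
    by (rule functional_separating[OF assms(1) _ z]) auto
  have "\<phi> ((x \<ominus>\<^bsub>M\<^esub> y) \<oplus>\<^bsub>M\<^esub> y) = \<one> \<oplus> \<phi> y" using \<phi> z(1) xy by (simp add: functionals_def)
  then have "\<phi> x = \<one> \<oplus> \<phi> y" by (simp only: x[symmetric])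
  moreover have \<phi>y: "\<phi> y \<in> carrier R" using \<phi>(1) xy by (auto simp: functionals_def)
  ultimately have "\<one> \<oplus> \<phi> y = \<zero> \<oplus> \<phi> y" using eq[OF \<phi>(1)] by simp
  then show False using R.add.right_cancel[OF \<phi>y R.one_closed R.zero_closed] by simp
qed

lemma functional_finsum:
  assumes "cring K" "cring F" "e \<in> Ring.ring_hom K F" and \<theta>: "\<theta> \<in> functionals K (fun_module F e I)"
    and T: "finite T" "\<And>t. t \<in> T \<Longrightarrow> c t \<in> carrier K" "\<And>t. t \<in> T \<Longrightarrow> v t \<in> I \<rightarrow>\<^sub>E carrier F"
  shows "\<theta> (\<lambda>i\<in>I. \<Oplus>\<^bsub>F\<^esub>t\<in>T. e (c t) \<otimes>\<^bsub>F\<^esub> v t i) = (\<Oplus>\<^bsub>K\<^esub>t\<in>T. c t \<otimes>\<^bsub>K\<^esub> \<theta> (v t))"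
  using T
proof (induction T rule: finite_induct)
  interpret K: cring K by fact
  interpret F: cring F by fact
  interpret ring_hom_cring K F e by unfold_locales fact
  have \<theta>c: "\<theta> x \<in> carrier K" if "x \<in> I \<rightarrow>\<^sub>E carrier F" for x using \<theta> that by (auto simp: functionals_def)
  have \<theta>a: "\<theta> (\<lambda>i\<in>I. x i \<oplus>\<^bsub>F\<^esub> y i) = \<theta> x \<oplus>\<^bsub>K\<^esub> \<theta> y" if "x \<in> I \<rightarrow>\<^sub>E carrier F" "y \<in> I \<rightarrow>\<^sub>E carrier F" for x y
    using \<theta> that by (simp add: functionals_def)
  have \<theta>s: "\<theta> (\<lambda>i\<in>I. e c \<otimes>\<^bsub>F\<^esub> x i) = c \<otimes>\<^bsub>K\<^esub> \<theta> x" if "x \<in> I \<rightarrow>\<^sub>E carrier F" "c \<in> carrier K" for x c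
    using \<theta> that by (simp add: functionals_def)
  {
    case empty
    have z: "(\<lambda>i\<in>I. \<zero>\<^bsub>F\<^esub>) \<in> I \<rightarrow>\<^sub>E carrier F" by auto
    have "(\<lambda>i\<in>I. e \<zero>\<^bsub>K\<^esub> \<otimes>\<^bsub>F\<^esub> (\<lambda>i\<in>I. \<zero>\<^bsub>F\<^esub>) i) = (\<lambda>i\<in>I. \<zero>\<^bsub>F\<^esub>)" by (auto simp: fun_eq_iff)
    then have "\<theta> (\<lambda>i\<in>I. \<zero>\<^bsub>F\<^esub>) = \<zero>\<^bsub>K\<^esub>" using \<theta>s[OF z K.zero_closed] \<theta>c[OF z] by simp
    then show ?case by (simp add: restrict_def)
  next
    case (insert t T)
    let ?x = "\<lambda>i\<in>I. e (c t) \<otimes>\<^bsub>F\<^esub> v t i" and ?y = "\<lambda>i\<in>I. \<Oplus>\<^bsub>F\<^esub>t\<in>T. e (c t) \<otimes>\<^bsub>F\<^esub> v t i"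
    have vc: "e (c r) \<otimes>\<^bsub>F\<^esub> v r i \<in> carrier F" if "r \<in> insert t T" "i \<in> I" for r i
      using insert.prems(1)[OF that(1)] insert.prems(2)[OF that(1)] that(2) by auto
    have xy: "?x \<in> I \<rightarrow>\<^sub>E carrier F" "?y \<in> I \<rightarrow>\<^sub>E carrier F" using vc by (auto intro!: F.finsum_closed)
    have eq: "(\<lambda>i\<in>I. \<Oplus>\<^bsub>F\<^esub>r\<in>insert t T. e (c r) \<otimes>\<^bsub>F\<^esub> v r i) = (\<lambda>i\<in>I. ?x i \<oplus>\<^bsub>F\<^esub> ?y i)"
    proof (rule restrict_ext)
      fix i assume i: "i \<in> I"
      then show "(\<Oplus>\<^bsub>F\<^esub>r\<in>insert t T. e (c r) \<otimes>\<^bsub>F\<^esub> v r i) = ?x i \<oplus>\<^bsub>F\<^esub> ?y i"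
        using vc[OF _ i] insert.hyps by (subst F.finsum_insert) auto
    qed
    have IH: "\<theta> ?y = (\<Oplus>\<^bsub>K\<^esub>r\<in>T. c r \<otimes>\<^bsub>K\<^esub> \<theta> (v r))"
      by (rule insert.IH) (use insert.prems in auto)
    from eq have "\<theta> (\<lambda>i\<in>I. \<Oplus>\<^bsub>F\<^esub>r\<in>insert t T. e (c r) \<otimes>\<^bsub>F\<^esub> v r i) = c t \<otimes>\<^bsub>K\<^esub> \<theta> (v t) \<oplus>\<^bsub>K\<^esub> \<theta> ?y"
      using \<theta>a[OF xy] \<theta>s[of "v t" "c t"] insert.prems by simp
    also have "\<dots> = (\<Oplus>\<^bsub>K\<^esub>r\<in>insert t T. c r \<otimes>\<^bsub>K\<^esub> \<theta> (v r))"
      unfolding IH using insert.hyps insert.prems \<theta>c by (subst K.finsum_insert) auto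
    finally show ?case .
  }
qed

lemma (in field) coordinate_algebra_mat_ring:
  assumes fin: "finite N"
  shows "coordinate_algebra (mat_ring R N) R (\<lambda>c. \<lambda>i\<in>N. \<lambda>j\<in>N. if i = j then c else \<zero>) (\<lambda>x A. A (fst x) (snd x)) (N \<times> N)"
proof -
  interpret M: ring "mat_ring R N" by (rule ring_mat_ring[OF fin])
  let ?s = "\<lambda>c. \<lambda>i\<in>N. \<lambda>j\<in>N. if i = j then c else \<zero>"
  have s: "?s c \<in> mats R N N" if "c \<in> carrier R" for c using that by (intro mats_restrict) auto
  have sl: "(?s c \<otimes>\<^bsub>mat_ring R N\<^esub> A) i j = c \<otimes> A i j" and sr: "(A \<otimes>\<^bsub>mat_ring R N\<^esub> ?s c) i j = A i j \<otimes> c"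
    if c: "c \<in> carrier R" and A: "A \<in> mats R N N" and ij: "i \<in> N" "j \<in> N" for c A i j
  proof -
    note cl = mats_closed[OF A]
    have "(\<Oplus>k\<in>N. ?s c i k \<otimes> A k j) = (\<Oplus>k\<in>N. if i = k then c \<otimes> A k j else \<zero>)"
      using cl c ij by (intro finsum_cong') auto
    also have "\<dots> = c \<otimes> A i j" using cl c ij by (intro finsum_delta fin) auto
    finally show "(?s c \<otimes>\<^bsub>mat_ring R N\<^esub> A) i j = c \<otimes> A i j" by (simp only: mult_entry[OF ij])
    have "(\<Oplus>k\<in>N. A i k \<otimes> ?s c k j) = (\<Oplus>k\<in>N. if j = k then A i k \<otimes> c else \<zero>)"
      using cl c ij by (intro finsum_cong') auto
    also have "\<dots> = A i j \<otimes> c" using cl c ij by (intro finsum_delta fin) auto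
    finally show "(A \<otimes>\<^bsub>mat_ring R N\<^esub> ?s c) i j = A i j \<otimes> c" by (simp only: mult_entry[OF ij])
  qed
  show ?thesis
  proof (intro coordinate_algebra.intro coordinate_algebra_axioms.intro)
    fix c A assume c: "c \<in> carrier R" and A: "A \<in> carrier (mat_ring R N)"
    have AM: "A \<in> mats R N N" using A by (simp add: carrier_mat_ring)
    have sM: "?s c \<in> carrier (mat_ring R N)" using s[OF c] by (simp add: carrier_mat_ring)
    show "?s c \<otimes>\<^bsub>mat_ring R N\<^esub> A = A \<otimes>\<^bsub>mat_ring R N\<^esub> ?s c"
      using M.m_closed[OF A sM] M.m_closed[OF sM A] c mats_closed[OF AM]
      by (intro mats_eqI[of _ R N N _ R]) (simp_all only: carrier_mat_ring sl[OF c AM] sr[OF c AM] m_comm)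
    fix B x assume B: "B \<in> carrier (mat_ring R N)" and x: "x \<in> N \<times> N"
    show "(B \<oplus>\<^bsub>mat_ring R N\<^esub> ?s c \<otimes>\<^bsub>mat_ring R N\<^esub> A) (fst x) (snd x) = B (fst x) (snd x) \<oplus> c \<otimes> A (fst x) (snd x)"
      using x sl[OF c AM] by (auto simp: add_entry)
  next
    fix A B assume A: "A \<in> carrier (mat_ring R N)" "B \<in> carrier (mat_ring R N)"
      and eq: "\<And>x. x \<in> N \<times> N \<Longrightarrow> A (fst x) (snd x) = B (fst x) (snd x)"
    show "A = B"
      using A eq[of "(_, _)"] by (intro mats_eqI[of _ R N N _ R]) (simp_all add: carrier_mat_ring)
  qed (use fin s mats_closed in \<open>auto simp: carrier_mat_ring M.ring_axioms field_axioms\<close>)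
qed

section \<open>From an isomorphism over the closure to a gauge matrix over the base field\<close>

context linear_group
begin

text \<open>The map \<open>id \<otimes> \<theta>\<close> into \<open>L\<close>, for a functional
  \<open>\<theta>\<close> on all \<open>U\<close>-valued functions on the group. As these
  functionals separate functions, they do the work of coordinates with respect to a basis of the
  coordinate ring.\<close>

lemma tensor_functional:
  assumes L: "diff_field_map K L e" and \<theta>: "\<theta> \<in> functionals K (fun_module U \<iota> G)"
  defines "th \<equiv> \<lambda>a. \<theta> (\<lambda>g\<in>G. val a g)"
  obtains h where "h \<in> hom (tensor_product K L e \<A> \<kappa>) (add_monoid L)"
    "\<And>x a. x \<in> carrier L \<Longrightarrow> a \<in> carrier \<A> \<Longrightarrow> h (pure_tensor K L e \<A> \<kappa> x a) = x \<otimes>\<^bsub>L\<^esub> e (th a)"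
    "\<And>a. a \<in> carrier \<A> \<Longrightarrow> th a \<in> carrier K"
    "th \<zero>\<^bsub>\<A>\<^esub> = \<zero>\<^bsub>K\<^esub>"
proof -
  interpret L: diff_field_map K L e by fact
  interpret T: tensor_pair K L e \<A> \<kappa> by (rule tensor_pair_coord[OF L])
  have v: "(\<lambda>g\<in>G. val a g) \<in> G \<rightarrow>\<^sub>E carrier U" if "a \<in> carrier \<A>" for a
    using val_closed[OF that] by auto
  have \<theta>c: "\<theta> x \<in> carrier K" if "x \<in> G \<rightarrow>\<^sub>E carrier U" for x
    using \<theta> that by (auto simp: functionals_def)
  have th: "th a \<in> carrier K" if "a \<in> carrier \<A>" for a
    unfolding th_def by (rule \<theta>c[OF v[OF that]])
  have add: "th (a \<oplus>\<^bsub>\<A>\<^esub> b) = th a \<oplus>\<^bsub>K\<^esub> th b" if "a \<in> carrier \<A>" "b \<in> carrier \<A>" for a b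
  proof -
    have "\<theta> (\<lambda>g\<in>G. (\<lambda>g\<in>G. val a g) g \<oplus>\<^bsub>U\<^esub> (\<lambda>g\<in>G. val b g) g) = th a \<oplus>\<^bsub>K\<^esub> th b"
      using \<theta> v[OF that(1)] v[OF that(2)] by (simp add: functionals_def th_def del: restrict_apply)
    moreover have "(\<lambda>g\<in>G. (\<lambda>g\<in>G. val a g) g \<oplus>\<^bsub>U\<^esub> (\<lambda>g\<in>G. val b g) g) = (\<lambda>g\<in>G. val (a \<oplus>\<^bsub>\<A>\<^esub> b) g)"
      by (rule restrict_ext) (simp add: coord_add that)
    ultimately show ?thesis by (simp only: th_def)
  qed
  have scale: "th (\<kappa> c \<otimes>\<^bsub>\<A>\<^esub> a) = c \<otimes>\<^bsub>K\<^esub> th a" if "c \<in> carrier K" "a \<in> carrier \<A>" for c a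
  proof -
    have "\<theta> (\<lambda>g\<in>G. \<iota> c \<otimes>\<^bsub>U\<^esub> (\<lambda>g\<in>G. val a g) g) = c \<otimes>\<^bsub>K\<^esub> th a"
      using \<theta> v[OF that(2)] that(1) by (simp add: functionals_def th_def del: restrict_apply)
    moreover have "(\<lambda>g\<in>G. \<iota> c \<otimes>\<^bsub>U\<^esub> (\<lambda>g\<in>G. val a g) g) = (\<lambda>g\<in>G. val (\<kappa> c \<otimes>\<^bsub>\<A>\<^esub> a) g)"
      by (rule restrict_ext) (simp add: coord_scale that)
    ultimately show ?thesis by (simp only: th_def)
  qed
  obtain h where h: "h \<in> hom T.\<T> (add_monoid L)"
    "\<And>x a. x \<in> carrier L \<Longrightarrow> a \<in> carrier \<A> \<Longrightarrow> h (T.pure x a) = x \<otimes>\<^bsub>L\<^esub> e (th a)"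
  proof (rule T.tensor_lift[where H = "add_monoid L" and \<beta> = "\<lambda>x a. x \<otimes>\<^bsub>L\<^esub> e (th a)"])
    show "comm_group (add_monoid L)" by (rule L.B.a_comm_group)
    show "x \<otimes>\<^bsub>L\<^esub> e (th a) \<in> carrier (add_monoid L)" if "x \<in> carrier L" "a \<in> carrier \<A>" for x a
      using that th by simp
    show "(x \<oplus>\<^bsub>L\<^esub> y) \<otimes>\<^bsub>L\<^esub> e (th a) = x \<otimes>\<^bsub>L\<^esub> e (th a) \<otimes>\<^bsub>add_monoid L\<^esub> (y \<otimes>\<^bsub>L\<^esub> e (th a))"
      if "x \<in> carrier L" "y \<in> carrier L" "a \<in> carrier \<A>" for x y a
      using that th by (simp add: L.B.l_distr)
    show "x \<otimes>\<^bsub>L\<^esub> e (th (a \<oplus>\<^bsub>\<A>\<^esub> b)) = x \<otimes>\<^bsub>L\<^esub> e (th a) \<otimes>\<^bsub>add_monoid L\<^esub> (x \<otimes>\<^bsub>L\<^esub> e (th b))"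
      if "x \<in> carrier L" "a \<in> carrier \<A>" "b \<in> carrier \<A>" for x a b
      using that th by (simp add: add L.B.r_distr)
    show "e c \<otimes>\<^bsub>L\<^esub> x \<otimes>\<^bsub>L\<^esub> e (th a) = x \<otimes>\<^bsub>L\<^esub> e (th (\<kappa> c \<otimes>\<^bsub>\<A>\<^esub> a))"
      if "c \<in> carrier K" "x \<in> carrier L" "a \<in> carrier \<A>" for c x a
      using that th by (simp add: scale L.B.m_ac)
  qed (rule that)
  have "\<zero>\<^bsub>\<A>\<^esub> \<oplus>\<^bsub>\<A>\<^esub> \<zero>\<^bsub>\<A>\<^esub> = \<zero>\<^bsub>\<A>\<^esub>" by (rule val_eqI) (simp_all add: coord_zero coord_add)
  then have "th \<zero>\<^bsub>\<A>\<^esub> = \<zero>\<^bsub>K\<^esub>"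
    using add[OF coord_zero(1) coord_zero(1)] th[OF coord_zero(1)] by (simp add: A.add.l_cancel_one')
  then show ?thesis using that h th by blast
qed

text \<open>Under \<open>id \<otimes> \<theta>\<close> the comodule equation becomes a matrix
  equation over \<open>L\<close> with \<open>\<alpha> \<theta>\<close> in the place of
  \<open>g\<close> and \<open>\<alpha>' \<theta>\<close> in the place of \<open>g'\<close>. One
  splitting \<open>y\<close> serves all \<open>\<theta>\<close> at once, and after its retraction to
  \<open>K\<close> the equation can be lifted back to functions on the group.\<close>

lemma gauge_if_iso:
  assumes L: "diff_field_map K L e"
    and iso: "iso_rep_over K L e \<A> \<kappa> (prolongation \<A> 1 \<V>) (direct_sum_rep \<A> {..1::nat} (\<lambda>_. \<V>))"
  obtains B where "gauge n G B"
proof -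
  interpret L: diff_field_map K L e by fact
  interpret T: tensor_pair K L e \<A> \<kappa> by (rule tensor_pair_coord[OF L])
  let ?N = "{..<n}" and ?J = "{..1::nat} \<times> {..<n}"
  have J: "{..1::nat} = {0, 1}" by auto
  let ?M = "mat_ring L ?N"
  interpret M: ring ?M by (rule L.B.ring_mat_ring) simp
  interpret coordinate_algebra ?M L "\<lambda>c. \<lambda>i\<in>?N. \<lambda>j\<in>?N. if i = j then c else \<zero>\<^bsub>L\<^esub>" "\<lambda>x A. A (fst x) (snd x)" "?N \<times> ?N"
    by (rule L.B.coordinate_algebra_mat_ring) simp
  let ?a = "coact (prolongation \<A> 1 \<V>)" and ?a' = "coact (direct_sum_rep \<A> {..1::nat} (\<lambda>_. \<V>))"
  obtain P Q where P: "P \<in> mats L ?J ?J" and Q: "Q \<in> mats L ?J ?J"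
    and PQ: "mat_mult L ?J ?J ?J P Q = mat_one L ?J"
    and "mat_mult L ?J ?J ?J Q P = mat_one L ?J"
    and all: "\<forall>x\<in>?J. \<forall>y\<in>?J. (\<Otimes>\<^bsub>T.\<T>\<^esub>z\<in>?J. T.pure (P x z) (?a z y)) = (\<Otimes>\<^bsub>T.\<T>\<^esub>z\<in>?J. T.pure (P z y) (?a' x z))"
    using iso unfolding iso_rep_over_def basis_reps by (elim bexE conjE) (rule that)
  have eq: "(\<Otimes>\<^bsub>T.\<T>\<^esub>z\<in>?J. T.pure (P x z) (?a z y)) = (\<Otimes>\<^bsub>T.\<T>\<^esub>z\<in>?J. T.pure (P z y) (?a' x z))"
    if "x \<in> ?J" "y \<in> ?J" for x y
    by (rule bspec[OF bspec[OF all that(1)] that(2)])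
  let ?F = "functionals K (fun_module U \<iota> G)"
  let ?X = "coord_entry K U \<iota> n G"
  define th where "th \<theta> a = \<theta> (\<lambda>g\<in>G. val a g)" for \<theta> :: "((nat \<Rightarrow> nat \<Rightarrow> 'c) \<Rightarrow> 'c) \<Rightarrow> 'a" and a
  define \<alpha> where "\<alpha> \<theta> = (\<lambda>i\<in>?N. \<lambda>j\<in>?N. e (th \<theta> (?X i j)))" for \<theta>
  define \<alpha>' where "\<alpha>' \<theta> = (\<lambda>i\<in>?N. \<lambda>j\<in>?N. e (th \<theta> (der \<A> (?X i j))))" for \<theta>
  \<comment> \<open>The block of the isomorphism from the part of order \<open>m\<close> of the
    prolongation to the \<open>s\<close>-th copy of \<open>V\<close>.\<close>
  define p where "p s m = (\<lambda>i\<in>?N. \<lambda>j\<in>?N. P (s, i) (m, j))" for s m :: nat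
  have Pc: "P (s, i) (m, j) \<in> carrier L" if "s \<le> 1" "m \<le> 1" "i < n" "j < n" for s m i j
    using mats_closed[OF P, of "(s, i)" "(m, j)"] that by auto
  have pM: "p s m \<in> carrier ?M" if "s \<le> 1" "m \<le> 1" for s m
    unfolding p_def carrier_mat_ring using Pc[OF that] by (intro mats_restrict) auto
  have thc: "th \<theta> a \<in> carrier K" and th0: "th \<theta> \<zero>\<^bsub>\<A>\<^esub> = \<zero>\<^bsub>K\<^esub>" if "\<theta> \<in> ?F" "a \<in> carrier \<A>" for \<theta> a
    using tensor_functional[OF L that(1)] that(2) unfolding th_def by metis+
  have Xc: "?X i j \<in> carrier \<A>" "der \<A> (?X i j) \<in> carrier \<A>" if "i < n" "j < n" for i j
    using coord_entry(1)[OF that] coord_der(1) by auto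
  have \<alpha>M: "\<alpha> \<theta> \<in> carrier ?M" "\<alpha>' \<theta> \<in> carrier ?M" if "\<theta> \<in> ?F" for \<theta>
    unfolding \<alpha>_def \<alpha>'_def carrier_mat_ring using thc[OF that] Xc by (auto intro!: mats_restrict)
  have ac: "?a z w \<in> carrier \<A>" "?a' z w \<in> carrier \<A>" if "z \<in> ?J" "w \<in> ?J" for z w
    using that prolongation_entry(1) direct_sum_entry(1) by auto
  have th_eq: "(\<Oplus>\<^bsub>L\<^esub>z\<in>?J. P x z \<otimes>\<^bsub>L\<^esub> e (th \<theta> (?a z y))) = (\<Oplus>\<^bsub>L\<^esub>z\<in>?J. P z y \<otimes>\<^bsub>L\<^esub> e (th \<theta> (?a' x z)))"
    if \<theta>: "\<theta> \<in> ?F" and x: "x \<in> ?J" and y: "y \<in> ?J" for \<theta> x y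
  proof -
    obtain h where h: "h \<in> hom T.\<T> (add_monoid L)"
      "\<And>x a. x \<in> carrier L \<Longrightarrow> a \<in> carrier \<A> \<Longrightarrow> h (T.pure x a) = x \<otimes>\<^bsub>L\<^esub> e (th \<theta> a)"
      using tensor_functional[OF L \<theta>] unfolding th_def by metis
    have fin: "finprod (add_monoid L) f ?J = (\<Oplus>\<^bsub>L\<^esub>z\<in>?J. f z)" for f by (simp add: finsum_def)
    have hom: "h (\<Otimes>\<^bsub>T.\<T>\<^esub>z\<in>?J. f z) = (\<Oplus>\<^bsub>L\<^esub>z\<in>?J. h (f z))" if "f \<in> ?J \<rightarrow> carrier T.\<T>" for f
      using hom_finprod_comm_group[OF T.comm_group_tensor L.B.a_comm_group h(1) that] by (simp only: fin)
    have "h (\<Otimes>\<^bsub>T.\<T>\<^esub>z\<in>?J. T.pure (P x z) (?a z y)) = (\<Oplus>\<^bsub>L\<^esub>z\<in>?J. h (T.pure (P x z) (?a z y)))"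
      using mats_closed[OF P x] ac y by (intro hom) (auto intro!: T.pure_closed)
    moreover have "h (\<Otimes>\<^bsub>T.\<T>\<^esub>z\<in>?J. T.pure (P z y) (?a' x z)) = (\<Oplus>\<^bsub>L\<^esub>z\<in>?J. h (T.pure (P z y) (?a' x z)))"
      using mats_closed[OF P _ y] ac x by (intro hom) (auto intro!: T.pure_closed)
    moreover have "(\<Oplus>\<^bsub>L\<^esub>z\<in>?J. h (T.pure (P x z) (?a z y))) = (\<Oplus>\<^bsub>L\<^esub>z\<in>?J. P x z \<otimes>\<^bsub>L\<^esub> e (th \<theta> (?a z y)))"
      using mats_closed[OF P x] ac y thc[OF \<theta>] by (intro L.B.finsum_cong' refl h(2)) auto
    moreover have "(\<Oplus>\<^bsub>L\<^esub>z\<in>?J. h (T.pure (P z y) (?a' x z))) = (\<Oplus>\<^bsub>L\<^esub>z\<in>?J. P z y \<otimes>\<^bsub>L\<^esub> e (th \<theta> (?a' x z)))"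
      using mats_closed[OF P _ y] ac x thc[OF \<theta>] by (intro L.B.finsum_cong' refl h(2)) auto
    ultimately show ?thesis using eq[OF x y] by simp
  qed
  have sum_J: "(\<Oplus>\<^bsub>L\<^esub>z\<in>?J. f z) = (\<Oplus>\<^bsub>L\<^esub>l\<in>?N. f (0, l)) \<oplus>\<^bsub>L\<^esub> (\<Oplus>\<^bsub>L\<^esub>l\<in>?N. f (1, l))"
    if "\<And>s l. s \<le> 1 \<Longrightarrow> l < n \<Longrightarrow> f (s, l) \<in> carrier L" for f
  proof -
    have "(\<Oplus>\<^bsub>L\<^esub>z\<in>?J. f z) = (\<Oplus>\<^bsub>L\<^esub>s\<in>{..1}. \<Oplus>\<^bsub>L\<^esub>l\<in>?N. f (s, l))"
      using that by (intro L.B.add.finprod_Times) auto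
    also have "\<dots> = (\<Oplus>\<^bsub>L\<^esub>l\<in>?N. f (0, l)) \<oplus>\<^bsub>L\<^esub> (\<Oplus>\<^bsub>L\<^esub>l\<in>?N. f (1, l))"
      unfolding J using that by (subst L.B.finsum_insert) (auto intro!: L.B.finsum_closed)
    finally show ?thesis .
  qed
  have a_eq: "?a (0, l) (0, j) = ?X l j" "?a (1, l) (0, j) = \<zero>\<^bsub>\<A>\<^esub>" "?a (0, l) (1, j) = der \<A> (?X l j)"
    "?a (1, l) (1, j) = ?X l j" if "l < n" "j < n" for l j
  proof -
    have one: "add_pow \<A> (1::nat) a = a" if "a \<in> carrier \<A>" for a
      using that by (intro val_eqI coord_add_pow) (auto simp: coord_add_pow val_closed)
    show "?a (0, l) (0, j) = ?X l j" "?a (1, l) (0, j) = \<zero>\<^bsub>\<A>\<^esub>" "?a (0, l) (1, j) = der \<A> (?X l j)"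
      "?a (1, l) (1, j) = ?X l j"
      using one[unfolded One_nat_def] Xc[OF that]
      by (simp_all add: prolongation_def standard_rep_def)
  qed
  have a'_eq: "coact (direct_sum_rep \<A> S (\<lambda>_. \<V>)) (s, i) (m, j) = (if s = m then ?X i j else \<zero>\<^bsub>\<A>\<^esub>)"
    for S :: "nat set" and s i m j
    by (simp add: standard_rep_def direct_sum_rep_def)
  have rhs: "(\<Oplus>\<^bsub>L\<^esub>z\<in>?J. P z (m, j) \<otimes>\<^bsub>L\<^esub> e (th \<theta> (?a' (s, i) z))) = (\<alpha> \<theta> \<otimes>\<^bsub>?M\<^esub> p s m) i j"
    if \<theta>: "\<theta> \<in> ?F" and "s \<le> 1" "m \<le> 1" "i < n" "j < n" for \<theta> s m i j
  proof -
    have *: "(\<Oplus>\<^bsub>L\<^esub>l\<in>?N. P (r, l) (m, j) \<otimes>\<^bsub>L\<^esub> e (th \<theta> (?a' (s, i) (r, l)))) =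
        (if r = s then (\<alpha> \<theta> \<otimes>\<^bsub>?M\<^esub> p s m) i j else \<zero>\<^bsub>L\<^esub>)" if r: "r \<le> 1" for r
    proof (cases "r = s")
      case True
      have "(\<Oplus>\<^bsub>L\<^esub>l\<in>?N. P (r, l) (m, j) \<otimes>\<^bsub>L\<^esub> e (th \<theta> (?a' (s, i) (r, l)))) = (\<Oplus>\<^bsub>L\<^esub>l\<in>?N. \<alpha> \<theta> i l \<otimes>\<^bsub>L\<^esub> p s m l j)"
        using True that Pc thc[OF \<theta>] Xc \<open>i < n\<close> \<open>j < n\<close> \<open>m \<le> 1\<close>
        by (intro L.B.finsum_cong') (auto simp: a'_eq \<alpha>_def p_def L.B.m_comm)
      then show ?thesis using True that \<open>i < n\<close> \<open>j < n\<close> by (simp add: mult_entry)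
    next
      case False
      have "(\<Oplus>\<^bsub>L\<^esub>l\<in>?N. P (r, l) (m, j) \<otimes>\<^bsub>L\<^esub> e (th \<theta> (?a' (s, i) (r, l)))) = (\<Oplus>\<^bsub>L\<^esub>l\<in>?N. \<zero>\<^bsub>L\<^esub>)"
        using False that Pc th0[OF \<theta> coord_zero(1)] \<open>i < n\<close> \<open>j < n\<close> \<open>m \<le> 1\<close>
        by (intro L.B.finsum_cong') (auto simp: a'_eq)
      then show ?thesis using False by simp
    qed
    have mc: "(\<alpha> \<theta> \<otimes>\<^bsub>?M\<^esub> p s m) i j \<in> carrier L"
      using M.m_closed[OF \<alpha>M(1)[OF \<theta>] pM] that mats_closed[of "\<alpha> \<theta> \<otimes>\<^bsub>?M\<^esub> p s m" L ?N ?N i j]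
      by (simp add: carrier_mat_ring)
    have "P (r, l) (m, j) \<otimes>\<^bsub>L\<^esub> e (th \<theta> (?a' (s, i) (r, l))) \<in> carrier L" if "r \<le> 1" "l < n" for r l
      using that Pc thc[OF \<theta>] ac(2)[of "(s, i)" "(r, l)"] \<open>s \<le> 1\<close> \<open>i < n\<close> \<open>j < n\<close> \<open>m \<le> 1\<close> by auto
    then show ?thesis
      using *[of 0] *[of 1] mc \<open>s \<le> 1\<close> by (subst sum_J) (auto simp: le_Suc_eq)
  qed
  have lhs: "(\<Oplus>\<^bsub>L\<^esub>z\<in>?J. P (s, i) z \<otimes>\<^bsub>L\<^esub> e (th \<theta> (?a z (0, j)))) = (p s 0 \<otimes>\<^bsub>?M\<^esub> \<alpha> \<theta>) i j"
    "(\<Oplus>\<^bsub>L\<^esub>z\<in>?J. P (s, i) z \<otimes>\<^bsub>L\<^esub> e (th \<theta> (?a z (1, j)))) =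
      (p s 0 \<otimes>\<^bsub>?M\<^esub> \<alpha>' \<theta>) i j \<oplus>\<^bsub>L\<^esub> (p s 1 \<otimes>\<^bsub>?M\<^esub> \<alpha> \<theta>) i j"
    if \<theta>: "\<theta> \<in> ?F" and "s \<le> 1" "i < n" "j < n" for \<theta> s i j
  proof -
    have c: "P (s, i) (r, l) \<otimes>\<^bsub>L\<^esub> e (th \<theta> (?a (r, l) (m, j))) \<in> carrier L" if "r \<le> 1" "m \<le> 1" "l < n" for r l m
      using that Pc thc[OF \<theta>] ac(1)[of "(r, l)" "(m, j)"] \<open>s \<le> 1\<close> \<open>i < n\<close> \<open>j < n\<close> by auto
    have m: "(p s r \<otimes>\<^bsub>?M\<^esub> \<gamma>) i j = (\<Oplus>\<^bsub>L\<^esub>l\<in>?N. P (s, i) (r, l) \<otimes>\<^bsub>L\<^esub> \<gamma> l j)"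
      if "\<gamma> \<in> carrier ?M" "r \<le> 1" for \<gamma> r
    proof -
      have "(\<Oplus>\<^bsub>L\<^esub>l\<in>?N. p s r i l \<otimes>\<^bsub>L\<^esub> \<gamma> l j) = (\<Oplus>\<^bsub>L\<^esub>l\<in>?N. P (s, i) (r, l) \<otimes>\<^bsub>L\<^esub> \<gamma> l j)"
        using that Pc mats_closed[of \<gamma> L ?N ?N] \<open>s \<le> 1\<close> \<open>i < n\<close> \<open>j < n\<close>
        by (intro L.B.finsum_cong') (auto simp: p_def carrier_mat_ring)
      then show ?thesis using \<open>i < n\<close> \<open>j < n\<close> by (simp add: mult_entry)
    qed
    have s00: "(\<Oplus>\<^bsub>L\<^esub>l\<in>?N. P (s, i) (0, l) \<otimes>\<^bsub>L\<^esub> e (th \<theta> (?a (0, l) (0, j)))) = (p s 0 \<otimes>\<^bsub>?M\<^esub> \<alpha> \<theta>) i j"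
      unfolding m[OF \<alpha>M(1)[OF \<theta>] le0] using Pc thc[OF \<theta>] Xc \<open>s \<le> 1\<close> \<open>i < n\<close> \<open>j < n\<close>
      by (intro L.B.finsum_cong') (auto simp: a_eq(1)[unfolded One_nat_def] \<alpha>_def)
    have s10: "(\<Oplus>\<^bsub>L\<^esub>l\<in>?N. P (s, i) (1, l) \<otimes>\<^bsub>L\<^esub> e (th \<theta> (?a (1, l) (0, j)))) = \<zero>\<^bsub>L\<^esub>"
    proof -
      have "(\<Oplus>\<^bsub>L\<^esub>l\<in>?N. P (s, i) (1, l) \<otimes>\<^bsub>L\<^esub> e (th \<theta> (?a (1, l) (0, j)))) = (\<Oplus>\<^bsub>L\<^esub>l\<in>?N. \<zero>\<^bsub>L\<^esub>)"
        using th0[OF \<theta> coord_zero(1)] Pc[of s 1 i] \<open>s \<le> 1\<close> \<open>i < n\<close> \<open>j < n\<close>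
        by (intro L.B.finsum_cong') (auto simp: a_eq(2)[unfolded One_nat_def])
      then show ?thesis by simp
    qed
    have s01: "(\<Oplus>\<^bsub>L\<^esub>l\<in>?N. P (s, i) (0, l) \<otimes>\<^bsub>L\<^esub> e (th \<theta> (?a (0, l) (1, j)))) = (p s 0 \<otimes>\<^bsub>?M\<^esub> \<alpha>' \<theta>) i j"
      unfolding m[OF \<alpha>M(2)[OF \<theta>] le0] using Pc thc[OF \<theta>] Xc \<open>s \<le> 1\<close> \<open>i < n\<close> \<open>j < n\<close>
      by (intro L.B.finsum_cong') (auto simp: a_eq(3)[unfolded One_nat_def] \<alpha>'_def)
    have s11: "(\<Oplus>\<^bsub>L\<^esub>l\<in>?N. P (s, i) (1, l) \<otimes>\<^bsub>L\<^esub> e (th \<theta> (?a (1, l) (1, j)))) = (p s 1 \<otimes>\<^bsub>?M\<^esub> \<alpha> \<theta>) i j"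
      unfolding m[OF \<alpha>M(1)[OF \<theta>] order_refl] using Pc thc[OF \<theta>] Xc \<open>s \<le> 1\<close> \<open>i < n\<close> \<open>j < n\<close>
      by (intro L.B.finsum_cong') (auto simp: a_eq(4)[unfolded One_nat_def] \<alpha>_def)
    have pc: "(p s 0 \<otimes>\<^bsub>?M\<^esub> \<alpha> \<theta>) i j \<in> carrier L"
      using M.m_closed[OF pM[of s 0] \<alpha>M(1)[OF \<theta>]] mats_closed[of "p s 0 \<otimes>\<^bsub>?M\<^esub> \<alpha> \<theta>" L ?N ?N i j] \<open>s \<le> 1\<close> \<open>i < n\<close> \<open>j < n\<close>
      by (simp add: carrier_mat_ring)
    have "(\<Oplus>\<^bsub>L\<^esub>z\<in>?J. P (s, i) z \<otimes>\<^bsub>L\<^esub> e (th \<theta> (?a z (0, j)))) =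
        (p s 0 \<otimes>\<^bsub>?M\<^esub> \<alpha> \<theta>) i j \<oplus>\<^bsub>L\<^esub> \<zero>\<^bsub>L\<^esub>"
      unfolding s00[symmetric] s10[symmetric] by (rule sum_J) (use c in auto)
    then show "(\<Oplus>\<^bsub>L\<^esub>z\<in>?J. P (s, i) z \<otimes>\<^bsub>L\<^esub> e (th \<theta> (?a z (0, j)))) = (p s 0 \<otimes>\<^bsub>?M\<^esub> \<alpha> \<theta>) i j"
      using pc by simp
    show "(\<Oplus>\<^bsub>L\<^esub>z\<in>?J. P (s, i) z \<otimes>\<^bsub>L\<^esub> e (th \<theta> (?a z (1, j)))) =
      (p s 0 \<otimes>\<^bsub>?M\<^esub> \<alpha>' \<theta>) i j \<oplus>\<^bsub>L\<^esub> (p s 1 \<otimes>\<^bsub>?M\<^esub> \<alpha> \<theta>) i j"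
      unfolding s01[symmetric] s11[symmetric] by (rule sum_J) (use c in auto)
  qed
  \<comment> \<open>Order 0 spans a copy of \<open>V\<close> inside the prolongation and gives the
    commutation; the columns of order 1, where \<open>\<alpha>'\<close> enters, give the cocycle
    equation.\<close>
  have comm: "p s 0 \<otimes>\<^bsub>?M\<^esub> \<alpha> \<theta> = \<alpha> \<theta> \<otimes>\<^bsub>?M\<^esub> p s 0"
    and cocycle: "p s 0 \<otimes>\<^bsub>?M\<^esub> \<alpha>' \<theta> \<oplus>\<^bsub>?M\<^esub> p s 1 \<otimes>\<^bsub>?M\<^esub> \<alpha> \<theta> = \<alpha> \<theta> \<otimes>\<^bsub>?M\<^esub> p s 1"
    if \<theta>: "\<theta> \<in> ?F" and s: "s \<le> 1" for \<theta> s
  proof -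
    have J': "(s, i) \<in> ?J" "(0, i) \<in> ?J" "(1, i) \<in> ?J" if "i < n" for i using that s by auto
    show "p s 0 \<otimes>\<^bsub>?M\<^esub> \<alpha> \<theta> = \<alpha> \<theta> \<otimes>\<^bsub>?M\<^esub> p s 0"
      using pM[OF s, of 0] \<alpha>M[OF \<theta>] lhs(1)[OF \<theta> s] rhs[OF \<theta> s, of 0] th_eq[OF \<theta> J'(1) J'(2)]
      by (intro mats_eqI[of _ L ?N ?N _ L]) (simp_all add: carrier_mat_ring[symmetric])
    show "p s 0 \<otimes>\<^bsub>?M\<^esub> \<alpha>' \<theta> \<oplus>\<^bsub>?M\<^esub> p s 1 \<otimes>\<^bsub>?M\<^esub> \<alpha> \<theta> = \<alpha> \<theta> \<otimes>\<^bsub>?M\<^esub> p s 1"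
    proof (rule mats_eqI[of _ L ?N ?N _ L])
      fix i j assume ij: "i \<in> ?N" "j \<in> ?N"
      then have "i < n" "j < n" by auto
      then show "(p s 0 \<otimes>\<^bsub>?M\<^esub> \<alpha>' \<theta> \<oplus>\<^bsub>?M\<^esub> p s 1 \<otimes>\<^bsub>?M\<^esub> \<alpha> \<theta>) i j = (\<alpha> \<theta> \<otimes>\<^bsub>?M\<^esub> p s 1) i j"
        unfolding add_entry[OF ij] lhs(2)[OF \<theta> s \<open>i < n\<close> \<open>j < n\<close>, symmetric]
          rhs[OF \<theta> s order_refl \<open>i < n\<close> \<open>j < n\<close>, symmetric] by (intro th_eq[OF \<theta> J'(1) J'(3)])
    qed (use pM[OF s] \<alpha>M[OF \<theta>] in \<open>simp_all add: carrier_mat_ring[symmetric]\<close>)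
  qed
  have inj: "x = \<zero>\<^bsub>?M\<^esub> \<and> y = \<zero>\<^bsub>?M\<^esub>"
    if x: "x \<in> carrier ?M" and y: "y \<in> carrier ?M"
      and 0: "x \<otimes>\<^bsub>?M\<^esub> p 0 0 \<oplus>\<^bsub>?M\<^esub> y \<otimes>\<^bsub>?M\<^esub> p 1 0 = \<zero>\<^bsub>?M\<^esub>"
      and 1: "x \<otimes>\<^bsub>?M\<^esub> p 0 1 \<oplus>\<^bsub>?M\<^esub> y \<otimes>\<^bsub>?M\<^esub> p 1 1 = \<zero>\<^bsub>?M\<^esub>" for x y
  proof -
    \<comment> \<open>The row of blocks \<open>(x, y)\<close>. The two hypotheses together say that
      \<open>F P = 0\<close>, and multiplication by \<open>Q\<close> on the right gives
      \<open>F = 0\<close>.\<close>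
    define F where "F = (\<lambda>i\<in>?N. \<lambda>z\<in>?J. if fst z = 0 then x i (snd z) else y i (snd z))"
    have xc: "x i j \<in> carrier L" "y i j \<in> carrier L" if "i < n" "j < n" for i j
      using x y that mats_closed[of x L ?N ?N i j] mats_closed[of y L ?N ?N i j] by (simp_all add: carrier_mat_ring)
    have F: "F \<in> mats L ?N ?J" unfolding F_def using xc by (intro mats_restrict) auto
    have "mat_mult L ?N ?J ?J F P i w = \<zero>\<^bsub>L\<^esub>" if "i \<in> ?N" "w \<in> ?J" for i w
    proof -
      obtain m j where w: "w = (m, j)" "m \<le> 1" "j < n" and i: "i < n" using \<open>w \<in> ?J\<close> \<open>i \<in> ?N\<close> by auto
      have m0: "x \<otimes>\<^bsub>?M\<^esub> p 0 m \<oplus>\<^bsub>?M\<^esub> y \<otimes>\<^bsub>?M\<^esub> p 1 m = \<zero>\<^bsub>?M\<^esub>" using 0 1 w(2) by (auto simp: le_Suc_eq)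
      have "(\<Oplus>\<^bsub>L\<^esub>l\<in>?N. F i (0, l) \<otimes>\<^bsub>L\<^esub> P (0, l) w) = (\<Oplus>\<^bsub>L\<^esub>l\<in>?N. x i l \<otimes>\<^bsub>L\<^esub> p 0 m l j)"
        using w i xc Pc by (intro L.B.finsum_cong') (auto simp: F_def p_def)
      moreover have "(\<Oplus>\<^bsub>L\<^esub>l\<in>?N. F i (1, l) \<otimes>\<^bsub>L\<^esub> P (1, l) w) = (\<Oplus>\<^bsub>L\<^esub>l\<in>?N. y i l \<otimes>\<^bsub>L\<^esub> p 1 m l j)"
        using w i xc Pc by (intro L.B.finsum_cong') (auto simp: F_def p_def)
      ultimately have "(\<Oplus>\<^bsub>L\<^esub>z\<in>?J. F i z \<otimes>\<^bsub>L\<^esub> P z w) = (x \<otimes>\<^bsub>?M\<^esub> p 0 m \<oplus>\<^bsub>?M\<^esub> y \<otimes>\<^bsub>?M\<^esub> p 1 m) i j"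
        using w i mats_closed[OF F] mats_closed[OF P _ \<open>w \<in> ?J\<close>] by (subst sum_J) (auto simp: add_entry mult_entry)
      then show ?thesis using m0 w i that by (simp add: mat_mult_entry zero_entry)
    qed
    note FP0 = this
    have "F i w = \<zero>\<^bsub>L\<^esub>" if iw: "i \<in> ?N" "w \<in> ?J" for i w
    proof -
      have "F = mat_mult L ?N ?J ?J (mat_mult L ?N ?J ?J F P) Q"
        using L.B.mat_mult_assoc[OF _ _ F P Q] L.B.mat_mult_one[OF _ F] PQ by simp
      then have "F i w = mat_mult L ?N ?J ?J (mat_mult L ?N ?J ?J F P) Q i w"
        by (rule arg_cong[where f = "\<lambda>F. F i w"])
      also have "\<dots> = (\<Oplus>\<^bsub>L\<^esub>z\<in>?J. mat_mult L ?N ?J ?J F P i z \<otimes>\<^bsub>L\<^esub> Q z w)"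
        by (rule mat_mult_entry[OF iw])
      also have "\<dots> = (\<Oplus>\<^bsub>L\<^esub>z\<in>?J. \<zero>\<^bsub>L\<^esub>)"
        using FP0[OF iw(1)] mats_closed[OF Q _ iw(2)] by (intro L.B.finsum_cong') auto
      finally show ?thesis by simp
    qed
    note F0 = this
    have "x i j = \<zero>\<^bsub>L\<^esub>" "y i j = \<zero>\<^bsub>L\<^esub>" if "i < n" "j < n" for i j
      using F0[of i "(0, j)"] F0[of i "(1, j)"] that by (auto simp: F_def)
    then show ?thesis
      using x y M.zero_closed by (auto intro!: mats_eqI[of _ L ?N ?N _ L] simp: carrier_mat_ring zero_entry)
  qed
  let ?\<Lambda> = "(\<lambda>\<theta>. (\<alpha> \<theta>, \<alpha>' \<theta>)) ` ?F"
  have "\<exists>y\<in>carrier ?M. \<forall>(\<gamma>, \<gamma>')\<in>?\<Lambda>. \<gamma>' \<oplus>\<^bsub>?M\<^esub> y \<otimes>\<^bsub>?M\<^esub> \<gamma> = \<gamma> \<otimes>\<^bsub>?M\<^esub> y"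
  proof (rule splitting[of ?\<Lambda> "p 0 0" "p 1 0" "p 0 1" "p 1 1"])
    show "p 0 0 \<in> carrier ?M" "p 1 0 \<in> carrier ?M" "p 0 1 \<in> carrier ?M" "p 1 1 \<in> carrier ?M"
      by (rule pM; simp)+
    fix x y assume "x \<in> carrier ?M" "y \<in> carrier ?M"
      "x \<otimes>\<^bsub>?M\<^esub> p 0 0 \<oplus>\<^bsub>?M\<^esub> y \<otimes>\<^bsub>?M\<^esub> p 1 0 = \<zero>\<^bsub>?M\<^esub>" "x \<otimes>\<^bsub>?M\<^esub> p 0 1 \<oplus>\<^bsub>?M\<^esub> y \<otimes>\<^bsub>?M\<^esub> p 1 1 = \<zero>\<^bsub>?M\<^esub>"
    then show "x = \<zero>\<^bsub>?M\<^esub> \<and> y = \<zero>\<^bsub>?M\<^esub>" by (rule inj)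
  next
    fix \<gamma> \<gamma>' assume "(\<gamma>, \<gamma>') \<in> ?\<Lambda>"
    then obtain \<theta> where \<theta>: "\<theta> \<in> ?F" "\<gamma> = \<alpha> \<theta>" "\<gamma>' = \<alpha>' \<theta>" by blast
    show "\<gamma> \<in> carrier ?M" "\<gamma>' \<in> carrier ?M" unfolding \<theta>(2,3) by (rule \<alpha>M[OF \<theta>(1)])+
    show "p 0 0 \<otimes>\<^bsub>?M\<^esub> \<gamma> = \<gamma> \<otimes>\<^bsub>?M\<^esub> p 0 0" "p 1 0 \<otimes>\<^bsub>?M\<^esub> \<gamma> = \<gamma> \<otimes>\<^bsub>?M\<^esub> p 1 0"
      unfolding \<theta>(2,3) by (rule comm[OF \<theta>(1)]; simp)+
    show "p 0 0 \<otimes>\<^bsub>?M\<^esub> \<gamma>' \<oplus>\<^bsub>?M\<^esub> p 0 1 \<otimes>\<^bsub>?M\<^esub> \<gamma> = \<gamma> \<otimes>\<^bsub>?M\<^esub> p 0 1"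
      "p 1 0 \<otimes>\<^bsub>?M\<^esub> \<gamma>' \<oplus>\<^bsub>?M\<^esub> p 1 1 \<otimes>\<^bsub>?M\<^esub> \<gamma> = \<gamma> \<otimes>\<^bsub>?M\<^esub> p 1 1"
      unfolding \<theta>(2,3) by (rule cocycle[OF \<theta>(1)]; simp)+
  qed
  then obtain y where y: "y \<in> carrier ?M"
    and split: "\<And>\<theta>. \<theta> \<in> ?F \<Longrightarrow> \<alpha>' \<theta> \<oplus>\<^bsub>?M\<^esub> y \<otimes>\<^bsub>?M\<^esub> \<alpha> \<theta> = \<alpha> \<theta> \<otimes>\<^bsub>?M\<^esub> y"
    by auto
  have yc: "y i j \<in> carrier L" if "i < n" "j < n" for i j
    using y that mats_closed[of y L ?N ?N i j] by (simp add: carrier_mat_ring)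
  interpret H: module K "hom_module L e"
    using L.hom A.is_cring L.B.is_cring by (intro module_hom_module) (auto simp: diff_hom_def)
  have H0: "\<ominus>\<^bsub>hom_module L e\<^esub> \<zero>\<^bsub>hom_module L e\<^esub> = \<zero>\<^bsub>hom_module L e\<^esub>"
    by (metis H.M.l_neg H.M.r_zero H.M.zero_closed H.M.a_inv_closed)
  have "submodule {\<zero>\<^bsub>hom_module L e\<^esub>} K (hom_module L e)"
  proof (rule H.submoduleI)
    show "c \<odot>\<^bsub>hom_module L e\<^esub> x \<in> {\<zero>\<^bsub>hom_module L e\<^esub>}"
      if "c \<in> carrier K" "x \<in> {\<zero>\<^bsub>hom_module L e\<^esub>}" for c x
      using that H.smult_r_null[OF that(1)] by blast
  qed (use H0 H.M.zero_closed in \<open>auto simp del: hom_module_simps\<close>)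
  \<comment> \<open>A \<open>K\<close>-linear functional on \<open>L\<close> with value 1 at 1 is a
    retraction of \<open>e\<close>. The split equation is linear in \<open>y\<close> with
    coefficients from \<open>K\<close>, so applying \<open>\<psi>\<close> to the entries of
    \<open>y\<close> preserves it.\<close>
  then obtain \<psi> where \<psi>: "\<psi> \<in> functionals K (hom_module L e)" "\<psi> \<one>\<^bsub>L\<^esub> = \<one>\<^bsub>K\<^esub>"
    by (rule H.functional_separating[OF A.field_axioms]) auto
  have \<psi>c: "\<psi> x \<in> carrier K" if "x \<in> carrier L" for x using \<psi>(1) that by (auto simp: functionals_def)
  have \<psi>a: "\<psi> (x \<oplus>\<^bsub>L\<^esub> z) = \<psi> x \<oplus>\<^bsub>K\<^esub> \<psi> z" if "x \<in> carrier L" "z \<in> carrier L" for x z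
    using \<psi>(1) that by (simp add: functionals_def)
  have \<psi>s: "\<psi> (e c \<otimes>\<^bsub>L\<^esub> x) = c \<otimes>\<^bsub>K\<^esub> \<psi> x" if "c \<in> carrier K" "x \<in> carrier L" for c x
    using \<psi>(1) that by (simp add: functionals_def)
  have \<psi>e: "\<psi> (e c) = c" if "c \<in> carrier K" for c using \<psi>s[OF that L.B.one_closed] that \<psi>(2) by simp
  have \<psi>0: "\<psi> \<zero>\<^bsub>L\<^esub> = \<zero>\<^bsub>K\<^esub>" using \<psi>e[OF A.zero_closed] by simp
  have \<psi>sum: "\<psi> (\<Oplus>\<^bsub>L\<^esub>t\<in>T. f t) = (\<Oplus>\<^bsub>K\<^esub>t\<in>T. \<psi> (f t))" if "finite T" "f \<in> T \<rightarrow> carrier L" for T :: "nat set" and f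
    using that
  proof (induction T rule: finite_induct)
    case (insert t T)
    then show ?case by (simp add: \<psi>a \<psi>c Pi_def)
  qed (simp add: \<psi>0)
  define B where "B i j = \<psi> (y i j)" for i j
  have Bc: "B i j \<in> carrier K" if "i < n" "j < n" for i j unfolding B_def by (rule \<psi>c[OF yc[OF that]])
  have th_split: "th \<theta> (der \<A> (?X i j)) \<oplus>\<^bsub>K\<^esub> (\<Oplus>\<^bsub>K\<^esub>l\<in>?N. B i l \<otimes>\<^bsub>K\<^esub> th \<theta> (?X l j)) =
      (\<Oplus>\<^bsub>K\<^esub>l\<in>?N. B l j \<otimes>\<^bsub>K\<^esub> th \<theta> (?X i l))" if \<theta>: "\<theta> \<in> ?F" and ij: "i < n" "j < n" for \<theta> i j
  proof -
    have ij': "i \<in> ?N" "j \<in> ?N" using ij by auto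
    note t = thc[OF \<theta> Xc(1)] thc[OF \<theta> Xc(2)]
    have y\<alpha>: "(y \<otimes>\<^bsub>?M\<^esub> \<alpha> \<theta>) i j = (\<Oplus>\<^bsub>L\<^esub>l\<in>?N. e (th \<theta> (?X l j)) \<otimes>\<^bsub>L\<^esub> y i l)"
      unfolding mult_entry[OF ij'] using yc t ij by (intro L.B.finsum_cong') (auto simp: \<alpha>_def L.B.m_comm)
    have \<alpha>y: "(\<alpha> \<theta> \<otimes>\<^bsub>?M\<^esub> y) i j = (\<Oplus>\<^bsub>L\<^esub>l\<in>?N. e (th \<theta> (?X i l)) \<otimes>\<^bsub>L\<^esub> y l j)"
      unfolding mult_entry[OF ij'] using yc t ij by (intro L.B.finsum_cong') (auto simp: \<alpha>_def)
    have \<alpha>'ij: "\<alpha>' \<theta> i j = e (th \<theta> (der \<A> (?X i j)))" using ij by (simp add: \<alpha>'_def)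
    have s1: "\<psi> (\<Oplus>\<^bsub>L\<^esub>l\<in>?N. e (th \<theta> (?X l j)) \<otimes>\<^bsub>L\<^esub> y i l) = (\<Oplus>\<^bsub>K\<^esub>l\<in>?N. B i l \<otimes>\<^bsub>K\<^esub> th \<theta> (?X l j))"
      using yc t ij Bc by (subst \<psi>sum) (auto intro!: A.finsum_cong' simp: \<psi>s A.m_comm \<psi>c B_def[symmetric])
    have s2: "\<psi> (\<Oplus>\<^bsub>L\<^esub>l\<in>?N. e (th \<theta> (?X i l)) \<otimes>\<^bsub>L\<^esub> y l j) = (\<Oplus>\<^bsub>K\<^esub>l\<in>?N. B l j \<otimes>\<^bsub>K\<^esub> th \<theta> (?X i l))"
      using yc t ij Bc by (subst \<psi>sum) (auto intro!: A.finsum_cong' simp: \<psi>s A.m_comm \<psi>c B_def[symmetric])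
    have "e (th \<theta> (der \<A> (?X i j))) \<oplus>\<^bsub>L\<^esub> (\<Oplus>\<^bsub>L\<^esub>l\<in>?N. e (th \<theta> (?X l j)) \<otimes>\<^bsub>L\<^esub> y i l) =
        (\<Oplus>\<^bsub>L\<^esub>l\<in>?N. e (th \<theta> (?X i l)) \<otimes>\<^bsub>L\<^esub> y l j)"
      using fun_cong[OF fun_cong[OF split[OF \<theta>], of i], of j]
      unfolding add_entry[OF ij'] y\<alpha> \<alpha>y \<alpha>'ij .
    then have "\<psi> (e (th \<theta> (der \<A> (?X i j))) \<oplus>\<^bsub>L\<^esub> (\<Oplus>\<^bsub>L\<^esub>l\<in>?N. e (th \<theta> (?X l j)) \<otimes>\<^bsub>L\<^esub> y i l)) =
        (\<Oplus>\<^bsub>K\<^esub>l\<in>?N. B l j \<otimes>\<^bsub>K\<^esub> th \<theta> (?X i l))"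
      unfolding s2[symmetric] by simp
    moreover have "(\<Oplus>\<^bsub>L\<^esub>l\<in>?N. e (th \<theta> (?X l j)) \<otimes>\<^bsub>L\<^esub> y i l) \<in> carrier L"
      using t yc ij by (intro L.B.finsum_closed) auto
    ultimately show ?thesis using t(2)[OF ij] by (simp add: \<psi>a s1 \<psi>e)
  qed
  interpret FG: module K "fun_module U \<iota> G"
    using hom A.is_cring B.is_cring by (intro module_fun_module) (auto simp: diff_hom_def)
  have \<iota>: "\<iota> \<in> Ring.ring_hom K U" using hom by (simp add: diff_hom_def)
  have "der U (g i j) = (\<Oplus>\<^bsub>U\<^esub>l\<in>?N. g i l \<otimes>\<^bsub>U\<^esub> \<iota> (B l j)) \<ominus>\<^bsub>U\<^esub> (\<Oplus>\<^bsub>U\<^esub>l\<in>?N. \<iota> (B i l) \<otimes>\<^bsub>U\<^esub> g l j)"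
    if g: "g \<in> G" and ij: "i < n" "j < n" for g i j
  proof -
    let ?d = "\<lambda>g\<in>G. val (der \<A> (?X i j)) g"
    let ?l = "\<lambda>g\<in>G. \<Oplus>\<^bsub>U\<^esub>l\<in>?N. \<iota> (B i l) \<otimes>\<^bsub>U\<^esub> (\<lambda>g\<in>G. val (?X l j) g) g"
    let ?r = "\<lambda>g\<in>G. \<Oplus>\<^bsub>U\<^esub>l\<in>?N. \<iota> (B l j) \<otimes>\<^bsub>U\<^esub> (\<lambda>g\<in>G. val (?X i l) g) g"
    have vX: "(\<lambda>g\<in>G. val (?X k l) g) \<in> G \<rightarrow>\<^sub>E carrier U" if "k < n" "l < n" for k l
      using val_closed[OF Xc(1)[OF that]] by auto
    have c: "?d \<in> G \<rightarrow>\<^sub>E carrier U" "?l \<in> G \<rightarrow>\<^sub>E carrier U" "?r \<in> G \<rightarrow>\<^sub>E carrier U"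
      using val_closed[OF Xc(2)[OF ij]] val_closed[OF Xc(1)] Bc ij by (auto intro!: B.finsum_closed)
    \<comment> \<open>Both sides are \<open>U\<close>-valued functions on the group. Every
      \<open>K\<close>-linear functional agrees on them by \<open>th_split\<close>, so they are
      equal, and evaluation at \<open>g\<close> gives the gauge equation.\<close>
    have "?d \<oplus>\<^bsub>fun_module U \<iota> G\<^esub> ?l = ?r"
    proof (rule FG.functionals_eqI[OF A.field_axioms])
      fix \<theta> assume \<theta>: "\<theta> \<in> ?F"
      note fs = functional_finsum[OF A.is_cring B.is_cring \<iota> \<theta>, of ?N]
      have "\<theta> ?l = (\<Oplus>\<^bsub>K\<^esub>l\<in>?N. B i l \<otimes>\<^bsub>K\<^esub> th \<theta> (?X l j))"
        unfolding th_def by (rule fs) (use Bc ij vX val_closed[OF Xc(1)] in auto)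
      moreover have "\<theta> ?r = (\<Oplus>\<^bsub>K\<^esub>l\<in>?N. B l j \<otimes>\<^bsub>K\<^esub> th \<theta> (?X i l))"
        unfolding th_def by (rule fs) (use Bc ij vX val_closed[OF Xc(1)] in auto)
      moreover have "\<theta> (?d \<oplus>\<^bsub>fun_module U \<iota> G\<^esub> ?l) = th \<theta> (der \<A> (?X i j)) \<oplus>\<^bsub>K\<^esub> \<theta> ?l"
        using \<theta> c unfolding functionals_def th_def by (simp del: fun_module_simps(3) restrict_apply)
      ultimately show "\<theta> (?d \<oplus>\<^bsub>fun_module U \<iota> G\<^esub> ?l) = \<theta> ?r" using th_split[OF \<theta> ij] by simp
    next
      show "?d \<oplus>\<^bsub>fun_module U \<iota> G\<^esub> ?l \<in> carrier (fun_module U \<iota> G)"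
        using c by (intro FG.M.a_closed) simp_all
    qed (use c in simp)
    from fun_cong[OF this, of g]
    have "val (der \<A> (?X i j)) g \<oplus>\<^bsub>U\<^esub> (\<Oplus>\<^bsub>U\<^esub>l\<in>?N. \<iota> (B i l) \<otimes>\<^bsub>U\<^esub> val (?X l j) g) =
        (\<Oplus>\<^bsub>U\<^esub>l\<in>?N. \<iota> (B l j) \<otimes>\<^bsub>U\<^esub> val (?X i l) g)" using g by simp
    moreover have "val (der \<A> (?X i j)) g = der U (g i j)" using coord_der(2)[OF Xc(1)[OF ij] g] coord_entry(2)[OF ij g] by simp
    moreover have "(\<Oplus>\<^bsub>U\<^esub>l\<in>?N. \<iota> (B i l) \<otimes>\<^bsub>U\<^esub> val (?X l j) g) = (\<Oplus>\<^bsub>U\<^esub>l\<in>?N. \<iota> (B i l) \<otimes>\<^bsub>U\<^esub> g l j)"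
      using Bc ij G_entry[OF g] by (intro B.finsum_cong') (auto simp: coord_entry(2) g)
    moreover have "(\<Oplus>\<^bsub>U\<^esub>l\<in>?N. \<iota> (B l j) \<otimes>\<^bsub>U\<^esub> val (?X i l) g) = (\<Oplus>\<^bsub>U\<^esub>l\<in>?N. g i l \<otimes>\<^bsub>U\<^esub> \<iota> (B l j))"
      using Bc ij G_entry[OF g] by (intro B.finsum_cong') (auto simp: coord_entry(2) g B.m_comm)
    ultimately have eq: "der U (g i j) \<oplus>\<^bsub>U\<^esub> (\<Oplus>\<^bsub>U\<^esub>l\<in>?N. \<iota> (B i l) \<otimes>\<^bsub>U\<^esub> g l j) = (\<Oplus>\<^bsub>U\<^esub>l\<in>?N. g i l \<otimes>\<^bsub>U\<^esub> \<iota> (B l j))" by simp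
    have cl: "(\<Oplus>\<^bsub>U\<^esub>l\<in>?N. \<iota> (B i l) \<otimes>\<^bsub>U\<^esub> g l j) \<in> carrier U" "der U (g i j) \<in> carrier U"
      using Bc ij G_entry[OF g] by (auto intro!: B.finsum_closed B.der_closed)
    show ?thesis unfolding eq[symmetric] using cl by (simp add: B.minus_eq B.a_assoc B.r_neg)
  qed
  then have "gauge n G B" using Bc by (auto simp: gauge_def)
  then show ?thesis by (rule that)
qed

end

theorem proposition3:
  fixes K :: "'a diff_ring" and Kbar :: "'b diff_ring" and U :: "'c diff_ring"
    and e :: "'a \<Rightarrow> 'b" and \<iota> :: "'a \<Rightarrow> 'c" and n :: nat and G :: "(nat \<Rightarrow> nat \<Rightarrow> 'c) set"
  assumes "differential_field K" and "char_zero K"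
    and "differential_closure K Kbar e"
    and "semi_universal K U \<iota>"
    and "linear_diff_alg_group K U \<iota> n G"
  shows "(\<exists>x \<in> carrier (GL U n). \<exists>H. subgroup H (GL U n) \<and> H \<subseteq> GL_const U n
            \<and> H = conjugate_by (GL U n) x G)
         \<longleftrightarrow> (\<forall>p\<ge>1. let A = coord_ring K U \<iota> n G; V = standard_rep K U \<iota> n G in
                iso_rep_over K Kbar e A (coord_const K U \<iota> n G)
                  (prolongation A p V) (direct_sum_rep A {..p} (\<lambda>_. V)))"
proof -
  have L: "diff_field_map K Kbar e"
    using assms(3) by (auto simp: differential_closure_def diff_extension_def diff_field_map_def diff_field_map_axioms_def)
  have U: "diff_field_map K U \<iota>"
    using assms(4) by (auto simp: semi_universal_def diff_extension_def diff_field_map_def diff_field_map_axioms_def)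
  interpret linear_group K U \<iota> n G
    using U assms by (auto simp: linear_group_def linear_group_axioms_def universal_domain_def universal_domain_axioms_def)
  interpret GL: group "GL U n" by (rule B.GL_group)
  show ?thesis
    unfolding Let_def
  proof (intro iffI allI impI)
    fix p :: nat
    assume "\<exists>x \<in> carrier (GL U n). \<exists>H. subgroup H (GL U n) \<and> H \<subseteq> GL_const U n \<and> H = conjugate_by (GL U n) x G"
    then obtain x where x: "x \<in> carrier (GL U n)" "conjugate_by (GL U n) x G \<subseteq> GL_const U n" by blast
    obtain B where "gauge n G B"
    proof (rule gauge_if_conjugate_to_constants[OF subgroup_G _ x])
      show "(\<lambda>i\<in>{..<n}. \<lambda>j\<in>{..<n}. \<sigma> (g i j)) \<in> G"
        if "g \<in> G" "S \<subseteq> carrier U" "specialization S \<sigma>" "\<And>i j. i < n \<Longrightarrow> j < n \<Longrightarrow> g i j \<in> S" for g S \<sigma>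
        by (rule specialization_stable[OF that])
    qed (rule that)
    then show "iso_rep_over K Kbar e \<A> \<kappa> (prolongation \<A> p \<V>) (direct_sum_rep \<A> {..p} (\<lambda>_. \<V>))"
      by (rule iso_if_gauge[OF L])
  next
    assume "\<forall>p\<ge>1. iso_rep_over K Kbar e \<A> \<kappa> (prolongation \<A> p \<V>) (direct_sum_rep \<A> {..p} (\<lambda>_. \<V>))"
    then have "iso_rep_over K Kbar e \<A> \<kappa> (prolongation \<A> 1 \<V>) (direct_sum_rep \<A> {..1::nat} (\<lambda>_. \<V>))" by blast
    then obtain B where "gauge n G B" by (rule gauge_if_iso[OF L])
    then obtain x where x: "x \<in> carrier (GL U n)" "conjugate_by (GL U n) x G \<subseteq> GL_const U n"
      using conjugate_to_constants_if_gauge[OF subgroup_G] by blast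
    then show "\<exists>x \<in> carrier (GL U n). \<exists>H. subgroup H (GL U n) \<and> H \<subseteq> GL_const U n \<and> H = conjugate_by (GL U n) x G"
      using GL.subgroup_conjugate[OF x(1) subgroup_G] by blast
  qed
qed

end
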